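(* Let $\mathscr{S}$ be a finite set of species, and let $\boldsymbol\Delta=(\Delta_{s_1,\dots,s_p})_{s_1,\dots,s_p\in\mathscr{S},\,p\ge1}$ (nonnegative, symmetric in the indices), $\boldsymbol\lambda_N=(\lambda_{s,N})_{s\in\mathscr S}$ and $\boldsymbol\lambda=(\lambda_s)_{s\in\mathscr S}$ be the parameters of a multi-species spin glass as in the context. Assume: (i) $\lim_{N\to\infty}\lambda_{s,N}=\lambda_s>0$ for each $s\in\mathscr S$; (ii) $\sum_{p=1}^\infty(1+\varepsilon)^p\sum_{s_1,\dots,s_p\in\mathscr S}\Delta^2_{s_1,\dots,s_p}\lambda_{s_1}\cdots\lambda_{s_p}<\infty$ for some $\varepsilon>0$; (iii) (balanced) $\Delta_t^2$ does not depend on $t\in\mathscr S$, and for every $p\ge2$ the quantity $\sum_{s_2,\dots,s_p\in\mathscr S}\Delta^2_{t,s_2,\dots,s_p}\lambda_{s_2}\cdots\lambda_{s_p}$ does not depend on $t\in\mathscr S$. Let $\boldsymbol\beta=(\beta_p)_{p\ge1}$ be given by $\beta_p\ge0$, $\beta_p^2=\sum_{s_1,\dots,s_p\in\mathscr S}\Delta^2_{s_1,\dots,s_p}\lambda_{s_1}\cdots\lambda_{s_p}$, and define $\xi^{\mathsf{single}}(x)=\sum_{p=1}^\infty\beta_p^2x^p$ for $x\in[-1,1]$. Then for either choice $\diamond\in\{\mathsf{Ising},\mathsf{spherical}\}$ the following implication holds: $$\lim_{N\to\infty}F^{\mathsf{single}}_{N,\diamond}(\boldsymbol\beta)=\fr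ac{\xi^{\mathsf{single}}(1)}2\quad\Longrightarrow\quad\lim_{N\to\infty}F_{N,\diamond}(\boldsymbol\Delta,\boldsymbol\lambda_N)=\frac{\xi^{\mathsf{single}}(1)}2.$$
   Context: Model. $\mathscr S$ is a finite set. For each positive integer $N$, $\{1,\dots,N\}=\biguplus_{s\in\mathscr S}\mathcal I_{s,N}$ is a partition, and $\lambda_{s,N}=\#\mathcal I_{s,N}/N$. The interaction parameters $\Delta_{s_1,\dots,s_p}\ge0$ are symmetric: $\Delta_{s_1,\dots,s_p}=\Delta_{s_{\pi(1)},\dots,s_{\pi(p)}}$ for every permutation $\pi$ of $\{1,\dots,p\}$; $\Delta^2_{s_1,\dots,s_p}$ denotes the square of $\Delta_{s_1,\dots,s_p}$. Configuration spaces. $\Sigma_{N,\mathsf{Ising}}=\{-1,+1\}^N$ with $\mu_{N,\mathsf{Ising}}$ the uniform probability measure. $\Sigma_{N,\mathsf{spherical}}=\{\sigma\in\mathbb R^N:\sum_{i\in\mathcal I_{s,N}}\sigma_i^2=\#\mathcal I_{s,N}\ \text{for all } s\in\mathscr S\}$, a product over $s$ of spheres $S_{\#\mathcal I_{s,N}}$, where $S_n=\{x\in\mathbb R^n:\|x\|_2^2=n\}$; $\mu_{N,\mathsf{spherical}}$ is the product of the uniform probability measures on these spheres. Hamiltonian. With $(g_{i_1,\dots,i_p})_{1\le i_1,\dots,i_p\le N,\,p\ge1}$ independent standard normal random variables, $$H_N(\sigma)=\sum_{p=1}^\infty\frac1{N^{(p-1)/2}}\sum_{s_1,\dots,s_p\in\mathscr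 S}\sqrt{\Delta^2_{s_1,\dots,s_p}}\sum_{i_1\in\mathcal I_{s_1,N},\dots,i_p\in\mathcal I_{s_p,N}}g_{i_1,\dots,i_p}\sigma_{i_1}\cdots\sigma_{i_p}.$$ (Under (i) and (ii) this is well defined for all sufficiently large $N$.) Free energy: $F_{N,\diamond}(\boldsymbol\Delta,\boldsymbol\lambda_N)=\frac1N\mathbb E\log\int_{\Sigma_{N,\diamond}}\exp H_N(\sigma)\,\mu_{N,\diamond}(\mathrm d\sigma)$. Single-species case. $F^{\mathsf{single}}_{N,\diamond}(\boldsymbol\beta)$ denotes this quantity when $\mathscr S=\{s\}$ is a singleton (so the species proportion is $1$) and $\Delta_{s,\dots,s}=\beta_p$ for the $p$-fold index, i.e. for the Hamiltonian $\sum_{p\ge1}\beta_pN^{-(p-1)/2}\sum_{i_1,\dots,i_p=1}^Ng_{i_1,\dots,i_p}\sigma_{i_1}\cdots\sigma_{i_p}$ on $\{-1,+1\}^N$ or on $S_N$. *)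

theory Defs
  imports "HOL-Probability.Probability" "HOL-Combinatorics.Permutations"
begin

text \<open>
  A multi-index (of species or of sites) is a nonempty list; its length is the order p of
  the interaction. Sites are the numbers 1, ..., N. A species partition of the sites is a
  function \<open>I\<close> taking a species \<open>s\<close> to its block \<open>I s\<close>, and a configuration is a function on
  \<open>{1..N}\<close> (extensional outside).
\<close>

definition species_partition :: "nat \<Rightarrow> ('s \<Rightarrow> nat set) \<Rightarrow> bool" where
  "species_partition N I \<longleftrightarrow> disjoint_family I \<and> (\<Union>s. I s) = {1..N}"

definition species_ratio :: "nat \<Rightarrow> ('s \<Rightarrow> nat set) \<Rightarrow> 's \<Rightarrow> real" where
  "species_ratio N I s = real (card (I s)) / real N"

definition interaction :: "('s list \<Rightarrow> real) \<Rightarrow> bool" where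
  "interaction \<Delta> \<longleftrightarrow>
     (\<forall>ss. ss \<noteq> [] \<longrightarrow> 0 \<le> \<Delta> ss) \<and>
     (\<forall>ss \<pi>. ss \<noteq> [] \<and> \<pi> permutes {..<length ss} \<longrightarrow> \<Delta> (permute_list \<pi> ss) = \<Delta> ss)"

definition std_gaussian_family :: "'w measure \<Rightarrow> (nat list \<Rightarrow> 'w \<Rightarrow> real) \<Rightarrow> bool" where
  "std_gaussian_family M g \<longleftrightarrow>
     (let J = {js. js \<noteq> [] \<and> (\<forall>i\<in>set js. 1 \<le> i)} in
       prob_space M \<and> prob_space.indep_vars M (\<lambda>_. borel) g J \<and>
       (\<forall>js\<in>J. distributed M lborel (g js) std_normal_density))"

subsection \<open>Configuration spaces\<close>

text \<open>
  The uniform probability measure on the sphere of radius \<open>sqrt n\<close> in the Euclidean space of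
  functions on \<open>A\<close>, where \<open>n = card A\<close>, is normalized surface area, i.e. the mass of a Borel
  set E of the sphere is the relative volume, in the unit ball, of the cone spanned by E: the
  image of the uniform measure on the ball under radial projection.
\<close>

definition sphere_measure :: "'i set \<Rightarrow> ('i \<Rightarrow> real) measure" where
  "sphere_measure A =
     distr (uniform_measure (Pi\<^sub>M A (\<lambda>_. lborel)) {x \<in> A \<rightarrow>\<^sub>E UNIV. L2_set x A \<le> 1})
       (Pi\<^sub>M A (\<lambda>_. borel))
       (\<lambda>x. \<lambda>i\<in>A. sqrt (real (card A)) * x i / L2_set x A)"

datatype spin_type = Ising | Spherical

fun config_space :: "spin_type \<Rightarrow> nat \<Rightarrow> ('s \<Rightarrow> nat set) \<Rightarrow> (nat \<Rightarrow> real) set" where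
  "config_space Ising N I = {1..N} \<rightarrow>\<^sub>E {-1, 1}"
| "config_space Spherical N I =
     {\<sigma> \<in> {1..N} \<rightarrow>\<^sub>E UNIV. \<forall>s. (\<Sum>i\<in>I s. (\<sigma> i)\<^sup>2) = real (card (I s))}"

text \<open>
  In the spherical case a point of the product over the species is a family \<open>x\<close> with
  \<open>x s\<close> a vector indexed by \<open>I s\<close>; it is identified with a vector indexed by \<open>{1..N}\<close>.
\<close>

fun config_measure :: "spin_type \<Rightarrow> nat \<Rightarrow> ('s \<Rightarrow> nat set) \<Rightarrow> (nat \<Rightarrow> real) measure" where
  "config_measure Ising N I = uniform_count_measure (config_space Ising N I)"
| "config_measure Spherical N I =
     distr (Pi\<^sub>M UNIV (\<lambda>s. sphere_measure (I s))) (Pi\<^sub>M {1..N} (\<lambda>_. borel))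
       (\<lambda>x. \<lambda>i\<in>{1..N}. x (THE s. i \<in> I s) i)"

subsection \<open>Hamiltonian and free energy\<close>

definition hamiltonian_term ::
  "nat \<Rightarrow> ('s::finite \<Rightarrow> nat set) \<Rightarrow> ('s list \<Rightarrow> real) \<Rightarrow> (nat list \<Rightarrow> real) \<Rightarrow> (nat \<Rightarrow> real) \<Rightarrow> nat \<Rightarrow> real"
where
  "hamiltonian_term N I \<Delta> G \<sigma> p =
     1 / real N powr ((real p - 1) / 2) *
     (\<Sum>ss | length ss = p. sqrt ((\<Delta> ss)\<^sup>2) *
        (\<Sum>js\<in>listset (map I ss). G js * prod_list (map \<sigma> js)))"

definition hamiltonian ::
  "nat \<Rightarrow> ('s::finite \<Rightarrow> nat set) \<Rightarrow> ('s list \<Rightarrow> real) \<Rightarrow> (nat list \<Rightarrow> real) \<Rightarrow> (nat \<Rightarrow> real) \<Rightarrow> real"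
where
  "hamiltonian N I \<Delta> G \<sigma> = (\<Sum>p. hamiltonian_term N I \<Delta> G \<sigma> (Suc p))"

definition free_energy ::
  "'w measure \<Rightarrow> (nat list \<Rightarrow> 'w \<Rightarrow> real) \<Rightarrow> spin_type \<Rightarrow> ('s::finite list \<Rightarrow> real) \<Rightarrow>
   ('s \<Rightarrow> nat set) \<Rightarrow> nat \<Rightarrow> real"
where
  "free_energy M g k \<Delta> I N =
     1 / real N *
     (LINT \<omega>|M. ln (LINT \<sigma>:config_space k N I|config_measure k N I.
        exp (hamiltonian N I \<Delta> (\<lambda>js. g js \<omega>) \<sigma>)))"

definition free_energy_single ::
  "'w measure \<Rightarrow> (nat list \<Rightarrow> 'w \<Rightarrow> real) \<Rightarrow> spin_type \<Rightarrow> (nat \<Rightarrow> real) \<Rightarrow> nat \<Rightarrow> real"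
where
  "free_energy_single M g k \<beta> N =
     free_energy M g k (\<lambda>ss::unit list. \<beta> (length ss)) (\<lambda>_::unit. {1..N}) N"

definition xi_single :: "(nat \<Rightarrow> real) \<Rightarrow> real \<Rightarrow> real" where
  "xi_single \<beta> x = (\<Sum>p. (\<beta> (Suc p))\<^sup>2 * x ^ Suc p)"

subsection \<open>Conditions on the parameters\<close>

definition variance_coeff :: "('s::finite list \<Rightarrow> real) \<Rightarrow> ('s \<Rightarrow> real) \<Rightarrow> nat \<Rightarrow> real" where
  "variance_coeff \<Delta> lam p = (\<Sum>ss | length ss = p. (\<Delta> ss)\<^sup>2 * prod_list (map lam ss))"

definition balanced :: "('s::finite list \<Rightarrow> real) \<Rightarrow> ('s \<Rightarrow> real) \<Rightarrow> bool" where
  "balanced \<Delta> lam \<longleftrightarrow>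
     (\<forall>t t'. (\<Delta> [t])\<^sup>2 = (\<Delta> [t'])\<^sup>2) \<and>
     (\<forall>p\<ge>2. \<forall>t t'.
        (\<Sum>ss | length ss = p - 1. (\<Delta> (t # ss))\<^sup>2 * prod_list (map lam ss)) =
        (\<Sum>ss | length ss = p - 1. (\<Delta> (t' # ss))\<^sup>2 * prod_list (map lam ss)))"

end

theory Submission
  imports Defs
begin

text \<open>
  The upper bound is Jensen's inequality. For the lower bound, truncate the Hamiltonian to orders \<open>p \<le> P\<close>
  and compare the multi-species model with the model in which every species carries an independent copy of the
  single-species model; the latter has the right free energy by hypothesis. Moving the variances linearly
  from the decoupled model to the multi-species one, Gaussian integration by parts expresses the derivative of the
  normalized moment of order \<open>1 - h\<close> of the partition function through the difference of the two covariances at two replicas.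
  For nonnegative overlaps balancedness and the AM-GM inequality show that the multi-species covariance is the
  smaller one. Overlaps are essentially nonnegative once a small external field is present: under the
  tilted measure one replica is planted, and flipping the signs of the other one in a species with negative
  overlap gains a factor exponential in \<open>N\<close>. Log-convexity of moments and Gaussian concentration lead from
  order \<open>1 - h\<close> back to the mean logarithm.
\<close>

subsection \<open>Gaussian vectors\<close>

text \<open>Order \<open>1 - h\<close> has two advantages over the mean logarithm. Along the
  interpolation the two-replica term carries the small prefactor h. And in E Z^(1-h) <f> the weight
  exp of the energy of one replica is a Cameron-Martin density; once it is absorbed, only the power
  -h of the planted partition function has to be controlled.

  Signs of overlaps matter for odd p only. For even p a monomial is at most its absolute value, and
  the decoupled covariance, a multiple of the sum of lam_s x_s^p, does not see signs. For odd p this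
  sum may become negative and the comparison by AM-GM fails.

  The flip gains h \<kappa>, while concentration loses 9 h^2 V. Both \<kappa> and V are proportional
  to N, so that a fixed h wins for every fixed field strength and overlap threshold. The field is
  needed because without linear terms a flip may cost nothing.

  Truncation is harmless in the single-species model: the omitted orders change the free energy by
  at most half of their variance, which is just their share of
  \<open>xi_single \<beta> 1 / 2\<close>. So the truncated model also attains its annealed
  value.\<close>

lemma has_real_derivative_lebesgue_integral:
  fixes f f' :: "real \<Rightarrow> 'a \<Rightarrow> real"
  assumes e: "0 < e"
    and int: "\<And>t. \<bar>t - t0\<bar> < e \<Longrightarrow> integrable M (f t)"
    and deriv: "\<And>t x. x \<in> space M \<Longrightarrow> \<bar>t - t0\<bar> < e \<Longrightarrow>
          ((\<lambda>t. f t x) has_real_derivative f' t x) (at t)"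
    and bound: "\<And>t x. x \<in> space M \<Longrightarrow> \<bar>t - t0\<bar> < e \<Longrightarrow> \<bar>f' t x\<bar> \<le> B x"
    and B: "integrable M B"
    and meas: "f' t0 \<in> borel_measurable M"
  shows "((\<lambda>t. LINT x|M. f t x) has_real_derivative (LINT x|M. f' t0 x)) (at t0)"
  unfolding DERIV_def LIMSEQ_SEQ_conv[symmetric]
proof (intro allI impI, elim conjE)
  fix S :: "nat \<Rightarrow> real"
  assume S0: "\<forall>n. S n \<noteq> 0" and S: "S \<longlonglongrightarrow> 0"
  obtain n0 where n0: "\<And>n. n \<ge> n0 \<Longrightarrow> \<bar>S n\<bar> < e"
    using LIMSEQ_D[OF S e] by auto
  \<comment> \<open>The derivative and its bound are available only within distance \<open>e\<close>
    of \<open>t0\<close>, so the first terms of the sequence are dropped.\<close>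
  define T where "T n = S (n + n0)" for n
  have T0: "T n \<noteq> 0" and Te: "\<bar>T n\<bar> < e" for n
    using S0 n0[of "n + n0"] by (auto simp: T_def)
  have T: "T \<longlonglongrightarrow> 0" unfolding T_def by (rule LIMSEQ_ignore_initial_segment[OF S])
  have int0: "integrable M (f t0)" using int[of t0] e by simp
  have intT: "integrable M (f (t0 + T n))" for n using int[of "t0 + T n"] Te by simp
  have lim: "(\<lambda>n. (f (t0 + T n) x - f t0 x) / T n) \<longlonglongrightarrow> f' t0 x" if x: "x \<in> space M" for x
  proof -
    have "((\<lambda>t. f t x) has_real_derivative f' t0 x) (at t0)" using deriv[OF x] e by simp
    then show ?thesis unfolding DERIV_def LIMSEQ_SEQ_conv[symmetric] using T0 T by auto
  qed
  have bnd: "\<bar>(f (t0 + T n) x - f t0 x) / T n\<bar> \<le> B x" if x: "x \<in> space M" for x n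
  proof -
    define a b where "a = min t0 (t0 + T n)" and "b = max t0 (t0 + T n)"
    have ab: "a < b" using T0[of n] unfolding a_def b_def by (auto simp: min_def max_def)
    have near: "\<bar>t - t0\<bar> < e" if "a \<le> t" "t \<le> b" for t
      using that Te[of n] unfolding a_def b_def by (auto simp: min_def max_def split: if_splits)
    obtain z where z: "a < z" "z < b" "f b x - f a x = (b - a) * f' z x"
      using MVT2[OF ab, of "\<lambda>t. f t x" "\<lambda>t. f' t x"] deriv[OF x near] by blast
    have "(f (t0 + T n) x - f t0 x) / T n = f' z x"
      using z(3) T0[of n] unfolding a_def b_def
      by (cases "T n > 0") (auto simp: min_def max_def field_simps split: if_splits)
    moreover have "\<bar>f' z x\<bar> \<le> B x" using bound[OF x near] z by simp
    ultimately show ?thesis by simp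
  qed
  have "(\<lambda>n. LINT x|M. (f (t0 + T n) x - f t0 x) / T n) \<longlonglongrightarrow> (LINT x|M. f' t0 x)"
  proof (rule integral_dominated_convergence[where w = B])
    show "f' t0 \<in> borel_measurable M" by fact
    show "(\<lambda>x. (f (t0 + T i) x - f t0 x) / T i) \<in> borel_measurable M" for i
      using int0 intT[of i] by measurable
    show "integrable M B" by fact
    show "AE x in M. (\<lambda>i. (f (t0 + T i) x - f t0 x) / T i) \<longlonglongrightarrow> f' t0 x"
      using lim by (auto intro!: AE_I2)
    show "AE x in M. norm ((f (t0 + T i) x - f t0 x) / T i) \<le> B x" for i
      using bnd by (auto intro!: AE_I2)
  qed
  then have "(\<lambda>n. ((LINT x|M. f (t0 + T n) x) - (LINT x|M. f t0 x)) / T n) \<longlonglongrightarrow> (LINT x|M. f' t0 x)"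
    using int0 intT by simp
  then show "(\<lambda>n. ((LINT x|M. f (t0 + S n) x) - (LINT x|M. f t0 x)) / S n) \<longlonglongrightarrow> (LINT x|M. f' t0 x)"
    unfolding T_def by (rule LIMSEQ_offset)
qed

section \<open>Product Gaussian measures: growth, sign changes, shifts, integration by parts\<close>

abbreviation std_normal :: "real measure" where
  "std_normal \<equiv> density lborel (\<lambda>x. ennreal (std_normal_density x))"

definition gauss :: "'j set \<Rightarrow> ('j \<Rightarrow> real) measure" where
  "gauss J = Pi\<^sub>M J (\<lambda>_. std_normal)"

lemma prob_space_std_normal: "prob_space std_normal"
  by (rule prob_space_normal_density) simp

lemma sets_gauss [measurable_cong]: "sets (gauss J) = sets (Pi\<^sub>M J (\<lambda>_. borel))"
  unfolding gauss_def by (rule sets_PiM_cong) auto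

lemma space_gauss: "space (gauss J) = J \<rightarrow>\<^sub>E UNIV"
  unfolding gauss_def by (simp add: space_PiM)

lemma prob_space_gauss: "prob_space (gauss J)"
  unfolding gauss_def by (intro prob_space_PiM prob_space_std_normal)

lemma product_sigma_finite_std_normal: "product_sigma_finite (\<lambda>_::'j. std_normal)"
proof -
  interpret prob_space std_normal by (rule prob_space_std_normal)
  show ?thesis by unfold_locales
qed

lemma distr_std_normal_affine:
  assumes "\<alpha> \<noteq> 0"
  shows "distr std_normal borel (\<lambda>x. a + \<alpha> * x) = density lborel (normal_density a \<bar>\<alpha>\<bar>)"
proof -
  interpret prob_space std_normal by (rule prob_space_std_normal)
  have 1: "distributed std_normal lborel (\<lambda>x. x) (normal_density 0 1)"
    unfolding distributed_def by (auto simp: distr_id2)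
  have "distr std_normal lborel (\<lambda>x. a + \<alpha> * x) = density lborel (normal_density a \<bar>\<alpha>\<bar>)"
    using normal_density_affine[OF 1 _ assms, of a] by (simp add: distributed_def)
  then show ?thesis
    by (metis distr_cong sets_lborel)
qed

lemma std_normal_density_shift:
  "std_normal_density x * exp (a * x - a\<^sup>2 / 2) = normal_density a 1 x"
  unfolding normal_density_def by (simp add: exp_add[symmetric] power2_eq_square field_simps)

lemma density_std_normal_exp:
  "density std_normal (\<lambda>x. ennreal (exp (a * x - a\<^sup>2 / 2))) = distr std_normal borel (\<lambda>x. x + a)"
proof -
  have "density std_normal (\<lambda>x. ennreal (exp (a * x - a\<^sup>2 / 2))) = density lborel (normal_density a 1)"
    by (subst density_density_eq)
       (auto simp: ennreal_mult[symmetric] std_normal_density_shift intro!: density_cong)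
  then show ?thesis using distr_std_normal_affine[of 1 a] by (simp add: add.commute)
qed

lemma integrable_std_normal_exp: "integrable std_normal (\<lambda>x. exp (a * x))"
proof -
  have "integrable lborel (\<lambda>x. exp (a\<^sup>2 / 2) * normal_density a 1 x)" by simp
  also have "(\<lambda>x. exp (a\<^sup>2 / 2) * normal_density a 1 x) = (\<lambda>x. std_normal_density x *\<^sub>R exp (a * x))"
    by (rule ext, subst std_normal_density_shift[symmetric]) (simp add: exp_diff)
  finally show ?thesis by (subst integrable_density) auto
qed

lemma integrable_std_normal_exp_abs: "integrable std_normal (\<lambda>x. exp (C * \<bar>x\<bar>))"
proof (rule Bochner_Integration.integrable_bound)
  show "integrable std_normal (\<lambda>x. exp (C * x) + exp (- C * x))"
    by (intro Bochner_Integration.integrable_add integrable_std_normal_exp)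
  have "exp (C * \<bar>x\<bar>) \<le> exp (C * x) + exp (- C * x)" for x :: real
    by (cases "x \<ge> 0") auto
  then show "AE x in std_normal. norm (exp (C * \<bar>x\<bar>)) \<le> norm (exp (C * x) + exp (- C * x))"
    by (intro AE_I2) (simp add: add_nonneg_nonneg)
qed simp

lemma integrable_gauss_exp_abs:
  assumes "finite J"
  shows "integrable (gauss J) (\<lambda>x. exp (C * (\<Sum>j\<in>J. \<bar>x j\<bar>)))"
proof -
  interpret product_sigma_finite "\<lambda>_. std_normal" by (rule product_sigma_finite_std_normal)
  have "integrable (Pi\<^sub>M J (\<lambda>_. std_normal)) (\<lambda>x. \<Prod>j\<in>J. exp (C * \<bar>x j\<bar>))"
    by (rule product_integrable_prod) (auto intro: assms integrable_std_normal_exp_abs)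
  then show ?thesis by (simp add: gauss_def exp_sum[OF assms, symmetric] sum_distrib_left)
qed

text \<open>Powers of partition functions and Gibbs averages grow at most exponentially in the l1
  norm of the disorder; this criterion settles their integrability throughout.\<close>

lemma integrable_gauss_exp_growth:
  assumes "finite J" and [measurable]: "f \<in> borel_measurable (gauss J)"
    and "\<And>x. x \<in> space (gauss J) \<Longrightarrow> \<bar>f x\<bar> \<le> K * exp (C * (\<Sum>j\<in>J. \<bar>x j\<bar>))"
  shows "integrable (gauss J) f"
proof (rule Bochner_Integration.integrable_bound)
  show "integrable (gauss J) (\<lambda>x. K * exp (C * (\<Sum>j\<in>J. \<bar>x j\<bar>)))"
    using integrable_gauss_exp_abs[OF assms(1)] by simp
  show "AE x in gauss J. norm (f x) \<le> norm (K * exp (C * (\<Sum>j\<in>J. \<bar>x j\<bar>)))"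
    using assms(3) by (intro AE_I2) (metis abs_ge_self order_trans real_norm_def)
qed fact

text \<open>Common source of the sign symmetry and the Cameron-Martin formula of Gaussian vectors,
  and later of the sign symmetry of a product of spheres.\<close>

lemma distr_PiM_componentwise:
  assumes J: "finite J" and M: "\<And>j. prob_space (M j)"
    and f[measurable]: "\<And>j. f j \<in> measurable (M j) (M' j)"
  shows "distr (Pi\<^sub>M J M) (Pi\<^sub>M J M') (\<lambda>x. \<lambda>j\<in>J. f j (x j)) = Pi\<^sub>M J (\<lambda>j. distr (M j) (M' j) (f j))"
proof -
  interpret N: product_prob_space "\<lambda>j. distr (M j) (M' j) (f j)"
    by (intro product_prob_spaceI prob_space.prob_space_distr M f)
  interpret MM: product_prob_space M by (intro product_prob_spaceI M)
  show ?thesis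
  proof (rule N.PiM_eqI[OF J])
    show "sets (distr (Pi\<^sub>M J M) (Pi\<^sub>M J M') (\<lambda>x. \<lambda>j\<in>J. f j (x j))) = sets (Pi\<^sub>M J (\<lambda>j. distr (M j) (M' j) (f j)))"
      by (simp cong: sets_PiM_cong)
    fix A assume A: "\<And>i. i \<in> J \<Longrightarrow> A i \<in> sets (distr (M i) (M' i) (f i))"
    then have A': "\<And>i. i \<in> J \<Longrightarrow> A i \<in> sets (M' i)" by simp
    have fx: "f i y \<in> space (M' i)" if "y \<in> space (M i)" for i y
      using f[of i] that by (rule measurable_space)
    have eq: "(\<lambda>x. \<lambda>j\<in>J. f j (x j)) -` (Pi\<^sub>E J A) \<inter> space (Pi\<^sub>M J M) = (\<Pi>\<^sub>E i\<in>J. f i -` A i \<inter> space (M i))"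
      by (auto simp: space_PiM PiE_def Pi_def extensional_def)
    have "emeasure (distr (Pi\<^sub>M J M) (Pi\<^sub>M J M') (\<lambda>x. \<lambda>j\<in>J. f j (x j))) (Pi\<^sub>E J A)
        = emeasure (Pi\<^sub>M J M) (\<Pi>\<^sub>E i\<in>J. f i -` A i \<inter> space (M i))"
      using A' J by (subst emeasure_distr) (auto simp: eq intro!: sets_PiM_I_finite)
    also have "\<dots> = (\<Prod>i\<in>J. emeasure (M i) (f i -` A i \<inter> space (M i)))"
      using A' J by (intro MM.emeasure_PiM) auto
    also have "\<dots> = (\<Prod>i\<in>J. emeasure (distr (M i) (M' i) (f i)) (A i))"
      using A' by (intro prod.cong refl emeasure_distr[symmetric]) auto
    finally show "emeasure (distr (Pi\<^sub>M J M) (Pi\<^sub>M J M') (\<lambda>x. \<lambda>j\<in>J. f j (x j))) (Pi\<^sub>E J A)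
        = (\<Prod>i\<in>J. emeasure (distr (M i) (M' i) (f i)) (A i))" .
  qed
qed

lemma gauss_sign_invariant:
  assumes J: "finite J" and chi: "\<And>j. j \<in> J \<Longrightarrow> chi j = 1 \<or> chi j = (-1::real)"
  shows "distr (gauss J) (gauss J) (\<lambda>x. \<lambda>j\<in>J. chi j * x j) = gauss J"
proof -
  \<comment> \<open>The identity of the component laws is used for all indices, so
    \<open>chi\<close> is extended by 1 off \<open>J\<close>.\<close>
  define c where "c j = (if j \<in> J then chi j else 1)" for j
  have c: "c j = 1 \<or> c j = -1" for j using chi by (auto simp: c_def)
  have "distr (Pi\<^sub>M J (\<lambda>_. std_normal)) (Pi\<^sub>M J (\<lambda>_. borel)) (\<lambda>x. \<lambda>j\<in>J. c j * x j)
      = Pi\<^sub>M J (\<lambda>j. distr std_normal borel (\<lambda>x. c j * x))"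
    by (rule distr_PiM_componentwise[OF J prob_space_std_normal]) simp
  also have "(\<lambda>j. distr std_normal borel (\<lambda>x. c j * x)) = (\<lambda>j. std_normal)"
    using distr_std_normal_affine[of "c j" 0 for j] c by (auto simp: fun_eq_iff) (metis abs_1 abs_minus mult_1 mult_minus1 zero_neq_neg_one zero_neq_one)
  finally have "distr (gauss J) (Pi\<^sub>M J (\<lambda>_. borel)) (\<lambda>x. \<lambda>j\<in>J. c j * x j) = gauss J"
    by (simp only: gauss_def)
  moreover have "distr (gauss J) (gauss J) (\<lambda>x. \<lambda>j\<in>J. chi j * x j) = distr (gauss J) (Pi\<^sub>M J (\<lambda>_. borel)) (\<lambda>x. \<lambda>j\<in>J. c j * x j)"
    by (intro distr_cong refl) (auto simp: sets_gauss c_def fun_eq_iff)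
  ultimately show ?thesis by simp
qed

text \<open>The Cameron-Martin formula in finite dimension: in each coordinate the square is
  completed, and a product measure is determined by its values on boxes.\<close>

lemma gauss_shift:
  assumes J: "finite J"
  shows "distr (gauss J) (gauss J) (\<lambda>x. \<lambda>j\<in>J. x j + a j) =
     density (gauss J) (\<lambda>x. ennreal (exp (\<Sum>j\<in>J. a j * x j - (a j)\<^sup>2 / 2)))"
proof -
  interpret S: product_sigma_finite "\<lambda>_. std_normal" by (rule product_sigma_finite_std_normal)
  have pr: "prob_space (distr std_normal borel (\<lambda>x. x + b))" for b
    by (intro prob_space.prob_space_distr prob_space_std_normal) simp
  interpret N: product_prob_space "\<lambda>j. distr std_normal borel (\<lambda>x. x + a j)"
    by (intro product_prob_spaceI pr)
  have "distr (Pi\<^sub>M J (\<lambda>_. std_normal)) (Pi\<^sub>M J (\<lambda>_. borel)) (\<lambda>x. \<lambda>j\<in>J. x j + a j)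
      = Pi\<^sub>M J (\<lambda>j. distr std_normal borel (\<lambda>x. x + a j))"
    by (rule distr_PiM_componentwise[OF J prob_space_std_normal]) simp
  moreover have "distr (gauss J) (gauss J) (\<lambda>x. \<lambda>j\<in>J. x j + a j) =
     distr (Pi\<^sub>M J (\<lambda>_. std_normal)) (Pi\<^sub>M J (\<lambda>_. borel)) (\<lambda>x. \<lambda>j\<in>J. x j + a j)"
    unfolding gauss_def[symmetric] by (intro distr_cong) (auto simp: sets_gauss)
  moreover have "Pi\<^sub>M J (\<lambda>j. distr std_normal borel (\<lambda>x. x + a j)) =
     density (gauss J) (\<lambda>x. ennreal (exp (\<Sum>j\<in>J. a j * x j - (a j)\<^sup>2 / 2)))"
  proof (rule N.PiM_eqI[symmetric, OF J]) 
    show "sets (density (gauss J) (\<lambda>x. ennreal (exp (\<Sum>j\<in>J. a j * x j - (a j)\<^sup>2 / 2)))) =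
       sets (Pi\<^sub>M J (\<lambda>j. distr std_normal borel (\<lambda>x. x + a j)))"
      by (simp add: sets_gauss cong: sets_PiM_cong)
    fix A assume A: "\<And>i. i \<in> J \<Longrightarrow> A i \<in> sets (distr std_normal borel (\<lambda>x. x + a i))"
    then have A': "\<And>i. i \<in> J \<Longrightarrow> A i \<in> sets borel" by simp
    have PA: "Pi\<^sub>E J A \<in> sets (gauss J)" unfolding gauss_def by (rule sets_PiM_I_finite[OF J]) (use A' in auto)
    have "emeasure (density (gauss J) (\<lambda>x. ennreal (exp (\<Sum>j\<in>J. a j * x j - (a j)\<^sup>2 / 2)))) (Pi\<^sub>E J A)
       = (\<integral>\<^sup>+x. ennreal (exp (\<Sum>j\<in>J. a j * x j - (a j)\<^sup>2 / 2)) * indicator (Pi\<^sub>E J A) x \<partial>gauss J)"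
      using PA by (intro emeasure_density) auto
    also have "\<dots> = (\<integral>\<^sup>+x. (\<Prod>j\<in>J. ennreal (exp (a j * x j - (a j)\<^sup>2 / 2)) * indicator (A j) (x j)) \<partial>gauss J)"
    proof (rule nn_integral_cong)
      fix x assume "x \<in> space (gauss J)"
      then have "indicator (Pi\<^sub>E J A) x = (\<Prod>j\<in>J. indicator (A j) (x j) :: ennreal)"
        using J by (auto simp: indicator_def space_gauss PiE_def Pi_def prod_zero_iff)
      then show "ennreal (exp (\<Sum>j\<in>J. a j * x j - (a j)\<^sup>2 / 2)) * indicator (Pi\<^sub>E J A) x =
         (\<Prod>j\<in>J. ennreal (exp (a j * x j - (a j)\<^sup>2 / 2)) * indicator (A j) (x j))"
        by (simp add: exp_sum[OF J] prod_ennreal prod.distrib)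
    qed
    also have "\<dots> = (\<Prod>j\<in>J. \<integral>\<^sup>+y. ennreal (exp (a j * y - (a j)\<^sup>2 / 2)) * indicator (A j) y \<partial>std_normal)"
      unfolding gauss_def using A' by (intro S.product_nn_integral_prod J) auto
    also have "\<dots> = (\<Prod>j\<in>J. emeasure (distr std_normal borel (\<lambda>x. x + a j)) (A j))"
      using A' by (intro prod.cong refl) (simp add: density_std_normal_exp[symmetric] emeasure_density)
    finally show "emeasure (density (gauss J) (\<lambda>x. ennreal (exp (\<Sum>j\<in>J. a j * x j - (a j)\<^sup>2 / 2)))) (Pi\<^sub>E J A) =
       (\<Prod>i\<in>J. emeasure (distr std_normal borel (\<lambda>x. x + a i)) (A i))" .
  qed
  ultimately show ?thesis by simp
qed

lemma integral_gauss_shift: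
  fixes f :: "_ \<Rightarrow> real"
  assumes J: "finite J" and [measurable]: "f \<in> borel_measurable (gauss J)"
  shows "(LINT x|gauss J. exp (\<Sum>j\<in>J. a j * x j) * f x) =
     exp ((\<Sum>j\<in>J. (a j)\<^sup>2) / 2) * (LINT x|gauss J. f (\<lambda>j\<in>J. x j + a j))"
proof -
  have "(LINT x|gauss J. f (\<lambda>j\<in>J. x j + a j)) = (LINT x|distr (gauss J) (gauss J) (\<lambda>x. \<lambda>j\<in>J. x j + a j). f x)"
    by (rule integral_distr[symmetric]) measurable
  also have "\<dots> = (LINT x|gauss J. exp (\<Sum>j\<in>J. a j * x j - (a j)\<^sup>2 / 2) * f x)"
    unfolding gauss_shift[OF J] by (subst integral_density) auto
  also have "\<dots> = (LINT x|gauss J. exp (- ((\<Sum>j\<in>J. (a j)\<^sup>2) / 2)) * (exp (\<Sum>j\<in>J. a j * x j) * f x))"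
  proof (intro Bochner_Integration.integral_cong refl)
    fix x
    show "exp (\<Sum>j\<in>J. a j * x j - (a j)\<^sup>2 / 2) * f x = exp (- ((\<Sum>j\<in>J. (a j)\<^sup>2) / 2)) * (exp (\<Sum>j\<in>J. a j * x j) * f x)"
      by (simp add: sum_subtractf sum_divide_distrib[symmetric] mult.assoc[symmetric] exp_add[symmetric])
  qed
  finally show ?thesis by (simp add: exp_minus)
qed

lemma exp_abs_bound: "\<bar>x\<bar> \<le> exp \<bar>x::real\<bar>"
  using exp_ge_add_one_self[of "\<bar>x\<bar>"] by linarith

text \<open>Both sides of the Cameron-Martin identity E f(x + s e_i) = E exp(s x_i - s^2/2) f(x) are
  differentiated at s = 0. This needs no integration over a single coordinate and produces no
  boundary terms.\<close>

lemma gauss_integration_by_parts: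
  fixes f :: "_ \<Rightarrow> real"
  assumes J: "finite J" and i: "i \<in> J"
    and [measurable]: "f \<in> borel_measurable (gauss J)" "f' \<in> borel_measurable (gauss J)"
    and deriv: "\<And>x t. x \<in> space (gauss J) \<Longrightarrow>
       ((\<lambda>t. f (x(i := t))) has_real_derivative f' (x(i := t))) (at t)"
    and f: "\<And>x. x \<in> space (gauss J) \<Longrightarrow> \<bar>f x\<bar> \<le> K * exp (C * (\<Sum>j\<in>J. \<bar>x j\<bar>))"
    and f': "\<And>x. x \<in> space (gauss J) \<Longrightarrow> \<bar>f' x\<bar> \<le> K * exp (C * (\<Sum>j\<in>J. \<bar>x j\<bar>))"
    and C: "0 \<le> C" and K: "0 \<le> K"
  shows "(LINT x|gauss J. x i * f x) = (LINT x|gauss J. f' x)"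
proof -
  let ?S = "\<lambda>x. \<Sum>j\<in>J. \<bar>x j\<bar>"
  have Si: "\<bar>x i\<bar> \<le> ?S x" for x :: "_ \<Rightarrow> real"
    using J i member_le_sum[of i J "\<lambda>j. \<bar>x j\<bar>"] by simp
  have upd: "x(i := t) \<in> space (gauss J)" if "x \<in> space (gauss J)" for x t
    using that i by (auto simp: space_gauss PiE_def extensional_def)
  have Supd: "?S (x(i := x i + s)) \<le> ?S x + \<bar>s\<bar>" for x :: "_ \<Rightarrow> real" and s
    by (simp add: sum.remove[OF J i])
  have f_bnd: "\<bar>F (x(i := x i + s))\<bar> \<le> K * exp C * exp (C * ?S x)"
    if F: "\<And>x. x \<in> space (gauss J) \<Longrightarrow> \<bar>F x\<bar> \<le> K * exp (C * ?S x)" and x: "x \<in> space (gauss J)" and s: "\<bar>s\<bar> < 1" for F x s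
  proof -
    have "\<bar>F (x(i := x i + s))\<bar> \<le> K * exp (C * ?S (x(i := x i + s)))"
      by (rule F[OF upd[OF x]])
    also have "\<dots> \<le> K * exp (C * (?S x + 1))"
      using Supd[of x s] s by (intro mult_left_mono K) (auto intro!: mult_left_mono C)
    finally show ?thesis by (simp add: algebra_simps exp_add)
  qed
  have meas_upd[measurable]: "(\<lambda>x. F (x(i := x i + s))) \<in> borel_measurable (gauss J)"
    if "F \<in> borel_measurable (gauss J)" for F :: "_ \<Rightarrow> real" and s
  proof -
    have "(\<lambda>x. x(i := x i + s)) \<in> measurable (gauss J) (gauss J)"
      using i unfolding gauss_def by (intro measurable_fun_upd[where J = J]) auto
    with that show ?thesis by measurable
  qed
  have int: "integrable (gauss J) (\<lambda>x. F (x(i := x i + s)))"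
    if [measurable]: "F \<in> borel_measurable (gauss J)" and F: "\<And>x. x \<in> space (gauss J) \<Longrightarrow> \<bar>F x\<bar> \<le> K * exp (C * ?S x)" and s: "\<bar>s\<bar> < 1" for F s
    by (rule integrable_gauss_exp_growth[OF J meas_upd[OF that(1)] f_bnd[OF F _ s]])
  have L: "((\<lambda>s. LINT x|gauss J. f (x(i := x i + s))) has_real_derivative (LINT x|gauss J. f' (x(i := x i + 0)))) (at 0)"
  proof (rule has_real_derivative_lebesgue_integral[where e = 1 and B = "\<lambda>x. K * exp C * exp (C * ?S x)"])
    fix s :: real and x assume x: "x \<in> space (gauss J)" and s: "\<bar>s - 0\<bar> < 1"
    have "((\<lambda>s. f (x(i := x i + s))) has_real_derivative f' (x(i := x i + s)) * 1) (at s)"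
      by (rule DERIV_chain'[OF _ deriv[OF x]]) (auto intro!: derivative_eq_intros)
    then show "((\<lambda>s. f (x(i := x i + s))) has_real_derivative f' (x(i := x i + s))) (at s)" by simp
    show "\<bar>f' (x(i := x i + s))\<bar> \<le> K * exp C * exp (C * ?S x)" using f_bnd[of f' x s, OF f' x] s by simp
  next
    show "integrable (gauss J) (\<lambda>x. K * exp C * exp (C * ?S x))"
      using integrable_gauss_exp_abs[OF J] by simp
  qed (auto intro!: int f)
  have R: "((\<lambda>s. LINT x|gauss J. exp (s * x i - s\<^sup>2 / 2) * f x) has_real_derivative
      (LINT x|gauss J. (x i - 0) * (exp (0 * x i - 0\<^sup>2 / 2) * f x))) (at 0)"
  proof (rule has_real_derivative_lebesgue_integral[where e = 1 and B = "\<lambda>x. exp 1 * K * exp ((C + 2) * ?S x)"])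
    fix s :: real and x assume x: "x \<in> space (gauss J)" and s: "\<bar>s - 0\<bar> < 1"
    show "((\<lambda>s. exp (s * x i - s\<^sup>2 / 2) * f x) has_real_derivative (x i - s) * (exp (s * x i - s\<^sup>2 / 2) * f x)) (at s)"
      by (auto intro!: derivative_eq_intros)
    have "\<bar>x i - s\<bar> \<le> exp \<bar>x i - s\<bar>" by (rule exp_abs_bound)
    also have "\<dots> \<le> exp (?S x + 1)" using Si[of x] s by auto
    finally have 1: "\<bar>x i - s\<bar> \<le> exp (?S x + 1)" .
    have "s * x i \<le> \<bar>s\<bar> * \<bar>x i\<bar>" by (simp add: abs_mult[symmetric])
    also have "\<dots> \<le> 1 * ?S x" using s Si[of x] by (intro mult_mono) auto
    finally have 2: "exp (s * x i - s\<^sup>2 / 2) \<le> exp (?S x)" by (simp add: add_increasing2 diff_le_eq)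
    have "\<bar>(x i - s) * (exp (s * x i - s\<^sup>2 / 2) * f x)\<bar> \<le> exp (?S x + 1) * (exp (?S x) * (K * exp (C * ?S x)))"
      unfolding abs_mult abs_exp_cancel using 1 2 f[OF x] K by (intro mult_mono) auto
    also have "\<dots> = exp 1 * K * exp ((C + 2) * ?S x)" by (simp add: exp_add[symmetric] algebra_simps)
    finally show "\<bar>(x i - s) * (exp (s * x i - s\<^sup>2 / 2) * f x)\<bar> \<le> exp 1 * K * exp ((C + 2) * ?S x)" .
  next
    fix t :: real assume t: "\<bar>t - 0\<bar> < 1"
    show "integrable (gauss J) (\<lambda>x. exp (t * x i - t\<^sup>2 / 2) * f x)"
    proof (rule integrable_gauss_exp_growth[OF J])
      show "(\<lambda>x. exp (t * x i - t\<^sup>2 / 2) * f x) \<in> borel_measurable (gauss J)" using i by measurable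
      fix x assume x: "x \<in> space (gauss J)"
      have "t * x i \<le> \<bar>t\<bar> * \<bar>x i\<bar>" by (simp add: abs_mult[symmetric])
      also have "\<dots> \<le> 1 * ?S x" using t Si[of x] by (intro mult_mono) auto
      finally have 2: "exp (t * x i - t\<^sup>2 / 2) \<le> exp (?S x)" by (simp add: add_increasing2 diff_le_eq)
      have "\<bar>exp (t * x i - t\<^sup>2 / 2) * f x\<bar> \<le> exp (?S x) * (K * exp (C * ?S x))"
        unfolding abs_mult abs_exp_cancel using 2 f[OF x] K by (intro mult_mono) auto
      then show "\<bar>exp (t * x i - t\<^sup>2 / 2) * f x\<bar> \<le> K * exp ((C + 1) * ?S x)"
        by (simp add: exp_add algebra_simps)
    qed
  next
    show "integrable (gauss J) (\<lambda>x. exp 1 * K * exp ((C + 2) * ?S x))"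
      using integrable_gauss_exp_abs[OF J] by simp
  next
    show "(\<lambda>x. (x i - 0) * (exp (0 * x i - 0\<^sup>2 / 2) * f x)) \<in> borel_measurable (gauss J)"
      using i by measurable
  qed simp
  have eq: "(LINT x|gauss J. f (x(i := x i + s))) = (LINT x|gauss J. exp (s * x i - s\<^sup>2 / 2) * f x)" for s
  proof -
    define a where "a j = (if j = i then s else 0)" for j
    have a: "(\<Sum>j\<in>J. a j * x j) = s * x i" "(\<Sum>j\<in>J. (a j)\<^sup>2) = s\<^sup>2" for x
      using J i by (auto simp: a_def if_distrib[of "\<lambda>z. z * _"] if_distrib[of "\<lambda>z. z\<^sup>2"] cong: if_cong)
    have sh: "(\<lambda>j\<in>J. x j + a j) = x(i := x i + s)" if "x \<in> space (gauss J)" for x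
      using that i by (auto simp: a_def space_gauss PiE_def extensional_def fun_eq_iff)
    have "exp (s\<^sup>2 / 2) * (LINT x|gauss J. f (x(i := x i + s))) = exp (s\<^sup>2 / 2) * (LINT x|gauss J. f (\<lambda>j\<in>J. x j + a j))"
      using sh by (simp cong: Bochner_Integration.integral_cong)
    also have "\<dots> = (LINT x|gauss J. exp (s * x i) * f x)"
      using integral_gauss_shift[OF J, of f a] by (simp add: a)
    also have "\<dots> = (LINT x|gauss J. exp (s\<^sup>2 / 2) * (exp (s * x i - s\<^sup>2 / 2) * f x))"
      by (simp add: exp_diff)
    finally show ?thesis by simp
  qed
  show ?thesis using DERIV_unique[OF L[unfolded eq] R] by (simp add: algebra_simps)
qed

subsection \<open>Gibbs averages and the Gaussian flow\<close>

definition energy :: "'j set \<Rightarrow> ('j \<Rightarrow> 'a \<Rightarrow> real) \<Rightarrow> ('j \<Rightarrow> real) \<Rightarrow> 'a \<Rightarrow> real" where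
  "energy J w x \<sigma> = (\<Sum>j\<in>J. x j * w j \<sigma>)"

text \<open>For the disorder \<open>x\<close>, \<open>num\<close> is the unnormalized Gibbs average,
  \<open>pf\<close> the partition function and \<open>gav\<close> the Gibbs average.\<close>

definition num :: "'a measure \<Rightarrow> 'j set \<Rightarrow> ('j \<Rightarrow> 'a \<Rightarrow> real) \<Rightarrow> ('a \<Rightarrow> real) \<Rightarrow> ('j \<Rightarrow> real) \<Rightarrow> real" where
  "num \<nu> J w \<phi> x = (LINT \<sigma>|\<nu>. \<phi> \<sigma> * exp (energy J w x \<sigma>))"

definition pf :: "'a measure \<Rightarrow> 'j set \<Rightarrow> ('j \<Rightarrow> 'a \<Rightarrow> real) \<Rightarrow> ('j \<Rightarrow> real) \<Rightarrow> real" where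
  "pf \<nu> J w x = (LINT \<sigma>|\<nu>. exp (energy J w x \<sigma>))"

definition gav :: "'a measure \<Rightarrow> 'j set \<Rightarrow> ('j \<Rightarrow> 'a \<Rightarrow> real) \<Rightarrow> ('a \<Rightarrow> real) \<Rightarrow> ('j \<Rightarrow> real) \<Rightarrow> real" where
  "gav \<nu> J w \<phi> x = num \<nu> J w \<phi> x / pf \<nu> J w x"

text \<open>\<open>u j\<close> is the variance of the coupling with index j. The disorder itself
  stays standard, so that one Gaussian measure serves all interpolation parameters.\<close>

definition scale :: "('j \<Rightarrow> real) \<Rightarrow> ('j \<Rightarrow> real) \<Rightarrow> 'j \<Rightarrow> real" where
  "scale u x j = sqrt (u j) * x j"

definition l1 :: "'j set \<Rightarrow> ('j \<Rightarrow> real) \<Rightarrow> real" where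
  "l1 J x = (\<Sum>j\<in>J. \<bar>x j\<bar>)"

lemma l1_nonneg [simp]: "0 \<le> l1 J x" by (simp add: l1_def sum_nonneg)

lemma abs_le_l1: "finite J \<Longrightarrow> j \<in> J \<Longrightarrow> \<bar>x j\<bar> \<le> l1 J x"
  unfolding l1_def by (rule member_le_sum) auto

lemma l1_scale_le:
  assumes "\<And>j. j \<in> J \<Longrightarrow> \<bar>sqrt (u j)\<bar> \<le> U"
  shows "l1 J (scale u x) \<le> U * l1 J x"
  unfolding l1_def scale_def sum_distrib_left abs_mult
  using assms by (intro sum_mono mult_right_mono) auto

lemma borel_measurable_l1 [measurable]: "l1 J \<in> borel_measurable (gauss J)"
  unfolding l1_def by measurable

text \<open>The reference measure is finite rather than a probability, because the planted measures
  and their restrictions to a set of configurations must be instances as well. Bounded observables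
  make every differentiation under the integral dominated.\<close>

locale gibbs = finite_measure \<nu> for \<nu> :: "'a measure" +
  fixes J :: "'j set" and w :: "'j \<Rightarrow> 'a \<Rightarrow> real" and C :: real
  assumes finite_J: "finite J"
    and meas_w [measurable]: "\<And>j. j \<in> J \<Longrightarrow> w j \<in> borel_measurable \<nu>"
    and bound_w: "\<And>j \<sigma>. j \<in> J \<Longrightarrow> \<sigma> \<in> space \<nu> \<Longrightarrow> \<bar>w j \<sigma>\<bar> \<le> C"
    and C_nonneg: "0 \<le> C"
    and mass_pos: "0 < measure \<nu> (space \<nu>)"
begin

abbreviation "Z \<equiv> pf \<nu> J w"
abbreviation "mass \<equiv> measure \<nu> (space \<nu>)"

lemma energy_bound: "\<sigma> \<in> space \<nu> \<Longrightarrow> \<bar>energy J w x \<sigma>\<bar> \<le> C * l1 J x"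
  unfolding energy_def l1_def sum_distrib_left
  by (rule order_trans[OF sum_abs], rule sum_mono)
     (auto simp: abs_mult mult.commute[of C] intro!: mult_left_mono bound_w)

lemma meas_energy [measurable]: "energy J w x \<in> borel_measurable \<nu>"
  unfolding energy_def by measurable

lemma integrable_bounded:
  assumes [measurable]: "f \<in> borel_measurable \<nu>" and "\<And>\<sigma>. \<sigma> \<in> space \<nu> \<Longrightarrow> \<bar>f \<sigma>\<bar> \<le> c"
  shows "integrable \<nu> (f :: 'a \<Rightarrow> real)"
  using assms by (intro integrable_const_bound[where B = c]) (auto intro!: AE_I2)

lemma integrable_num:
  assumes [measurable]: "\<phi> \<in> borel_measurable \<nu>" and \<phi>: "\<And>\<sigma>. \<sigma> \<in> space \<nu> \<Longrightarrow> \<bar>\<phi> \<sigma>\<bar> \<le> c"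
  shows "integrable \<nu> (\<lambda>\<sigma>. \<phi> \<sigma> * exp (energy J w x \<sigma>))"
proof (rule integrable_bounded)
  fix \<sigma> assume s: "\<sigma> \<in> space \<nu>"
  have "0 \<le> c" using \<phi>[OF s] by linarith
  then show "\<bar>\<phi> \<sigma> * exp (energy J w x \<sigma>)\<bar> \<le> c * exp (C * l1 J x)"
    unfolding abs_mult using \<phi>[OF s] energy_bound[OF s, of x] by (intro mult_mono) auto
qed simp

lemma integrable_exp_energy: "integrable \<nu> (\<lambda>\<sigma>. exp (energy J w x \<sigma>))"
  using integrable_num[of "\<lambda>_. 1" 1] by simp

lemma pf_eq_num: "pf \<nu> J w = num \<nu> J w (\<lambda>_. 1)"
  by (simp add: pf_def num_def fun_eq_iff)

lemma pf_lower: "mass * exp (- (C * l1 J x)) \<le> Z x"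
proof -
  have "mass * exp (- (C * l1 J x)) = (LINT \<sigma>|\<nu>. exp (- (C * l1 J x)))" by simp
  also have "\<dots> \<le> Z x" unfolding pf_def
    using energy_bound[of _ x] by (intro integral_mono integrable_exp_energy) (auto simp: abs_le_iff minus_le_iff)
  finally show ?thesis .
qed

lemma pf_upper: "Z x \<le> mass * exp (C * l1 J x)"
proof -
  have "Z x \<le> (LINT \<sigma>|\<nu>. exp (C * l1 J x))" unfolding pf_def
    using energy_bound[of _ x] by (intro integral_mono integrable_exp_energy) (auto simp: abs_le_iff)
  then show ?thesis by (simp add: mult.commute)
qed

lemma pf_pos: "0 < Z x"
  using mass_pos by (intro less_le_trans[OF _ pf_lower]) auto

lemma ln_pf_bound: "\<bar>ln (Z x)\<bar> \<le> \<bar>ln mass\<bar> + C * l1 J x"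
proof -
  have "ln (Z x) \<le> ln (mass * exp (C * l1 J x))" using pf_upper pf_pos mass_pos by (subst ln_le_cancel_iff) auto
  then have 1: "ln (Z x) \<le> ln mass + C * l1 J x" using mass_pos by (simp add: ln_mult)
  have "ln (mass * exp (- (C * l1 J x))) \<le> ln (Z x)" using pf_lower pf_pos mass_pos by (subst ln_le_cancel_iff) auto
  then have "ln mass - C * l1 J x \<le> ln (Z x)" using mass_pos by (simp add: ln_mult)
  with 1 show ?thesis by linarith
qed

lemma num_mono:
  assumes "\<phi> \<in> borel_measurable \<nu>" "\<And>\<sigma>. \<sigma> \<in> space \<nu> \<Longrightarrow> \<bar>\<phi> \<sigma>\<bar> \<le> c"
    and "\<psi> \<in> borel_measurable \<nu>" "\<And>\<sigma>. \<sigma> \<in> space \<nu> \<Longrightarrow> \<bar>\<psi> \<sigma>\<bar> \<le> d"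
    and "\<And>\<sigma>. \<sigma> \<in> space \<nu> \<Longrightarrow> \<phi> \<sigma> \<le> \<psi> \<sigma>"
  shows "num \<nu> J w \<phi> x \<le> num \<nu> J w \<psi> x"
  unfolding num_def using assms
  by (intro integral_mono integrable_num[of \<phi> c] integrable_num[of \<psi> d] mult_right_mono) auto

lemma num_bound:
  assumes "\<phi> \<in> borel_measurable \<nu>" "\<And>\<sigma>. \<sigma> \<in> space \<nu> \<Longrightarrow> \<bar>\<phi> \<sigma>\<bar> \<le> c"
  shows "\<bar>num \<nu> J w \<phi> x\<bar> \<le> c * Z x"
proof -
  have "\<bar>num \<nu> J w \<phi> x\<bar> \<le> (LINT \<sigma>|\<nu>. c * exp (energy J w x \<sigma>))"
    unfolding num_def
  proof (rule order_trans[OF integral_abs_bound integral_mono])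
    show "integrable \<nu> (\<lambda>\<sigma>. \<bar>\<phi> \<sigma> * exp (energy J w x \<sigma>)\<bar>)" using integrable_num[OF assms] by (rule integrable_abs)
    show "integrable \<nu> (\<lambda>\<sigma>. c * exp (energy J w x \<sigma>))" using integrable_exp_energy by simp
    show "\<bar>\<phi> \<sigma> * exp (energy J w x \<sigma>)\<bar> \<le> c * exp (energy J w x \<sigma>)" if "\<sigma> \<in> space \<nu>" for \<sigma>
      using assms(2)[OF that] by (simp add: abs_mult)
  qed
  then show ?thesis by (simp add: pf_def)
qed

lemma gav_bound:
  assumes "\<phi> \<in> borel_measurable \<nu>" "\<And>\<sigma>. \<sigma> \<in> space \<nu> \<Longrightarrow> \<bar>\<phi> \<sigma>\<bar> \<le> c"
  shows "\<bar>gav \<nu> J w \<phi> x\<bar> \<le> c"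
  using num_bound[OF assms, of x] pf_pos[of x] by (simp add: gav_def pos_divide_le_eq)

lemma borel_measurable_num:
  assumes [measurable]: "\<And>j. j \<in> J \<Longrightarrow> (\<lambda>x. y x j) \<in> borel_measurable N" "\<phi> \<in> borel_measurable \<nu>"
  shows "(\<lambda>x. num \<nu> J w \<phi> (y x)) \<in> borel_measurable N"
  unfolding num_def energy_def by measurable

lemma borel_measurable_pf:
  assumes [measurable]: "\<And>j. j \<in> J \<Longrightarrow> (\<lambda>x. y x j) \<in> borel_measurable N"
  shows "(\<lambda>x. Z (y x)) \<in> borel_measurable N"
  unfolding pf_def energy_def by measurable

lemma borel_measurable_gav:
  assumes "\<And>j. j \<in> J \<Longrightarrow> (\<lambda>x. y x j) \<in> borel_measurable N" "\<phi> \<in> borel_measurable \<nu>"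
  shows "(\<lambda>x. gav \<nu> J w \<phi> (y x)) \<in> borel_measurable N"
  unfolding gav_def using borel_measurable_num[of y N \<phi>] borel_measurable_pf[of y N] assms by measurable

lemma pf_tendsto:
  assumes y: "\<And>j. j \<in> J \<Longrightarrow> (\<lambda>n. y n j) \<longlonglongrightarrow> y0 j"
  shows "(\<lambda>n. Z (y n)) \<longlonglongrightarrow> Z y0"
proof -
  have "\<exists>B. \<forall>n. \<forall>j\<in>J. \<bar>y n j\<bar> \<le> B"
  proof -
    have "\<forall>j\<in>J. \<exists>b. \<forall>n. \<bar>y n j\<bar> \<le> b"
      using y by (metis Bseq_def convergentI convergent_imp_Bseq real_norm_def)
    then obtain b where b: "\<And>j n. j \<in> J \<Longrightarrow> \<bar>y n j\<bar> \<le> b j" by metis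
    have "\<bar>y n j\<bar> \<le> (\<Sum>j\<in>J. \<bar>b j\<bar>)" if "j \<in> J" for n j
      using b[OF that, of n] member_le_sum[of j J "\<lambda>j. \<bar>b j\<bar>"] that finite_J by force
    then show ?thesis by blast
  qed
  then obtain B where B: "\<And>n j. j \<in> J \<Longrightarrow> \<bar>y n j\<bar> \<le> B" by blast
  show ?thesis unfolding pf_def
  proof (rule integral_dominated_convergence[where w = "\<lambda>_. exp (C * (card J * B))"])
    show "AE \<sigma> in \<nu>. (\<lambda>n. exp (energy J w (y n) \<sigma>)) \<longlonglongrightarrow> exp (energy J w y0 \<sigma>)"
      unfolding energy_def by (intro AE_I2 tendsto_intros y)
    have "l1 J (y n) \<le> card J * B" for n
      unfolding l1_def using B by (intro sum_bounded_above) auto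
    then have "C * l1 J (y n) \<le> C * (card J * B)" for n by (intro mult_left_mono C_nonneg)
    then show "AE \<sigma> in \<nu>. norm (exp (energy J w (y n) \<sigma>)) \<le> exp (C * (card J * B))" for n
      using energy_bound[of _ "y n"] by (intro AE_I2) (smt (verit) exp_le_cancel_iff norm_exp real_norm_def abs_exp_cancel)
  qed auto
qed

text \<open>A general curve \<open>y\<close> in the space of couplings covers the two that occur:
  one coordinate moving alone, for integration by parts, and all coordinates rescaled by changing
  variances.\<close>

lemma num_has_derivative:
  assumes e: "0 < e"
    and y: "\<And>t j. j \<in> J \<Longrightarrow> \<bar>t - t0\<bar> < e \<Longrightarrow> ((\<lambda>t. y t j) has_real_derivative y' t j) (at t)"
    and Y: "\<And>t j. j \<in> J \<Longrightarrow> \<bar>t - t0\<bar> < e \<Longrightarrow> \<bar>y t j\<bar> \<le> Y \<and> \<bar>y' t j\<bar> \<le> Y"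
    and \<phi>m[measurable]: "\<phi> \<in> borel_measurable \<nu>" and \<phi>: "\<And>\<sigma>. \<sigma> \<in> space \<nu> \<Longrightarrow> \<bar>\<phi> \<sigma>\<bar> \<le> c"
  shows "((\<lambda>t. num \<nu> J w \<phi> (y t)) has_real_derivative
     (\<Sum>j\<in>J. y' t0 j * num \<nu> J w (\<lambda>\<sigma>. \<phi> \<sigma> * w j \<sigma>) (y t0))) (at t0)"
proof -
  let ?D = "\<lambda>t \<sigma>. (\<Sum>j\<in>J. y' t j * w j \<sigma>) * (\<phi> \<sigma> * exp (energy J w (y t) \<sigma>))"
  have l1Y: "l1 J (y t) \<le> card J * Y" "l1 J (y' t) \<le> card J * Y" if "\<bar>t - t0\<bar> < e" for t
    unfolding l1_def using Y that by (auto intro!: sum_bounded_above)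
  have "((\<lambda>t. LINT \<sigma>|\<nu>. \<phi> \<sigma> * exp (energy J w (y t) \<sigma>)) has_real_derivative (LINT \<sigma>|\<nu>. ?D t0 \<sigma>)) (at t0)"
  proof (rule has_real_derivative_lebesgue_integral[OF e, where B = "\<lambda>_. (C * (card J * Y)) * (c * exp (C * (card J * Y)))"])
    show "integrable \<nu> (\<lambda>\<sigma>. \<phi> \<sigma> * exp (energy J w (y t) \<sigma>))" for t by (rule integrable_num[OF \<phi>m \<phi>])
    fix t \<sigma> assume s: "\<sigma> \<in> space \<nu>" and t: "\<bar>t - t0\<bar> < e"
    show "((\<lambda>t. \<phi> \<sigma> * exp (energy J w (y t) \<sigma>)) has_real_derivative ?D t \<sigma>) (at t)"
      unfolding energy_def by (auto intro!: derivative_eq_intros y t simp: mult_ac)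
    have "0 \<le> c" using \<phi>[OF s] by linarith
    have "\<bar>(\<Sum>j\<in>J. y' t j * w j \<sigma>)\<bar> \<le> C * (card J * Y)"
      using energy_bound[OF s, of "y' t"] mult_left_mono[OF l1Y(2)[OF t] C_nonneg] by (simp add: energy_def)
    moreover have "exp (energy J w (y t) \<sigma>) \<le> exp (C * (card J * Y))"
      using energy_bound[OF s, of "y t"] mult_left_mono[OF l1Y(1)[OF t] C_nonneg] by simp
    ultimately show "\<bar>?D t \<sigma>\<bar> \<le> (C * (card J * Y)) * (c * exp (C * (card J * Y)))"
      unfolding abs_mult abs_exp_cancel using \<phi>[OF s] \<open>0 \<le> c\<close> by (intro mult_mono) auto
  qed auto
  moreover have "(LINT \<sigma>|\<nu>. ?D t0 \<sigma>) = (\<Sum>j\<in>J. y' t0 j * num \<nu> J w (\<lambda>\<sigma>. \<phi> \<sigma> * w j \<sigma>) (y t0))"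
  proof -
    have "integrable \<nu> (\<lambda>\<sigma>. (\<phi> \<sigma> * w j \<sigma>) * exp (energy J w (y t0) \<sigma>))" if j: "j \<in> J" for j
    proof (rule integrable_num)
      show "(\<lambda>\<sigma>. \<phi> \<sigma> * w j \<sigma>) \<in> borel_measurable \<nu>" using j by measurable
      fix \<sigma> assume s: "\<sigma> \<in> space \<nu>"
      show "\<bar>\<phi> \<sigma> * w j \<sigma>\<bar> \<le> c * C" unfolding abs_mult
        using \<phi>[OF s] bound_w[OF j s] by (intro mult_mono) auto
    qed
    then have "(\<Sum>j\<in>J. y' t0 j * num \<nu> J w (\<lambda>\<sigma>. \<phi> \<sigma> * w j \<sigma>) (y t0)) =
      (LINT \<sigma>|\<nu>. (\<Sum>j\<in>J. y' t0 j * ((\<phi> \<sigma> * w j \<sigma>) * exp (energy J w (y t0) \<sigma>))))"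
      unfolding num_def by (subst Bochner_Integration.integral_sum) auto
    also have "\<dots> = (LINT \<sigma>|\<nu>. ?D t0 \<sigma>)"
      by (intro Bochner_Integration.integral_cong refl) (simp add: sum_distrib_right sum_distrib_left mult_ac)
    finally show ?thesis by simp
  qed
  ultimately show ?thesis by (simp add: num_def)
qed

lemma ln_pf_has_derivative:
  assumes e: "0 < e"
    and y: "\<And>t j. j \<in> J \<Longrightarrow> \<bar>t - t0\<bar> < e \<Longrightarrow> ((\<lambda>t. y t j) has_real_derivative y' t j) (at t)"
    and Y: "\<And>t j. j \<in> J \<Longrightarrow> \<bar>t - t0\<bar> < e \<Longrightarrow> \<bar>y t j\<bar> \<le> Y \<and> \<bar>y' t j\<bar> \<le> Y"
  shows "((\<lambda>t. ln (Z (y t))) has_real_derivative (\<Sum>j\<in>J. y' t0 j * gav \<nu> J w (w j) (y t0))) (at t0)"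
proof -
  have "((\<lambda>t. Z (y t)) has_real_derivative (\<Sum>j\<in>J. y' t0 j * num \<nu> J w (w j) (y t0))) (at t0)"
    using num_has_derivative[of e t0 y y' Y "\<lambda>_. 1" 1] e y Y by (simp add: pf_eq_num)
  then have "((\<lambda>t. ln (Z (y t))) has_real_derivative 1 / Z (y t0) * (\<Sum>j\<in>J. y' t0 j * num \<nu> J w (w j) (y t0))) (at t0)"
    using pf_pos by (auto intro!: derivative_eq_intros)
  then show ?thesis by (simp add: gav_def sum_distrib_left)
qed

lemma gav_has_derivative:
  assumes i: "i \<in> J"
  shows "((\<lambda>t. gav \<nu> J w (w i) (x(i := t))) has_real_derivative
     gav \<nu> J w (\<lambda>\<sigma>. (w i \<sigma>)\<^sup>2) (x(i := t)) - (gav \<nu> J w (w i) (x(i := t)))\<^sup>2) (at t)"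
proof -
  define y y' where "y s = x(i := s)" and "y' s j = (if j = i then 1 else 0 :: real)" for s :: real and j
  define Y where "Y = l1 J x + \<bar>t\<bar> + 1"
  have y: "((\<lambda>s. y s j) has_real_derivative y' s j) (at s)" for s j
    by (auto simp: y_def y'_def)
  have Y: "\<bar>y s j\<bar> \<le> Y \<and> \<bar>y' s j\<bar> \<le> Y" if "j \<in> J" "\<bar>s - t\<bar> < 1" for s j
    using abs_le_l1[OF finite_J that(1), of x] that(2) l1_nonneg[of J x] unfolding y_def y'_def Y_def by auto
  have sum: "(\<Sum>j\<in>J. y' t j * f j) = f i" for f :: "'j \<Rightarrow> real"
    using finite_J i by (simp add: y'_def if_distrib[of "\<lambda>z. z * _"] cong: if_cong)
  have 1: "((\<lambda>s. num \<nu> J w (w i) (y s)) has_real_derivative num \<nu> J w (\<lambda>\<sigma>. w i \<sigma> * w i \<sigma>) (y t)) (at t)"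
    using num_has_derivative[of 1 t y y' Y "w i" C] y Y meas_w[OF i] bound_w[OF i] by (simp add: sum)
  have 2: "((\<lambda>s. Z (y s)) has_real_derivative num \<nu> J w (w i) (y t)) (at t)"
    using num_has_derivative[of 1 t y y' Y "\<lambda>_. 1" 1] y Y by (simp add: sum pf_eq_num)
  have "((\<lambda>s. num \<nu> J w (w i) (y s) / Z (y s)) has_real_derivative
     (num \<nu> J w (\<lambda>\<sigma>. w i \<sigma> * w i \<sigma>) (y t) * Z (y t) - num \<nu> J w (w i) (y t) * num \<nu> J w (w i) (y t)) / (Z (y t) * Z (y t))) (at t)"
    by (rule DERIV_divide[OF 1 2]) (use pf_pos[of "y t"] in auto)
  then show ?thesis using pf_pos[of "y t"]
    by (simp add: y_def gav_def power2_eq_square diff_divide_distrib)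
qed

text \<open>The Gibbs variance <(w - <w>)^2> is nonnegative.\<close>

lemma gav_square_le:
  assumes "i \<in> J"
  shows "(gav \<nu> J w (w i) x)\<^sup>2 \<le> gav \<nu> J w (\<lambda>\<sigma>. (w i \<sigma>)\<^sup>2) x"
proof -
  let ?m = "gav \<nu> J w (w i) x"
  note [measurable] = meas_w[OF assms]
  have b: "\<And>\<sigma>. \<sigma> \<in> space \<nu> \<Longrightarrow> \<bar>(w i \<sigma>)\<^sup>2\<bar> \<le> C\<^sup>2"
    using bound_w[OF assms] C_nonneg by (simp add: abs_le_square_iff[symmetric])
  have n: "num \<nu> J w (w i) x = ?m * Z x" using pf_pos[of x] by (simp add: gav_def)
  have "0 \<le> (LINT \<sigma>|\<nu>. (w i \<sigma> - ?m)\<^sup>2 * exp (energy J w x \<sigma>))" by (rule integral_nonneg_AE) auto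
  also have "\<dots> = (LINT \<sigma>|\<nu>. (w i \<sigma>)\<^sup>2 * exp (energy J w x \<sigma>) - (2 * ?m) * (w i \<sigma> * exp (energy J w x \<sigma>)) + ?m\<^sup>2 * exp (energy J w x \<sigma>))"
    by (intro Bochner_Integration.integral_cong refl) (simp add: power2_diff algebra_simps)
  also have "\<dots> = num \<nu> J w (\<lambda>\<sigma>. (w i \<sigma>)\<^sup>2) x - (2 * ?m) * num \<nu> J w (w i) x + ?m\<^sup>2 * Z x"
    unfolding num_def pf_def using integrable_exp_energy[of x] integrable_num[of "w i" C x] integrable_num[of "\<lambda>\<sigma>. (w i \<sigma>)\<^sup>2" "C\<^sup>2" x] bound_w[OF assms] b
    by simp
  also have "\<dots> = num \<nu> J w (\<lambda>\<sigma>. (w i \<sigma>)\<^sup>2) x - ?m\<^sup>2 * Z x" unfolding n by (simp add: power2_eq_square)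
  finally show ?thesis using pf_pos[of x] unfolding gav_def[of \<nu> J w "\<lambda>\<sigma>. (w i \<sigma>)\<^sup>2"] by (simp add: pos_le_divide_eq)
qed

end

text \<open>Two systems driven by the same disorder and the functional Z1^a Z2^b. With b = 0 this is
  a moment of one system; with exponents a and -a and partly shared couplings it gives
  concentration.\<close>

locale gibbs2 = g1: gibbs \<nu>1 J w1 C + g2: gibbs \<nu>2 J w2 C
  for \<nu>1 :: "'a measure" and \<nu>2 :: "'b measure" and J :: "'j set" and w1 w2 C +
  fixes a b :: real
begin

text \<open>\<open>G j\<close> is the derivative of ln F in the coordinate j and \<open>G2 j\<close>
  that of \<open>G j\<close>, so that the second derivative of F is F (G^2 + G2). In
  \<open>G2\<close> the derivative of a Gibbs average appears as a Gibbs variance.\<close>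

definition "F x = exp (a * ln (g1.Z x) + b * ln (g2.Z x))"
definition "G j x = a * gav \<nu>1 J w1 (w1 j) x + b * gav \<nu>2 J w2 (w2 j) x"
definition "G2 j x = a * (gav \<nu>1 J w1 (\<lambda>\<sigma>. (w1 j \<sigma>)\<^sup>2) x - (gav \<nu>1 J w1 (w1 j) x)\<^sup>2)
   + b * (gav \<nu>2 J w2 (\<lambda>\<sigma>. (w2 j \<sigma>)\<^sup>2) x - (gav \<nu>2 J w2 (w2 j) x)\<^sup>2)"

definition "K0 = exp (\<bar>a\<bar> * \<bar>ln g1.mass\<bar> + \<bar>b\<bar> * \<bar>ln g2.mass\<bar>)"
definition "C0 = (\<bar>a\<bar> + \<bar>b\<bar>) * C"

lemma F_pos: "0 < F x" by (simp add: F_def)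

lemma C0_nonneg: "0 \<le> C0" using g1.C_nonneg by (simp add: C0_def)

lemma F_bound: "F x \<le> K0 * exp (C0 * l1 J x)"
proof -
  have "a * ln (g1.Z x) \<le> \<bar>a\<bar> * \<bar>ln (g1.Z x)\<bar>" by (simp add: abs_mult[symmetric])
  also have "\<dots> \<le> \<bar>a\<bar> * (\<bar>ln g1.mass\<bar> + C * l1 J x)" by (intro mult_left_mono g1.ln_pf_bound) auto
  finally have 1: "a * ln (g1.Z x) \<le> \<bar>a\<bar> * (\<bar>ln g1.mass\<bar> + C * l1 J x)" .
  have "b * ln (g2.Z x) \<le> \<bar>b\<bar> * \<bar>ln (g2.Z x)\<bar>" by (simp add: abs_mult[symmetric])
  also have "\<dots> \<le> \<bar>b\<bar> * (\<bar>ln g2.mass\<bar> + C * l1 J x)" by (intro mult_left_mono g2.ln_pf_bound) auto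
  finally have 2: "b * ln (g2.Z x) \<le> \<bar>b\<bar> * (\<bar>ln g2.mass\<bar> + C * l1 J x)" .
  show ?thesis using 1 2 unfolding F_def K0_def C0_def exp_add[symmetric] by (simp add: algebra_simps)
qed

lemma G_bound: "j \<in> J \<Longrightarrow> \<bar>G j x\<bar> \<le> C0"
proof -
  assume j: "j \<in> J"
  have "\<bar>G j x\<bar> \<le> \<bar>a\<bar> * \<bar>gav \<nu>1 J w1 (w1 j) x\<bar> + \<bar>b\<bar> * \<bar>gav \<nu>2 J w2 (w2 j) x\<bar>"
    unfolding G_def by (simp add: abs_mult[symmetric])
  also have "\<dots> \<le> \<bar>a\<bar> * C + \<bar>b\<bar> * C"
    using g1.gav_bound[OF g1.meas_w[OF j] g1.bound_w[OF j]] g2.gav_bound[OF g2.meas_w[OF j] g2.bound_w[OF j]]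
    by (intro add_mono mult_left_mono) auto
  finally show ?thesis by (simp add: C0_def algebra_simps)
qed

lemma G2_bound: "j \<in> J \<Longrightarrow> \<bar>G2 j x\<bar> \<le> C0 * C"
proof -
  assume j: "j \<in> J"
  have b1: "\<bar>gav \<nu>1 J w1 (\<lambda>\<sigma>. (w1 j \<sigma>)\<^sup>2) x\<bar> \<le> C\<^sup>2"
    using g1.meas_w[OF j] g1.bound_w[OF j] g1.C_nonneg by (intro g1.gav_bound) (auto simp: abs_le_square_iff[symmetric])
  have b2: "\<bar>gav \<nu>2 J w2 (\<lambda>\<sigma>. (w2 j \<sigma>)\<^sup>2) x\<bar> \<le> C\<^sup>2"
    using g2.meas_w[OF j] g2.bound_w[OF j] g2.C_nonneg by (intro g2.gav_bound) (auto simp: abs_le_square_iff[symmetric])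
  have c1: "\<bar>gav \<nu>1 J w1 (\<lambda>\<sigma>. (w1 j \<sigma>)\<^sup>2) x - (gav \<nu>1 J w1 (w1 j) x)\<^sup>2\<bar> \<le> C\<^sup>2"
    using b1 g1.gav_square_le[OF j, of x] zero_le_power2[of "gav \<nu>1 J w1 (w1 j) x"] by linarith
  have c2: "\<bar>gav \<nu>2 J w2 (\<lambda>\<sigma>. (w2 j \<sigma>)\<^sup>2) x - (gav \<nu>2 J w2 (w2 j) x)\<^sup>2\<bar> \<le> C\<^sup>2"
    using b2 g2.gav_square_le[OF j, of x] zero_le_power2[of "gav \<nu>2 J w2 (w2 j) x"] by linarith
  have "\<bar>G2 j x\<bar> \<le> \<bar>a\<bar> * C\<^sup>2 + \<bar>b\<bar> * C\<^sup>2"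
    unfolding G2_def using mult_left_mono[OF c1, of "\<bar>a\<bar>"] mult_left_mono[OF c2, of "\<bar>b\<bar>"]
    by (simp add: abs_mult[symmetric])
  then show ?thesis by (simp add: C0_def algebra_simps power2_eq_square)
qed

lemma meas_FG:
  assumes y: "\<And>j. j \<in> J \<Longrightarrow> (\<lambda>x. y x j) \<in> borel_measurable N"
  shows "(\<lambda>x. F (y x)) \<in> borel_measurable N"
    and "i \<in> J \<Longrightarrow> (\<lambda>x. G i (y x)) \<in> borel_measurable N"
    and "i \<in> J \<Longrightarrow> (\<lambda>x. G2 i (y x)) \<in> borel_measurable N"
proof -
  note [measurable] = g1.borel_measurable_pf[OF y] g2.borel_measurable_pf[OF y]
    g1.borel_measurable_gav[OF y] g2.borel_measurable_gav[OF y]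
  show "(\<lambda>x. F (y x)) \<in> borel_measurable N" unfolding F_def by measurable
  show "(\<lambda>x. G i (y x)) \<in> borel_measurable N" if [measurable]: "i \<in> J" unfolding G_def by measurable
  show "(\<lambda>x. G2 i (y x)) \<in> borel_measurable N" if [measurable]: "i \<in> J" unfolding G2_def by measurable
qed

lemma meas_scale: "j \<in> J \<Longrightarrow> (\<lambda>x. scale u x j) \<in> borel_measurable (gauss J)"
  unfolding scale_def by measurable

lemma F_has_derivative:
  assumes e: "0 < e"
    and y: "\<And>t j. j \<in> J \<Longrightarrow> \<bar>t - t0\<bar> < e \<Longrightarrow> ((\<lambda>t. y t j) has_real_derivative y' t j) (at t)"
    and Y: "\<And>t j. j \<in> J \<Longrightarrow> \<bar>t - t0\<bar> < e \<Longrightarrow> \<bar>y t j\<bar> \<le> Y \<and> \<bar>y' t j\<bar> \<le> Y"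
  shows "((\<lambda>t. F (y t)) has_real_derivative F (y t0) * (\<Sum>j\<in>J. y' t0 j * G j (y t0))) (at t0)"
  unfolding F_def
  by (rule derivative_eq_intros g1.ln_pf_has_derivative[OF e y Y] g2.ln_pf_has_derivative[OF e y Y] refl | assumption)+
     (simp add: G_def sum_distrib_left sum.distrib[symmetric] algebra_simps)

lemma FG_has_derivative:
  assumes i: "i \<in> J"
  shows "((\<lambda>t. F (scale u (x(i := t))) * G i (scale u (x(i := t)))) has_real_derivative
     sqrt (u i) * (F (scale u (x(i := t))) * ((G i (scale u (x(i := t))))\<^sup>2 + G2 i (scale u (x(i := t)))))) (at t)"
proof -
  define q where "q = scale u x"
  have sc: "scale u (x(i := s)) = q(i := sqrt (u i) * s)" for s
    by (auto simp: scale_def fun_eq_iff q_def)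
  define y y' where "y s = q(i := s)" and "y' s j = (if j = i then 1 else 0 :: real)" for s :: real and j
  have y: "((\<lambda>s. y s j) has_real_derivative y' s j) (at s)" for s j
    by (auto simp: y_def y'_def)
  have Y: "\<bar>y s j\<bar> \<le> l1 J q + \<bar>t\<bar> + 1 \<and> \<bar>y' s j\<bar> \<le> l1 J q + \<bar>t\<bar> + 1" if "j \<in> J" "\<bar>s - t\<bar> < 1" for s j t
    using abs_le_l1[OF g1.finite_J that(1), of q] that(2) l1_nonneg[of J q] unfolding y_def y'_def by auto
  have sum: "(\<Sum>j\<in>J. y' t j * f j) = f i" for f :: "'j \<Rightarrow> real" and t
    using g1.finite_J i by (simp add: y'_def if_distrib[of "\<lambda>z. z * _"] cong: if_cong)
  have F: "((\<lambda>s. F (q(i := s))) has_real_derivative F (q(i := s)) * G i (q(i := s))) (at s)" for s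
    using F_has_derivative[of 1 s y y' "l1 J q + \<bar>s\<bar> + 1"] y Y[where t = s] by (simp add: sum y_def)
  have G: "((\<lambda>s. G i (q(i := s))) has_real_derivative G2 i (q(i := s))) (at s)" for s
    unfolding G_def G2_def
    by (rule derivative_eq_intros g1.gav_has_derivative[OF i] g2.gav_has_derivative[OF i] refl)+ simp
  have "((\<lambda>s. F (q(i := s)) * G i (q(i := s))) has_real_derivative
     F (q(i := s)) * ((G i (q(i := s)))\<^sup>2 + G2 i (q(i := s)))) (at s)" for s
    by (rule derivative_eq_intros F G refl)+ (simp add: power2_eq_square algebra_simps)
  moreover have "((\<lambda>t. sqrt (u i) * t) has_real_derivative sqrt (u i)) (at t)"
    by (auto intro!: derivative_eq_intros)
  ultimately show ?thesis unfolding sc using DERIV_chain' by (fastforce simp: mult.commute)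
qed

lemma F_scale_bound:
  assumes U: "\<And>j. j \<in> J \<Longrightarrow> \<bar>sqrt (u j)\<bar> \<le> U" 
  shows "F (scale u x) \<le> K0 * exp (C0 * U * l1 J x)"
proof -
  have "C0 * l1 J (scale u x) \<le> C0 * (U * l1 J x)"
    by (intro mult_left_mono l1_scale_le U C0_nonneg)
  then have "K0 * exp (C0 * l1 J (scale u x)) \<le> K0 * exp (C0 * (U * l1 J x))"
    by (simp add: K0_def)
  with F_bound[of "scale u x"] show ?thesis by (simp add: mult.assoc)
qed

lemma integrable_growth:
  assumes "f \<in> borel_measurable (gauss J)" "\<And>x. x \<in> space (gauss J) \<Longrightarrow> \<bar>f x\<bar> \<le> K * exp (D * l1 J x)"
  shows "integrable (gauss J) f"
  using integrable_gauss_exp_growth[OF g1.finite_J assms[unfolded l1_def]] by simp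

lemma integrable_F_scale: "integrable (gauss J) (\<lambda>x. F (scale u x))"
proof (rule integrable_growth)
  show "(\<lambda>x. F (scale u x)) \<in> borel_measurable (gauss J)" by (intro meas_FG meas_scale)
  fix x
  have "\<bar>sqrt (u j)\<bar> \<le> l1 J (\<lambda>j. sqrt (u j))" if "j \<in> J" for j using abs_le_l1[OF g1.finite_J that] .
  from F_scale_bound[OF this] show "\<bar>F (scale u x)\<bar> \<le> K0 * exp (C0 * l1 J (\<lambda>j. sqrt (u j)) * l1 J x)"
    using F_pos[of "scale u x"] by simp
qed

lemma integrable_F_scale_mult:
  assumes [measurable]: "f \<in> borel_measurable (gauss J)" and f: "\<And>x. x \<in> space (gauss J) \<Longrightarrow> \<bar>f x\<bar> \<le> c"
  shows "integrable (gauss J) (\<lambda>x. F (scale u x) * f x)"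
proof (rule Bochner_Integration.integrable_bound[where f = "\<lambda>x. c * F (scale u x)"])
  show "integrable (gauss J) (\<lambda>x. c * F (scale u x))" using integrable_F_scale by simp
  show "(\<lambda>x. F (scale u x) * f x) \<in> borel_measurable (gauss J)"
    using meas_FG(1)[OF meas_scale] by measurable
  show "AE x in gauss J. norm (F (scale u x) * f x) \<le> norm (c * F (scale u x))"
  proof (rule AE_I2)
    fix x assume "x \<in> space (gauss J)"
    from f[OF this] show "norm (F (scale u x) * f x) \<le> norm (c * F (scale u x))"
      by (simp add: abs_mult mult.commute) (intro mult_right_mono, auto)
  qed
qed

lemma F_tendsto:
  assumes y: "\<And>j. j \<in> J \<Longrightarrow> (\<lambda>n. y n j) \<longlonglongrightarrow> y0 j"
  shows "(\<lambda>n. F (y n)) \<longlonglongrightarrow> F y0"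
proof -
  have "g1.Z y0 \<noteq> 0" "g2.Z y0 \<noteq> 0" using g1.pf_pos[of y0] g2.pf_pos[of y0] by auto
  then show ?thesis unfolding F_def
    by (intro tendsto_intros g1.pf_tendsto g2.pf_tendsto y)
qed

end

section \<open>Linear interpolation of variances and the heat equation\<close>

definition mix :: "('j \<Rightarrow> real) \<Rightarrow> ('j \<Rightarrow> real) \<Rightarrow> real \<Rightarrow> 'j \<Rightarrow> real" where
  "mix u0 u1 t j = (1 - t) * u0 j + t * u1 j"

lemma mix_nonneg: "0 \<le> u0 j \<Longrightarrow> 0 \<le> u1 j \<Longrightarrow> 0 \<le> t \<Longrightarrow> t \<le> 1 \<Longrightarrow> 0 \<le> mix u0 u1 t j"
  by (simp add: mix_def)

lemma mix_le: "0 \<le> u0 j \<Longrightarrow> 0 \<le> u1 j \<Longrightarrow> 0 \<le> t \<Longrightarrow> t \<le> 1 \<Longrightarrow> mix u0 u1 t j \<le> u0 j + u1 j"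
  unfolding mix_def by (intro add_mono mult_left_le_one_le) auto

lemma mix_ge:
  assumes "0 \<le> u0 j" "0 \<le> u1 j" "e \<le> t" "t \<le> 1 - e"
  shows "e * (u0 j + u1 j) \<le> mix u0 u1 t j"
  using mult_right_mono[OF assms(3,2)] mult_right_mono[of e "1 - t" "u0 j"] assms
  by (simp add: mix_def algebra_simps)

text \<open>The derivative of \<open>sqrt (mix u0 u1 t j)\<close> in t. It can blow up at an
  endpoint where the variance vanishes; if both variances vanish, 0 / 0 = 0 is the correct
  value.\<close>

definition sqrt_mix' :: "('j \<Rightarrow> real) \<Rightarrow> ('j \<Rightarrow> real) \<Rightarrow> real \<Rightarrow> 'j \<Rightarrow> real" where
  "sqrt_mix' u0 u1 t j = (u1 j - u0 j) / (2 * sqrt (mix u0 u1 t j))"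

lemma sqrt_mix_has_derivative:
  assumes "0 \<le> u0 j" "0 \<le> u1 j" "0 < t" "t < 1"
  shows "((\<lambda>t. sqrt (mix u0 u1 t j)) has_real_derivative sqrt_mix' u0 u1 t j) (at t)"
proof (cases "u0 j = 0 \<and> u1 j = 0")
  case True
  then show ?thesis by (simp add: mix_def sqrt_mix'_def)
next
  case False
  define e where "e = min t (1 - t)"
  have "0 < e * (u0 j + u1 j)" using assms False by (intro mult_pos_pos) (auto simp: e_def less_le)
  also have "\<dots> \<le> mix u0 u1 t j" using assms by (intro mix_ge) (auto simp: e_def)
  finally have pos: "0 < mix u0 u1 t j" .
  have "((\<lambda>t. mix u0 u1 t j) has_real_derivative u1 j - u0 j) (at t)"
    unfolding mix_def by (auto intro!: derivative_eq_intros)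
  from DERIV_chain'[OF this DERIV_real_sqrt[OF pos]] show ?thesis
    by (simp add: sqrt_mix'_def field_simps)
qed

lemma sqrt_mix'_bound:
  assumes "0 \<le> u0 j" "0 \<le> u1 j" "0 < e" "e \<le> t" "t \<le> 1 - e"
  shows "\<bar>sqrt_mix' u0 u1 t j\<bar> \<le> sqrt (u0 j + u1 j) / sqrt e"
proof (cases "u0 j = 0 \<and> u1 j = 0")
  case True
  then show ?thesis by (simp add: sqrt_mix'_def)
next
  case False
  let ?q = "u0 j + u1 j"
  have q: "0 < ?q" using False assms by linarith
  have "sqrt e * sqrt ?q \<le> sqrt (mix u0 u1 t j)"
    unfolding real_sqrt_mult[symmetric] using mix_ge[of u0 j u1 e t] assms by simp
  then have ge: "sqrt e * sqrt ?q \<le> 2 * sqrt (mix u0 u1 t j)"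
    using real_sqrt_ge_zero[OF mix_nonneg[of u0 j u1 t]] assms by linarith
  have pos: "0 < sqrt e * sqrt ?q" using q assms by simp
  have "\<bar>sqrt_mix' u0 u1 t j\<bar> = \<bar>u1 j - u0 j\<bar> / (2 * sqrt (mix u0 u1 t j))"
  proof -
    have "0 < 2 * sqrt (mix u0 u1 t j)" using ge pos by linarith
    then show ?thesis unfolding sqrt_mix'_def abs_divide by (simp only: abs_of_pos)
  qed
  also have "\<dots> \<le> ?q / (sqrt e * sqrt ?q)"
    using ge pos assms q by (intro frac_le) auto
  also have "\<dots> = sqrt ?q / sqrt e" using q assms by (simp add: field_simps)
  finally show ?thesis .
qed

text \<open>Integration by parts produces a factor sqrt of the variance, which cancels the singular
  denominator; the rate \<open>u1 j - u0 j\<close> then enters linearly.\<close>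

lemma sqrt_mix'_mult_sqrt:
  assumes "0 \<le> u0 j" "0 \<le> u1 j" "0 < t" "t < 1"
  shows "sqrt_mix' u0 u1 t j * sqrt (mix u0 u1 t j) = (u1 j - u0 j) / 2"
proof (cases "u0 j = 0 \<and> u1 j = 0")
  case True
  then show ?thesis by (simp add: mix_def sqrt_mix'_def)
next
  case False
  define e where "e = min t (1 - t)"
  have "0 < e * (u0 j + u1 j)" using assms False by (intro mult_pos_pos) (auto simp: e_def less_le)
  also have "\<dots> \<le> mix u0 u1 t j" using assms by (intro mix_ge) (auto simp: e_def)
  finally show ?thesis by (simp add: sqrt_mix'_def)
qed

context gibbs2
begin

lemma gauss_ibp_FG:
  assumes i: "i \<in> J"
  shows "(LINT x|gauss J. x i * (F (scale u x) * G i (scale u x))) =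
    sqrt (u i) * (LINT x|gauss J. F (scale u x) * ((G i (scale u x))\<^sup>2 + G2 i (scale u x)))"
proof -
  define U where "U = l1 J (\<lambda>j. sqrt (u j))"
  have U: "\<bar>sqrt (u j)\<bar> \<le> U" if "j \<in> J" for j using abs_le_l1[OF g1.finite_J that] by (simp add: U_def)
  have U0: "0 \<le> U" by (simp add: U_def)
  define K where "K = K0 * (C0 + U * (C0\<^sup>2 + C0 * C))"
  have K0: "0 < K0" by (simp add: K0_def)
  note [measurable] = meas_FG[OF meas_scale[of _ u]]
  have "(LINT x|gauss J. x i * (F (scale u x) * G i (scale u x))) =
    (LINT x|gauss J. sqrt (u i) * (F (scale u x) * ((G i (scale u x))\<^sup>2 + G2 i (scale u x))))"
  proof (rule gauss_integration_by_parts[where K = K and C = "C0 * U", OF g1.finite_J i])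
    show "((\<lambda>t. F (scale u (x(i := t))) * G i (scale u (x(i := t)))) has_real_derivative
      sqrt (u i) * (F (scale u (x(i := t))) * ((G i (scale u (x(i := t))))\<^sup>2 + G2 i (scale u (x(i := t)))))) (at t)" for x t
      by (rule FG_has_derivative[OF i])
    fix x
    have F: "F (scale u x) \<le> K0 * exp (C0 * U * (\<Sum>j\<in>J. \<bar>x j\<bar>))"
      using F_scale_bound[OF U] by (simp add: l1_def)
    have "\<bar>F (scale u x) * G i (scale u x)\<bar> \<le> (K0 * exp (C0 * U * (\<Sum>j\<in>J. \<bar>x j\<bar>))) * C0"
      unfolding abs_mult using F F_pos[of "scale u x"] G_bound[OF i] C0_nonneg K0 by (intro mult_mono) auto
    also have "\<dots> \<le> K * exp (C0 * U * (\<Sum>j\<in>J. \<bar>x j\<bar>))"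
      unfolding K_def using K0 C0_nonneg U0 g1.C_nonneg by (simp add: algebra_simps)
    finally show "\<bar>F (scale u x) * G i (scale u x)\<bar> \<le> K * exp (C0 * U * (\<Sum>j\<in>J. \<bar>x j\<bar>))" .
    have Gs: "\<bar>(G i (scale u x))\<^sup>2 + G2 i (scale u x)\<bar> \<le> C0\<^sup>2 + C0 * C"
    proof -
      have "(G i (scale u x))\<^sup>2 \<le> C0\<^sup>2" using G_bound[OF i, of "scale u x"] C0_nonneg by (simp add: abs_le_square_iff[symmetric])
      then show ?thesis using G2_bound[OF i, of "scale u x"] abs_triangle_ineq[of "(G i (scale u x))\<^sup>2" "G2 i (scale u x)"] by simp
    qed
    have "\<bar>sqrt (u i) * (F (scale u x) * ((G i (scale u x))\<^sup>2 + G2 i (scale u x)))\<bar>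
      \<le> U * ((K0 * exp (C0 * U * (\<Sum>j\<in>J. \<bar>x j\<bar>))) * (C0\<^sup>2 + C0 * C))"
      unfolding abs_mult[of "sqrt (u i)"] abs_mult[of "F (scale u x)"] using F F_pos[of "scale u x"] Gs U[OF i] C0_nonneg K0 U0 g1.C_nonneg
      by (intro mult_mono) auto
    also have "\<dots> \<le> K * exp (C0 * U * (\<Sum>j\<in>J. \<bar>x j\<bar>))"
      unfolding K_def using K0 C0_nonneg U0 g1.C_nonneg by (simp add: algebra_simps)
    finally show "\<bar>sqrt (u i) * (F (scale u x) * ((G i (scale u x))\<^sup>2 + G2 i (scale u x)))\<bar> \<le> K * exp (C0 * U * (\<Sum>j\<in>J. \<bar>x j\<bar>))" .
  qed (use i K0 C0_nonneg U0 g1.C_nonneg in \<open>auto simp: K_def\<close>)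
  then show ?thesis by simp
qed

text \<open>The heat equation for a Gaussian expectation: each variance contributes its rate times
  half of the second derivative. The chain rule gives terms linear in x_j, and integration by parts
  removes the x_j. Only interior times are possible since sqrt is not differentiable at variance 0;
  the endpoints are reached by \<open>gaussian_flow_continuous\<close>.\<close>

theorem gaussian_flow:
  assumes u: "\<And>j. j \<in> J \<Longrightarrow> 0 \<le> u0 j" "\<And>j. j \<in> J \<Longrightarrow> 0 \<le> u1 j" and t0: "0 < t0" "t0 < 1"
  shows "((\<lambda>t. LINT x|gauss J. F (scale (mix u0 u1 t) x)) has_real_derivative
    (\<Sum>j\<in>J. (u1 j - u0 j) / 2 * (LINT x|gauss J. F (scale (mix u0 u1 t0) x) *
       ((G j (scale (mix u0 u1 t0) x))\<^sup>2 + G2 j (scale (mix u0 u1 t0) x))))) (at t0)"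
proof -
  \<comment> \<open>Half of the distance to the endpoints: times within \<open>e\<close> of
    \<open>t0\<close> keep distance \<open>e\<close> from 0 and 1, where the derivative of the
    square root is bounded.\<close>
  define e where "e = min t0 (1 - t0) / 2"
  have e: "0 < e" using t0 by (simp add: e_def)
  have near: "e \<le> t \<and> t \<le> 1 - e" if "\<bar>t - t0\<bar> < e" for t
  proof -
    have "2 * e \<le> t0" "2 * e \<le> 1 - t0" by (auto simp: e_def)
    then show ?thesis using that by (auto simp: abs_less_iff)
  qed
  \<comment> \<open>One constant for two bounds: the summand 1 serves the square roots of the
    variances, the summand \<open>1 / sqrt e\<close> their derivatives.\<close>
  define U where "U = (\<Sum>j\<in>J. sqrt (u0 j + u1 j)) * (1 + 1 / sqrt e)"
  have q: "sqrt (u0 j + u1 j) \<le> (\<Sum>j\<in>J. sqrt (u0 j + u1 j))" if "j \<in> J" for j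
    using u that by (intro member_le_sum g1.finite_J) auto
  have qs: "0 \<le> (\<Sum>j\<in>J. sqrt (u0 j + u1 j))" using u by (intro sum_nonneg) auto
  have U0: "0 \<le> U" unfolding U_def using qs e by (intro mult_nonneg_nonneg) auto
  have b1: "\<bar>sqrt (mix u0 u1 t j)\<bar> \<le> U" if j: "j \<in> J" and t: "\<bar>t - t0\<bar> < e" for j t
  proof -
    have "\<bar>sqrt (mix u0 u1 t j)\<bar> \<le> sqrt (u0 j + u1 j)"
      using mix_le[of u0 j u1 t] mix_nonneg[of u0 j u1 t] u j near[OF t] e by simp
    also have "\<dots> \<le> (\<Sum>j\<in>J. sqrt (u0 j + u1 j)) * 1" using q[OF j] by simp
    also have "\<dots> \<le> U" unfolding U_def using qs e by (intro mult_left_mono) auto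
    finally show ?thesis .
  qed
  have b2: "\<bar>sqrt_mix' u0 u1 t j\<bar> \<le> U" if j: "j \<in> J" and t: "\<bar>t - t0\<bar> < e" for j t
  proof -
    have "\<bar>sqrt_mix' u0 u1 t j\<bar> \<le> sqrt (u0 j + u1 j) / sqrt e"
      using u j near[OF t] e by (intro sqrt_mix'_bound) auto
    also have "\<dots> \<le> (\<Sum>j\<in>J. sqrt (u0 j + u1 j)) * (1 / sqrt e)" using q[OF j] e by (simp add: divide_right_mono)
    also have "\<dots> \<le> U" unfolding U_def using qs e by (intro mult_left_mono) auto
    finally show ?thesis .
  qed
  let ?s = "\<lambda>t x. scale (mix u0 u1 t) x"
  let ?f' = "\<lambda>t x. F (?s t x) * (\<Sum>j\<in>J. sqrt_mix' u0 u1 t j * x j * G j (?s t x))"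
  note [measurable] = meas_FG[OF meas_scale]
  have K0: "0 < K0" by (simp add: K0_def)
  have "((\<lambda>t. LINT x|gauss J. F (?s t x)) has_real_derivative (LINT x|gauss J. ?f' t0 x)) (at t0)"
  proof (rule has_real_derivative_lebesgue_integral[OF e, where B = "\<lambda>x. K0 * C0 * U * exp ((C0 * U + 1) * l1 J x)"])
    show "integrable (gauss J) (\<lambda>x. F (?s t x))" for t by (rule integrable_F_scale)
    show "integrable (gauss J) (\<lambda>x. K0 * C0 * U * exp ((C0 * U + 1) * l1 J x))"
      using integrable_gauss_exp_abs[OF g1.finite_J] by (simp add: l1_def)
    show "?f' t0 \<in> borel_measurable (gauss J)" by measurable
    fix t x assume x: "x \<in> space (gauss J)" and t: "\<bar>t - t0\<bar> < e"
    \<comment> \<open>Differentiability at \<open>t\<close> is derived from a neighbourhood of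
      \<open>t\<close> that stays inside the one around \<open>t0\<close>.\<close>
    have e1: "0 < e - \<bar>t - t0\<bar>" using t by simp
    show "((\<lambda>t. F (?s t x)) has_real_derivative ?f' t x) (at t)"
    proof (rule F_has_derivative[OF e1, where Y = "U * l1 J x"])
      fix r j assume j: "j \<in> J" and r: "\<bar>r - t\<bar> < e - \<bar>t - t0\<bar>"
      have r': "\<bar>r - t0\<bar> < e" using r by linarith
      have "((\<lambda>t. sqrt (mix u0 u1 t j)) has_real_derivative sqrt_mix' u0 u1 r j) (at r)"
        using u j near[OF r'] e by (intro sqrt_mix_has_derivative) auto
      then show "((\<lambda>t. ?s t x j) has_real_derivative sqrt_mix' u0 u1 r j * x j) (at r)"
        unfolding scale_def by (rule DERIV_cmult_right)
      show "\<bar>?s r x j\<bar> \<le> U * l1 J x \<and> \<bar>sqrt_mix' u0 u1 r j * x j\<bar> \<le> U * l1 J x"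
        unfolding scale_def abs_mult using b1[OF j r'] b2[OF j r'] abs_le_l1[OF g1.finite_J j, of x] U0
        by (auto intro!: mult_mono)
    qed
    have "\<bar>\<Sum>j\<in>J. sqrt_mix' u0 u1 t j * x j * G j (?s t x)\<bar> \<le> (\<Sum>j\<in>J. U * \<bar>x j\<bar> * C0)"
      unfolding abs_mult using b2[OF _ t] G_bound U0 C0_nonneg
      by (intro order_trans[OF sum_abs] sum_mono) (auto simp: abs_mult intro!: mult_mono)
    also have "\<dots> = U * C0 * l1 J x" by (simp add: l1_def sum_distrib_left mult_ac)
    finally have S: "\<bar>\<Sum>j\<in>J. sqrt_mix' u0 u1 t j * x j * G j (?s t x)\<bar> \<le> U * C0 * l1 J x" .
    have "\<bar>?f' t x\<bar> \<le> (K0 * exp (C0 * U * l1 J x)) * (U * C0 * l1 J x)"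
      unfolding abs_mult using S F_scale_bound[of "mix u0 u1 t" U x, OF b1[OF _ t]] F_pos[of "?s t x"] K0 U0 C0_nonneg
      by (intro mult_mono) auto
    also have "\<dots> = K0 * C0 * U * (exp (C0 * U * l1 J x) * l1 J x)" by (simp add: mult_ac)
    also have "\<dots> \<le> K0 * C0 * U * (exp (C0 * U * l1 J x) * exp (l1 J x))"
      using exp_abs_bound[of "l1 J x"] K0 U0 C0_nonneg by (intro mult_left_mono) auto
    also have "\<dots> = K0 * C0 * U * exp ((C0 * U + 1) * l1 J x)" by (simp add: exp_add[symmetric] algebra_simps)
    finally show "\<bar>?f' t x\<bar> \<le> K0 * C0 * U * exp ((C0 * U + 1) * l1 J x)" .
  qed
  moreover have "(LINT x|gauss J. ?f' t0 x) = (\<Sum>j\<in>J. (u1 j - u0 j) / 2 * (LINT x|gauss J. F (?s t0 x) * ((G j (?s t0 x))\<^sup>2 + G2 j (?s t0 x))))"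
  proof -
    have int: "integrable (gauss J) (\<lambda>x. x j * (F (?s t0 x) * G j (?s t0 x)))" if j: "j \<in> J" for j
    proof (rule integrable_growth)
      show "(\<lambda>x. x j * (F (?s t0 x) * G j (?s t0 x))) \<in> borel_measurable (gauss J)" using j by measurable
      fix x
      have "\<bar>x j * (F (?s t0 x) * G j (?s t0 x))\<bar> \<le> exp (l1 J x) * ((K0 * exp (C0 * U * l1 J x)) * C0)"
        unfolding abs_mult using abs_le_l1[OF g1.finite_J j, of x] exp_abs_bound[of "l1 J x"] F_scale_bound[of "mix u0 u1 t0" U x, OF b1]
          F_pos[of "?s t0 x"] G_bound[OF j] K0 U0 C0_nonneg e
        by (intro mult_mono) auto
      also have "\<dots> = (K0 * C0) * exp ((C0 * U + 1) * l1 J x)" by (simp add: exp_add algebra_simps)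
      finally show "\<bar>x j * (F (?s t0 x) * G j (?s t0 x))\<bar> \<le> (K0 * C0) * exp ((C0 * U + 1) * l1 J x)" .
    qed
    have "(LINT x|gauss J. ?f' t0 x) = (LINT x|gauss J. (\<Sum>j\<in>J. sqrt_mix' u0 u1 t0 j * (x j * (F (?s t0 x) * G j (?s t0 x)))))"
      by (intro Bochner_Integration.integral_cong refl) (simp add: sum_distrib_left mult_ac)
    also have "\<dots> = (\<Sum>j\<in>J. sqrt_mix' u0 u1 t0 j * (LINT x|gauss J. x j * (F (?s t0 x) * G j (?s t0 x))))"
      using int by (subst Bochner_Integration.integral_sum) auto
    also have "\<dots> = (\<Sum>j\<in>J. sqrt_mix' u0 u1 t0 j * sqrt (mix u0 u1 t0 j) * (LINT x|gauss J. F (?s t0 x) * ((G j (?s t0 x))\<^sup>2 + G2 j (?s t0 x))))"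
      by (intro sum.cong refl) (simp add: gauss_ibp_FG)
    also have "\<dots> = (\<Sum>j\<in>J. (u1 j - u0 j) / 2 * (LINT x|gauss J. F (?s t0 x) * ((G j (?s t0 x))\<^sup>2 + G2 j (?s t0 x))))"
      using u t0 by (intro sum.cong refl) (simp add: sqrt_mix'_mult_sqrt)
    finally show ?thesis .
  qed
  ultimately show ?thesis by simp
qed

lemma gaussian_flow_continuous:
  assumes u: "\<And>j. j \<in> J \<Longrightarrow> 0 \<le> u0 j" "\<And>j. j \<in> J \<Longrightarrow> 0 \<le> u1 j"
  shows "continuous_on {0..1} (\<lambda>t. LINT x|gauss J. F (scale (mix u0 u1 t) x))"
proof (rule continuous_on_sequentiallyI)
  fix t :: "nat \<Rightarrow> real" and a assume t: "\<forall>n. t n \<in> {0..1}" and a: "a \<in> {0..1}" and lim: "t \<longlonglongrightarrow> a"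
  define U where "U = (\<Sum>j\<in>J. sqrt (u0 j + u1 j))"
  have b1: "\<bar>sqrt (mix u0 u1 r j)\<bar> \<le> U" if j: "j \<in> J" and r: "r \<in> {0..1}" for j r
  proof -
    have "\<bar>sqrt (mix u0 u1 r j)\<bar> \<le> sqrt (u0 j + u1 j)"
      using mix_le[of u0 j u1 r] mix_nonneg[of u0 j u1 r] u j r by simp
    also have "\<dots> \<le> U" unfolding U_def using u j by (intro member_le_sum g1.finite_J) auto
    finally show ?thesis .
  qed
  show "(\<lambda>n. LINT x|gauss J. F (scale (mix u0 u1 (t n)) x)) \<longlonglongrightarrow> (LINT x|gauss J. F (scale (mix u0 u1 a) x))"
  proof (rule integral_dominated_convergence[where w = "\<lambda>x. K0 * exp (C0 * U * l1 J x)"])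
    show "(\<lambda>x. F (scale (mix u0 u1 (t i)) x)) \<in> borel_measurable (gauss J)" for i by (intro meas_FG meas_scale)
    show "(\<lambda>x. F (scale (mix u0 u1 a) x)) \<in> borel_measurable (gauss J)" by (intro meas_FG meas_scale)
    show "integrable (gauss J) (\<lambda>x. K0 * exp (C0 * U * l1 J x))"
      using integrable_gauss_exp_abs[OF g1.finite_J] by (simp add: l1_def)
    show "AE x in gauss J. norm (F (scale (mix u0 u1 (t i)) x)) \<le> K0 * exp (C0 * U * l1 J x)" for i
      using F_scale_bound[OF b1[of _ "t i"]] t F_pos by (intro AE_I2) (simp add: less_imp_le abs_of_pos)
    show "AE x in gauss J. (\<lambda>n. F (scale (mix u0 u1 (t n)) x)) \<longlonglongrightarrow> F (scale (mix u0 u1 a) x)"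
      by (intro AE_I2 F_tendsto) (auto simp: scale_def mix_def intro!: tendsto_intros lim)
  qed
qed

end

subsection \<open>Moments of the partition function\<close>

text \<open>Jensen's inequality, by integrating the tangent of exp at the mean.\<close>

lemma (in prob_space) exp_expectation_le:
  fixes Y :: "'a \<Rightarrow> real"
  assumes "integrable M Y" "integrable M (\<lambda>x. exp (Y x))"
  shows "exp (expectation Y) \<le> expectation (\<lambda>x. exp (Y x))"
proof -
  let ?m = "expectation Y"
  have "exp ?m = expectation (\<lambda>x. exp ?m * (1 + (Y x - ?m)))" using assms(1) by (simp add: prob_space)
  also have "\<dots> \<le> expectation (\<lambda>x. exp (Y x))"
  proof (rule integral_mono)
    show "integrable M (\<lambda>x. exp ?m * (1 + (Y x - ?m)))" using assms(1) by simp
    fix x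
    have "exp ?m * (1 + (Y x - ?m)) \<le> exp ?m * exp (Y x - ?m)"
      by (intro mult_left_mono exp_ge_add_one_self) auto
    then show "exp ?m * (1 + (Y x - ?m)) \<le> exp (Y x)" by (simp add: exp_add[symmetric])
  qed fact
  finally show ?thesis .
qed

lemma energy_cong: "(\<And>j. j \<in> J \<Longrightarrow> x j = y j) \<Longrightarrow> energy J w x = energy J w y"
  by (auto simp: energy_def fun_eq_iff)

lemma pf_cong: "(\<And>j. j \<in> J \<Longrightarrow> x j = y j) \<Longrightarrow> pf \<nu> J w x = pf \<nu> J w y"
  unfolding pf_def by (simp cong: energy_cong)

lemma gauss_reindex:
  fixes f :: "_ \<Rightarrow> real"
  assumes "inj_on \<rho> J" "\<rho> ` J \<subseteq> K" and [measurable]: "f \<in> borel_measurable (gauss J)"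
  shows "(LINT x|gauss K. f (\<lambda>j\<in>J. x (\<rho> j))) = (LINT x|gauss J. f x)"
    and "integrable (gauss K) (\<lambda>x. f (\<lambda>j\<in>J. x (\<rho> j))) \<longleftrightarrow> integrable (gauss J) f"
proof -
  have d: "distr (gauss K) (gauss J) (\<lambda>x. \<lambda>j\<in>J. x (\<rho> j)) = gauss J"
    unfolding gauss_def using assms
    by (intro distr_PiM_reindex prob_space_std_normal) auto
  have m: "(\<lambda>x. \<lambda>j\<in>J. x (\<rho> j)) \<in> measurable (gauss K) (gauss J)"
    unfolding gauss_def using assms(2) by (intro measurable_restrict measurable_component_singleton) auto
  show "(LINT x|gauss K. f (\<lambda>j\<in>J. x (\<rho> j))) = (LINT x|gauss J. f x)"
    using integral_distr[OF m assms(3)] by (simp add: d)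
  show "integrable (gauss K) (\<lambda>x. f (\<lambda>j\<in>J. x (\<rho> j))) \<longleftrightarrow> integrable (gauss J) f"
    using integrable_distr_eq[OF m assms(3)] by (simp add: d)
qed

text \<open>Serves the concentration estimate, where at the final time the two partition functions
  read disjoint blocks of one larger Gaussian vector.\<close>

lemma gauss_integral_mult:
  fixes f h :: "('b \<Rightarrow> real) \<Rightarrow> real" and \<rho>1 \<rho>2 :: "'b \<Rightarrow> 'a"
  assumes inj: "inj_on \<rho>1 J" "inj_on \<rho>2 J" and sub: "\<rho>1 ` J \<subseteq> K" "\<rho>2 ` J \<subseteq> K" "\<rho>1 ` J \<inter> \<rho>2 ` J = {}"
    and f: "integrable (gauss J) f" and h: "integrable (gauss J) h"
  shows "(LINT x|gauss K. f (\<lambda>j\<in>J. x (\<rho>1 j)) * h (\<lambda>j\<in>J. x (\<rho>2 j))) = (LINT x|gauss J. f x) * (LINT x|gauss J. h x)"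
proof -
  interpret P: prob_space "gauss K" by (rule prob_space_gauss)
  have "distr (gauss K) (Pi\<^sub>M K (\<lambda>_. borel)) (\<lambda>x. \<lambda>i\<in>K. x i) = Pi\<^sub>M K (\<lambda>i. distr (gauss K) borel (\<lambda>x. x i))"
  proof -
    have "distr (gauss K) (Pi\<^sub>M K (\<lambda>_. borel)) (\<lambda>x. \<lambda>i\<in>K. x i) = distr (gauss K) (gauss K) (\<lambda>x. x)"
      by (intro distr_cong) (auto simp: sets_gauss space_gauss)
    also have "\<dots> = gauss K" by (rule distr_id2) simp
    also have "\<dots> = Pi\<^sub>M K (\<lambda>i. distr (gauss K) borel (\<lambda>x. x i))"
      unfolding gauss_def
    proof (rule PiM_cong[OF refl])
      fix i assume "i \<in> K"
      then show "std_normal = distr (Pi\<^sub>M K (\<lambda>_. std_normal)) borel (\<lambda>x. x i)"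
        using distr_PiM_component[of K "\<lambda>_. std_normal" i] prob_space_std_normal by (simp cong: distr_cong)
    qed
    finally show ?thesis .
  qed
  then have "P.indep_vars (\<lambda>_. borel) (\<lambda>i x. x i) K"
  proof (cases "K = {}")
    case True
    then show ?thesis unfolding P.indep_vars_def P.indep_sets_def by auto
  next
    case False
    then show ?thesis using \<open>distr (gauss K) _ _ = _\<close> by (subst P.indep_vars_iff_distr_eq_PiM') auto
  qed
  from P.indep_var_restrict[OF this sub(3,1,2)]
  have ind: "P.indep_var (Pi\<^sub>M (\<rho>1 ` J) (\<lambda>_. borel)) (\<lambda>x. restrict x (\<rho>1 ` J)) (Pi\<^sub>M (\<rho>2 ` J) (\<lambda>_. borel)) (\<lambda>x. restrict x (\<rho>2 ` J))"
    by simp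
  have fm[measurable]: "f \<in> borel_measurable (gauss J)" "h \<in> borel_measurable (gauss J)" using f h by auto
  have m: "(\<lambda>x. q (\<lambda>j\<in>J. x (\<rho> j))) \<in> borel_measurable (Pi\<^sub>M (\<rho> ` J) (\<lambda>_. borel))"
    if [measurable]: "q \<in> borel_measurable (gauss J)" for q :: "_ \<Rightarrow> real" and \<rho>
  proof -
    have "(\<lambda>x. \<lambda>j\<in>J. x (\<rho> j)) \<in> measurable (Pi\<^sub>M (\<rho> ` J) (\<lambda>_. borel)) (gauss J)"
      unfolding gauss_def by (intro measurable_restrict measurable_component_singleton) auto
    then show ?thesis by measurable
  qed
  have e: "(\<lambda>j\<in>J. restrict x (\<rho> ` J) (\<rho> j)) = (\<lambda>j\<in>J. x (\<rho> j))" for x :: "'a \<Rightarrow> real" and \<rho> :: "'b \<Rightarrow> 'a"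
    by (auto simp: fun_eq_iff)
  have "P.indep_var borel (\<lambda>x. f (\<lambda>j\<in>J. x (\<rho>1 j))) borel (\<lambda>x. h (\<lambda>j\<in>J. x (\<rho>2 j)))"
    using P.indep_var_compose[OF ind m[OF fm(1)] m[OF fm(2)]] by (simp only: comp_def e)
  then have "(LINT x|gauss K. f (\<lambda>j\<in>J. x (\<rho>1 j)) * h (\<lambda>j\<in>J. x (\<rho>2 j))) =
     (LINT x|gauss K. f (\<lambda>j\<in>J. x (\<rho>1 j))) * (LINT x|gauss K. h (\<lambda>j\<in>J. x (\<rho>2 j)))"
    using gauss_reindex(2)[OF inj(1) sub(1) fm(1)] gauss_reindex(2)[OF inj(2) sub(2) fm(2)] f h
    by (intro P.indep_var_lebesgue_integral) auto
  then show ?thesis using gauss_reindex(1)[OF inj(1) sub(1) fm(1)] gauss_reindex(1)[OF inj(2) sub(2) fm(2)] by simp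
qed

section \<open>Moments of the partition function: flow inequality and concentration\<close>

context gibbs
begin

text \<open>The moment E Z^a for couplings with variances \<open>u\<close>.\<close>

definition pm :: "real \<Rightarrow> ('j \<Rightarrow> real) \<Rightarrow> real" where
  "pm a u = (LINT x|gauss J. exp (a * ln (Z (scale u x))))"

lemma meas_Z_scale [measurable]: "(\<lambda>x. Z (scale u x)) \<in> borel_measurable (gauss J)"
  by (rule borel_measurable_pf) (simp add: scale_def)

lemma meas_gav_scale: "\<phi> \<in> borel_measurable \<nu> \<Longrightarrow> (\<lambda>x. gav \<nu> J w \<phi> (scale u x)) \<in> borel_measurable (gauss J)"
  by (rule borel_measurable_gav) (simp_all add: scale_def)

lemma gibbs2_self: "gibbs2 \<nu> \<nu> J w w C" ..

lemma integrable_pm: "integrable (gauss J) (\<lambda>x. exp (a * ln (Z (scale u x))))"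
proof -
  interpret g2: gibbs2 \<nu> \<nu> J w w C a 0 by (rule gibbs2_self)
  show ?thesis using g2.integrable_F_scale[of u] by (simp add: g2.F_def)
qed

lemma pm_pos: "0 < pm a u"
proof -
  interpret P: prob_space "gauss J" by (rule prob_space_gauss)
  have "0 \<le> pm a u" unfolding pm_def by (rule integral_nonneg_AE) auto
  moreover have "pm a u \<noteq> 0"
    unfolding pm_def using integral_nonneg_eq_0_iff_AE[OF integrable_pm[of a u]] P.AE_False by auto
  ultimately show ?thesis by simp
qed

lemma integrable_ln_pf: "integrable (gauss J) (\<lambda>x. ln (Z (scale u x)))"
proof (rule integrable_gauss_exp_growth[OF finite_J])
  define U where "U = l1 J (\<lambda>j. sqrt (u j))"
  fix x
  have "\<bar>sqrt (u j)\<bar> \<le> U" if "j \<in> J" for j using abs_le_l1[OF finite_J that] by (simp add: U_def)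
  then have "C * l1 J (scale u x) \<le> C * (U * l1 J x)" by (intro mult_left_mono l1_scale_le C_nonneg)
  then have "\<bar>ln (Z (scale u x))\<bar> \<le> \<bar>ln mass\<bar> + C * (U * l1 J x)" using ln_pf_bound[of "scale u x"] by linarith
  also have "\<dots> \<le> exp (\<bar>ln mass\<bar> + C * (U * l1 J x))" using exp_ge_add_one_self[of "\<bar>ln mass\<bar> + C * (U * l1 J x)"] by linarith
  finally show "\<bar>ln (Z (scale u x))\<bar> \<le> exp \<bar>ln mass\<bar> * exp (C * U * (\<Sum>j\<in>J. \<bar>x j\<bar>))"
    by (simp add: exp_add l1_def mult.assoc)
qed measurable

lemma exp_mean_le_pm: "exp (a * (LINT x|gauss J. ln (Z (scale u x)))) \<le> pm a u"
proof -
  interpret P: prob_space "gauss J" by (rule prob_space_gauss)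
  show ?thesis using P.exp_expectation_le[of "\<lambda>x. a * ln (Z (scale u x))"] integrable_pm[of a u] integrable_ln_pf[of u]
    by (simp add: pm_def)
qed

lemma gav_sum:
  assumes "\<And>j. j \<in> K \<Longrightarrow> f j \<in> borel_measurable \<nu>" "\<And>j \<sigma>. j \<in> K \<Longrightarrow> \<sigma> \<in> space \<nu> \<Longrightarrow> \<bar>f j \<sigma>\<bar> \<le> c"
  shows "(\<Sum>j\<in>K. d j * gav \<nu> J w (f j) x) = gav \<nu> J w (\<lambda>\<sigma>. \<Sum>j\<in>K. d j * f j \<sigma>) x"
proof -
  have "(\<Sum>j\<in>K. d j * num \<nu> J w (f j) x) = (LINT \<sigma>|\<nu>. (\<Sum>j\<in>K. d j * (f j \<sigma> * exp (energy J w x \<sigma>))))"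
    unfolding num_def using integrable_num[OF assms] by (subst Bochner_Integration.integral_sum) auto
  then show ?thesis unfolding gav_def num_def
    by (simp add: sum_distrib_right sum_divide_distrib[symmetric] mult.assoc)
qed

lemma gav_const:
  assumes "\<And>\<sigma>. \<sigma> \<in> space \<nu> \<Longrightarrow> \<phi> \<sigma> = c"
  shows "gav \<nu> J w \<phi> x = c"
proof -
  have "num \<nu> J w \<phi> x = c * Z x" unfolding num_def pf_def using assms by (simp cong: Bochner_Integration.integral_cong)
  then show ?thesis using pf_pos[of x] by (simp add: gav_def)
qed

lemma gav_mono:
  assumes "\<phi> \<in> borel_measurable \<nu>" "\<And>\<sigma>. \<sigma> \<in> space \<nu> \<Longrightarrow> \<bar>\<phi> \<sigma>\<bar> \<le> c"
    and "\<psi> \<in> borel_measurable \<nu>" "\<And>\<sigma>. \<sigma> \<in> space \<nu> \<Longrightarrow> \<bar>\<psi> \<sigma>\<bar> \<le> d"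
    and "\<And>\<sigma>. \<sigma> \<in> space \<nu> \<Longrightarrow> \<phi> \<sigma> \<le> \<psi> \<sigma>"
  shows "gav \<nu> J w \<phi> x \<le> gav \<nu> J w \<psi> x"
  unfolding gav_def using num_mono[OF assms] pf_pos[of x] by (simp add: divide_right_mono)

lemma w_sq_bound: "j \<in> J \<Longrightarrow> \<sigma> \<in> space \<nu> \<Longrightarrow> \<bar>(w j \<sigma>)\<^sup>2\<bar> \<le> C\<^sup>2"
  using bound_w C_nonneg by (simp add: abs_le_square_iff[symmetric])

text \<open>For F = Z^a the heat equation has the terms a <w_j^2> and -a (1 - a) <w_j>^2. The first
  sums to a constant because the self-covariance does not depend on the configuration. The second is
  the two-replica term; its coefficient is nonpositive for a in [0,1], so an upper bound \<kappa> in
  the mean weighted by Z^a gives a lower bound on the rate of growth.\<close>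

theorem flow_inequality:
  assumes u: "\<And>j. j \<in> J \<Longrightarrow> 0 \<le> u0 j" "\<And>j. j \<in> J \<Longrightarrow> 0 \<le> u1 j"
    and V: "\<And>\<sigma>. \<sigma> \<in> space \<nu> \<Longrightarrow> (\<Sum>j\<in>J. u0 j * (w j \<sigma>)\<^sup>2) = V0" "\<And>\<sigma>. \<sigma> \<in> space \<nu> \<Longrightarrow> (\<Sum>j\<in>J. u1 j * (w j \<sigma>)\<^sup>2) = V1"
    and a: "0 \<le> a" "a \<le> 1"
    and \<kappa>: "\<And>t. 0 < t \<Longrightarrow> t < 1 \<Longrightarrow>
      (LINT x|gauss J. exp (a * ln (Z (scale (mix u0 u1 t) x))) * (\<Sum>j\<in>J. (u1 j - u0 j) * (gav \<nu> J w (w j) (scale (mix u0 u1 t) x))\<^sup>2))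
       \<le> \<kappa> * pm a (mix u0 u1 t)"
  shows "pm a u0 * exp (a * (V1 - V0) / 2 - a * (1 - a) / 2 * \<kappa>) \<le> pm a u1"
proof -
  interpret g2: gibbs2 \<nu> \<nu> J w w C a 0 by (rule gibbs2_self)
  let ?s = "\<lambda>t x. scale (mix u0 u1 t) x"
  have F: "g2.F x = exp (a * ln (Z x))" for x by (simp add: g2.F_def)
  have pm: "pm a (mix u0 u1 t) = (LINT x|gauss J. g2.F (?s t x))" for t by (simp add: pm_def F)
  define m where "m = a * (V1 - V0) / 2 - a * (1 - a) / 2 * \<kappa>"
  define D where "D t = (\<Sum>j\<in>J. (u1 j - u0 j) / 2 * (LINT x|gauss J. g2.F (?s t x) * ((g2.G j (?s t x))\<^sup>2 + g2.G2 j (?s t x))))" for t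
  note [measurable] = g2.meas_FG[OF g2.meas_scale] meas_gav_scale
  have gb: "\<bar>(gav \<nu> J w (w j) x)\<^sup>2\<bar> \<le> C\<^sup>2" if "j \<in> J" for j x
    using gav_bound[OF meas_w[OF that] bound_w[OF that]] C_nonneg by (simp add: abs_le_square_iff[symmetric])
  have D_ge: "m * pm a (mix u0 u1 t) \<le> D t" if t: "0 < t" "t < 1" for t
  proof -
    have sq: "(\<Sum>j\<in>J. (u1 j - u0 j) * gav \<nu> J w (\<lambda>\<sigma>. (w j \<sigma>)\<^sup>2) x) = V1 - V0" for x
    proof -
      have "(\<Sum>j\<in>J. (u1 j - u0 j) * gav \<nu> J w (\<lambda>\<sigma>. (w j \<sigma>)\<^sup>2) x) = gav \<nu> J w (\<lambda>\<sigma>. \<Sum>j\<in>J. (u1 j - u0 j) * (w j \<sigma>)\<^sup>2) x"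
        by (rule gav_sum[where c = "C\<^sup>2"]) (use w_sq_bound in auto)
      also have "\<dots> = V1 - V0" by (rule gav_const) (simp add: left_diff_distrib sum_subtractf V)
      finally show ?thesis .
    qed
    have int: "integrable (gauss J) (\<lambda>x. g2.F (?s t x) * ((g2.G j (?s t x))\<^sup>2 + g2.G2 j (?s t x)))" if j: "j \<in> J" for j
    proof (rule g2.integrable_F_scale_mult[where c = "g2.C0\<^sup>2 + g2.C0 * C"])
      fix x
      have "(g2.G j (?s t x))\<^sup>2 \<le> g2.C0\<^sup>2" using g2.G_bound[OF j, of "?s t x"] g2.C0_nonneg by (simp add: abs_le_square_iff[symmetric])
      then show "\<bar>(g2.G j (?s t x))\<^sup>2 + g2.G2 j (?s t x)\<bar> \<le> g2.C0\<^sup>2 + g2.C0 * C"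
        using g2.G2_bound[OF j, of "?s t x"] abs_triangle_ineq[of "(g2.G j (?s t x))\<^sup>2" "g2.G2 j (?s t x)"] by simp
    qed (use j in measurable)
    have "D t = (LINT x|gauss J. (\<Sum>j\<in>J. (u1 j - u0 j) / 2 * (g2.F (?s t x) * ((g2.G j (?s t x))\<^sup>2 + g2.G2 j (?s t x)))))"
      unfolding D_def using int by (subst Bochner_Integration.integral_sum) auto
    also have "\<dots> = (LINT x|gauss J. (a * (V1 - V0) / 2) * g2.F (?s t x) - (a * (1 - a) / 2) * (g2.F (?s t x) * (\<Sum>j\<in>J. (u1 j - u0 j) * (gav \<nu> J w (w j) (?s t x))\<^sup>2)))"
    proof (intro Bochner_Integration.integral_cong refl)
      fix x
      let ?y = "?s t x"
      have "(\<Sum>j\<in>J. (u1 j - u0 j) / 2 * (g2.F ?y * ((g2.G j ?y)\<^sup>2 + g2.G2 j ?y))) =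
        (\<Sum>j\<in>J. (a / 2 * g2.F ?y) * ((u1 j - u0 j) * gav \<nu> J w (\<lambda>\<sigma>. (w j \<sigma>)\<^sup>2) ?y) - (a * (1 - a) / 2 * g2.F ?y) * ((u1 j - u0 j) * (gav \<nu> J w (w j) ?y)\<^sup>2))"
        by (intro sum.cong refl) (simp add: g2.G_def g2.G2_def power2_eq_square field_simps)
      also have "\<dots> = (a / 2 * g2.F ?y) * (V1 - V0) - (a * (1 - a) / 2 * g2.F ?y) * (\<Sum>j\<in>J. (u1 j - u0 j) * (gav \<nu> J w (w j) ?y)\<^sup>2)"
        by (simp only: sum_subtractf sum_distrib_left[symmetric] sq)
      finally show "(\<Sum>j\<in>J. (u1 j - u0 j) / 2 * (g2.F ?y * ((g2.G j ?y)\<^sup>2 + g2.G2 j ?y))) =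
         (a * (V1 - V0) / 2) * g2.F ?y - (a * (1 - a) / 2) * (g2.F ?y * (\<Sum>j\<in>J. (u1 j - u0 j) * (gav \<nu> J w (w j) ?y)\<^sup>2))"
        by (simp add: mult_ac)
    qed
    also have "\<dots> = (a * (V1 - V0) / 2) * pm a (mix u0 u1 t) - (a * (1 - a) / 2) * (LINT x|gauss J. g2.F (?s t x) * (\<Sum>j\<in>J. (u1 j - u0 j) * (gav \<nu> J w (w j) (?s t x))\<^sup>2))"
    proof -
      have "integrable (gauss J) (\<lambda>x. g2.F (?s t x) * (\<Sum>j\<in>J. (u1 j - u0 j) * (gav \<nu> J w (w j) (?s t x))\<^sup>2))"
      proof (rule g2.integrable_F_scale_mult[where c = "\<Sum>j\<in>J. \<bar>u1 j - u0 j\<bar> * C\<^sup>2"])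
        fix x
        show "\<bar>\<Sum>j\<in>J. (u1 j - u0 j) * (gav \<nu> J w (w j) (?s t x))\<^sup>2\<bar> \<le> (\<Sum>j\<in>J. \<bar>u1 j - u0 j\<bar> * C\<^sup>2)"
          by (rule order_trans[OF sum_abs], rule sum_mono) (use gb in \<open>auto simp: abs_mult intro!: mult_left_mono\<close>)
      qed measurable
      then show ?thesis using g2.integrable_F_scale[of "mix u0 u1 t"] by (simp add: pm)
    qed
    also have "\<dots> \<ge> (a * (V1 - V0) / 2) * pm a (mix u0 u1 t) - (a * (1 - a) / 2) * (\<kappa> * pm a (mix u0 u1 t))"
      using mult_left_mono[OF \<kappa>[OF t], of "a * (1 - a) / 2"] a by (simp add: F)
    finally show ?thesis by (simp add: m_def algebra_simps)
  qed
  \<comment> \<open>Integrating factor: \<open>m\<close> is the guaranteed growth rate of the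
    logarithm of the moment.\<close>
  define \<Psi> where "\<Psi> t = exp (- m * t) * pm a (mix u0 u1 t)" for t
  have "\<Psi> 0 \<le> \<Psi> 1"
  proof (rule DERIV_nonneg_imp_increasing_open[where f = \<Psi> and a = 0 and b = 1])
    show "continuous_on {0..1} \<Psi>" unfolding \<Psi>_def pm
      by (intro continuous_intros g2.gaussian_flow_continuous u)
    fix t :: real assume t: "0 < t" "t < 1"
    have "((\<lambda>t. pm a (mix u0 u1 t)) has_real_derivative D t) (at t)"
      unfolding pm D_def by (rule g2.gaussian_flow[OF u t])
    then have "(\<Psi> has_real_derivative exp (- m * t) * (D t - m * pm a (mix u0 u1 t))) (at t)"
      unfolding \<Psi>_def by (auto intro!: derivative_eq_intros simp: algebra_simps)
    moreover have "0 \<le> exp (- m * t) * (D t - m * pm a (mix u0 u1 t))" using D_ge[OF t] by simp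
    ultimately show "\<exists>y. (\<Psi> has_real_derivative y) (at t) \<and> 0 \<le> y" by blast
  qed simp
  then have "pm a u0 \<le> exp (- m) * pm a u1" by (simp add: \<Psi>_def mix_def[abs_def])
  then show ?thesis unfolding m_def[symmetric] by (simp add: exp_minus field_simps)
qed

text \<open>Concentration by decoupling. At time 0 both partition functions use copy 0 of the
  disorder and their quotient is 1; at time 1 they use the independent copies 1 and 2, and the
  expectation is E Z^a E Z^(-a). Each of the two keeps its law on the way, only their correlation
  decreases. Jensen's inequality bounds E Z^(-a) from below by exp(-a E ln Z). The exponent
  \<open>a\<^sup>2 * V\<close> is that of a difference of two independent copies.\<close>

theorem pm_concentration:
  assumes u: "\<And>j. j \<in> J \<Longrightarrow> 0 \<le> u j"
    and V: "\<And>\<sigma>. \<sigma> \<in> space \<nu> \<Longrightarrow> (\<Sum>j\<in>J. u j * (w j \<sigma>)\<^sup>2) \<le> V"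
  shows "pm a u \<le> exp (a\<^sup>2 * V + a * (LINT x|gauss J. ln (Z (scale u x))))"
proof -
  define K where "K = {0,1,2::nat} \<times> J"
  define sq where "sq j = sqrt (u j)" for j
  have sq2: "(sq j)\<^sup>2 = u j" if "j \<in> J" for j using u[OF that] by (simp add: sq_def)
  \<comment> \<open>The variances \<open>u\<close> are moved into the observables, so that the
    interpolated variances are 0 or 1 at the ends. Copy 2 is invisible to the first system and copy
    1 to the second.\<close>
  define w1 where "w1 = (\<lambda>(k::nat, j) \<sigma>. if k = 2 then 0 else sq j * w j \<sigma>)"
  define w2 where "w2 = (\<lambda>(k::nat, j) \<sigma>. if k = 1 then 0 else sq j * w j \<sigma>)"
  define U where "U = l1 J (\<lambda>j. sqrt (u j))"
  have U: "\<bar>sqrt (u j)\<bar> \<le> U" if "j \<in> J" for j using abs_le_l1[OF finite_J that] by (simp add: U_def)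
  have U0: "0 \<le> U" by (simp add: U_def)
  have finK: "finite K" using finite_J by (simp add: K_def)
  have bw: "\<bar>sq j * w j \<sigma>\<bar> \<le> U * C" if "j \<in> J" "\<sigma> \<in> space \<nu>" for j \<sigma>
    unfolding abs_mult sq_def using U bound_w that U0 by (intro mult_mono) auto
  have UC: "0 \<le> U * C" using U0 C_nonneg by simp
  have i1: "gibbs \<nu> K w1 (U * C)"
    by unfold_locales (use finK bw UC mass_pos in \<open>auto simp: K_def w1_def\<close>)
  have i2: "gibbs \<nu> K w2 (U * C)"
    by unfold_locales (use finK bw UC mass_pos in \<open>auto simp: K_def w2_def\<close>)
  interpret g2: gibbs2 \<nu> \<nu> K w1 w2 "U * C" a "-a" by (intro gibbs2.intro i1 i2)
  define u0 u1 :: "nat \<times> 'j \<Rightarrow> real" where "u0 = (\<lambda>(k, j). if k = 0 then 1 else 0)" and "u1 = (\<lambda>(k, j). if k = 0 then 0 else 1)"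
  have sumK: "(\<Sum>q\<in>K. f q) = (\<Sum>j\<in>J. f (0, j) + f (1, j) + f (2, j))" for f :: "_ \<Rightarrow> real"
    unfolding K_def sum.cartesian_product' by (simp add: sum.distrib)
  let ?s = "\<lambda>t x. scale (mix u0 u1 t) x"
  define p where "p t = (LINT x|gauss K. g2.F (?s t x))" for t
  define D where "D t = (\<Sum>j\<in>K. (u1 j - u0 j) / 2 * (LINT x|gauss K. g2.F (?s t x) * ((g2.G j (?s t x))\<^sup>2 + g2.G2 j (?s t x))))" for t
  note [measurable] = g2.meas_FG[OF g2.meas_scale]
  have gavw: "gav \<nu> K w1 (w1 (k, j)) x = (if k = 2 then 0 else sq j * gav \<nu> K w1 (w j) x)"
     "gav \<nu> K w2 (w2 (k, j)) x = (if k = 1 then 0 else sq j * gav \<nu> K w2 (w j) x)"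
     "gav \<nu> K w1 (\<lambda>\<sigma>. (w1 (k, j) \<sigma>)\<^sup>2) x = (if k = 2 then 0 else (sq j)\<^sup>2 * gav \<nu> K w1 (\<lambda>\<sigma>. (w j \<sigma>)\<^sup>2) x)"
     "gav \<nu> K w2 (\<lambda>\<sigma>. (w2 (k, j) \<sigma>)\<^sup>2) x = (if k = 1 then 0 else (sq j)\<^sup>2 * gav \<nu> K w2 (\<lambda>\<sigma>. (w j \<sigma>)\<^sup>2) x)" for k j x
    by (auto simp: w1_def w2_def gav_def num_def mult.assoc power_mult_distrib)
  \<comment> \<open>\<open>gav_square_le\<close> concerns the observables of the system itself,
    whereas here \<open>w j\<close> is averaged under the energy built from \<open>ww\<close>; hence
    the direct argument from (w - m)^2 \<ge> 0.\<close>
  have Vg: "(\<Sum>j\<in>J. u j * (gav \<nu> K ww (w j) x)\<^sup>2) \<le> V" if "gibbs \<nu> K ww (U * C)" for ww x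
  proof -
    interpret g: gibbs \<nu> K ww "U * C" by fact
    have "(gav \<nu> K ww (w j) x)\<^sup>2 \<le> gav \<nu> K ww (\<lambda>\<sigma>. (w j \<sigma>)\<^sup>2) x" if j: "j \<in> J" for j
    proof -
      let ?m = "gav \<nu> K ww (w j) x"
      have "gav \<nu> K ww (\<lambda>\<sigma>. 2 * ?m * w j \<sigma> - ?m\<^sup>2) x \<le> gav \<nu> K ww (\<lambda>\<sigma>. (w j \<sigma>)\<^sup>2) x"
      proof (rule g.gav_mono[where c = "2 * \<bar>?m\<bar> * C + ?m\<^sup>2" and d = "C\<^sup>2"])
        fix \<sigma> assume s: "\<sigma> \<in> space \<nu>"
        have "\<bar>2 * ?m * w j \<sigma>\<bar> \<le> 2 * \<bar>?m\<bar> * C"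
          unfolding abs_mult using bound_w[OF j s] by (intro mult_mono) auto
        then show "\<bar>2 * ?m * w j \<sigma> - ?m\<^sup>2\<bar> \<le> 2 * \<bar>?m\<bar> * C + ?m\<^sup>2" by (intro order_trans[OF abs_triangle_ineq4]) simp
        show "2 * ?m * w j \<sigma> - ?m\<^sup>2 \<le> (w j \<sigma>)\<^sup>2" using zero_le_power2[of "w j \<sigma> - ?m"] by (simp add: power2_diff algebra_simps)
      qed (use j w_sq_bound in auto)
      moreover have "gav \<nu> K ww (\<lambda>\<sigma>. 2 * ?m * w j \<sigma> - ?m\<^sup>2) x = ?m\<^sup>2"
      proof -
        have "num \<nu> K ww (\<lambda>\<sigma>. 2 * ?m * w j \<sigma> - ?m\<^sup>2) x = (LINT \<sigma>|\<nu>. 2 * ?m * (w j \<sigma> * exp (energy K ww x \<sigma>)) - ?m\<^sup>2 * exp (energy K ww x \<sigma>))"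
          unfolding num_def by (simp add: algebra_simps)
        also have "\<dots> = 2 * ?m * num \<nu> K ww (w j) x - ?m\<^sup>2 * pf \<nu> K ww x"
          unfolding num_def pf_def using g.integrable_num[OF meas_w[OF j] bound_w[OF j], of x] g.integrable_exp_energy[of x] by simp
        finally show ?thesis using g.pf_pos[of x] by (simp add: gav_def[of \<nu> K ww _ x] power2_eq_square field_simps)
      qed
      ultimately show ?thesis by simp
    qed
    then have "(\<Sum>j\<in>J. u j * (gav \<nu> K ww (w j) x)\<^sup>2) \<le> (\<Sum>j\<in>J. u j * gav \<nu> K ww (\<lambda>\<sigma>. (w j \<sigma>)\<^sup>2) x)"
      using u by (intro sum_mono mult_left_mono) auto
    also have "\<dots> = gav \<nu> K ww (\<lambda>\<sigma>. \<Sum>j\<in>J. u j * (w j \<sigma>)\<^sup>2) x"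
      by (rule g.gav_sum[where c = "C\<^sup>2"]) (use w_sq_bound in auto)
    also have "\<dots> \<le> gav \<nu> K ww (\<lambda>_. V) x"
    proof (rule g.gav_mono[where c = "\<bar>V\<bar>" and d = "\<bar>V\<bar>"])
      fix \<sigma> assume "\<sigma> \<in> space \<nu>"
      then show "\<bar>\<Sum>j\<in>J. u j * (w j \<sigma>)\<^sup>2\<bar> \<le> \<bar>V\<bar>" using V[of \<sigma>] sum_nonneg[of J "\<lambda>j. u j * (w j \<sigma>)\<^sup>2"] u by auto
    qed (use V in auto)
    also have "\<dots> = V" by (rule g.gav_const) simp
    finally show ?thesis .
  qed
  have D_le: "D t \<le> a\<^sup>2 * V * p t" for t
  proof -
    have bnd: "\<bar>(g2.G j y)\<^sup>2 + g2.G2 j y\<bar> \<le> g2.C0\<^sup>2 + g2.C0 * (U * C)" if j: "j \<in> K" for j y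
    proof -
      have "(g2.G j y)\<^sup>2 \<le> g2.C0\<^sup>2" using g2.G_bound[OF j, of y] g2.C0_nonneg by (simp add: abs_le_square_iff[symmetric])
      then show ?thesis
        using g2.G2_bound[OF j, of y] abs_triangle_ineq[of "(g2.G j y)\<^sup>2" "g2.G2 j y"] by simp
    qed
    have int: "integrable (gauss K) (\<lambda>x. g2.F (?s t x) * ((g2.G j (?s t x))\<^sup>2 + g2.G2 j (?s t x)))" if j: "j \<in> K" for j
      by (rule g2.integrable_F_scale_mult[OF _ bnd[OF j]]) (use j in measurable)
    have "D t = (LINT x|gauss K. (\<Sum>j\<in>K. (u1 j - u0 j) / 2 * (g2.F (?s t x) * ((g2.G j (?s t x))\<^sup>2 + g2.G2 j (?s t x)))))"
      unfolding D_def using int by (subst Bochner_Integration.integral_sum) auto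
    also have "\<dots> \<le> (LINT x|gauss K. a\<^sup>2 * V * g2.F (?s t x))"
    proof (rule integral_mono)
      show "integrable (gauss K) (\<lambda>x. \<Sum>j\<in>K. (u1 j - u0 j) / 2 * (g2.F (?s t x) * ((g2.G j (?s t x))\<^sup>2 + g2.G2 j (?s t x))))"
        using int by auto
      show "integrable (gauss K) (\<lambda>x. a\<^sup>2 * V * g2.F (?s t x))" using g2.integrable_F_scale by simp
      fix x
      let ?y = "?s t x"
      let ?g1 = "\<lambda>j. gav \<nu> K w1 (w j) ?y" and ?g2 = "\<lambda>j. gav \<nu> K w2 (w j) ?y"
      have "(\<Sum>j\<in>K. (u1 j - u0 j) / 2 * (g2.F ?y * ((g2.G j ?y)\<^sup>2 + g2.G2 j ?y))) = g2.F ?y * (\<Sum>j\<in>J. (sq j)\<^sup>2 * (a\<^sup>2 * (?g1 j * ?g2 j)))"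
        unfolding sumK sum_distrib_left
      proof (intro sum.cong refl)
        fix j
        let ?P = "gav \<nu> K w1 (\<lambda>\<sigma>. (w j \<sigma>)\<^sup>2) ?y" and ?Q = "gav \<nu> K w2 (\<lambda>\<sigma>. (w j \<sigma>)\<^sup>2) ?y"
        have du: "u1 (0, j) - u0 (0, j) = -1" "u1 (1, j) - u0 (1, j) = 1" "u1 (2, j) - u0 (2, j) = 1"
          by (simp_all add: u0_def u1_def)
        have G: "g2.G (0, j) ?y = a * (sq j * ?g1 j) - a * (sq j * ?g2 j)" "g2.G (1, j) ?y = a * (sq j * ?g1 j)" "g2.G (2, j) ?y = - (a * (sq j * ?g2 j))"
          by (simp_all add: g2.G_def gavw)
        have G2: "g2.G2 (0, j) ?y = a * ((sq j)\<^sup>2 * ?P - (sq j * ?g1 j)\<^sup>2) - a * ((sq j)\<^sup>2 * ?Q - (sq j * ?g2 j)\<^sup>2)"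
          "g2.G2 (1, j) ?y = a * ((sq j)\<^sup>2 * ?P - (sq j * ?g1 j)\<^sup>2)" "g2.G2 (2, j) ?y = - (a * ((sq j)\<^sup>2 * ?Q - (sq j * ?g2 j)\<^sup>2))"
          by (simp_all add: g2.G2_def gavw)
        \<comment> \<open>All terms belonging to one system cancel between the shared copy 0 and the
          private copies 1 and 2. What survives is the cross term of the two systems.\<close>
        have id: "-1 / 2 * (f * ((a * (s * p) - a * (s * q))\<^sup>2 + (a * (s\<^sup>2 * P - (s * p)\<^sup>2) - a * (s\<^sup>2 * Q - (s * q)\<^sup>2)))) +
            1 / 2 * (f * ((a * (s * p))\<^sup>2 + a * (s\<^sup>2 * P - (s * p)\<^sup>2))) + 1 / 2 * (f * ((- (a * (s * q)))\<^sup>2 + - (a * (s\<^sup>2 * Q - (s * q)\<^sup>2))))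
            = f * (s\<^sup>2 * (a\<^sup>2 * (p * q)))" for f s p q P Q :: real
          by (simp add: power2_eq_square algebra_simps)
        show "(u1 (0, j) - u0 (0, j)) / 2 * (g2.F ?y * ((g2.G (0, j) ?y)\<^sup>2 + g2.G2 (0, j) ?y)) +
            (u1 (1, j) - u0 (1, j)) / 2 * (g2.F ?y * ((g2.G (1, j) ?y)\<^sup>2 + g2.G2 (1, j) ?y)) +
            (u1 (2, j) - u0 (2, j)) / 2 * (g2.F ?y * ((g2.G (2, j) ?y)\<^sup>2 + g2.G2 (2, j) ?y)) =
            g2.F ?y * ((sq j)\<^sup>2 * (a\<^sup>2 * (?g1 j * ?g2 j)))"
          unfolding du G G2 by (rule id)
      qed
      also have "\<dots> \<le> g2.F ?y * (a\<^sup>2 * V)"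
      proof (intro mult_left_mono)
        have "(\<Sum>j\<in>J. (sq j)\<^sup>2 * (a\<^sup>2 * (?g1 j * ?g2 j))) \<le> (\<Sum>j\<in>J. a\<^sup>2 * ((u j * (?g1 j)\<^sup>2 + u j * (?g2 j)\<^sup>2) / 2))"
        proof (rule sum_mono)
          fix j assume j: "j \<in> J"
          have "?g1 j * ?g2 j \<le> ((?g1 j)\<^sup>2 + (?g2 j)\<^sup>2) / 2" using zero_le_power2[of "?g1 j - ?g2 j"] by (simp add: power2_diff)
          then have "(a\<^sup>2 * u j) * (?g1 j * ?g2 j) \<le> (a\<^sup>2 * u j) * (((?g1 j)\<^sup>2 + (?g2 j)\<^sup>2) / 2)" using u[OF j] by (intro mult_left_mono) auto
          then show "(sq j)\<^sup>2 * (a\<^sup>2 * (?g1 j * ?g2 j)) \<le> a\<^sup>2 * ((u j * (?g1 j)\<^sup>2 + u j * (?g2 j)\<^sup>2) / 2)"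
            using sq2[OF j] by (simp add: algebra_simps)
        qed
        also have "\<dots> = a\<^sup>2 * (((\<Sum>j\<in>J. u j * (?g1 j)\<^sup>2) + (\<Sum>j\<in>J. u j * (?g2 j)\<^sup>2)) / 2)"
          by (simp add: sum_distrib_left[symmetric] sum_divide_distrib[symmetric] sum.distrib)
        also have "\<dots> \<le> a\<^sup>2 * V" using Vg[OF i1, of ?y] Vg[OF i2, of ?y] by (intro mult_left_mono) auto
        finally show "(\<Sum>j\<in>J. (sq j)\<^sup>2 * (a\<^sup>2 * (?g1 j * ?g2 j))) \<le> a\<^sup>2 * V" .
      qed (simp add: g2.F_def)
      finally show "(\<Sum>j\<in>K. (u1 j - u0 j) / 2 * (g2.F ?y * ((g2.G j ?y)\<^sup>2 + g2.G2 j ?y))) \<le> a\<^sup>2 * V * g2.F ?y" by (simp add: mult_ac)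
    qed
    finally show ?thesis by (simp add: p_def)
  qed
  have "exp (- (a\<^sup>2 * V) * 1) * p 1 \<le> exp (- (a\<^sup>2 * V) * 0) * p 0"
  proof (rule DERIV_nonpos_imp_decreasing_open[where f = "\<lambda>t. exp (- (a\<^sup>2 * V) * t) * p t"])
    show "continuous_on {0..1} (\<lambda>t. exp (- (a\<^sup>2 * V) * t) * p t)" unfolding p_def
      by (intro continuous_intros g2.gaussian_flow_continuous) (auto simp: u0_def u1_def split: prod.splits)
    fix t :: real assume t: "0 < t" "t < 1"
    have "(p has_real_derivative D t) (at t)"
      unfolding p_def D_def by (rule g2.gaussian_flow[OF _ _ t]) (auto simp: u0_def u1_def split: prod.splits)
    then have "((\<lambda>t. exp (- (a\<^sup>2 * V) * t) * p t) has_real_derivative exp (- (a\<^sup>2 * V) * t) * (D t - a\<^sup>2 * V * p t)) (at t)"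
      by (auto intro!: derivative_eq_intros simp: algebra_simps)
    moreover have "exp (- (a\<^sup>2 * V) * t) * (D t - a\<^sup>2 * V * p t) \<le> 0" using D_le[of t] by (simp add: mult_nonneg_nonpos)
    ultimately show "\<exists>y. ((\<lambda>t. exp (- (a\<^sup>2 * V) * t) * p t) has_real_derivative y) (at t) \<and> y \<le> 0" by blast
  qed simp
  then have le: "p 1 \<le> exp (a\<^sup>2 * V) * p 0" by (simp add: exp_minus field_simps)
  have e1: "energy K w1 x = energy J w (scale u (\<lambda>j. x (0, j) + x (1, j)))"
    and e2: "energy K w2 x = energy J w (scale u (\<lambda>j. x (0, j) + x (2, j)))" for x
    unfolding energy_def sumK by (auto simp: w1_def w2_def scale_def sq_def algebra_simps fun_eq_iff)
  have "p 0 = 1"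
  proof -
    interpret P: prob_space "gauss K" by (rule prob_space_gauss)
    have "pf \<nu> K w1 (?s 0 x) = pf \<nu> K w2 (?s 0 x)" for x
      unfolding pf_def e1 e2 by (simp add: scale_def mix_def u0_def)
    then show ?thesis by (simp add: p_def g2.F_def P.prob_space)
  qed
  moreover have "p 1 = pm a u * pm (- a) u"
  proof -
    have p1: "pf \<nu> K w1 (?s 1 x) = Z (scale u (\<lambda>j\<in>J. x (1, j)))"
      and p2: "pf \<nu> K w2 (?s 1 x) = Z (scale u (\<lambda>j\<in>J. x (2, j)))" for x
      unfolding pf_def e1 e2 by (simp_all add: scale_def mix_def u0_def u1_def cong: energy_cong)
    have "p 1 = (LINT x|gauss K. exp (a * ln (Z (scale u (\<lambda>j\<in>J. x (1, j))))) * exp (- a * ln (Z (scale u (\<lambda>j\<in>J. x (2, j))))))"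
      unfolding p_def g2.F_def p1 p2 by (simp only: exp_add)
    also have "\<dots> = pm a u * pm (- a) u" unfolding pm_def
      by (rule gauss_integral_mult[OF _ _ _ _ _ integrable_pm integrable_pm]) (auto simp: K_def inj_on_def)
    finally show ?thesis .
  qed
  ultimately have "pm a u * pm (- a) u \<le> exp (a\<^sup>2 * V)" using le by simp
  moreover have "pm a u * exp (- a * (LINT x|gauss J. ln (Z (scale u x)))) \<le> pm a u * pm (- a) u"
    using exp_mean_le_pm[of "- a" u] pm_pos[of a u] by (intro mult_left_mono) auto
  ultimately have "pm a u * exp (- a * (LINT x|gauss J. ln (Z (scale u x)))) \<le> exp (a\<^sup>2 * V)" by linarith
  then show ?thesis by (simp add: exp_add exp_minus field_simps)
qed

end

subsection \<open>Positivity of overlaps\<close>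

context gibbs
begin

text \<open>The average over two independent replicas with the same disorder.\<close>

definition gav2 :: "('a \<Rightarrow> 'a \<Rightarrow> real) \<Rightarrow> ('j \<Rightarrow> real) \<Rightarrow> real" where
  "gav2 f x = gav \<nu> J w (\<lambda>\<sigma>. gav \<nu> J w (f \<sigma>) x) x"

lemma meas_gav_param:
  assumes [measurable]: "(\<lambda>(\<sigma>, \<tau>). f \<sigma> \<tau>) \<in> borel_measurable (\<nu> \<Otimes>\<^sub>M \<nu>)"
  shows "(\<lambda>\<sigma>. gav \<nu> J w (f \<sigma>) x) \<in> borel_measurable \<nu>"
  unfolding gav_def num_def energy_def by measurable

lemma meas_section:
  assumes "(\<lambda>(\<sigma>, \<tau>). f \<sigma> \<tau>) \<in> borel_measurable (\<nu> \<Otimes>\<^sub>M \<nu>)" "\<sigma> \<in> space \<nu>"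
  shows "f \<sigma> \<in> borel_measurable \<nu>"
  using measurable_Pair2[OF assms] by simp

lemma gav2_mono:
  assumes f: "(\<lambda>(\<sigma>, \<tau>). f \<sigma> \<tau>) \<in> borel_measurable (\<nu> \<Otimes>\<^sub>M \<nu>)" "\<And>\<sigma> \<tau>. \<sigma> \<in> space \<nu> \<Longrightarrow> \<tau> \<in> space \<nu> \<Longrightarrow> \<bar>f \<sigma> \<tau>\<bar> \<le> c"
    and g: "(\<lambda>(\<sigma>, \<tau>). g \<sigma> \<tau>) \<in> borel_measurable (\<nu> \<Otimes>\<^sub>M \<nu>)" "\<And>\<sigma> \<tau>. \<sigma> \<in> space \<nu> \<Longrightarrow> \<tau> \<in> space \<nu> \<Longrightarrow> \<bar>g \<sigma> \<tau>\<bar> \<le> d"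
    and le: "\<And>\<sigma> \<tau>. \<sigma> \<in> space \<nu> \<Longrightarrow> \<tau> \<in> space \<nu> \<Longrightarrow> f \<sigma> \<tau> \<le> g \<sigma> \<tau>"
  shows "gav2 f x \<le> gav2 g x"
  unfolding gav2_def
  by (rule gav_mono[where c = c and d = d])
     (auto intro!: meas_gav_param f g gav_bound[where c = c] gav_bound[where c = d] gav_mono[where c = c and d = d] meas_section le)

lemma gav2_bound:
  assumes f: "(\<lambda>(\<sigma>, \<tau>). f \<sigma> \<tau>) \<in> borel_measurable (\<nu> \<Otimes>\<^sub>M \<nu>)" "\<And>\<sigma> \<tau>. \<sigma> \<in> space \<nu> \<Longrightarrow> \<tau> \<in> space \<nu> \<Longrightarrow> \<bar>f \<sigma> \<tau>\<bar> \<le> c"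
  shows "\<bar>gav2 f x\<bar> \<le> c"
  unfolding gav2_def
  by (auto intro!: meas_gav_param f gav_bound[where c = c] meas_section)

lemma gav_cong: "(\<And>\<sigma>. \<sigma> \<in> space \<nu> \<Longrightarrow> \<phi> \<sigma> = \<psi> \<sigma>) \<Longrightarrow> gav \<nu> J w \<phi> x = gav \<nu> J w \<psi> x"
  unfolding gav_def num_def by (simp cong: Bochner_Integration.integral_cong)

lemma gav2_sum:
  assumes "finite K"
    and f: "\<And>k. k \<in> K \<Longrightarrow> (\<lambda>(\<sigma>, \<tau>). f k \<sigma> \<tau>) \<in> borel_measurable (\<nu> \<Otimes>\<^sub>M \<nu>)" "\<And>k \<sigma> \<tau>. k \<in> K \<Longrightarrow> \<sigma> \<in> space \<nu> \<Longrightarrow> \<tau> \<in> space \<nu> \<Longrightarrow> \<bar>f k \<sigma> \<tau>\<bar> \<le> c"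
  shows "gav2 (\<lambda>\<sigma> \<tau>. \<Sum>k\<in>K. d k * f k \<sigma> \<tau>) x = (\<Sum>k\<in>K. d k * gav2 (f k) x)"
proof -
  have "gav2 (\<lambda>\<sigma> \<tau>. \<Sum>k\<in>K. d k * f k \<sigma> \<tau>) x = gav \<nu> J w (\<lambda>\<sigma>. \<Sum>k\<in>K. d k * gav \<nu> J w (f k \<sigma>) x) x"
    unfolding gav2_def
    by (rule gav_cong, rule gav_sum[symmetric, where c = c]) (auto intro!: meas_section f)
  also have "\<dots> = (\<Sum>k\<in>K. d k * gav2 (f k) x)"
    unfolding gav2_def
    by (rule gav_sum[symmetric, where c = c]) (auto intro!: meas_gav_param f gav_bound[where c = c] meas_section)
  finally show ?thesis .
qed

lemma gav_cmult: "gav \<nu> J w (\<lambda>\<sigma>. c * \<phi> \<sigma>) x = c * gav \<nu> J w \<phi> x"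
  unfolding gav_def num_def by (simp add: mult.assoc)

lemma gav2_product: "gav2 (\<lambda>\<sigma> \<tau>. \<phi> \<sigma> * \<psi> \<tau>) x = gav \<nu> J w \<phi> x * gav \<nu> J w \<psi> x"
  unfolding gav2_def gav_cmult using gav_cmult[of "gav \<nu> J w \<psi> x" \<phi>] by (simp add: mult.commute)

lemma gav2_const: "gav2 (\<lambda>_ _. c) x = c"
  unfolding gav2_def by (intro gav_const refl)

text \<open>Turns the second term of the flow into a two-replica average of a covariance, to which
  pointwise inequalities between configurations apply.\<close>

lemma sum_gav_sq_eq_gav2:
  "(\<Sum>j\<in>J. d j * (gav \<nu> J w (w j) x)\<^sup>2) = gav2 (\<lambda>\<sigma> \<tau>. \<Sum>j\<in>J. d j * (w j \<sigma> * w j \<tau>)) x"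
proof -
  have "gav2 (\<lambda>\<sigma> \<tau>. \<Sum>j\<in>J. d j * (w j \<sigma> * w j \<tau>)) x = (\<Sum>j\<in>J. d j * gav2 (\<lambda>\<sigma> \<tau>. w j \<sigma> * w j \<tau>) x)"
    by (rule gav2_sum[where c = "C * C"]) (auto simp: finite_J abs_mult intro!: mult_mono bound_w C_nonneg)
  then show ?thesis by (simp add: gav2_product power2_eq_square)
qed

lemma meas_pair_energy [measurable]: "(\<lambda>(x, \<sigma>). energy J w (scale u x) \<sigma>) \<in> borel_measurable (gauss J \<Otimes>\<^sub>M \<nu>)"
  unfolding energy_def scale_def by measurable

lemma integrable_pair_growth:
  assumes [measurable]: "(\<lambda>(x, \<sigma>). f x \<sigma>) \<in> borel_measurable (gauss J \<Otimes>\<^sub>M \<nu>)"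
    and b: "\<And>x \<sigma>. x \<in> space (gauss J) \<Longrightarrow> \<sigma> \<in> space \<nu> \<Longrightarrow> \<bar>f x \<sigma>\<bar> \<le> K * exp (D * l1 J x)"
  shows "integrable (gauss J \<Otimes>\<^sub>M \<nu>) (\<lambda>(x, \<sigma>). f x \<sigma> :: real)"
proof -
  interpret P: prob_space "gauss J" by (rule prob_space_gauss)
  interpret PP: pair_sigma_finite "gauss J" \<nu> ..
  have i: "integrable (gauss J) (\<lambda>x. exp (D * l1 J x))" using integrable_gauss_exp_abs[OF finite_J, of D] by (simp add: l1_def)
  have "integrable (gauss J \<Otimes>\<^sub>M \<nu>) (\<lambda>(x, \<sigma>). K * exp (D * l1 J x) * 1)"
  proof (rule PP.Fubini_integrable)
    show "integrable (gauss J) (\<lambda>x. LINT y|\<nu>. norm (case (x, y) of (x, \<sigma>) \<Rightarrow> K * exp (D * l1 J x) * 1))"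
      using i by (simp add: abs_mult)
  qed auto
  then show ?thesis
    by (rule Bochner_Integration.integrable_bound)
       (use b in \<open>auto simp: space_pair_measure intro!: AE_I2 order_trans[OF b] \<close>)
qed

end

text \<open>Convexity of exp, through its tangent at x + y + z. It separates three dependent
  fluctuations so that each is estimated alone; the factor 3 in the exponents becomes the 9 in the
  concentration error.\<close>

lemma exp_sum3_le: "exp (x + y + z) \<le> (exp (3 * x) + exp (3 * y) + exp (3 * z)) / (3::real)"
proof -
  define m where "m = x + y + z"
  have "exp m * (1 + (3 * t - m)) \<le> exp (3 * t)" for t
  proof -
    have "exp m * (1 + (3 * t - m)) \<le> exp m * exp (3 * t - m)" by (intro mult_left_mono exp_ge_add_one_self) auto
    then show ?thesis by (simp add: exp_add[symmetric])
  qed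
  from this[of x] this[of y] this[of z]
  have "exp m * (1 + (3 * x - m)) + exp m * (1 + (3 * y - m)) + exp m * (1 + (3 * z - m)) \<le> exp (3 * x) + exp (3 * y) + exp (3 * z)" by linarith
  moreover have "exp m * (1 + (3 * x - m)) + exp m * (1 + (3 * y - m)) + exp m * (1 + (3 * z - m)) = 3 * exp m"
    unfolding distrib_left[symmetric] by (simp add: m_def algebra_simps)
  ultimately show ?thesis unfolding m_def by simp
qed

text \<open>\<theta> is a symmetry of the reference measure that changes signs of the observables.
  \<open>B\<close> contains pairs for which applying \<theta> to the second replica lowers the
  covariance by at least \<kappa>. The bad pairs are those which the flip sends into
  \<open>B\<close>, and they are to be shown rare.\<close>

locale gibbs_flip = gibbs \<nu> J w C + prob_space \<nu> for \<nu> :: "'a measure" and J :: "'j set" and w C +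
  fixes u :: "'j \<Rightarrow> real" and V :: real and \<theta> :: "'a \<Rightarrow> 'a" and sg :: "'j \<Rightarrow> real" and B :: "('a \<times> 'a) set" and \<kappa> :: real
  assumes u_nonneg: "\<And>j. j \<in> J \<Longrightarrow> 0 \<le> u j"
    and V: "\<And>\<sigma>. \<sigma> \<in> space \<nu> \<Longrightarrow> (\<Sum>j\<in>J. u j * (w j \<sigma>)\<^sup>2) = V"
    and meas_\<theta> [measurable]: "\<theta> \<in> measurable \<nu> \<nu>"
    and distr_\<theta>: "distr \<nu> \<nu> \<theta> = \<nu>"
    and invol: "\<And>\<tau>. \<tau> \<in> space \<nu> \<Longrightarrow> \<theta> (\<theta> \<tau>) = \<tau>"
    and sign: "\<And>j. j \<in> J \<Longrightarrow> sg j = 1 \<or> sg j = -1"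
    and flip: "\<And>j \<tau>. j \<in> J \<Longrightarrow> \<tau> \<in> space \<nu> \<Longrightarrow> w j (\<theta> \<tau>) = sg j * w j \<tau>"
    and meas_B [measurable]: "B \<in> sets (\<nu> \<Otimes>\<^sub>M \<nu>)"
    and gap: "\<And>\<sigma> \<tau>. (\<sigma>, \<tau>) \<in> B \<Longrightarrow> (\<Sum>j\<in>J. u j * (w j \<sigma> * w j (\<theta> \<tau>))) \<le> (\<Sum>j\<in>J. u j * (w j \<sigma> * w j \<tau>)) - \<kappa>"
begin

text \<open>The covariance of the Gaussian energies of two configurations.\<close>

definition "\<Gamma> \<sigma> \<tau> = (\<Sum>j\<in>J. u j * (w j \<sigma> * w j \<tau>))"
definition "bad \<sigma> \<tau> = (indicator B (\<sigma>, \<theta> \<tau>) :: real)"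

lemma meas_bad [measurable]: "(\<lambda>(\<sigma>, \<tau>). bad \<sigma> \<tau>) \<in> borel_measurable (\<nu> \<Otimes>\<^sub>M \<nu>)"
  unfolding bad_def by measurable

lemma bad_bound: "0 \<le> bad \<sigma> \<tau>" "bad \<sigma> \<tau> \<le> 1" by (auto simp: bad_def indicator_def)

lemma \<Gamma>_bound: "\<sigma> \<in> space \<nu> \<Longrightarrow> \<tau> \<in> space \<nu> \<Longrightarrow> \<bar>\<Gamma> \<sigma> \<tau>\<bar> \<le> (\<Sum>j\<in>J. u j * (C * C))"
  unfolding \<Gamma>_def by (rule order_trans[OF sum_abs], rule sum_mono)
    (auto simp: abs_mult u_nonneg intro!: mult_mono bound_w C_nonneg)

text \<open>Given the planted point \<open>\<sigma>\<close>, reweighting by \<open>exp (\<Gamma> \<sigma>)\<close> is the effect on the Gibbs measure of the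
  Cameron-Martin shift along \<open>\<sigma>\<close>.\<close>

definition "planted \<sigma> f = density \<nu> (\<lambda>\<tau>. ennreal (f \<tau> * exp (\<Gamma> \<sigma> \<tau>)))"

context
  fixes \<sigma> assumes \<sigma>: "\<sigma> \<in> space \<nu>"
begin

lemma meas_\<Gamma>1 [measurable]: "\<Gamma> \<sigma> \<in> borel_measurable \<nu>"
  unfolding \<Gamma>_def by measurable

lemma integral_planted:
  assumes [measurable]: "f \<in> borel_measurable \<nu>" "g \<in> borel_measurable \<nu>" and f: "\<And>\<tau>. \<tau> \<in> space \<nu> \<Longrightarrow> 0 \<le> f \<tau>"
  shows "(LINT \<tau>|planted \<sigma> f. g \<tau>) = (LINT \<tau>|\<nu>. f \<tau> * exp (\<Gamma> \<sigma> \<tau>) * g \<tau> :: real)"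
  unfolding planted_def using f by (subst integral_density) (auto intro!: AE_I2)

lemma pf_planted:
  assumes [measurable]: "f \<in> borel_measurable \<nu>" and f: "\<And>\<tau>. \<tau> \<in> space \<nu> \<Longrightarrow> 0 \<le> f \<tau>"
  shows "pf (planted \<sigma> f) J w x = (LINT \<tau>|\<nu>. f \<tau> * exp (\<Gamma> \<sigma> \<tau> + energy J w x \<tau>))"
  unfolding pf_def by (subst integral_planted) (auto simp: f exp_add mult.assoc)

lemma integrable_planted:
  assumes [measurable]: "f \<in> borel_measurable \<nu>" and f: "\<And>\<tau>. \<tau> \<in> space \<nu> \<Longrightarrow> \<bar>f \<tau>\<bar> \<le> 1"
  shows "integrable \<nu> (\<lambda>\<tau>. f \<tau> * exp (\<Gamma> \<sigma> \<tau> + energy J w x \<tau>))"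
proof (rule integrable_bounded[where c = "1 * exp ((\<Sum>j\<in>J. u j * (C * C)) + C * l1 J x)"])
  fix \<tau> assume t: "\<tau> \<in> space \<nu>"
  show "\<bar>f \<tau> * exp (\<Gamma> \<sigma> \<tau> + energy J w x \<tau>)\<bar> \<le> 1 * exp ((\<Sum>j\<in>J. u j * (C * C)) + C * l1 J x)"
    unfolding abs_mult abs_exp_cancel using f[OF t] \<Gamma>_bound[OF \<sigma> t] energy_bound[OF t, of x]
    by (intro mult_mono) auto
qed measurable

text \<open>Positivity of the partition function for a single disorder \<open>x0\<close> is enough:
  the exponential weights never vanish, so a measure of mass 0 would have partition function 0 for
  every disorder.\<close>

lemma gibbs_planted:
  assumes [measurable]: "f \<in> borel_measurable \<nu>" and f: "\<And>\<tau>. \<tau> \<in> space \<nu> \<Longrightarrow> 0 \<le> f \<tau>" "\<And>\<tau>. \<tau> \<in> space \<nu> \<Longrightarrow> f \<tau> \<le> 1"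
    and pos: "0 < pf (planted \<sigma> f) J w x0"
  shows "gibbs (planted \<sigma> f) J w C"
proof -
  have b: "\<And>\<tau>. \<tau> \<in> space \<nu> \<Longrightarrow> \<bar>f \<tau>\<bar> \<le> 1" using f by auto
  have int: "integrable \<nu> (\<lambda>\<tau>. f \<tau> * exp (\<Gamma> \<sigma> \<tau>))"
    using integrable_planted[OF assms(1) b, of "\<lambda>_. 0"] by (simp add: energy_def)
  have em: "emeasure (planted \<sigma> f) (space \<nu>) = ennreal (LINT \<tau>|\<nu>. f \<tau> * exp (\<Gamma> \<sigma> \<tau>))"
    unfolding planted_def using f int
    by (subst emeasure_density) (auto simp: nn_integral_eq_integral intro!: AE_I2 nn_integral_cong simp flip: nn_integral_eq_integral)
  have fin: "finite_measure (planted \<sigma> f)"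
    by (rule finite_measureI) (simp add: em[unfolded planted_def] planted_def)
  have "0 < (LINT \<tau>|\<nu>. f \<tau> * exp (\<Gamma> \<sigma> \<tau>))"
  proof (rule ccontr)
    assume "\<not> 0 < (LINT \<tau>|\<nu>. f \<tau> * exp (\<Gamma> \<sigma> \<tau>))"
    moreover have "0 \<le> (LINT \<tau>|\<nu>. f \<tau> * exp (\<Gamma> \<sigma> \<tau>))" by (rule integral_nonneg_AE) (use f in \<open>auto intro!: AE_I2\<close>)
    ultimately have "(LINT \<tau>|\<nu>. f \<tau> * exp (\<Gamma> \<sigma> \<tau>)) = 0" by simp
    then have "AE \<tau> in \<nu>. f \<tau> * exp (\<Gamma> \<sigma> \<tau>) = 0"
      using integral_nonneg_eq_0_iff_AE[OF int] f by (auto intro!: AE_I2)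
    then have "(LINT \<tau>|\<nu>. f \<tau> * exp (\<Gamma> \<sigma> \<tau> + energy J w x0 \<tau>)) = (LINT \<tau>|\<nu>. 0)"
      by (intro integral_cong_AE) auto
    then show False using pos pf_planted[OF assms(1) f(1), of x0] by simp
  qed
  moreover have "measure (planted \<sigma> f) (space (planted \<sigma> f)) = (LINT \<tau>|\<nu>. f \<tau> * exp (\<Gamma> \<sigma> \<tau>))"
    using em calculation by (simp add: measure_def planted_def)
  ultimately show ?thesis
    using finite_J bound_w C_nonneg fin unfolding gibbs_def gibbs_axioms_def by (auto simp: planted_def)
qed

text \<open>The flip \<open>\<theta>\<close> maps the bad region onto \<open>B\<close>, preserves the law of the disorder and loses \<open>\<kappa>\<close> in the planted energy.\<close>

lemma pf_bad_le:
  "pf (planted \<sigma> (bad \<sigma>)) J w x \<le> exp (- \<kappa>) * pf (planted \<sigma> (\<lambda>\<tau>. indicator B (\<sigma>, \<tau>))) J w (\<lambda>j. sg j * x j)"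
proof -
  note [measurable] = meas_section[OF meas_bad \<sigma>]
  have mB[measurable]: "(\<lambda>\<tau>. indicator B (\<sigma>, \<tau>) :: real) \<in> borel_measurable \<nu>" using \<sigma> by measurable
  have "pf (planted \<sigma> (bad \<sigma>)) J w x = (LINT \<tau>|\<nu>. bad \<sigma> \<tau> * exp (\<Gamma> \<sigma> \<tau> + energy J w x \<tau>))"
    by (rule pf_planted) (auto simp: bad_bound)
  also have "\<dots> = (LINT \<tau>|distr \<nu> \<nu> \<theta>. bad \<sigma> \<tau> * exp (\<Gamma> \<sigma> \<tau> + energy J w x \<tau>))" by (simp add: distr_\<theta>)
  also have "\<dots> = (LINT \<tau>|\<nu>. bad \<sigma> (\<theta> \<tau>) * exp (\<Gamma> \<sigma> (\<theta> \<tau>) + energy J w x (\<theta> \<tau>)))"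
    by (rule integral_distr) measurable
  also have "\<dots> \<le> (LINT \<tau>|\<nu>. exp (- \<kappa>) * (indicator B (\<sigma>, \<tau>) * exp (\<Gamma> \<sigma> \<tau> + energy J w (\<lambda>j. sg j * x j) \<tau>)))"
  proof (rule integral_mono)
    have "integrable (distr \<nu> \<nu> \<theta>) (\<lambda>\<tau>. bad \<sigma> \<tau> * exp (\<Gamma> \<sigma> \<tau> + energy J w x \<tau>))"
      unfolding distr_\<theta> by (rule integrable_planted) (auto simp: bad_bound)
    then show "integrable \<nu> (\<lambda>\<tau>. bad \<sigma> (\<theta> \<tau>) * exp (\<Gamma> \<sigma> (\<theta> \<tau>) + energy J w x (\<theta> \<tau>)))"
      by (subst (asm) integrable_distr_eq) auto
    show "integrable \<nu> (\<lambda>\<tau>. exp (- \<kappa>) * (indicator B (\<sigma>, \<tau>) * exp (\<Gamma> \<sigma> \<tau> + energy J w (\<lambda>j. sg j * x j) \<tau>)))"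
      by (intro integrable_mult_right integrable_planted) auto
    fix \<tau> assume t: "\<tau> \<in> space \<nu>"
    have e: "energy J w x (\<theta> \<tau>) = energy J w (\<lambda>j. sg j * x j) \<tau>"
      unfolding energy_def by (intro sum.cong refl) (simp add: flip[OF _ t])
    show "bad \<sigma> (\<theta> \<tau>) * exp (\<Gamma> \<sigma> (\<theta> \<tau>) + energy J w x (\<theta> \<tau>))
       \<le> exp (- \<kappa>) * (indicator B (\<sigma>, \<tau>) * exp (\<Gamma> \<sigma> \<tau> + energy J w (\<lambda>j. sg j * x j) \<tau>))"
      unfolding bad_def invol[OF t] e
      using gap[of \<sigma> \<tau>] by (auto simp: indicator_def \<Gamma>_def exp_add[symmetric])
  qed
  also have "\<dots> = exp (- \<kappa>) * pf (planted \<sigma> (\<lambda>\<tau>. indicator B (\<sigma>, \<tau>))) J w (\<lambda>j. sg j * x j)"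
    by (subst pf_planted) auto
  finally show ?thesis .
qed

text \<open>Let A, B and Z be the planted partition functions of the bad pairs, of the pairs in
  \<open>B\<close>, and of all pairs. As A and B are at most Z, A Z^(-1-h) \<le> (A / B)^h Z^(-h),
  and E ln A \<le> E ln B - \<kappa>. Concentration replaces the logarithms by their means at the
  price of 9 h^2 V, and Jensen's inequality turns the mean of ln Z back into a moment. Using only
  the power h of A / B makes the error quadratic in h against a linear gain.\<close>

lemma planted_positivity:
  assumes h: "0 < h" "h \<le> 1"
  shows "(LINT x|gauss J. pf (planted \<sigma> (bad \<sigma>)) J w (scale u x) * exp (- (1 + h) * ln (pf (planted \<sigma> (\<lambda>_. 1)) J w (scale u x))))
    \<le> exp (- h * \<kappa> + 9 * h\<^sup>2 * V) * (LINT x|gauss J. exp (- h * ln (pf (planted \<sigma> (\<lambda>_. 1)) J w (scale u x))))"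
proof -
  note [measurable] = meas_section[OF meas_bad \<sigma>]
  have mB[measurable]: "(\<lambda>\<tau>. indicator B (\<sigma>, \<tau>) :: real) \<in> borel_measurable \<nu>" using \<sigma> by measurable
  let ?A = "pf (planted \<sigma> (bad \<sigma>)) J w" and ?B = "pf (planted \<sigma> (\<lambda>\<tau>. indicator B (\<sigma>, \<tau>))) J w" and ?Z = "pf (planted \<sigma> (\<lambda>_. 1)) J w"
  have pfs: "?A x = (LINT \<tau>|\<nu>. bad \<sigma> \<tau> * exp (\<Gamma> \<sigma> \<tau> + energy J w x \<tau>))"
    "?B x = (LINT \<tau>|\<nu>. indicator B (\<sigma>, \<tau>) * exp (\<Gamma> \<sigma> \<tau> + energy J w x \<tau>))"
    "?Z x = (LINT \<tau>|\<nu>. 1 * exp (\<Gamma> \<sigma> \<tau> + energy J w x \<tau>))" for x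
    by (rule pf_planted; auto simp: bad_bound)+
  have AZ: "?A x \<le> ?Z x" for x
    unfolding pfs by (intro integral_mono integrable_planted mult_right_mono) (auto simp: bad_bound)
  have BZ: "?B x \<le> ?Z x" for x
    unfolding pfs by (intro integral_mono integrable_planted mult_right_mono) (auto split: split_indicator)
  have A0: "0 \<le> ?A x" for x
    unfolding pfs by (intro integral_nonneg_AE AE_I2) (auto simp: bad_bound)
  interpret P: prob_space "gauss J" by (rule prob_space_gauss)
  have Zpos: "0 < ?Z (\<lambda>_. 0)"
  proof -
    have "(LINT \<tau>|\<nu>. exp (- (\<Sum>j\<in>J. u j * (C * C)))) \<le> ?Z (\<lambda>_. 0)"
      unfolding pfs using \<Gamma>_bound[OF \<sigma>]
      by (intro integral_mono integrable_planted) (auto simp: energy_def abs_le_iff minus_le_iff)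
    then show ?thesis using exp_gt_zero[of "- (\<Sum>j\<in>J. u j * (C * C))"] by (simp add: prob_space del: exp_gt_zero)
  qed
  interpret gZ: gibbs "planted \<sigma> (\<lambda>_. 1)" J w C by (rule gibbs_planted[OF _ _ _ Zpos]) auto
  have sp: "space (planted \<sigma> f) = space \<nu>" for f by (simp add: planted_def)
  show ?thesis
  \<comment> \<open>If the bad part vanishes for every disorder, it has no meaningful logarithm, but
    then the left side is 0.\<close>
  proof (cases "\<exists>x. 0 < ?A x")
    case False
    then have "?A x = 0" for x using A0[of x] by (metis less_eq_real_def)
    then have "(LINT x|gauss J. ?A (scale u x) * exp (- (1 + h) * ln (?Z (scale u x)))) = 0" by simp
    also have "0 \<le> exp (- h * \<kappa> + 9 * h\<^sup>2 * V) * (LINT x|gauss J. exp (- h * ln (?Z (scale u x))))"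
      by (intro mult_nonneg_nonneg integral_nonneg_AE) auto
    finally show ?thesis .
  next
    case True
    then obtain x0 where x0: "0 < ?A x0" by blast
    have x1: "0 < ?B (\<lambda>j. sg j * x0 j)"
      using less_le_trans[OF x0 pf_bad_le[of x0]] by (simp add: zero_less_mult_iff)
    interpret gA: gibbs "planted \<sigma> (bad \<sigma>)" J w C by (rule gibbs_planted[OF _ _ _ x0]) (auto simp: bad_bound)
    interpret gB: gibbs "planted \<sigma> (\<lambda>\<tau>. indicator B (\<sigma>, \<tau>))" J w C by (rule gibbs_planted[OF _ _ _ x1]) auto
    define mA mB mZ where "mA = (LINT x|gauss J. ln (?A (scale u x)))" and "mB = (LINT x|gauss J. ln (?B (scale u x)))" and "mZ = (LINT x|gauss J. ln (?Z (scale u x)))"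
    \<comment> \<open>\<open>pf_bad_le\<close> compares A and B at disorders that differ by signs,
      which is invisible in the mean since the Gaussian law is symmetric.\<close>
    have mAB: "mA \<le> mB - \<kappa>"
    proof -
      have "mA \<le> (LINT x|gauss J. ln (?B (scale u (\<lambda>j\<in>J. sg j * x j))) - \<kappa>)"
        unfolding mA_def
      proof (rule integral_mono)
        have "integrable (distr (gauss J) (gauss J) (\<lambda>x. \<lambda>j\<in>J. sg j * x j)) (\<lambda>x. ln (?B (scale u x)))"
          using gB.integrable_ln_pf by (subst gauss_sign_invariant) (auto simp: finite_J sign)
        then have "integrable (gauss J) (\<lambda>x. ln (?B (scale u (\<lambda>j\<in>J. sg j * x j))))"
          by (subst (asm) integrable_distr_eq) (auto simp: gB.meas_Z_scale)
        then show "integrable (gauss J) (\<lambda>x. ln (?B (scale u (\<lambda>j\<in>J. sg j * x j))) - \<kappa>)" by simp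
        fix x
        have "?B (\<lambda>j. sg j * scale u x j) = ?B (scale u (\<lambda>j\<in>J. sg j * x j))"
          by (rule pf_cong) (simp add: scale_def)
        then have "ln (?A (scale u x)) \<le> ln (exp (- \<kappa>) * ?B (scale u (\<lambda>j\<in>J. sg j * x j)))"
          using pf_bad_le[of "scale u x"] gA.pf_pos by (subst ln_le_cancel_iff) (auto simp: gB.pf_pos)
        also have "\<dots> = ln (?B (scale u (\<lambda>j\<in>J. sg j * x j))) - \<kappa>"
          using gB.pf_pos[of "scale u (\<lambda>j\<in>J. sg j * x j)"] by (simp add: ln_mult)
        finally show "ln (?A (scale u x)) \<le> ln (?B (scale u (\<lambda>j\<in>J. sg j * x j))) - \<kappa>" .
      qed (rule gA.integrable_ln_pf)
      also have "\<dots> = mB - \<kappa>"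
      proof -
        have "mB = (LINT x|distr (gauss J) (gauss J) (\<lambda>x. \<lambda>j\<in>J. sg j * x j). ln (?B (scale u x)))"
          unfolding mB_def by (subst gauss_sign_invariant) (auto simp: finite_J sign)
        also have "\<dots> = (LINT x|gauss J. ln (?B (scale u (\<lambda>j\<in>J. sg j * x j))))"
          by (rule integral_distr) (auto simp: gB.meas_Z_scale)
        finally have e: "mB = (LINT x|gauss J. ln (?B (scale u (\<lambda>j\<in>J. sg j * x j))))" .
        have "integrable (distr (gauss J) (gauss J) (\<lambda>x. \<lambda>j\<in>J. sg j * x j)) (\<lambda>x. ln (?B (scale u x)))"
          using gB.integrable_ln_pf by (subst gauss_sign_invariant) (auto simp: finite_J sign)
        then have "integrable (gauss J) (\<lambda>x. ln (?B (scale u (\<lambda>j\<in>J. sg j * x j))))"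
          by (subst (asm) integrable_distr_eq) (auto simp: gB.meas_Z_scale)
        then show ?thesis unfolding e by (simp add: P.prob_space)
      qed
      finally show ?thesis .
    qed
    have conc: "gibbs.pm \<mu> J w a u \<le> exp (a\<^sup>2 * V + a * (LINT x|gauss J. ln (pf \<mu> J w (scale u x))))"
      if g: "gibbs \<mu> J w C" and s: "space \<mu> = space \<nu>" for \<mu> a
      by (rule gibbs.pm_concentration[OF g]) (auto simp: u_nonneg s V)
    have cA: "(LINT x|gauss J. exp (3 * h * ln (?A (scale u x)))) \<le> exp (9 * h\<^sup>2 * V + 3 * h * mA)"
      using conc[OF gA.gibbs_axioms sp, of "3 * h"] by (simp add: gA.pm_def mA_def power_mult_distrib)
    have cB: "(LINT x|gauss J. exp (- 3 * h * ln (?B (scale u x)))) \<le> exp (9 * h\<^sup>2 * V - 3 * h * mB)"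
      using conc[OF gB.gibbs_axioms sp, of "- 3 * h"] by (simp add: gB.pm_def mB_def power_mult_distrib)
    have cZ: "(LINT x|gauss J. exp (- 3 * h * ln (?Z (scale u x)))) \<le> exp (9 * h\<^sup>2 * V - 3 * h * mZ)"
      using conc[OF gZ.gibbs_axioms sp, of "- 3 * h"] by (simp add: gZ.pm_def mZ_def power_mult_distrib)
    let ?e = "exp (h * (mA - mB - mZ))"
    let ?r = "\<lambda>x. ?e / 3 * (exp (- 3 * h * mA) * exp (3 * h * ln (?A (scale u x))) + exp (3 * h * mB) * exp (- 3 * h * ln (?B (scale u x))) + exp (3 * h * mZ) * exp (- 3 * h * ln (?Z (scale u x))))"
    have iA: "integrable (gauss J) (\<lambda>x. exp (3 * h * ln (?A (scale u x))))" by (rule gA.integrable_pm)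
    have iB: "integrable (gauss J) (\<lambda>x. exp (- 3 * h * ln (?B (scale u x))))" by (rule gB.integrable_pm)
    have iZ: "integrable (gauss J) (\<lambda>x. exp (- 3 * h * ln (?Z (scale u x))))" by (rule gZ.integrable_pm)
    have ir: "integrable (gauss J) ?r"
      by (intro integrable_mult_right Bochner_Integration.integrable_add iA iB iZ)
    have le: "?A (scale u x) * exp (- (1 + h) * ln (?Z (scale u x))) \<le> ?r x" for x
    proof -
      let ?a = "ln (?A (scale u x))" and ?b = "ln (?B (scale u x))" and ?z = "ln (?Z (scale u x))"
      have az: "?a \<le> ?z" using AZ gA.pf_pos gZ.pf_pos by (subst ln_le_cancel_iff) auto
      have bz: "?b \<le> ?z" using BZ gB.pf_pos gZ.pf_pos by (subst ln_le_cancel_iff) auto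
      have "?A (scale u x) * exp (- (1 + h) * ?z) = exp (?a - (1 + h) * ?z)"
        using gA.pf_pos[of "scale u x"] by (simp add: exp_diff exp_minus exp_add field_simps)
      also have "\<dots> \<le> exp (h * ?a - h * ?b - h * ?z)"
      proof -
        have "(1 - h) * ?a \<le> (1 - h) * ?z" using az h by (intro mult_left_mono) auto
        moreover have "h * ?b \<le> h * ?z" using bz h by (intro mult_left_mono) auto
        ultimately show ?thesis by (simp add: algebra_simps)
      qed
      also have "\<dots> = ?e * exp (h * (?a - mA) + - h * (?b - mB) + - h * (?z - mZ))"
        by (simp add: exp_add[symmetric] algebra_simps)
      also have "\<dots> \<le> ?e * ((exp (3 * (h * (?a - mA))) + exp (3 * (- h * (?b - mB))) + exp (3 * (- h * (?z - mZ)))) / 3)"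
        by (intro mult_left_mono exp_sum3_le) auto
      also have "\<dots> = ?r x" by (simp add: exp_add[symmetric] algebra_simps)
      finally show ?thesis .
    qed
    have "(LINT x|gauss J. ?A (scale u x) * exp (- (1 + h) * ln (?Z (scale u x)))) \<le> (LINT x|gauss J. ?r x)"
    proof (rule integral_mono[OF _ ir])
      show "integrable (gauss J) (\<lambda>x. ?A (scale u x) * exp (- (1 + h) * ln (?Z (scale u x))))"
        by (rule Bochner_Integration.integrable_bound[OF ir])
           (use le A0 in \<open>auto simp: gA.meas_Z_scale gZ.meas_Z_scale abs_mult intro!: AE_I2 order_trans[OF le abs_ge_self]\<close>)
    qed (rule le)
    also have "\<dots> = ?e / 3 * (exp (- 3 * h * mA) * (LINT x|gauss J. exp (3 * h * ln (?A (scale u x)))) + exp (3 * h * mB) * (LINT x|gauss J. exp (- 3 * h * ln (?B (scale u x)))) + exp (3 * h * mZ) * (LINT x|gauss J. exp (- 3 * h * ln (?Z (scale u x)))))"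
      using iA iB iZ by simp
    also have "\<dots> \<le> ?e / 3 * (exp (- 3 * h * mA) * exp (9 * h\<^sup>2 * V + 3 * h * mA) + exp (3 * h * mB) * exp (9 * h\<^sup>2 * V - 3 * h * mB) + exp (3 * h * mZ) * exp (9 * h\<^sup>2 * V - 3 * h * mZ))"
      by (intro mult_left_mono add_mono cA cB cZ) auto
    also have "\<dots> = ?e * exp (9 * h\<^sup>2 * V)" by (simp add: exp_add[symmetric])
    also have "\<dots> \<le> exp (- h * \<kappa> + 9 * h\<^sup>2 * V) * exp (- h * mZ)"
      using mult_left_mono[OF mAB, of h] h by (simp add: exp_add[symmetric] algebra_simps)
    also have "\<dots> \<le> exp (- h * \<kappa> + 9 * h\<^sup>2 * V) * (LINT x|gauss J. exp (- h * ln (?Z (scale u x))))"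
      using gZ.exp_mean_le_pm[of "- h" u] by (intro mult_left_mono) (auto simp: gZ.pm_def mZ_def)
    finally show ?thesis .
  qed
qed

end

text \<open>The weight exp of the energy at \<sigma> is a Cameron-Martin density: it shifts the
  couplings by their covariances with that energy. The congruence assumption on \<Phi> is there
  because the shift formula produces a vector restricted to \<open>J\<close>.\<close>

lemma planted_shift:
  fixes \<Phi> :: "('j \<Rightarrow> real) \<Rightarrow> real"
  assumes \<sigma>: "\<sigma> \<in> space \<nu>" and m: "(\<lambda>x. \<Phi> (scale u x)) \<in> borel_measurable (gauss J)"
    and cong: "\<And>x y. (\<And>j. j \<in> J \<Longrightarrow> x j = y j) \<Longrightarrow> \<Phi> x = \<Phi> y"
  shows "(LINT x|gauss J. exp (energy J w (scale u x) \<sigma>) * \<Phi> (scale u x)) =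
     exp (V / 2) * (LINT x|gauss J. \<Phi> (\<lambda>j. scale u x j + u j * w j \<sigma>))"
proof -
  have e: "(\<Sum>j\<in>J. sqrt (u j) * w j \<sigma> * x j) = energy J w (scale u x) \<sigma>" for x
    unfolding energy_def scale_def by (intro sum.cong refl) simp
  have v: "(\<Sum>j\<in>J. (sqrt (u j) * w j \<sigma>)\<^sup>2) = V"
    unfolding V[OF \<sigma>, symmetric] by (intro sum.cong refl) (simp add: power_mult_distrib u_nonneg)
  have c: "\<Phi> (scale u (\<lambda>j\<in>J. x j + sqrt (u j) * w j \<sigma>)) = \<Phi> (\<lambda>j. scale u x j + u j * w j \<sigma>)" for x
    by (rule cong) (simp add: scale_def algebra_simps u_nonneg flip: mult.assoc)
  show ?thesis using integral_gauss_shift[OF finite_J m, of "\<lambda>j. sqrt (u j) * w j \<sigma>"] by (simp only: e v c)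
qed

lemma energy_planted_shift:
  "energy J w (\<lambda>j. x j + u j * w j \<sigma>) \<tau> = \<Gamma> \<sigma> \<tau> + energy J w x \<tau>"
  unfolding energy_def \<Gamma>_def by (simp add: algebra_simps sum.distrib)

lemma Z_scale_growth:
  "\<exists>K D. \<forall>x. \<forall>\<sigma>\<in>space \<nu>. exp (energy J w (scale u x) \<sigma>) * exp (- h * ln (Z (scale u x))) \<le> K * exp (D * l1 J x)"
proof -
  define U where "U = l1 J (\<lambda>j. sqrt (u j))"
  have U: "l1 J (scale u x) \<le> U * l1 J x" for x
    by (rule l1_scale_le) (use abs_le_l1[OF finite_J, of _ "\<lambda>j. sqrt (u j)"] in \<open>simp add: U_def\<close>)
  have "exp (energy J w (scale u x) \<sigma>) * exp (- h * ln (Z (scale u x))) \<le> exp (\<bar>h\<bar> * \<bar>ln mass\<bar>) * exp (((1 + \<bar>h\<bar>) * C * U) * l1 J x)"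
    if s: "\<sigma> \<in> space \<nu>" for x \<sigma>
  proof -
    have "- h * ln (Z (scale u x)) \<le> \<bar>h\<bar> * \<bar>ln (Z (scale u x))\<bar>" by (simp add: abs_mult[symmetric])
    also have "\<dots> \<le> \<bar>h\<bar> * (\<bar>ln mass\<bar> + C * l1 J (scale u x))" by (intro mult_left_mono ln_pf_bound) auto
    finally have 1: "energy J w (scale u x) \<sigma> + - h * ln (Z (scale u x)) \<le> \<bar>h\<bar> * \<bar>ln mass\<bar> + (1 + \<bar>h\<bar>) * C * l1 J (scale u x)"
      using energy_bound[OF s, of "scale u x"] by (simp add: algebra_simps)
    have 2: "(1 + \<bar>h\<bar>) * C * l1 J (scale u x) \<le> (1 + \<bar>h\<bar>) * C * (U * l1 J x)"
      using U C_nonneg by (intro mult_left_mono) auto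
    show ?thesis unfolding exp_add[symmetric] using 1 2 by (simp add: mult.assoc)
  qed
  then show ?thesis by blast
qed

text \<open>Z^(1-h) times the two-replica average is the integral over the first replica \<sigma> of
  exp(energy at \<sigma>) \<open>num\<close> Z^(-1-h), which is \<open>f1\<close>. Replacing the
  indicator of bad pairs by 1 gives \<open>f2\<close>, whose integral is Z^(1-h). After exchanging
  integrals, planting \<sigma> turns the comparison of \<open>f1\<close> with \<open>f2\<close> into
  \<open>planted_positivity\<close>.\<close>

theorem gav2_bad_le:
  assumes h: "0 < h" "h \<le> 1"
  shows "(LINT x|gauss J. exp ((1 - h) * ln (Z (scale u x))) * gav2 bad (scale u x)) \<le> exp (- h * \<kappa> + 9 * h\<^sup>2 * V) * pm (1 - h) u"
proof -
  interpret P: prob_space "gauss J" by (rule prob_space_gauss)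
  interpret PP: pair_sigma_finite "gauss J" \<nu> ..
  let ?E = "\<lambda>x \<sigma>. exp (energy J w (scale u x) \<sigma>)"
  let ?q = "exp (- h * \<kappa> + 9 * h\<^sup>2 * V)"
  define f1 where "f1 x \<sigma> = ?E x \<sigma> * (num \<nu> J w (bad \<sigma>) (scale u x) * exp (- (1 + h) * ln (Z (scale u x))))" for x \<sigma>
  define f2 where "f2 x \<sigma> = ?E x \<sigma> * exp (- h * ln (Z (scale u x)))" for x \<sigma>
  obtain K D where KD: "\<And>x \<sigma>. \<sigma> \<in> space \<nu> \<Longrightarrow> f2 x \<sigma> \<le> K * exp (D * l1 J x)"
    using Z_scale_growth[of h] unfolding f2_def by blast
  have bad0: "0 \<le> num \<nu> J w (bad \<sigma>) x" for x \<sigma> unfolding num_def by (intro integral_nonneg_AE AE_I2) (simp add: bad_bound)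
  have badZ: "num \<nu> J w (bad \<sigma>) x \<le> Z x" if "\<sigma> \<in> space \<nu>" for x \<sigma>
    using num_bound[OF meas_section[OF meas_bad that], of 1 x] bad_bound bad0[of \<sigma> x] by simp
  have f12: "\<bar>f1 x \<sigma>\<bar> \<le> f2 x \<sigma>" if s: "\<sigma> \<in> space \<nu>" for x \<sigma>
  proof -
    have "num \<nu> J w (bad \<sigma>) (scale u x) * exp (- (1 + h) * ln (Z (scale u x))) \<le> Z (scale u x) * exp (- (1 + h) * ln (Z (scale u x)))"
      by (intro mult_right_mono badZ s) auto
    also have "\<dots> = exp (- h * ln (Z (scale u x)))"
    proof -
      have "Z (scale u x) * exp (- (1 + h) * ln (Z (scale u x))) = exp (ln (Z (scale u x))) * exp (- (1 + h) * ln (Z (scale u x)))"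
        by (simp add: pf_pos)
      then show ?thesis by (simp only: exp_add[symmetric]) (simp add: algebra_simps)
    qed
    finally show ?thesis unfolding f1_def f2_def using bad0 by (simp add: abs_mult mult_left_mono)
  qed
  have meas_num[measurable]: "(\<lambda>(x, \<sigma>). num \<nu> J w (bad \<sigma>) (scale u x)) \<in> borel_measurable (gauss J \<Otimes>\<^sub>M \<nu>)"
    unfolding num_def energy_def scale_def by measurable
  have [measurable]: "(\<lambda>(x, \<sigma>). f1 x \<sigma>) \<in> borel_measurable (gauss J \<Otimes>\<^sub>M \<nu>)" "(\<lambda>(x, \<sigma>). f2 x \<sigma>) \<in> borel_measurable (gauss J \<Otimes>\<^sub>M \<nu>)"
    unfolding f1_def f2_def by measurable
  have i2: "integrable (gauss J \<Otimes>\<^sub>M \<nu>) (\<lambda>(x, \<sigma>). f2 x \<sigma>)"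
  proof (rule integrable_pair_growth[where K = K and D = D])
    fix x \<sigma> assume "\<sigma> \<in> space \<nu>"
    moreover have "0 \<le> f2 x \<sigma>" by (simp add: f2_def)
    ultimately show "\<bar>f2 x \<sigma>\<bar> \<le> K * exp (D * l1 J x)" using KD by simp
  qed measurable
  have i1: "integrable (gauss J \<Otimes>\<^sub>M \<nu>) (\<lambda>(x, \<sigma>). f1 x \<sigma>)"
    by (rule integrable_pair_growth[where K = K and D = D]) (auto intro: order_trans[OF f12 KD])
  have per: "(LINT x|gauss J. f1 x \<sigma>) \<le> ?q * (LINT x|gauss J. f2 x \<sigma>)" if s: "\<sigma> \<in> space \<nu>" for \<sigma>
  proof -
    note [measurable] = meas_section[OF meas_bad s]
    have sZ: "Z (\<lambda>j. x j + u j * w j \<sigma>) = pf (planted \<sigma> (\<lambda>_. 1)) J w x" for x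
    proof -
      have "pf (planted \<sigma> (\<lambda>_. 1)) J w x = (LINT \<tau>|\<nu>. 1 * exp (\<Gamma> \<sigma> \<tau> + energy J w x \<tau>))"
        by (rule pf_planted[OF s]) auto
      then show ?thesis by (simp add: pf_def[of \<nu>] energy_planted_shift)
    qed
    have sA: "num \<nu> J w (bad \<sigma>) (\<lambda>j. x j + u j * w j \<sigma>) = pf (planted \<sigma> (bad \<sigma>)) J w x" for x
      unfolding num_def energy_planted_shift by (rule pf_planted[OF s, symmetric]) (auto simp: bad_bound)
    have [measurable]: "(\<lambda>x. num \<nu> J w (bad \<sigma>) (scale u x)) \<in> borel_measurable (gauss J)"
      by (rule borel_measurable_num) (auto simp: scale_def)
    have c: "num \<nu> J w (bad \<sigma>) x = num \<nu> J w (bad \<sigma>) y" "Z x = Z y" if "\<And>j. j \<in> J \<Longrightarrow> x j = y j" for x y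
      using energy_cong[of J x y w] that by (auto simp: num_def pf_def)
    have "(LINT x|gauss J. f1 x \<sigma>) = exp (V / 2) * (LINT x|gauss J. num \<nu> J w (bad \<sigma>) (\<lambda>j. scale u x j + u j * w j \<sigma>) * exp (- (1 + h) * ln (Z (\<lambda>j. scale u x j + u j * w j \<sigma>))))"
      unfolding f1_def
    proof (rule planted_shift[OF s, where \<Phi> = "\<lambda>x. num \<nu> J w (bad \<sigma>) x * exp (- (1 + h) * ln (Z x))"])
      fix x y :: "'j \<Rightarrow> real" assume "\<And>j. j \<in> J \<Longrightarrow> x j = y j"
      from c[OF this] show "num \<nu> J w (bad \<sigma>) x * exp (- (1 + h) * ln (Z x)) = num \<nu> J w (bad \<sigma>) y * exp (- (1 + h) * ln (Z y))" by simp
    qed measurable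
    also have "\<dots> \<le> exp (V / 2) * (?q * (LINT x|gauss J. exp (- h * ln (Z (\<lambda>j. scale u x j + u j * w j \<sigma>)))))"
      unfolding sZ sA by (intro mult_left_mono planted_positivity s h) auto
    also have "\<dots> = ?q * (LINT x|gauss J. f2 x \<sigma>)"
    proof -
      have "(LINT x|gauss J. f2 x \<sigma>) = exp (V / 2) * (LINT x|gauss J. exp (- h * ln (Z (\<lambda>j. scale u x j + u j * w j \<sigma>))))"
        unfolding f2_def
      proof (rule planted_shift[OF s, where \<Phi> = "\<lambda>x. exp (- h * ln (Z x))"])
        fix x y :: "'j \<Rightarrow> real" assume "\<And>j. j \<in> J \<Longrightarrow> x j = y j"
        from c(2)[OF this] show "exp (- h * ln (Z x)) = exp (- h * ln (Z y))" by simp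
      qed measurable
      then show ?thesis by simp
    qed
    finally show ?thesis .
  qed
  have e1: "(LINT \<sigma>|\<nu>. f1 x \<sigma>) = exp ((1 - h) * ln (Z (scale u x))) * gav2 bad (scale u x)" for x
  proof -
    have z: "exp (- (1 + h) * ln (Z (scale u x))) = exp ((1 - h) * ln (Z (scale u x))) / Z (scale u x) / Z (scale u x)"
    proof -
      have "exp ((1 - h) * ln (Z (scale u x))) / Z (scale u x) / Z (scale u x) = exp ((1 - h) * ln (Z (scale u x))) / exp (ln (Z (scale u x))) / exp (ln (Z (scale u x)))"
        by (simp add: pf_pos)
      then show ?thesis by (simp only: exp_diff[symmetric]) (simp add: algebra_simps)
    qed
    have "(LINT \<sigma>|\<nu>. f1 x \<sigma>) = (LINT \<sigma>|\<nu>. exp ((1 - h) * ln (Z (scale u x))) / Z (scale u x) * (gav \<nu> J w (bad \<sigma>) (scale u x) * ?E x \<sigma>))"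
      unfolding f1_def z gav_def by (intro Bochner_Integration.integral_cong refl) simp
    then show ?thesis by (simp add: gav2_def gav_def num_def)
  qed
  have e2: "(LINT \<sigma>|\<nu>. f2 x \<sigma>) = exp ((1 - h) * ln (Z (scale u x)))" for x
  proof -
    have "(LINT \<sigma>|\<nu>. f2 x \<sigma>) = Z (scale u x) * exp (- h * ln (Z (scale u x)))"
      unfolding f2_def pf_def by simp
    also have "\<dots> = exp (ln (Z (scale u x))) * exp (- h * ln (Z (scale u x)))" by (simp add: pf_pos)
    finally show ?thesis by (simp only: exp_add[symmetric]) (simp add: algebra_simps)
  qed
  have "(LINT x|gauss J. exp ((1 - h) * ln (Z (scale u x))) * gav2 bad (scale u x)) = (LINT \<sigma>|\<nu>. LINT x|gauss J. f1 x \<sigma>)"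
    unfolding e1[symmetric] by (rule PP.Fubini_integral[symmetric]) (rule i1)
  also have "\<dots> \<le> (LINT \<sigma>|\<nu>. ?q * (LINT x|gauss J. f2 x \<sigma>))"
    using PP.integrable_snd[OF i1] PP.integrable_snd[OF i2] per by (intro integral_mono) auto
  also have "\<dots> = ?q * (LINT \<sigma>|\<nu>. LINT x|gauss J. f2 x \<sigma>)" by simp
  also have "(LINT \<sigma>|\<nu>. LINT x|gauss J. f2 x \<sigma>) = pm (1 - h) u"
    unfolding pm_def e2[symmetric] by (rule PP.Fubini_integral) (rule i2)
  finally show ?thesis .
qed

end

text \<open>The covariance difference need not be small everywhere: pairs violating the bound
  \<open>e0\<close> are charged to the flips in \<open>E\<close>, and each flip has weight at most
  \<open>exp (- h * \<kappa> + 9 * h\<^sup>2 * Vm)\<close> under the moment of order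
  \<open>1 - h\<close>. The self-covariance moves with t, hence the common bound
  \<open>Vm\<close>.\<close>

theorem (in gibbs) flow_with_flips:
  assumes pr: "prob_space \<nu>"
    and u: "\<And>j. j \<in> J \<Longrightarrow> 0 \<le> u0 j" "\<And>j. j \<in> J \<Longrightarrow> 0 \<le> u1 j"
    and V: "\<And>\<sigma>. \<sigma> \<in> space \<nu> \<Longrightarrow> (\<Sum>j\<in>J. u0 j * (w j \<sigma>)\<^sup>2) = V0" "\<And>\<sigma>. \<sigma> \<in> space \<nu> \<Longrightarrow> (\<Sum>j\<in>J. u1 j * (w j \<sigma>)\<^sup>2) = V1"
    and Vm: "V0 \<le> Vm" "V1 \<le> Vm"
    and h: "0 < h" "h \<le> 1"
    and E: "finite E"
    and flips: "\<And>e t. e \<in> E \<Longrightarrow> 0 < t \<Longrightarrow> t < 1 \<Longrightarrow>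
        gibbs_flip \<nu> J w C (mix u0 u1 t) ((1 - t) * V0 + t * V1) (\<theta> e) (sg e) (B e) \<kappa>"
    and G: "0 \<le> G"
    and ptw: "\<And>\<sigma> \<tau>. \<sigma> \<in> space \<nu> \<Longrightarrow> \<tau> \<in> space \<nu> \<Longrightarrow>
        (\<Sum>j\<in>J. (u1 j - u0 j) * (w j \<sigma> * w j \<tau>)) \<le> e0 + G * (\<Sum>e\<in>E. indicator (B e) (\<sigma>, \<theta> e \<tau>))"
  shows "pm (1 - h) u0 * exp ((1 - h) * (V1 - V0) / 2 - (1 - h) * h / 2 * (e0 + G * (card E * exp (- h * \<kappa> + 9 * h\<^sup>2 * Vm)))) \<le> pm (1 - h) u1"
proof -
  let ?a = "1 - h" and ?q = "exp (- h * \<kappa> + 9 * h\<^sup>2 * Vm)"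
  have "pm ?a u0 * exp (?a * (V1 - V0) / 2 - ?a * (1 - ?a) / 2 * (e0 + G * (card E * ?q))) \<le> pm ?a u1"
  proof (rule flow_inequality[OF u V])
    fix t :: real assume t: "0 < t" "t < 1"
    let ?u = "mix u0 u1 t" and ?Vt = "(1 - t) * V0 + t * V1"
    let ?ind = "\<lambda>e \<sigma> \<tau>. indicator (B e) (\<sigma>, \<theta> e \<tau>) :: real"
    let ?D = "\<lambda>\<sigma> \<tau>. \<Sum>j\<in>J. (u1 j - u0 j) * (w j \<sigma> * w j \<tau>)"
    have Vt: "?Vt \<le> Vm"
    proof -
      have "?Vt \<le> (1 - t) * Vm + t * Vm" using t Vm by (intro add_mono mult_left_mono) auto
      then show ?thesis by (simp add: algebra_simps)
    qed
    have mind: "(\<lambda>(\<sigma>, \<tau>). ?ind e \<sigma> \<tau>) \<in> borel_measurable (\<nu> \<Otimes>\<^sub>M \<nu>)" if "e \<in> E" for e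
    proof -
      interpret gf: gibbs_flip \<nu> J w C ?u ?Vt "\<theta> e" "sg e" "B e" \<kappa> by (rule flips[OF that t])
      show ?thesis using gf.meas_bad by (simp add: gf.bad_def[abs_def])
    qed
    have bind: "\<bar>?ind e \<sigma> \<tau>\<bar> \<le> 1" for e \<sigma> \<tau> by (simp add: indicator_def)
    have each: "(LINT x|gauss J. exp (?a * ln (Z (scale ?u x))) * gav2 (?ind e) (scale ?u x)) \<le> ?q * pm ?a ?u"
      if e: "e \<in> E" for e
    proof -
      interpret gf: gibbs_flip \<nu> J w C ?u ?Vt "\<theta> e" "sg e" "B e" \<kappa> by (rule flips[OF e t])
      have "gf.bad = ?ind e" by (simp add: gf.bad_def fun_eq_iff)
      then have "(LINT x|gauss J. exp (?a * ln (Z (scale ?u x))) * gav2 (?ind e) (scale ?u x)) \<le> exp (- h * \<kappa> + 9 * h\<^sup>2 * ?Vt) * pm ?a ?u"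
        using gf.gav2_bad_le[OF h] by simp
      also have "\<dots> \<le> ?q * pm ?a ?u"
        using Vt pm_pos[of ?a ?u] by (intro mult_right_mono) (auto intro!: mult_left_mono)
      finally show ?thesis .
    qed
    interpret g2: gibbs2 \<nu> \<nu> J w w C ?a 0 by (rule gibbs2_self)
    have meas_gav2: "(\<lambda>x. gav2 f (scale ?u x)) \<in> borel_measurable (gauss J)"
      if [measurable]: "(\<lambda>(\<sigma>, \<tau>). f \<sigma> \<tau>) \<in> borel_measurable (\<nu> \<Otimes>\<^sub>M \<nu>)" for f
      unfolding gav2_def gav_def num_def pf_def energy_def scale_def by measurable
    have int: "integrable (gauss J) (\<lambda>x. exp (?a * ln (Z (scale ?u x))) * gav2 f (scale ?u x))"
      if "(\<lambda>(\<sigma>, \<tau>). f \<sigma> \<tau>) \<in> borel_measurable (\<nu> \<Otimes>\<^sub>M \<nu>)" "\<And>\<sigma> \<tau>. \<sigma> \<in> space \<nu> \<Longrightarrow> \<tau> \<in> space \<nu> \<Longrightarrow> \<bar>f \<sigma> \<tau>\<bar> \<le> c" for f c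
      using g2.integrable_F_scale_mult[OF meas_gav2[OF that(1)] gav2_bound[OF that], of ?u] by (simp add: g2.F_def)
    have D1: "(\<lambda>(\<sigma>, \<tau>). ?D \<sigma> \<tau>) \<in> borel_measurable (\<nu> \<Otimes>\<^sub>M \<nu>)" by measurable
    have D2: "\<bar>?D \<sigma> \<tau>\<bar> \<le> (\<Sum>j\<in>J. \<bar>u1 j - u0 j\<bar> * (C * C))" if "\<sigma> \<in> space \<nu>" "\<tau> \<in> space \<nu>" for \<sigma> \<tau>
      using that by (intro order_trans[OF sum_abs] sum_mono) (auto simp: abs_mult intro!: mult_mono bound_w C_nonneg)
    have S1: "(\<lambda>(\<sigma>, \<tau>). e0 + G * (\<Sum>e\<in>E. ?ind e \<sigma> \<tau>)) \<in> borel_measurable (\<nu> \<Otimes>\<^sub>M \<nu>)"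
    proof -
      have "(\<lambda>z. e0 + G * (\<Sum>e\<in>E. (\<lambda>(\<sigma>, \<tau>). ?ind e \<sigma> \<tau>) z)) \<in> borel_measurable (\<nu> \<Otimes>\<^sub>M \<nu>)"
        by (intro borel_measurable_add borel_measurable_times borel_measurable_sum mind) auto
      then show ?thesis by (simp add: case_prod_beta')
    qed
    have S2: "\<bar>e0 + G * (\<Sum>e\<in>E. ?ind e \<sigma> \<tau>)\<bar> \<le> \<bar>e0\<bar> + G * card E" for \<sigma> \<tau>
    proof -
      have "0 \<le> (\<Sum>e\<in>E. ?ind e \<sigma> \<tau>)" by (intro sum_nonneg) auto
      moreover have "(\<Sum>e\<in>E. ?ind e \<sigma> \<tau>) \<le> of_nat (card E) * 1" by (intro sum_bounded_above) (simp add: indicator_def)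
      ultimately have "\<bar>G * (\<Sum>e\<in>E. ?ind e \<sigma> \<tau>)\<bar> \<le> G * card E" using G by (simp add: abs_mult mult_left_mono)
      then show ?thesis by linarith
    qed
    have g2S: "gav2 (\<lambda>\<sigma> \<tau>. e0 + G * (\<Sum>e\<in>E. ?ind e \<sigma> \<tau>)) y = e0 + G * (\<Sum>e\<in>E. gav2 (?ind e) y)" for y
    proof -
      \<comment> \<open>The index \<open>None\<close> carries the constant \<open>e0\<close>, so
        that the affine expression becomes one finite sum.\<close>
      have "gav2 (\<lambda>\<sigma> \<tau>. e0 + G * (\<Sum>e\<in>E. ?ind e \<sigma> \<tau>)) y =
          gav2 (\<lambda>\<sigma> \<tau>. \<Sum>k\<in>insert None (Some ` E). (case k of None \<Rightarrow> e0 | Some e \<Rightarrow> G) * (case k of None \<Rightarrow> 1 | Some e \<Rightarrow> ?ind e \<sigma> \<tau>)) y"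
        using E by (simp add: sum.reindex sum_distrib_left)
      also have "\<dots> = (\<Sum>k\<in>insert None (Some ` E). (case k of None \<Rightarrow> e0 | Some e \<Rightarrow> G) * gav2 (\<lambda>\<sigma> \<tau>. case k of None \<Rightarrow> 1 | Some e \<Rightarrow> ?ind e \<sigma> \<tau>) y)"
        by (rule gav2_sum[where c = 1]) (use E mind bind in \<open>auto split: option.splits\<close>)
      also have "\<dots> = e0 + G * (\<Sum>e\<in>E. gav2 (?ind e) y)"
        using E by (simp add: sum.reindex sum_distrib_left gav2_const)
      finally show ?thesis .
    qed
    have "(LINT x|gauss J. exp (?a * ln (Z (scale ?u x))) * (\<Sum>j\<in>J. (u1 j - u0 j) * (gav \<nu> J w (w j) (scale ?u x))\<^sup>2))
       = (LINT x|gauss J. exp (?a * ln (Z (scale ?u x))) * gav2 ?D (scale ?u x))"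
      by (simp only: sum_gav_sq_eq_gav2)
    also have "\<dots> \<le> (LINT x|gauss J. exp (?a * ln (Z (scale ?u x))) * gav2 (\<lambda>\<sigma> \<tau>. e0 + G * (\<Sum>e\<in>E. ?ind e \<sigma> \<tau>)) (scale ?u x))"
      by (intro integral_mono int[OF D1 D2] int[OF S1 S2] mult_left_mono gav2_mono[OF D1 D2 S1 S2] ptw) auto
    also have "\<dots> = (LINT x|gauss J. e0 * exp (?a * ln (Z (scale ?u x))) + (\<Sum>e\<in>E. G * (exp (?a * ln (Z (scale ?u x))) * gav2 (?ind e) (scale ?u x))))"
      unfolding g2S by (simp add: algebra_simps sum_distrib_left sum_distrib_right)
    also have "\<dots> = e0 * pm ?a ?u + (\<Sum>e\<in>E. G * (LINT x|gauss J. exp (?a * ln (Z (scale ?u x))) * gav2 (?ind e) (scale ?u x)))"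
    proof -
      have ie: "integrable (gauss J) (\<lambda>x. G * (exp (?a * ln (Z (scale ?u x))) * gav2 (?ind e) (scale ?u x)))" if "e \<in> E" for e
        using int[OF mind[OF that], of 1] bind by simp
      then show ?thesis
        using integrable_pm[of ?a ?u]
        by (subst Bochner_Integration.integral_add) (auto simp: pm_def Bochner_Integration.integral_sum)
    qed
    also have "\<dots> \<le> e0 * pm ?a ?u + (\<Sum>e\<in>E. G * (?q * pm ?a ?u))"
      using each G by (intro add_left_mono sum_mono mult_left_mono) auto
    also have "\<dots> = (e0 + G * (card E * ?q)) * pm ?a ?u" by (simp add: algebra_simps)
    finally show "(LINT x|gauss J. exp (?a * ln (Z (scale ?u x))) * (\<Sum>j\<in>J. (u1 j - u0 j) * (gav \<nu> J w (w j) (scale ?u x))\<^sup>2)) \<le> (e0 + G * (card E * ?q)) * pm ?a ?u" .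
  qed (use h in auto)
  then show ?thesis by simp
qed

abbreviation species_of :: "('s \<Rightarrow> nat set) \<Rightarrow> nat \<Rightarrow> 's" where
  "species_of I i \<equiv> THE s. i \<in> I s"

lemma species_of_eq:
  assumes "disjoint_family I" "i \<in> I s"
  shows "species_of I i = s"
  using assms by (intro the_equality) (auto simp: disjoint_family_on_def)

subsection \<open>Uniform measure on a sphere\<close>

abbreviation Leb :: "'i set \<Rightarrow> ('i \<Rightarrow> real) measure" where
  "Leb A \<equiv> Pi\<^sub>M A (\<lambda>_. lborel)"

definition unit_ball :: "'i set \<Rightarrow> ('i \<Rightarrow> real) set" where
  "unit_ball A = {x \<in> A \<rightarrow>\<^sub>E UNIV. L2_set x A \<le> 1}"

definition radial :: "'i set \<Rightarrow> ('i \<Rightarrow> real) \<Rightarrow> 'i \<Rightarrow> real" where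
  "radial A x = (\<lambda>i\<in>A. sqrt (real (card A)) * x i / L2_set x A)"

lemma sphere_measure_alt:
  "sphere_measure A = distr (uniform_measure (Leb A) (unit_ball A)) (Pi\<^sub>M A (\<lambda>_. borel)) (radial A)"
  by (simp add: sphere_measure_def unit_ball_def radial_def[abs_def])

lemma sets_Leb [measurable_cong]: "sets (Leb A) = sets (Pi\<^sub>M A (\<lambda>_. borel))"
  by (rule sets_PiM_cong) auto

lemma meas_L2 [measurable]: "(\<lambda>x. L2_set x A) \<in> borel_measurable (Pi\<^sub>M A (\<lambda>_. borel))"
  unfolding L2_set_def by measurable

lemma meas_radial [measurable]: "radial A \<in> measurable (Pi\<^sub>M A (\<lambda>_. borel)) (Pi\<^sub>M A (\<lambda>_. borel))"
  unfolding radial_def by measurable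

lemma emeasure_unit_ball:
  assumes "finite A"
  shows "emeasure (Leb A) (unit_ball A) = ennreal (unit_ball_vol (real (card A)))"
proof -
  have "unit_ball A = {f. sqrt (\<Sum>i\<in>A. (f i)\<^sup>2) \<le> 1} \<inter> space (Leb A)"
    by (auto simp: unit_ball_def L2_set_def space_PiM)
  then show ?thesis using emeasure_cball_aux[OF assms, of 1] by simp
qed

lemma unit_ball_sets [measurable]: "unit_ball A \<in> sets (Pi\<^sub>M A (\<lambda>_. borel))"
proof -
  have "unit_ball A = {x \<in> space (Pi\<^sub>M A (\<lambda>_. borel)). L2_set x A \<le> 1}"
    by (auto simp: unit_ball_def space_PiM)
  then show ?thesis by simp
qed

lemma prob_space_ball:
  assumes "finite A"
  shows "prob_space (uniform_measure (Leb A) (unit_ball A))"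
proof (rule prob_space_uniform_measure)
  have "0 < unit_ball_vol (real (card A))" by simp
  then show "emeasure (Leb A) (unit_ball A) \<noteq> 0" unfolding emeasure_unit_ball[OF assms] by (metis ennreal_eq_0_iff not_le)
  show "emeasure (Leb A) (unit_ball A) \<noteq> \<infinity>" unfolding emeasure_unit_ball[OF assms] by simp
qed

lemma prob_space_sphere: "finite A \<Longrightarrow> prob_space (sphere_measure A)"
  unfolding sphere_measure_alt by (intro prob_space.prob_space_distr prob_space_ball) auto

lemma sets_sphere [measurable_cong]: "sets (sphere_measure A) = sets (Pi\<^sub>M A (\<lambda>_. borel))"
  by (simp add: sphere_measure_alt)

text \<open>Only the origin fails to be projected onto the sphere, division by zero returning 0
  there, and it is a null set. For empty \<open>A\<close> the equation reads 0 = 0.\<close>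

lemma AE_sphere:
  assumes A: "finite A"
  shows "AE x in sphere_measure A. (\<Sum>i\<in>A. (x i)\<^sup>2) = real (card A)"
proof (cases "A = {}")
  case False
  interpret product_sigma_finite "\<lambda>_. lborel :: real measure" by unfold_locales
  have "emeasure (Leb A) (PiE A (\<lambda>_. {0})) = 0"
    using False A by (subst emeasure_PiM) auto
  then have null: "PiE A (\<lambda>_. {0}) \<in> null_sets (Leb A)"
    by (rule null_setsI) (rule sets_PiM_I_finite[OF A], simp)
  have nz: "AE x in Leb A. L2_set x A \<noteq> 0"
  proof (rule AE_I'[OF null])
    show "{x \<in> space (Leb A). \<not> L2_set x A \<noteq> 0} \<subseteq> PiE A (\<lambda>_. {0})"
      using A by (auto simp: L2_set_eq_0_iff space_PiM PiE_iff extensional_def fun_eq_iff)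
  qed
  have rad: "(\<Sum>i\<in>A. (radial A x i)\<^sup>2) = real (card A)" if "L2_set x A \<noteq> 0" for x
  proof -
    have "(L2_set x A)\<^sup>2 = (\<Sum>i\<in>A. (x i)\<^sup>2)" unfolding L2_set_def by (simp add: sum_nonneg)
    then have "(\<Sum>i\<in>A. (radial A x i)\<^sup>2) = real (card A) * (L2_set x A)\<^sup>2 / (L2_set x A)\<^sup>2"
      by (simp add: radial_def power_divide power_mult_distrib sum_divide_distrib[symmetric] sum_distrib_left[symmetric])
    then show ?thesis using that by simp
  qed
  have "AE x in uniform_measure (Leb A) (unit_ball A). (\<Sum>i\<in>A. (radial A x i)\<^sup>2) = real (card A)"
    using nz by (intro AE_uniform_measureI) (auto elim!: eventually_mono simp: rad)
  then show ?thesis unfolding sphere_measure_alt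
    by (subst AE_distr_iff) auto
qed auto

text \<open>One map for the two symmetries needed: renaming the coordinates through a bijection
  (with sign 1), and a global change of sign (with the identity as bijection).\<close>

definition relabel :: "'b set \<Rightarrow> ('b \<Rightarrow> 'a) \<Rightarrow> real \<Rightarrow> ('a \<Rightarrow> real) \<Rightarrow> 'b \<Rightarrow> real" where
  "relabel A' b e x = (\<lambda>i\<in>A'. e * x (b i))"

context
  fixes A :: "'a set" and A' :: "'b set" and b :: "'b \<Rightarrow> 'a" and e :: real
  assumes A: "finite A" and b: "bij_betw b A' A" and e: "e = 1 \<or> e = -1"
begin

lemma b_in: "i \<in> A' \<Longrightarrow> b i \<in> A" using b by (auto simp: bij_betw_def)

lemma finite_A': "finite A'" using A b by (simp add: bij_betw_finite)

lemma card_A': "card A' = card A" using b by (rule bij_betw_same_card)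

lemma sum_b: "(\<Sum>i\<in>A'. f (b i)) = (\<Sum>i\<in>A. f i)"
  by (rule sum.reindex_bij_betw[OF b])

lemma e_sq: "e\<^sup>2 = 1" "e * e = 1" using e by auto

lemma L2_relabel: "L2_set (relabel A' b e x) A' = L2_set x A"
  unfolding L2_set_def relabel_def using sum_b[of "\<lambda>i. (x i)\<^sup>2"] by (simp add: power_mult_distrib e_sq)

lemma meas_relabel [measurable]: "relabel A' b e \<in> measurable (Pi\<^sub>M A (\<lambda>_. borel)) (Pi\<^sub>M A' (\<lambda>_. borel))"
  unfolding relabel_def using b_in by measurable

lemma lborel_sign: "emeasure lborel {y. e * y \<in> X} = emeasure lborel X" if "X \<in> sets borel"
proof -
  have "distr lborel borel ((*) e) = (lborel :: real measure)"
  proof (cases "e = 1")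
    case True
    then have "(*) e = (\<lambda>x. x)" by (simp add: fun_eq_iff)
    then show ?thesis by (simp add: distr_id2)
  next
    case False
    then have "e = -1" using e by simp
    then have "(*) e = uminus" by (simp add: fun_eq_iff)
    then show ?thesis using lborel_distr_uminus by simp
  qed
  then have "emeasure lborel X = emeasure (distr lborel borel ((*) e)) X" by simp
  also have "\<dots> = emeasure lborel {y. e * y \<in> X}" using that by (subst emeasure_distr) (auto simp: vimage_def)
  finally show ?thesis by simp
qed

lemma distr_Leb_relabel: "distr (Leb A) (Leb A') (relabel A' b e) = Leb A'"
proof -
  interpret p: product_sigma_finite "\<lambda>_::'b. lborel :: real measure" by unfold_locales
  interpret q: product_sigma_finite "\<lambda>_::'a. lborel :: real measure" by unfold_locales
  show ?thesis
  proof (rule p.PiM_eqI[OF finite_A'])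
    fix X :: "'b \<Rightarrow> real set" assume X: "\<And>i. i \<in> A' \<Longrightarrow> X i \<in> sets lborel"
    define c where "c = the_inv_into A' b"
    have c: "c (b i) = i" if "i \<in> A'" for i using b that by (simp add: c_def bij_betw_def the_inv_into_f_f)
    have bc: "b (c j) = j" "c j \<in> A'" if "j \<in> A" for j
      using b that by (auto simp: c_def bij_betw_def f_the_inv_into_f the_inv_into_into)
    have eq: "relabel A' b e -` (PiE A' X) \<inter> space (Leb A) = PiE A (\<lambda>j. {y. e * y \<in> X (c j)})"
    proof (rule set_eqI)
      fix x
      have "x \<in> relabel A' b e -` (PiE A' X) \<inter> space (Leb A) \<longleftrightarrow> x \<in> extensional A \<and> (\<forall>i\<in>A'. e * x (b i) \<in> X i)"
        by (auto simp: space_PiM PiE_iff relabel_def)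
      also have "\<dots> \<longleftrightarrow> x \<in> extensional A \<and> (\<forall>j\<in>A. e * x j \<in> X (c j))"
        using bc c b_in by metis
      also have "\<dots> \<longleftrightarrow> x \<in> PiE A (\<lambda>j. {y. e * y \<in> X (c j)})" by (auto simp: PiE_iff)
      finally show "x \<in> relabel A' b e -` (PiE A' X) \<inter> space (Leb A) \<longleftrightarrow> x \<in> PiE A (\<lambda>j. {y. e * y \<in> X (c j)})" .
    qed
    have s: "{y. e * y \<in> X (c j)} \<in> sets borel" if "j \<in> A" for j
    proof -
      have "(\<lambda>y. e * y) -` X (c j) \<inter> space borel \<in> sets borel" by (rule measurable_sets[where A = borel]) (use X bc that in auto)
      then show ?thesis by (simp add: vimage_def)
    qed
    have "emeasure (distr (Leb A) (Leb A') (relabel A' b e)) (PiE A' X) = emeasure (Leb A) (PiE A (\<lambda>j. {y. e * y \<in> X (c j)}))"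
      using X finite_A' by (subst emeasure_distr) (auto simp: eq intro!: sets_PiM_I_finite)
    also have "\<dots> = (\<Prod>j\<in>A. emeasure lborel {y. e * y \<in> X (c j)})"
      using s A by (intro q.emeasure_PiM) auto
    also have "\<dots> = (\<Prod>j\<in>A. emeasure lborel (X (c j)))" using X bc by (intro prod.cong refl lborel_sign) auto
    also have "\<dots> = (\<Prod>i\<in>A'. emeasure lborel (X (c (b i))))" by (rule prod.reindex_bij_betw[OF b, symmetric])
    also have "\<dots> = (\<Prod>i\<in>A'. emeasure lborel (X i))" using c by simp
    finally show "emeasure (distr (Leb A) (Leb A') (relabel A' b e)) (PiE A' X) = (\<Prod>i\<in>A'. emeasure lborel (X i))" .
  qed simp
qed

text \<open>Lebesgue measure and the unit ball are preserved by relabelling, and the radial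
  projection commutes with it.\<close>

lemma distr_sphere_relabel:
  "distr (sphere_measure A) (Pi\<^sub>M A' (\<lambda>_. borel)) (relabel A' b e) = sphere_measure A'"
proof -
  have vim: "relabel A' b e -` unit_ball A' \<inter> space (Leb A) = unit_ball A"
    by (auto simp: unit_ball_def L2_relabel space_PiM) (auto simp: relabel_def)
  have eb: "emeasure (Leb A') (unit_ball A') = emeasure (Leb A) (unit_ball A)"
    using emeasure_unit_ball[OF A] emeasure_unit_ball[OF finite_A'] card_A' by simp
  have unif: "distr (uniform_measure (Leb A) (unit_ball A)) (Leb A') (relabel A' b e) = uniform_measure (Leb A') (unit_ball A')"
  proof (rule measure_eqI)
    fix X assume "X \<in> sets (distr (uniform_measure (Leb A) (unit_ball A)) (Leb A') (relabel A' b e))"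
    then have X[measurable]: "X \<in> sets (Leb A')" by simp
    have "emeasure (distr (uniform_measure (Leb A) (unit_ball A)) (Leb A') (relabel A' b e)) X
      = emeasure (uniform_measure (Leb A) (unit_ball A)) (relabel A' b e -` X \<inter> space (Leb A))"
      by (subst emeasure_distr) auto
    also have "\<dots> = emeasure (Leb A) (unit_ball A \<inter> (relabel A' b e -` X \<inter> space (Leb A))) / emeasure (Leb A) (unit_ball A)"
      by (rule emeasure_uniform_measure) measurable
    also have "unit_ball A \<inter> (relabel A' b e -` X \<inter> space (Leb A)) = relabel A' b e -` (unit_ball A' \<inter> X) \<inter> space (Leb A)"
      using vim by blast
    also have "emeasure (Leb A) (relabel A' b e -` (unit_ball A' \<inter> X) \<inter> space (Leb A)) = emeasure (distr (Leb A) (Leb A') (relabel A' b e)) (unit_ball A' \<inter> X)"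
      by (subst emeasure_distr) auto
    also have "\<dots> = emeasure (Leb A') (unit_ball A' \<inter> X)" by (simp add: distr_Leb_relabel)
    also have "\<dots> / emeasure (Leb A) (unit_ball A) = emeasure (uniform_measure (Leb A') (unit_ball A')) X"
      unfolding eb[symmetric] by (rule emeasure_uniform_measure[symmetric]) auto
    finally show "emeasure (distr (uniform_measure (Leb A) (unit_ball A)) (Leb A') (relabel A' b e)) X = emeasure (uniform_measure (Leb A') (unit_ball A')) X" .
  qed simp
  have comm: "relabel A' b e (radial A x) = radial A' (relabel A' b e x)" for x
    using b_in by (auto simp: radial_def L2_relabel card_A' fun_eq_iff) (auto simp: relabel_def)
  have "distr (sphere_measure A) (Pi\<^sub>M A' (\<lambda>_. borel)) (relabel A' b e)
     = distr (uniform_measure (Leb A) (unit_ball A)) (Pi\<^sub>M A' (\<lambda>_. borel)) (\<lambda>x. relabel A' b e (radial A x))"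
    unfolding sphere_measure_alt by (subst distr_distr) (auto simp: comp_def)
  also have "\<dots> = distr (distr (uniform_measure (Leb A) (unit_ball A)) (Leb A') (relabel A' b e)) (Pi\<^sub>M A' (\<lambda>_. borel)) (radial A')"
    by (subst distr_distr) (auto simp: comp_def comm)
  also have "\<dots> = sphere_measure A'" unfolding unif sphere_measure_alt ..
  finally show ?thesis .
qed

end

subsection \<open>Configurations\<close>

text \<open>The restriction makes the sphere equations hold at every point of the space and not only
  almost everywhere, as the pointwise assumptions of \<open>gibbs\<close> demand.\<close>

definition config :: "spin_type \<Rightarrow> nat \<Rightarrow> ('s \<Rightarrow> nat set) \<Rightarrow> (nat \<Rightarrow> real) measure" where
  "config k N I = restrict_space (config_measure k N I) (config_space k N I)"

text \<open>The reference measure of one species whose sites are renamed to 1, ..., n.\<close>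

definition block_measure :: "spin_type \<Rightarrow> nat \<Rightarrow> (nat \<Rightarrow> real) measure" where
  "block_measure k n = (case k of Ising \<Rightarrow> uniform_count_measure ({1..n} \<rightarrow>\<^sub>E {-1, 1}) | Spherical \<Rightarrow> sphere_measure {1..n})"

lemma bij_betw_vimage_Int:
  assumes "bij_betw f E E'" "X \<subseteq> E'"
  shows "bij_betw f (f -` X \<inter> E) X"
proof (rule bij_betw_imageI)
  show "inj_on f (f -` X \<inter> E)" using assms by (auto simp: bij_betw_def inj_on_def)
  have "E' = f ` E" using assms by (simp add: bij_betw_def)
  then show "f ` (f -` X \<inter> E) = X" using assms(2) by auto
qed

locale partition =
  fixes N :: nat and I :: "'s::finite \<Rightarrow> nat set"
  assumes part: "species_partition N I"
begin

lemma disj: "disjoint_family I" and Un: "(\<Union>s. I s) = {1..N}"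
  using part by (auto simp: species_partition_def)

lemma sub: "I s \<subseteq> {1..N}" using Un by auto

lemma fin [simp, intro]: "finite (I s)" using sub finite_subset by blast

lemma sp_in: "i \<in> {1..N} \<Longrightarrow> i \<in> I (species_of I i)"
  using Un disj by (metis UN_E species_of_eq)

lemma sp_eq: "i \<in> I s \<Longrightarrow> species_of I i = s" using disj by (rule species_of_eq)

abbreviation "BB \<equiv> Pi\<^sub>M {1..N} (\<lambda>_. borel :: real measure)"

definition glue :: "('s \<Rightarrow> nat \<Rightarrow> real) \<Rightarrow> nat \<Rightarrow> real" where
  "glue x = (\<lambda>i\<in>{1..N}. x (species_of I i) i)"

lemma config_measure_spherical:
  "config_measure Spherical N I = distr (Pi\<^sub>M UNIV (\<lambda>s. sphere_measure (I s))) BB glue"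
  by (simp add: glue_def[abs_def])

lemma meas_glue [measurable]: "glue \<in> measurable (Pi\<^sub>M UNIV (\<lambda>s. sphere_measure (I s))) BB"
  unfolding glue_def
proof (rule measurable_restrict)
  fix i assume i: "i \<in> {1..N}"
  have "(\<lambda>x. x (species_of I i)) \<in> measurable (Pi\<^sub>M UNIV (\<lambda>s. sphere_measure (I s))) (sphere_measure (I (species_of I i)))"
    by (rule measurable_component_singleton) simp
  moreover have "(\<lambda>y. y i) \<in> borel_measurable (sphere_measure (I (species_of I i)))"
    using sp_in[OF i] by measurable
  ultimately show "(\<lambda>x. x (species_of I i) i) \<in> borel_measurable (Pi\<^sub>M UNIV (\<lambda>s. sphere_measure (I s)))"
    by (rule measurable_compose)
qed

lemma prob_spheres: "prob_space (Pi\<^sub>M UNIV (\<lambda>s. sphere_measure (I s)))"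
  by (intro prob_space_PiM prob_space_sphere) auto

lemma prob_space_config_measure: "prob_space (config_measure k N I)"
proof (cases k)
  case Ising
  then show ?thesis by (simp add: prob_space_uniform_count_measure finite_PiE PiE_eq_empty_iff)
next
  case Spherical
  then show ?thesis unfolding Spherical config_measure_spherical
    by (intro prob_space.prob_space_distr prob_spheres meas_glue)
qed

lemma config_space_sets: "config_space k N I \<in> sets (config_measure k N I)"
proof (cases k)
  case Spherical
  have "config_space Spherical N I = (\<Inter>s. {\<sigma> \<in> space BB. (\<Sum>i\<in>I s. (\<sigma> i)\<^sup>2) = real (card (I s))})"
    by (auto simp: space_PiM)
  also have "\<dots> \<in> sets BB"
  proof (rule sets.finite_INT)
    fix s :: 's
    have [measurable]: "(\<lambda>\<sigma>. \<Sum>i\<in>I s. (\<sigma> i)\<^sup>2) \<in> borel_measurable BB"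
      by (intro borel_measurable_sum borel_measurable_power measurable_component_singleton) (use sub[of s] in blast)
    show "{\<sigma> \<in> space BB. (\<Sum>i\<in>I s. (\<sigma> i)\<^sup>2) = real (card (I s))} \<in> sets BB" by measurable
  qed auto
  finally show ?thesis by (simp add: Spherical config_measure_spherical del: config_measure.simps)
qed (simp add: sets_uniform_count_measure)

lemma AE_config_space: "AE \<sigma> in config_measure k N I. \<sigma> \<in> config_space k N I"
proof (cases k)
  case Spherical
  interpret product_prob_space "\<lambda>s. sphere_measure (I s)" UNIV by (intro product_prob_spaceI prob_space_sphere) auto
  have "AE x in Pi\<^sub>M UNIV (\<lambda>s. sphere_measure (I s)). \<forall>s\<in>UNIV. (\<Sum>i\<in>I s. (x s i)\<^sup>2) = real (card (I s))"
    by (intro AE_finite_allI AE_component AE_sphere) auto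
  then have "AE x in Pi\<^sub>M UNIV (\<lambda>s. sphere_measure (I s)). glue x \<in> config_space Spherical N I"
  proof (rule eventually_mono)
    fix x assume x: "\<forall>s\<in>UNIV. (\<Sum>i\<in>I s. (x s i)\<^sup>2) = real (card (I s))"
    have "(\<Sum>i\<in>I s. (glue x i)\<^sup>2) = (\<Sum>i\<in>I s. (x s i)\<^sup>2)" for s
      by (intro sum.cong refl) (use sub[of s] in \<open>auto simp: glue_def sp_eq subset_eq\<close>)
    then show "glue x \<in> config_space Spherical N I" using x by (auto simp: glue_def)
  qed
  moreover have "{x \<in> space BB. x \<in> config_space Spherical N I} \<in> sets BB"
  proof -
    have "config_space Spherical N I \<in> sets BB"
      using config_space_sets[of Spherical] unfolding config_measure_spherical sets_distr .
    moreover from this have "{x \<in> space BB. x \<in> config_space Spherical N I} = config_space Spherical N I"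
      using sets.sets_into_space by blast
    ultimately show ?thesis by (simp only:)
  qed
  ultimately show ?thesis unfolding Spherical config_measure_spherical
    by (subst AE_distr_iff[OF meas_glue])
qed (rule AE_I2, simp add: space_uniform_count_measure)

lemma space_config: "space (config k N I) = config_space k N I"
  using sets.sets_into_space[OF config_space_sets[of k]] by (auto simp: config_def space_restrict_space)

lemma prob_space_config: "prob_space (config k N I)"
proof -
  interpret prob_space "config_measure k N I" by (rule prob_space_config_measure)
  show ?thesis unfolding config_def
    using config_space_sets AE_config_space
    by (intro prob_space_restrict_space) (auto simp: prob_eq_1 emeasure_eq_measure)
qed

lemma integral_config:
  fixes f :: "_ \<Rightarrow> real"
  shows "(LINT \<sigma>|config k N I. f \<sigma>) = (LINT \<sigma>:config_space k N I|config_measure k N I. f \<sigma>)"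
  unfolding config_def set_lebesgue_integral_def
  using sets.sets_into_space[OF config_space_sets[of k]] config_space_sets
  by (intro integral_restrict_space) (simp add: Int_absorb2)

lemma integral_config_AE:
  fixes f :: "_ \<Rightarrow> real"
  assumes [measurable]: "f \<in> borel_measurable (config_measure k N I)"
  shows "(LINT \<sigma>|config k N I. f \<sigma>) = (LINT \<sigma>|config_measure k N I. f \<sigma>)"
  unfolding integral_config set_lebesgue_integral_def
proof (rule integral_cong_AE)
  show "AE \<sigma> in config_measure k N I. indicator (config_space k N I) \<sigma> *\<^sub>R f \<sigma> = f \<sigma>"
    using AE_config_space by (rule eventually_mono) simp
qed (use config_space_sets in measurable)

lemma config_sq_sum:
  assumes "\<sigma> \<in> config_space k N I"
  shows "(\<Sum>i\<in>I s. (\<sigma> i)\<^sup>2) = real (card (I s))"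
proof (cases k)
  case Ising
  have "(\<sigma> i)\<^sup>2 = 1" if "i \<in> I s" for i
  proof -
    have "\<sigma> i \<in> {-1, 1}" using assms Ising subsetD[OF sub[of s] that] by (simp add: PiE_iff)
    then show ?thesis by auto
  qed
  then show ?thesis by simp
qed (use assms in auto)

text \<open>A crude bound valid for both kinds of spins; only boundedness for fixed \<open>N\<close>
  matters.\<close>

lemma config_bound:
  assumes "\<sigma> \<in> config_space k N I" "i \<in> {1..N}"
  shows "\<bar>\<sigma> i\<bar> \<le> real N"
proof -
  let ?s = "species_of I i"
  have "(\<sigma> i)\<^sup>2 \<le> (\<Sum>i\<in>I ?s. (\<sigma> i)\<^sup>2)" by (rule member_le_sum) (use sp_in[OF assms(2)] in auto)
  also have "\<dots> = real (card (I ?s))" by (rule config_sq_sum[OF assms(1)])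
  also have "\<dots> \<le> real N" using card_mono[OF _ sub[of ?s]] by simp
  also have "\<dots> \<le> (real N)\<^sup>2" using assms(2) by (simp add: power2_eq_square mult_le_cancel_left1)
  finally show ?thesis by (metis abs_le_square_iff abs_of_nat)
qed

lemma meas_config [measurable]: "i \<in> {1..N} \<Longrightarrow> (\<lambda>\<sigma>. \<sigma> i) \<in> borel_measurable (config k N I)"
  unfolding config_def
  by (rule measurable_restrict_space1, cases k)
     (auto simp: config_measure_spherical simp del: config_measure.simps(2) intro!: measurable_component_singleton)

definition flip :: "('s \<Rightarrow> real) \<Rightarrow> (nat \<Rightarrow> real) \<Rightarrow> nat \<Rightarrow> real" where
  "flip \<epsilon> \<sigma> = (\<lambda>i\<in>{1..N}. \<epsilon> (species_of I i) * \<sigma> i)"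

section \<open>Reversing whole species preserves the reference measure\<close>

context
  fixes \<epsilon> :: "'s \<Rightarrow> real"
  assumes eps: "\<And>s. \<epsilon> s = 1 \<or> \<epsilon> s = -1"
begin

lemma flip_config: "\<sigma> \<in> config_space k N I \<Longrightarrow> flip \<epsilon> \<sigma> \<in> config_space k N I"
proof (cases k)
  case Ising
  assume "\<sigma> \<in> config_space k N I"
  then have "\<sigma> i = 1 \<or> \<sigma> i = -1" if "i \<in> {1..N}" for i using that Ising by (auto simp: PiE_def Pi_def)
  then show ?thesis using eps unfolding Ising by (auto simp: flip_def PiE_def Pi_def) (metis mult_minus1 mult_1 minus_minus)+
next
  case Spherical
  assume s: "\<sigma> \<in> config_space k N I"
  have e2: "(\<epsilon> s)\<^sup>2 = 1" for s using eps[of s] by auto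
  have "(\<Sum>i\<in>I s. (flip \<epsilon> \<sigma> i)\<^sup>2) = (\<Sum>i\<in>I s. (\<sigma> i)\<^sup>2)" for s
    by (intro sum.cong refl) (use sub[of s] in \<open>auto simp: flip_def power_mult_distrib e2 subset_eq\<close>)
  then show ?thesis using s unfolding Spherical by (auto simp: flip_def)
qed

lemma flip_flip: "\<sigma> \<in> config_space k N I \<Longrightarrow> flip \<epsilon> (flip \<epsilon> \<sigma>) = \<sigma>"
proof -
  assume "\<sigma> \<in> config_space k N I"
  then have "\<sigma> \<in> extensional {1..N}" by (cases k) (auto simp: PiE_def)
  moreover have "\<epsilon> s * (\<epsilon> s * x) = x" for s x using eps[of s] by auto
  ultimately show ?thesis by (auto simp: flip_def fun_eq_iff extensional_def)
qed

lemma meas_flip_BB: "flip \<epsilon> \<in> measurable BB BB"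
  unfolding flip_def by measurable

lemma meas_flip_measure: "flip \<epsilon> \<in> measurable (config_measure k N I) (config_measure k N I)"
proof (cases k)
  case Ising
  have "flip \<epsilon> \<in> config_space Ising N I \<rightarrow> config_space Ising N I" using flip_config[of _ Ising] by (auto simp del: config_space.simps)
  then show ?thesis unfolding Ising by (auto simp: measurable_def sets_uniform_count_measure space_uniform_count_measure simp del: config_space.simps)
next
  case Spherical
  then show ?thesis unfolding Spherical config_measure_spherical using meas_flip_BB by simp
qed

lemma distr_flip_measure: "distr (config_measure k N I) (config_measure k N I) (flip \<epsilon>) = config_measure k N I"
proof (cases k)
  case Ising
  let ?E = "config_space Ising N I"
  have finE: "finite ?E" by (simp add: finite_PiE)
  have bij: "bij_betw (flip \<epsilon>) ?E ?E"
    by (rule bij_betw_byWitness[where f' = "flip \<epsilon>"]) (auto simp: flip_flip[of _ Ising] flip_config[of _ Ising] simp del: config_space.simps)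
  show ?thesis unfolding Ising
  proof (rule measure_eqI)
    fix X assume "X \<in> sets (distr (config_measure Ising N I) (config_measure Ising N I) (flip \<epsilon>))"
    then have X: "X \<subseteq> ?E" by (simp add: sets_uniform_count_measure del: config_space.simps)
    have "card (flip \<epsilon> -` X \<inter> ?E) = card X"
    proof -
      have "bij_betw (flip \<epsilon>) (flip \<epsilon> -` X \<inter> ?E) X"
        by (rule bij_betw_vimage_Int[OF bij X])
      then show ?thesis by (rule bij_betw_same_card)
    qed
    then show "emeasure (distr (config_measure Ising N I) (config_measure Ising N I) (flip \<epsilon>)) X = emeasure (config_measure Ising N I) X"
      using X finE meas_flip_measure[of Ising]
      by (subst emeasure_distr) (auto simp: emeasure_uniform_count_measure sets_uniform_count_measure space_uniform_count_measure simp del: config_space.simps)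
  qed simp
next
  case Spherical
  let ?P = "Pi\<^sub>M UNIV (\<lambda>s. sphere_measure (I s))"
  \<comment> \<open>A flip multiplies each block by its own sign, so the invariance reduces to that
    of a single sphere.\<close>
  let ?r = "\<lambda>s. relabel (I s) (\<lambda>i. i) (\<epsilon> s)"
  have b: "bij_betw (\<lambda>i. i) (I s) (I s)" for s by (simp add: bij_betw_def)
  have r: "?r s \<in> measurable (sphere_measure (I s)) (sphere_measure (I s))" for s
    using meas_relabel[OF fin b eps, of s] by simp
  have "distr ?P ?P (\<lambda>x. \<lambda>s\<in>UNIV. ?r s (x s)) = Pi\<^sub>M UNIV (\<lambda>s. distr (sphere_measure (I s)) (sphere_measure (I s)) (?r s))"
    by (rule distr_PiM_componentwise) (auto intro: prob_space_sphere r)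
  also have "(\<lambda>s. distr (sphere_measure (I s)) (sphere_measure (I s)) (?r s)) = (\<lambda>s. sphere_measure (I s))"
    using distr_sphere_relabel[OF fin b eps] by (simp add: sets_sphere cong: distr_cong)
  finally have d: "distr ?P ?P (\<lambda>x s. ?r s (x s)) = ?P" by simp
  have comm: "flip \<epsilon> (glue x) = glue (\<lambda>s. ?r s (x s))" for x
    using sp_in by (auto simp: flip_def glue_def relabel_def fun_eq_iff)
  have m: "(\<lambda>x s. ?r s (x s)) \<in> measurable ?P ?P"
  proof -
    have "(\<lambda>x. \<lambda>s\<in>UNIV. ?r s (x s)) \<in> measurable ?P ?P"
    proof (rule measurable_restrict)
      fix s :: 's
      have "(\<lambda>x. x s) \<in> measurable ?P (sphere_measure (I s))" by (rule measurable_component_singleton) simp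
      then show "(\<lambda>x. ?r s (x s)) \<in> measurable ?P (sphere_measure (I s))" by (rule measurable_compose[OF _ r])
    qed
    then show ?thesis unfolding restrict_UNIV .
  qed
  have "distr (distr ?P BB glue) BB (flip \<epsilon>) = distr ?P BB (\<lambda>x. flip \<epsilon> (glue x))"
    by (subst distr_distr[OF meas_flip_BB meas_glue]) (simp add: comp_def)
  also have "\<dots> = distr (distr ?P ?P (\<lambda>x s. ?r s (x s))) BB glue"
    unfolding comm by (subst distr_distr[OF meas_glue m]) (simp add: comp_def)
  also have "\<dots> = distr ?P BB glue" by (simp add: d)
  finally show ?thesis unfolding Spherical config_measure_spherical by (simp cong: distr_cong)
qed

lemma meas_flip: "flip \<epsilon> \<in> measurable (config k N I) (config k N I)"
  unfolding config_def
  by (rule measurable_restrict_space3[OF meas_flip_measure]) (auto simp: flip_config)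

lemma distr_flip: "distr (config k N I) (config k N I) (flip \<epsilon>) = config k N I"
proof (rule measure_eqI)
  fix X assume "X \<in> sets (distr (config k N I) (config k N I) (flip \<epsilon>))"
  then have X: "X \<in> sets (config k N I)" by simp
  let ?c = "config_measure k N I" and ?E = "config_space k N I"
  have E: "?E \<inter> space ?c \<in> sets ?c" using config_space_sets[of k] by simp
  have X': "X \<in> sets ?c" "X \<subseteq> ?E" using X config_space_sets[of k] by (auto simp: config_def sets_restrict_space_iff[OF E])
  have "emeasure (distr (config k N I) (config k N I) (flip \<epsilon>)) X = emeasure (config k N I) (flip \<epsilon> -` X \<inter> space (config k N I))"
    using X by (intro emeasure_distr meas_flip)
  also have "\<dots> = emeasure ?c (flip \<epsilon> -` X \<inter> ?E)"
    unfolding space_config unfolding config_def by (rule emeasure_restrict_space[OF E]) auto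
  also have "\<dots> = emeasure ?c (flip \<epsilon> -` X \<inter> space ?c)"
  proof (rule emeasure_eq_AE)
    show "AE x in ?c. (x \<in> flip \<epsilon> -` X \<inter> ?E) = (x \<in> flip \<epsilon> -` X \<inter> space ?c)"
      using AE_config_space[of k] AE_space by eventually_elim auto
    have "flip \<epsilon> -` X \<inter> ?E = (flip \<epsilon> -` X \<inter> space ?c) \<inter> ?E"
      using sets.sets_into_space[OF config_space_sets[of k]] by auto
    then show "flip \<epsilon> -` X \<inter> ?E \<in> sets ?c"
      using measurable_sets[OF meas_flip_measure X'(1)] config_space_sets[of k] by (metis sets.Int)
    show "flip \<epsilon> -` X \<inter> space ?c \<in> sets ?c" using measurable_sets[OF meas_flip_measure X'(1)] .
  qed
  also have "\<dots> = emeasure (distr ?c ?c (flip \<epsilon>)) X" using X' by (intro emeasure_distr[symmetric] meas_flip_measure)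
  also have "\<dots> = emeasure ?c X" by (simp add: distr_flip_measure)
  also have "\<dots> = emeasure (config k N I) X" unfolding config_def by (rule emeasure_restrict_space[OF E X'(2), symmetric])
  finally show "emeasure (distr (config k N I) (config k N I) (flip \<epsilon>)) X = emeasure (config k N I) X" .
qed simp

end

text \<open>The block of species \<open>s\<close>, read through an enumeration \<open>b s\<close> of
  its sites.\<close>

definition pull :: "('s \<Rightarrow> nat \<Rightarrow> nat) \<Rightarrow> 's \<Rightarrow> (nat \<Rightarrow> real) \<Rightarrow> nat \<Rightarrow> real" where
  "pull b s \<sigma> = (\<lambda>i\<in>{1..card (I s)}. \<sigma> (b s i))"

context
  fixes b :: "'s \<Rightarrow> nat \<Rightarrow> nat"
  assumes b: "\<And>s. bij_betw (b s) {1..card (I s)} (I s)"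
begin

lemma b_site: "i \<in> {1..card (I s)} \<Longrightarrow> b s i \<in> I s"
  using b[of s] by (auto simp: bij_betw_def)

lemma sum_Ising_factor:
  fixes F :: "'s \<Rightarrow> (nat \<Rightarrow> real) \<Rightarrow> real"
  shows "(\<Sum>\<sigma>\<in>{1..N} \<rightarrow>\<^sub>E {-1, 1}. \<Prod>s\<in>UNIV. F s (pull b s \<sigma>)) = (\<Prod>s\<in>UNIV. \<Sum>\<tau>\<in>{1..card (I s)} \<rightarrow>\<^sub>E {-1, 1}. F s \<tau>)"
proof -
  let ?A = "\<lambda>s. {1..card (I s)} \<rightarrow>\<^sub>E {-1, 1::real}"
  define c where "c s = the_inv_into {1..card (I s)} (b s)" for s
  have c: "c s (b s i) = i" if "i \<in> {1..card (I s)}" for s i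
    using b[of s] that by (simp add: c_def bij_betw_def the_inv_into_f_f)
  have bc: "b s (c s j) = j" "c s j \<in> {1..card (I s)}" if "j \<in> I s" for s j
    using f_the_inv_into_f_bij_betw[OF b[of s]] bij_betwE[OF bij_betw_the_inv_into[OF b[of s]]] that
    unfolding c_def by blast+
  have bN: "b s i \<in> {1..N}" if "i \<in> {1..card (I s)}" for s i using b_site[OF that] sub by blast
  have "(\<Prod>s\<in>UNIV. \<Sum>\<tau>\<in>?A s. F s \<tau>) = (\<Sum>g\<in>PiE UNIV ?A. \<Prod>s\<in>UNIV. F s (g s))"
    by (rule prod_sum_PiE) (auto simp: finite_PiE)
  also have "\<dots> = (\<Sum>\<sigma>\<in>{1..N} \<rightarrow>\<^sub>E {-1, 1}. \<Prod>s\<in>UNIV. F s (pull b s \<sigma>))"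
  proof (rule sum.reindex_bij_witness[where j = "\<lambda>g. \<lambda>i\<in>{1..N}. g (species_of I i) (c (species_of I i) i)" and i = "\<lambda>\<sigma> s. pull b s \<sigma>"])
    fix g assume g: "g \<in> PiE UNIV ?A"
    let ?\<sigma> = "\<lambda>i\<in>{1..N}. g (species_of I i) (c (species_of I i) i)"
    have gs: "g s \<in> ?A s" for s using g by (simp add: PiE_iff)
    show "(\<lambda>s. pull b s ?\<sigma>) = g"
    proof (rule ext, rule ext)
      fix s i
      show "pull b s ?\<sigma> i = g s i"
      proof (cases "i \<in> {1..card (I s)}")
        case True
        then show ?thesis using bN[OF True] sp_eq[OF b_site[OF True]] c[OF True] by (simp add: pull_def)
      next
        case False
        then show ?thesis using gs[of s] by (auto simp: pull_def PiE_iff extensional_def)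
      qed
    qed
    then show "(\<Prod>s\<in>UNIV. F s (pull b s ?\<sigma>)) = (\<Prod>s\<in>UNIV. F s (g s))" by (metis (no_types))
    show "?\<sigma> \<in> {1..N} \<rightarrow>\<^sub>E {-1, 1}"
    proof (rule PiE_I)
      fix i assume i: "i \<in> {1..N}"
      show "?\<sigma> i \<in> {-1, 1}" using gs[of "species_of I i"] bc(2)[OF sp_in[OF i]] i by (simp add: PiE_iff del: One_nat_def)
    qed auto
  next
    fix \<sigma> assume s: "\<sigma> \<in> {1..N} \<rightarrow>\<^sub>E {-1, 1::real}"
    show "(\<lambda>s. pull b s \<sigma>) \<in> PiE UNIV ?A"
      using s bN by (simp add: pull_def PiE_iff del: One_nat_def)
    show "(\<lambda>i\<in>{1..N}. pull b (species_of I i) \<sigma> (c (species_of I i) i)) = \<sigma>"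
    proof
      fix i
      show "(\<lambda>i\<in>{1..N}. pull b (species_of I i) \<sigma> (c (species_of I i) i)) i = \<sigma> i"
      proof (cases "i \<in> {1..N}")
        case True
        then show ?thesis using bc[OF sp_in[OF True]] by (simp add: pull_def del: One_nat_def)
      next
        case False
        then show ?thesis using s by (auto simp: PiE_iff extensional_def)
      qed
    qed
  qed
  finally show ?thesis by simp
qed

text \<open>Both reference measures are products over the species, and after enumeration a factor
  depends on its block through the size alone. This makes the decoupled model a family of separate
  single-species models.\<close>

lemma integral_config_factor:
  fixes F :: "'s \<Rightarrow> (nat \<Rightarrow> real) \<Rightarrow> real"
  assumes m: "\<And>s. F s \<in> borel_measurable (Pi\<^sub>M {1..card (I s)} (\<lambda>_. borel))"
    and int: "\<And>s. integrable (block_measure k (card (I s))) (F s)"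
  shows "(LINT \<sigma>|config k N I. (\<Prod>s\<in>UNIV. F s (pull b s \<sigma>))) = (\<Prod>s\<in>UNIV. (LINT \<tau>|block_measure k (card (I s)). F s \<tau>))"
proof (cases k)
  case Ising
  \<comment> \<open>The case of constant factors 1 gives the normalization.\<close>
  have card: "real (card ({1..N} \<rightarrow>\<^sub>E {-1, 1::real})) = (\<Prod>s\<in>UNIV. real (card ({1..card (I s)} \<rightarrow>\<^sub>E {-1, 1::real})))"
    using sum_Ising_factor[of "\<lambda>_ _. 1"] by simp
  have "(LINT \<sigma>|config k N I. (\<Prod>s\<in>UNIV. F s (pull b s \<sigma>))) = (LINT \<sigma>|uniform_count_measure ({1..N} \<rightarrow>\<^sub>E {-1, 1}). (\<Prod>s\<in>UNIV. F s (pull b s \<sigma>)))"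
    by (subst integral_config_AE) (simp_all add: Ising measurable_def sets_uniform_count_measure space_uniform_count_measure)
  also have "\<dots> = (\<Sum>\<sigma>\<in>{1..N} \<rightarrow>\<^sub>E {-1, 1}. \<Prod>s\<in>UNIV. F s (pull b s \<sigma>)) / real (card ({1..N} \<rightarrow>\<^sub>E {-1, 1::real}))"
    by (rule integral_uniform_count_measure) (simp add: finite_PiE)
  also have "\<dots> = (\<Prod>s\<in>UNIV. (\<Sum>\<tau>\<in>{1..card (I s)} \<rightarrow>\<^sub>E {-1, 1}. F s \<tau>) / real (card ({1..card (I s)} \<rightarrow>\<^sub>E {-1, 1::real})))"
    unfolding sum_Ising_factor card by (simp add: prod_dividef)
  also have "\<dots> = (\<Prod>s\<in>UNIV. (LINT \<tau>|block_measure k (card (I s)). F s \<tau>))"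
    by (intro prod.cong refl) (simp add: block_measure_def Ising integral_uniform_count_measure finite_PiE)
  finally show ?thesis .
next
  case Spherical
  let ?P = "Pi\<^sub>M UNIV (\<lambda>s. sphere_measure (I s))"
  let ?r = "\<lambda>s. relabel {1..card (I s)} (b s) 1"
  interpret product_prob_space "\<lambda>s. sphere_measure (I s)" UNIV by (intro product_prob_spaceI prob_space_sphere) auto
  have r: "?r s \<in> measurable (sphere_measure (I s)) (Pi\<^sub>M {1..card (I s)} (\<lambda>_. borel))" for s
    using meas_relabel[OF fin b, of 1 s] by simp
  have d: "distr (sphere_measure (I s)) (Pi\<^sub>M {1..card (I s)} (\<lambda>_. borel)) (?r s) = sphere_measure {1..card (I s)}" for s
    by (rule distr_sphere_relabel[OF fin b]) simp
  have pg: "pull b s (glue x) = ?r s (x s)" for s x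
  proof
    fix i
    show "pull b s (glue x) i = ?r s (x s) i"
    proof (cases "i \<in> {1..card (I s)}")
      case True
      have "b s i \<in> {1..N}" using b_site[OF True] sub by blast
      then show ?thesis using sp_eq[OF b_site[OF True]] by (simp add: pull_def glue_def relabel_def)
    qed (auto simp: pull_def relabel_def)
  qed
  have mp: "pull b s \<in> measurable BB (Pi\<^sub>M {1..card (I s)} (\<lambda>_. borel))" for s
    unfolding pull_def
    by (intro measurable_restrict measurable_component_singleton) (use b_site[of _ s] sub[of s] in blast)
  have mF: "(\<lambda>\<sigma>. F s (pull b s \<sigma>)) \<in> borel_measurable BB" for s
    by (rule measurable_compose[OF mp m])
  then have mPF: "(\<lambda>\<sigma>. \<Prod>s\<in>UNIV. F s (pull b s \<sigma>)) \<in> borel_measurable BB" by (rule borel_measurable_prod)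
  have "(LINT \<sigma>|config k N I. (\<Prod>s\<in>UNIV. F s (pull b s \<sigma>))) = (LINT \<sigma>|distr ?P BB glue. (\<Prod>s\<in>UNIV. F s (pull b s \<sigma>)))"
    using mPF by (subst integral_config_AE) (simp_all only: Spherical config_measure_spherical measurable_distr_eq1)
  also have "\<dots> = (LINT x|?P. (\<Prod>s\<in>UNIV. F s (?r s (x s))))"
    unfolding pg[symmetric] by (rule integral_distr[OF meas_glue mPF])
  also have "\<dots> = (\<Prod>s\<in>UNIV. (LINT y|sphere_measure (I s). F s (?r s y)))"
  proof (rule product_integral_prod)
    fix s
    have "integrable (distr (sphere_measure (I s)) (Pi\<^sub>M {1..card (I s)} (\<lambda>_. borel)) (?r s)) (F s)"
      unfolding d using int[of s] by (simp add: block_measure_def Spherical)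
    then show "integrable (sphere_measure (I s)) (\<lambda>y. F s (?r s y))" by (subst (asm) integrable_distr_eq[OF r m])
  qed simp
  also have "\<dots> = (\<Prod>s\<in>UNIV. (LINT \<tau>|sphere_measure {1..card (I s)}. F s \<tau>))"
    unfolding d[symmetric] by (intro prod.cong refl integral_distr[symmetric] r m)
  finally show ?thesis by (simp add: block_measure_def Spherical)
qed

end

end

subsection \<open>From moments to the mean logarithm\<close>

context gibbs
begin

text \<open>The two-replica term is at most \<open>V1 - V0\<close> because <w>^2 \<le> <w^2>. Its
  coefficient a (1 - a) / 2 is small for a close to 1, so switching on a weak field loses little
  against the annealed rate.\<close>

lemma flow_up:
  assumes u: "\<And>j. j \<in> J \<Longrightarrow> 0 \<le> u0 j" "\<And>j. j \<in> J \<Longrightarrow> u0 j \<le> u1 j"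
    and V: "\<And>\<sigma>. \<sigma> \<in> space \<nu> \<Longrightarrow> (\<Sum>j\<in>J. u0 j * (w j \<sigma>)\<^sup>2) = V0" "\<And>\<sigma>. \<sigma> \<in> space \<nu> \<Longrightarrow> (\<Sum>j\<in>J. u1 j * (w j \<sigma>)\<^sup>2) = V1"
    and a: "0 \<le> a" "a \<le> 1"
  shows "pm a u0 * exp (a * (V1 - V0) / 2 - a * (1 - a) / 2 * (V1 - V0)) \<le> pm a u1"
proof (rule flow_inequality[OF u(1) _ V a])
  show "0 \<le> u1 j" if "j \<in> J" for j using u[OF that] by linarith
  fix t :: real
  let ?s = "scale (mix u0 u1 t)"
  have le: "(\<Sum>j\<in>J. (u1 j - u0 j) * (gav \<nu> J w (w j) x)\<^sup>2) \<le> V1 - V0" for x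
  proof -
    have "(\<Sum>j\<in>J. (u1 j - u0 j) * (gav \<nu> J w (w j) x)\<^sup>2) \<le> (\<Sum>j\<in>J. (u1 j - u0 j) * gav \<nu> J w (\<lambda>\<sigma>. (w j \<sigma>)\<^sup>2) x)"
      using u gav_square_le by (intro sum_mono mult_left_mono) auto
    also have "\<dots> = gav \<nu> J w (\<lambda>\<sigma>. \<Sum>j\<in>J. (u1 j - u0 j) * (w j \<sigma>)\<^sup>2) x"
      by (rule gav_sum[where c = "C\<^sup>2"]) (use w_sq_bound in auto)
    also have "\<dots> = V1 - V0" by (rule gav_const) (simp add: left_diff_distrib sum_subtractf V)
    finally show ?thesis .
  qed
  interpret g2: gibbs2 \<nu> \<nu> J w w C a 0 by (rule gibbs2_self)
  have gb: "\<bar>(gav \<nu> J w (w j) x)\<^sup>2\<bar> \<le> C\<^sup>2" if "j \<in> J" for j x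
    using gav_bound[OF meas_w[OF that] bound_w[OF that]] C_nonneg by (simp add: abs_le_square_iff[symmetric])
  note [measurable] = meas_gav_scale
  have "integrable (gauss J) (\<lambda>x. g2.F (?s x) * (\<Sum>j\<in>J. (u1 j - u0 j) * (gav \<nu> J w (w j) (?s x))\<^sup>2))"
  proof (rule g2.integrable_F_scale_mult[where c = "\<Sum>j\<in>J. \<bar>u1 j - u0 j\<bar> * C\<^sup>2"])
    fix x
    show "\<bar>\<Sum>j\<in>J. (u1 j - u0 j) * (gav \<nu> J w (w j) (?s x))\<^sup>2\<bar> \<le> (\<Sum>j\<in>J. \<bar>u1 j - u0 j\<bar> * C\<^sup>2)"
      by (rule order_trans[OF sum_abs], rule sum_mono) (use gb in \<open>auto simp: abs_mult intro!: mult_left_mono\<close>)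
  qed measurable
  then have "(LINT x|gauss J. exp (a * ln (Z (?s x))) * (\<Sum>j\<in>J. (u1 j - u0 j) * (gav \<nu> J w (w j) (?s x))\<^sup>2))
    \<le> (LINT x|gauss J. exp (a * ln (Z (?s x))) * (V1 - V0))"
    using integrable_pm[of a "mix u0 u1 t"] le by (intro integral_mono mult_left_mono) (auto simp: g2.F_def)
  then show "(LINT x|gauss J. exp (a * ln (Z (?s x))) * (\<Sum>j\<in>J. (u1 j - u0 j) * (gav \<nu> J w (w j) (?s x))\<^sup>2)) \<le> (V1 - V0) * pm a (mix u0 u1 t)"
    by (simp add: pm_def mult.commute)
qed

text \<open>With decreasing variances the two-replica term is nonpositive, so switching the field
  off loses nothing against the annealed rate.\<close>

lemma flow_down:
  assumes u: "\<And>j. j \<in> J \<Longrightarrow> 0 \<le> u1 j" "\<And>j. j \<in> J \<Longrightarrow> u1 j \<le> u0 j"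
    and V: "\<And>\<sigma>. \<sigma> \<in> space \<nu> \<Longrightarrow> (\<Sum>j\<in>J. u0 j * (w j \<sigma>)\<^sup>2) = V0" "\<And>\<sigma>. \<sigma> \<in> space \<nu> \<Longrightarrow> (\<Sum>j\<in>J. u1 j * (w j \<sigma>)\<^sup>2) = V1"
    and a: "0 \<le> a" "a \<le> 1"
  shows "pm a u0 * exp (a * (V1 - V0) / 2) \<le> pm a u1"
proof -
  have "pm a u0 * exp (a * (V1 - V0) / 2 - a * (1 - a) / 2 * 0) \<le> pm a u1"
  proof (rule flow_inequality[OF _ u(1) V a])
    show "0 \<le> u0 j" if "j \<in> J" for j using u[OF that] by linarith
    fix t :: real
    let ?s = "scale (mix u0 u1 t)"
    have "(\<Sum>j\<in>J. (u1 j - u0 j) * (gav \<nu> J w (w j) x)\<^sup>2) \<le> 0" for x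
      using u by (intro sum_nonpos mult_nonpos_nonneg) auto
    then have "0 \<le> (LINT x|gauss J. - (exp (a * ln (Z (?s x))) * (\<Sum>j\<in>J. (u1 j - u0 j) * (gav \<nu> J w (w j) (?s x))\<^sup>2)))"
      by (intro integral_nonneg_AE AE_I2) (simp add: mult_nonneg_nonpos)
    then show "(LINT x|gauss J. exp (a * ln (Z (?s x))) * (\<Sum>j\<in>J. (u1 j - u0 j) * (gav \<nu> J w (w j) (?s x))\<^sup>2)) \<le> 0 * pm a (mix u0 u1 t)"
      by simp
  qed
  then show ?thesis by simp
qed

text \<open>The annealed value: Fubini and the exponential moment of a Gaussian of variance
  \<open>V\<close>.\<close>

lemma pm_one:
  assumes pr: "prob_space \<nu>" and u: "\<And>j. j \<in> J \<Longrightarrow> 0 \<le> u j"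
    and V: "\<And>\<sigma>. \<sigma> \<in> space \<nu> \<Longrightarrow> (\<Sum>j\<in>J. u j * (w j \<sigma>)\<^sup>2) = V"
  shows "pm 1 u = exp (V / 2)"
proof -
  interpret P: prob_space "gauss J" by (rule prob_space_gauss)
  interpret Q: prob_space \<nu> by (rule pr)
  interpret PP: pair_sigma_finite "gauss J" \<nu> ..
  define U where "U = l1 J (\<lambda>j. sqrt (u j))"
  have U: "l1 J (scale u x) \<le> U * l1 J x" for x
    by (rule l1_scale_le) (use abs_le_l1[OF finite_J, of _ "\<lambda>j. sqrt (u j)"] in \<open>simp add: U_def\<close>)
  have i: "integrable (gauss J \<Otimes>\<^sub>M \<nu>) (\<lambda>(x, \<sigma>). exp (energy J w (scale u x) \<sigma>))"
  proof (rule integrable_pair_growth[where K = 1 and D = "C * U"])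
    fix x \<sigma> assume "\<sigma> \<in> space \<nu>"
    from energy_bound[OF this, of "scale u x"] mult_left_mono[OF U[of x] C_nonneg]
    show "\<bar>exp (energy J w (scale u x) \<sigma>)\<bar> \<le> 1 * exp (C * U * l1 J x)" by (simp add: mult.assoc)
  qed measurable
  have "pm 1 u = (LINT x|gauss J. LINT \<sigma>|\<nu>. exp (energy J w (scale u x) \<sigma>))"
    unfolding pm_def by (simp add: pf_pos) (simp add: pf_def)
  also have "\<dots> = (LINT \<sigma>|\<nu>. LINT x|gauss J. exp (energy J w (scale u x) \<sigma>))"
    by (rule PP.Fubini_integral[symmetric]) (rule i)
  also have "\<dots> = (LINT \<sigma>|\<nu>. exp (V / 2))"
  proof (intro Bochner_Integration.integral_cong refl)
    fix \<sigma> assume s: "\<sigma> \<in> space \<nu>"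
    have e: "(\<Sum>j\<in>J. sqrt (u j) * w j \<sigma> * x j) = energy J w (scale u x) \<sigma>" for x
      unfolding energy_def scale_def by (intro sum.cong refl) simp
    have v: "(\<Sum>j\<in>J. (sqrt (u j) * w j \<sigma>)\<^sup>2) = V"
      unfolding V[OF s, symmetric] by (intro sum.cong refl) (simp add: power_mult_distrib u)
    show "(LINT x|gauss J. exp (energy J w (scale u x) \<sigma>)) = exp (V / 2)"
      using integral_gauss_shift[OF finite_J, of "\<lambda>_. 1" "\<lambda>j. sqrt (u j) * w j \<sigma>"]
      by (simp add: e v P.prob_space)
  qed
  finally show ?thesis by (simp add: Q.prob_space)
qed

text \<open>Log-convexity of the moments transfers a lower bound on the moment of order \<open>1 - h\<close> to small orders,
  where the moment is controlled by the mean of the logarithm.\<close>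

lemma mean_ln_lower:
  assumes pr: "prob_space \<nu>" and u: "\<And>j. j \<in> J \<Longrightarrow> 0 \<le> u j"
    and V: "\<And>\<sigma>. \<sigma> \<in> space \<nu> \<Longrightarrow> (\<Sum>j\<in>J. u j * (w j \<sigma>)\<^sup>2) = V"
    and b: "0 < b" "b < 1" and h: "0 < h" "h < 1 - b" and \<eta>: "0 \<le> \<eta>"
    and low: "exp ((1 - h) * V / 2 - \<eta>) \<le> pm (1 - h) u"
  shows "V / 2 - \<eta> / (h * b) - b * V \<le> (LINT x|gauss J. ln (Z (scale u x)))"
proof -
  interpret P: prob_space "gauss J" by (rule prob_space_gauss)
  define m where "m = (LINT x|gauss J. ln (Z (scale u x)))"
  \<comment> \<open>Chosen so that 1 - h = \<theta> b + (1 - \<theta>): order \<open>1 - h\<close>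
    lies between the small order \<open>b\<close> and order 1, whose moment is known
    exactly.\<close>
  define \<theta> where "\<theta> = h / (1 - b)"
  have \<theta>: "0 < \<theta>" "\<theta> < 1" "\<theta> * (1 - b) = h" using b h by (auto simp: \<theta>_def)
  define A where "A = ln (pm b u)"
  have eA: "exp A = pm b u" using pm_pos[of b u] by (simp add: A_def)
  \<comment> \<open>Hoelder's inequality, by integrating the convexity of exp after both moments are
    normalized to 1.\<close>
  have "pm (1 - h) u \<le> exp (\<theta> * A + (1 - \<theta>) * (V / 2))"
  proof -
    let ?L = "\<lambda>x. ln (Z (scale u x))"
    let ?k = "exp (\<theta> * A + (1 - \<theta>) * (V / 2))"
    have "pm (1 - h) u \<le> (LINT x|gauss J. ?k * (\<theta> * (exp (b * ?L x) / exp A) + (1 - \<theta>) * (exp (1 * ?L x) / exp (V / 2))))"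
      unfolding pm_def
    proof (rule integral_mono)
      show "integrable (gauss J) (\<lambda>x. exp ((1 - h) * ?L x))" by (rule integrable_pm)
      show "integrable (gauss J) (\<lambda>x. ?k * (\<theta> * (exp (b * ?L x) / exp A) + (1 - \<theta>) * (exp (1 * ?L x) / exp (V / 2))))"
        by (intro integrable_mult_right Bochner_Integration.integrable_add integrable_divide integrable_pm)
      fix x
      have cvx: "exp (\<theta> * p + (1 - \<theta>) * q) \<le> \<theta> * exp p + (1 - \<theta>) * exp q" for p q :: real
        using convex_onD[OF convex_on_exp[of 1], of "1 - \<theta>" p q] \<theta> by (simp add: algebra_simps)
      have hb: "1 - h = \<theta> * b + (1 - \<theta>)" using \<theta>(3) by (simp add: algebra_simps)
      have "exp ((1 - h) * ?L x) = ?k * exp (\<theta> * (b * ?L x - A) + (1 - \<theta>) * (?L x - V / 2))"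
        unfolding exp_add[symmetric] hb by (simp add: algebra_simps)
      also have "\<dots> \<le> ?k * (\<theta> * exp (b * ?L x - A) + (1 - \<theta>) * exp (?L x - V / 2))"
        by (intro mult_left_mono cvx) auto
      finally show "exp ((1 - h) * ?L x) \<le> ?k * (\<theta> * (exp (b * ?L x) / exp A) + (1 - \<theta>) * (exp (1 * ?L x) / exp (V / 2)))"
        by (simp add: exp_diff)
    qed
    also have "\<dots> = ?k * (\<theta> * (pm b u / exp A) + (1 - \<theta>) * (pm 1 u / exp (V / 2)))"
      unfolding pm_def using integrable_pm[of b u] integrable_pm[of 1 u] by simp
    also have "\<dots> = ?k" using eA pm_pos[of b u] by (simp add: pm_one[OF pr u V])
    finally show ?thesis .
  qed
  with low have "exp ((1 - h) * V / 2 - \<eta>) \<le> exp (\<theta> * A + (1 - \<theta>) * (V / 2))" by linarith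
  then have 1: "(1 - h) * V / 2 - \<eta> \<le> \<theta> * A + (1 - \<theta>) * (V / 2)" by simp
  \<comment> \<open>At order \<open>b\<close> concentration errs by b^2 V. Dividing by
    \<open>b\<close> to recover the mean logarithm leaves the term b V of the conclusion.\<close>
  have "pm b u \<le> exp (b\<^sup>2 * V + b * m)" unfolding m_def by (rule pm_concentration[OF u]) (simp_all add: V)
  then have A: "A \<le> b\<^sup>2 * V + b * m" unfolding eA[symmetric] by simp
  have "h = \<theta> - \<theta> * b" using \<theta>(3) by (simp add: algebra_simps)
  with 1 have "\<theta> * b * V / 2 - \<eta> \<le> \<theta> * A" by (simp add: field_simps)
  also have "\<dots> \<le> \<theta> * (b\<^sup>2 * V + b * m)" using A \<theta> by (intro mult_left_mono) auto
  finally have "\<theta> * b * (V / 2 - b * V - m) \<le> \<eta>" by (simp add: algebra_simps power2_eq_square)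
  then have 2: "V / 2 - b * V - m \<le> \<eta> / (\<theta> * b)" using \<theta> b by (simp add: pos_le_divide_eq mult.commute)
  have "h \<le> \<theta>" using \<theta> b by (smt (verit) mult_left_le)
  then have "\<eta> / (\<theta> * b) \<le> \<eta> / (h * b)" using h b \<eta> by (intro divide_left_mono mult_right_mono) auto
  with 2 show ?thesis unfolding m_def by linarith
qed

end

subsection \<open>Multi-indices\<close>

definition words :: "nat \<Rightarrow> 's list set" where
  "words P = {ss. 1 \<le> length ss \<and> length ss \<le> P}"

definition idx :: "('s \<Rightarrow> nat set) \<Rightarrow> nat \<Rightarrow> nat list set" where
  "idx I P = (\<Union>ss\<in>words P. listset (map I ss))"

definition spin :: "nat list \<Rightarrow> (nat \<Rightarrow> real) \<Rightarrow> real" where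
  "spin js \<sigma> = prod_list (map \<sigma> js)"

text \<open>The variance of a coupling depends only on the species of its sites.\<close>

definition weight :: "('s \<Rightarrow> nat set) \<Rightarrow> ('s list \<Rightarrow> real) \<Rightarrow> nat list \<Rightarrow> real" where
  "weight I c js = c (map (species_of I) js)"

text \<open>The covariance polynomial: at the vector of overlaps it is the covariance of the
  truncated energies.\<close>

definition form :: "nat \<Rightarrow> ('s list \<Rightarrow> real) \<Rightarrow> ('s \<Rightarrow> real) \<Rightarrow> real" where
  "form P c x = (\<Sum>ss\<in>words P. c ss * prod_list (map x ss))"

lemma finite_words [simp]: "finite (words P :: 's::finite list set)"
  using finite_lists_length_le[of "UNIV :: 's set" P] by (rule rev_finite_subset) (auto simp: words_def)

lemma in_listset_iff: "js \<in> listset As \<longleftrightarrow> length js = length As \<and> (\<forall>n<length As. js ! n \<in> As ! n)"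
proof (induction As arbitrary: js)
  case (Cons A As)
  show ?case
  proof (cases js)
    case (Cons j js')
    then show ?thesis using Cons.IH[of js'] by (auto simp: set_Cons_def less_Suc_eq_0_disj nth_Cons split: nat.splits)
  qed (auto simp: set_Cons_def)
qed simp

lemma finite_listset: "(\<And>A. A \<in> set As \<Longrightarrow> finite A) \<Longrightarrow> finite (listset As)"
proof (induction As)
  case (Cons A As)
  have "listset (A # As) = (\<lambda>(x, xs). x # xs) ` (A \<times> listset As)" by (auto simp: set_Cons_def)
  then show ?case using Cons by simp
qed simp

lemma sum_listset_prod:
  fixes f :: "'b \<Rightarrow> real"
  shows "(\<Sum>js\<in>listset (map I ss). prod_list (map f js)) = prod_list (map (\<lambda>s. \<Sum>i\<in>I s. f i) ss)"
proof (induction ss)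
  case (Cons s ss)
  have "listset (map I (s # ss)) = (\<lambda>(x, xs). x # xs) ` (I s \<times> listset (map I ss))" by (auto simp: set_Cons_def)
  then have "(\<Sum>js\<in>listset (map I (s # ss)). prod_list (map f js)) = (\<Sum>(x, xs)\<in>I s \<times> listset (map I ss). f x * prod_list (map f xs))"
    by (simp add: sum.reindex inj_on_def case_prod_beta)
  also have "\<dots> = (\<Sum>x\<in>I s. f x) * (\<Sum>js\<in>listset (map I ss). prod_list (map f js))"
    by (simp add: sum.cartesian_product[symmetric] sum_distrib_left sum_distrib_right) (rule sum.swap)
  finally show ?case by (simp add: Cons.IH)
qed simp

lemma prod_list_mult: "prod_list (map f xs) * prod_list (map g xs) = prod_list (map (\<lambda>x. f x * g x :: real) xs)"
  by (induction xs) (auto simp: algebra_simps)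

lemma prod_list_abs_le:
  assumes "\<And>x. x \<in> set xs \<Longrightarrow> \<bar>f x\<bar> \<le> (g x :: real)"
  shows "\<bar>prod_list (map f xs)\<bar> \<le> prod_list (map g xs)"
  using assms
proof (induction xs)
  case (Cons a xs)
  then have "\<bar>f a\<bar> \<le> g a" "\<bar>prod_list (map f xs)\<bar> \<le> prod_list (map g xs)" by auto
  then show ?case by (simp add: abs_mult mult_mono')
qed simp

lemma prod_list_pos_mono:
  assumes "\<And>x. x \<in> set xs \<Longrightarrow> 0 \<le> f x \<and> f x \<le> (g x :: real)"
  shows "prod_list (map f xs) \<le> prod_list (map g xs)"
  using prod_list_abs_le[of xs f g] assms by (auto simp: abs_le_iff)

lemma form_mono:
  assumes "\<And>ss. ss \<in> words P \<Longrightarrow> 0 \<le> c ss" "\<And>s. \<bar>x s\<bar> \<le> y s"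
  shows "\<bar>form P c x\<bar> \<le> form P (c :: 's::finite list \<Rightarrow> real) y"
  unfolding form_def using assms
  by (intro order_trans[OF sum_abs] sum_mono) (auto simp: abs_mult intro!: mult_left_mono prod_list_abs_le)

context partition
begin

lemma idx_eq: "idx I P = {js. js \<noteq> [] \<and> length js \<le> P \<and> set js \<subseteq> {1..N}}"
proof (intro equalityI subsetI)
  fix js assume "js \<in> idx I P"
  then obtain ss where ss: "1 \<le> length ss" "length ss \<le> P" "length js = length ss" "\<forall>n<length ss. js ! n \<in> I (ss ! n)"
    by (auto simp: idx_def words_def in_listset_iff)
  have "set js \<subseteq> {1..N}"
  proof
    fix i assume "i \<in> set js"
    then obtain n where "n < length js" "js ! n = i" by (auto simp: in_set_conv_nth)
    then have "i \<in> I (ss ! n)" using ss by auto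
    then show "i \<in> {1..N}" using sub by blast
  qed
  then show "js \<in> {js. js \<noteq> [] \<and> length js \<le> P \<and> set js \<subseteq> {1..N}}" using ss by auto
next
  fix js assume js: "js \<in> {js. js \<noteq> [] \<and> length js \<le> P \<and> set js \<subseteq> {1..N}}"
  have "js \<in> listset (map I (map (species_of I) js))"
  proof -
    have "js ! n \<in> I (species_of I (js ! n))" if "n < length js" for n
      using js that by (intro sp_in) (auto dest!: nth_mem)
    then show ?thesis by (simp add: in_listset_iff)
  qed
  moreover have "map (species_of I) js \<in> words P" using js by (cases js) (auto simp: words_def)
  ultimately show "js \<in> idx I P" unfolding idx_def by blast
qed

lemma species_listset: "js \<in> listset (map I ss) \<Longrightarrow> map (species_of I) js = ss"
  by (rule nth_equalityI) (auto simp: in_listset_iff sp_eq)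

lemma finite_idx [simp]: "finite (idx I P)"
  unfolding idx_def by (intro finite_UN_I finite_words finite_listset) auto

lemma sum_idx:
  fixes f :: "nat list \<Rightarrow> real"
  shows "(\<Sum>js\<in>idx I P. f js) = (\<Sum>ss\<in>words P. \<Sum>js\<in>listset (map I ss). f js)"
  unfolding idx_def
proof (rule sum.UNION_disjoint)
  show "\<forall>ss\<in>words P. finite (listset (map I ss))" by (intro ballI finite_listset) auto
  show "\<forall>ss\<in>words P. \<forall>ts\<in>words P. ss \<noteq> ts \<longrightarrow> listset (map I ss) \<inter> listset (map I ts) = {}"
    using species_listset by blast
qed simp

text \<open>Not divided by the number of sites, which matches coefficients that already contain the
  powers of \<open>N\<close>.\<close>

definition overlap :: "(nat \<Rightarrow> real) \<Rightarrow> (nat \<Rightarrow> real) \<Rightarrow> 's \<Rightarrow> real" where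
  "overlap \<sigma> \<tau> s = (\<Sum>i\<in>I s. \<sigma> i * \<tau> i)"

text \<open>The sum over the sites within a word of species factorizes. From here on replicas enter
  only through polynomials in finitely many overlaps.\<close>

lemma sum_weight_spin: "(\<Sum>js\<in>idx I P. weight I c js * (spin js \<sigma> * spin js \<tau>)) = form P c (overlap \<sigma> \<tau>)"
proof -
  have "(\<Sum>js\<in>idx I P. weight I c js * (spin js \<sigma> * spin js \<tau>)) = (\<Sum>ss\<in>words P. \<Sum>js\<in>listset (map I ss). c ss * prod_list (map (\<lambda>i. \<sigma> i * \<tau> i) js))"
    unfolding sum_idx by (intro sum.cong refl) (simp add: weight_def species_listset spin_def prod_list_mult)
  then show ?thesis by (simp add: form_def sum_distrib_left[symmetric] sum_listset_prod overlap_def[abs_def])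
qed

lemma overlap_self: "\<sigma> \<in> config_space k N I \<Longrightarrow> overlap \<sigma> \<sigma> s = card (I s)"
  using config_sq_sum[of \<sigma> k s] by (simp add: overlap_def power2_eq_square)

lemma overlap_bound:
  assumes "\<sigma> \<in> config_space k N I" "\<tau> \<in> config_space k N I"
  shows "\<bar>overlap \<sigma> \<tau> s\<bar> \<le> card (I s)"
proof -
  have "\<bar>overlap \<sigma> \<tau> s\<bar> \<le> (\<Sum>i\<in>I s. ((\<sigma> i)\<^sup>2 + (\<tau> i)\<^sup>2) / 2)"
    unfolding overlap_def
  proof (rule order_trans[OF sum_abs], rule sum_mono)
    fix i
    show "\<bar>\<sigma> i * \<tau> i\<bar> \<le> ((\<sigma> i)\<^sup>2 + (\<tau> i)\<^sup>2) / 2"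
      using zero_le_power2[of "\<bar>\<sigma> i\<bar> - \<bar>\<tau> i\<bar>"] by (simp add: power2_diff abs_mult)
  qed
  also have "\<dots> = card (I s)" using config_sq_sum[OF assms(1)] config_sq_sum[OF assms(2)]
    by (simp add: sum_divide_distrib[symmetric] sum.distrib)
  finally show ?thesis .
qed

lemma weight_sq_sum: "\<sigma> \<in> config_space k N I \<Longrightarrow> (\<Sum>js\<in>idx I P. weight I c js * (spin js \<sigma>)\<^sup>2) = form P c (\<lambda>s. card (I s))"
proof -
  assume "\<sigma> \<in> config_space k N I"
  then have "overlap \<sigma> \<sigma> = (\<lambda>s. card (I s))" using overlap_self by (intro ext) blast
  then show ?thesis using sum_weight_spin[where c = c and P = P and \<sigma> = \<sigma> and \<tau> = \<sigma>] by (simp only: power2_eq_square)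
qed

lemma spin_bound:
  assumes "\<sigma> \<in> config_space k N I" "js \<in> idx I P"
  shows "\<bar>spin js \<sigma>\<bar> \<le> real N ^ P"
proof -
  have js: "js \<noteq> []" "length js \<le> P" "set js \<subseteq> {1..N}" using assms(2) by (auto simp: idx_eq)
  then have N: "1 \<le> N" by (cases js) auto
  have "\<bar>spin js \<sigma>\<bar> \<le> prod_list (map (\<lambda>_. real N) js)"
    unfolding spin_def using config_bound[OF assms(1)] js(3) by (intro prod_list_abs_le) blast
  also have "\<dots> = real N ^ length js" by (induction js) auto
  also have "\<dots> \<le> real N ^ P" using N js by (intro power_increasing) auto
  finally show ?thesis .
qed

lemma meas_spin: "js \<in> idx I P \<Longrightarrow> spin js \<in> borel_measurable (config k N I)"
proof -
  assume "js \<in> idx I P"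
  then have "set js \<subseteq> {1..N}" by (simp add: idx_eq)
  then show ?thesis
  proof (induction js)
    case (Cons j js)
    then have "(\<lambda>\<sigma>. \<sigma> j * spin js \<sigma>) \<in> borel_measurable (config k N I)" by (intro borel_measurable_times meas_config) auto
    then show ?case by (simp add: spin_def[abs_def])
  qed (simp add: spin_def[abs_def])
qed

lemma gibbs_config: "gibbs (config k N I) (idx I P) spin (real N ^ P)"
proof -
  interpret prob_space "config k N I" by (rule prob_space_config)
  show ?thesis
  proof
    show "spin js \<in> borel_measurable (config k N I)" if "js \<in> idx I P" for js by (rule meas_spin[OF that])
    show "\<bar>spin js \<sigma>\<bar> \<le> real N ^ P" if "js \<in> idx I P" "\<sigma> \<in> space (config k N I)" for js \<sigma>
      by (rule spin_bound[OF _ that(1)]) (use that in \<open>simp add: space_config\<close>)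
  qed (simp_all add: prob_space)
qed

lemma overlap_flip: "overlap \<sigma> (flip \<epsilon> \<tau>) s = \<epsilon> s * overlap \<sigma> \<tau> s"
  unfolding overlap_def sum_distrib_left
proof (rule sum.cong[OF refl])
  fix i assume i: "i \<in> I s"
  then have "i \<in> {1..N}" using sub by blast
  then show "\<sigma> i * flip \<epsilon> \<tau> i = \<epsilon> s * (\<sigma> i * \<tau> i)" using sp_eq[OF i] by (simp add: flip_def)
qed

lemma spin_flip:
  assumes "js \<in> idx I P"
  shows "spin js (flip \<epsilon> \<tau>) = prod_list (map (\<lambda>i. \<epsilon> (species_of I i)) js) * spin js \<tau>"
proof -
  have "set js \<subseteq> {1..N}" using assms by (simp add: idx_eq)
  then have "map (flip \<epsilon> \<tau>) js = map (\<lambda>i. \<epsilon> (species_of I i) * \<tau> i) js" by (auto simp: flip_def subset_eq)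
  then show ?thesis unfolding spin_def prod_list_mult by (simp only:)
qed

end

lemma prod_list_sign:
  "(\<And>x. x \<in> set xs \<Longrightarrow> f x = 1 \<or> f x = (-1::real)) \<Longrightarrow> prod_list (map f xs) = 1 \<or> prod_list (map f xs) = -1"
proof (induction xs)
  case (Cons a xs)
  then show ?case using Cons.prems[of a] by force
qed simp

lemma form_mix: "form P (mix c0 c1 t) x = (1 - t) * form P c0 x + t * form P c1 x"
  unfolding form_def mix_def by (simp add: sum_distrib_left sum.distrib[symmetric] algebra_simps)

lemma weight_mix: "mix (weight I c0) (weight I c1) t = weight I (mix c0 c1 t)"
  by (simp add: fun_eq_iff mix_def weight_def)

section \<open>Sign patterns of overlaps and the gap created by the field\<close>

definition signs :: "('s \<Rightarrow> real) set" where
  "signs = UNIV \<rightarrow>\<^sub>E {1, -1}"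

lemma finite_signs [simp]: "finite (signs :: ('s::finite \<Rightarrow> real) set)"
  unfolding signs_def by (rule finite_PiE) auto

lemma signs_iff: "\<epsilon> \<in> signs \<longleftrightarrow> (\<forall>s. \<epsilon> s = 1 \<or> \<epsilon> s = -1)"
  by (auto simp: signs_def PiE_iff)

text \<open>At nonnegative overlaps no monomial gains from a change of signs, and the linear
  monomial of a flipped species loses exactly \<open>2 * c [s] * R s\<close>. This is the only place
  where the field pays off.\<close>

lemma form_sign_gap:
  fixes c :: "'s::finite list \<Rightarrow> real"
  assumes P: "1 \<le> P" and c: "\<And>ss. ss \<in> words P \<Longrightarrow> 0 \<le> c ss" and \<epsilon>: "\<And>s. \<epsilon> s = 1 \<or> \<epsilon> s = -1"
    and R: "\<And>s. 0 \<le> R s" and s: "\<epsilon> s = -1"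
  shows "form P c (\<lambda>s. \<epsilon> s * R s) \<le> form P c R - 2 * c [s] * R s"
proof -
  have s1: "[s] \<in> words P" using P by (simp add: words_def)
  have pos: "0 \<le> c ss * (prod_list (map R ss) - prod_list (map (\<lambda>s. \<epsilon> s * R s) ss))" if "ss \<in> words P" for ss
  proof -
    have ab: "\<bar>\<epsilon> s * R s\<bar> \<le> R s" for s using \<epsilon>[of s] R[of s] by auto
    have "\<bar>prod_list (map (\<lambda>s. \<epsilon> s * R s) ss)\<bar> \<le> prod_list (map R ss)" by (rule prod_list_abs_le) (rule ab)
    then show ?thesis using c[OF that] by (intro mult_nonneg_nonneg) auto
  qed
  have "c [s] * (prod_list (map R [s]) - prod_list (map (\<lambda>s. \<epsilon> s * R s) [s])) \<le> (\<Sum>ss\<in>words P. c ss * (prod_list (map R ss) - prod_list (map (\<lambda>s. \<epsilon> s * R s) ss)))"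
    by (rule member_le_sum[OF s1]) (use pos in auto)
  then show ?thesis using s by (simp add: form_def right_diff_distrib sum_subtractf algebra_simps)
qed

context partition
begin

lemma meas_overlap [measurable]: "(\<lambda>(\<sigma>, \<tau>). overlap \<sigma> \<tau> s) \<in> borel_measurable (config k N I \<Otimes>\<^sub>M config k N I)"
  unfolding overlap_def case_prod_beta'
proof (rule borel_measurable_sum)
  fix i assume "i \<in> I s"
  then have "i \<in> {1..N}" using sub by blast
  then have m: "(\<lambda>\<sigma>. \<sigma> i) \<in> borel_measurable (config k N I)" by (rule meas_config)
  show "(\<lambda>x. fst x i * snd x i) \<in> borel_measurable (config k N I \<Otimes>\<^sub>M config k N I)"
    using measurable_compose[OF measurable_fst m] measurable_compose[OF measurable_snd m] by (rule borel_measurable_times)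
qed

text \<open>Pairs after repair: all overlaps are nonnegative, and some species reversed by
  \<epsilon> has overlap at least \<open>r\<close> per site, so that before the repair it was at
  most -r per site.\<close>

definition flip_region :: "spin_type \<Rightarrow> real \<Rightarrow> ('s \<Rightarrow> real) \<Rightarrow> ((nat \<Rightarrow> real) \<times> (nat \<Rightarrow> real)) set" where
  "flip_region k r \<epsilon> = {z \<in> space (config k N I \<Otimes>\<^sub>M config k N I).
     (\<forall>s\<in>UNIV. 0 \<le> (\<lambda>(\<sigma>, \<tau>). overlap \<sigma> \<tau> s) z) \<and> (\<exists>s\<in>{s. \<epsilon> s = -1}. r * card (I s) \<le> (\<lambda>(\<sigma>, \<tau>). overlap \<sigma> \<tau> s) z)}"

lemma flip_region_sets [measurable]: "flip_region k r \<epsilon> \<in> sets (config k N I \<Otimes>\<^sub>M config k N I)"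
  unfolding flip_region_def
  by (intro sets.sets_Collect_conj sets.sets_Collect_finite_All' sets.sets_Collect_finite_Ex borel_measurable_le) auto

text \<open>In the gap \<open>2 * \<delta> * r * nm\<close> the linear coefficient is at least
  \<delta> and the overlap of the reversed species at least \<open>r\<close> times its size, which
  is at least \<open>nm\<close>.\<close>

lemma gibbs_flip_config:
  assumes P: "1 \<le> P" and c: "\<And>ss. ss \<in> words P \<Longrightarrow> 0 \<le> c ss" and \<delta>: "0 \<le> \<delta>" "\<And>s. \<delta> \<le> c [s]"
    and \<epsilon>: "\<epsilon> \<in> signs" and r: "0 < r" and nm: "0 < nm" "\<And>s. nm \<le> real (card (I s))"
  shows "gibbs_flip (config k N I) (idx I P) spin (real N ^ P) (weight I c) (form P c (\<lambda>s. card (I s))) (flip \<epsilon>)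
     (\<lambda>js. prod_list (map (\<lambda>i. \<epsilon> (species_of I i)) js)) (flip_region k r \<epsilon>) (2 * \<delta> * r * nm)"
proof -
  have eps: "\<epsilon> s = 1 \<or> \<epsilon> s = -1" for s using \<epsilon> by (simp add: signs_iff)
  interpret gibbs "config k N I" "idx I P" spin "real N ^ P" by (rule gibbs_config)
  interpret Q: prob_space "config k N I" by (rule prob_space_config)
  show ?thesis
  proof
    fix js assume js: "js \<in> idx I P"
    then have "map (species_of I) js \<in> words P" by (cases js) (auto simp: words_def idx_eq)
    then show "0 \<le> weight I c js" by (simp add: weight_def c)
    show "prod_list (map (\<lambda>i. \<epsilon> (species_of I i)) js) = 1 \<or> prod_list (map (\<lambda>i. \<epsilon> (species_of I i)) js) = -1"
      by (rule prod_list_sign) (rule eps)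
    show "spin js (flip \<epsilon> \<tau>) = prod_list (map (\<lambda>i. \<epsilon> (species_of I i)) js) * spin js \<tau>" for \<tau> by (rule spin_flip[OF js])
  next
    fix \<sigma> assume s: "\<sigma> \<in> space (config k N I)"
    then show "(\<Sum>js\<in>idx I P. weight I c js * (spin js \<sigma>)\<^sup>2) = form P c (\<lambda>s. card (I s))"
      using weight_sq_sum by (simp add: space_config)
    show "flip \<epsilon> (flip \<epsilon> \<sigma>) = \<sigma>" using flip_flip[OF eps] s by (simp add: space_config)
  next
    show "flip \<epsilon> \<in> measurable (config k N I) (config k N I)" by (rule meas_flip[OF eps])
    show "distr (config k N I) (config k N I) (flip \<epsilon>) = config k N I" by (rule distr_flip[OF eps])
    show "flip_region k r \<epsilon> \<in> sets (config k N I \<Otimes>\<^sub>M config k N I)" by (rule flip_region_sets)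
  next
    fix \<sigma> \<tau> assume B: "(\<sigma>, \<tau>) \<in> flip_region k r \<epsilon>"
    then have R: "0 \<le> overlap \<sigma> \<tau> s" for s by (simp add: flip_region_def)
    from B obtain s where s: "\<epsilon> s = -1" "r * card (I s) \<le> overlap \<sigma> \<tau> s" by (auto simp: flip_region_def)
    have "r * nm \<le> overlap \<sigma> \<tau> s" 
    proof -
      have "r * nm \<le> r * real (card (I s))" using nm(2)[of s] r by (intro mult_left_mono) auto
      then show ?thesis using s(2) by linarith
    qed
    moreover have "0 \<le> r * nm" using r nm(1) by simp
    ultimately have "\<delta> * (r * nm) \<le> c [s] * overlap \<sigma> \<tau> s"
      using \<delta>(1) \<delta>(2)[of s] by (intro mult_mono) auto
    moreover have "(\<Sum>js\<in>idx I P. weight I c js * (spin js \<sigma> * spin js (flip \<epsilon> \<tau>))) = form P c (\<lambda>s. \<epsilon> s * overlap \<sigma> \<tau> s)"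
      unfolding sum_weight_spin overlap_flip[abs_def] ..
    moreover have "form P c (\<lambda>s. \<epsilon> s * overlap \<sigma> \<tau> s) \<le> form P c (overlap \<sigma> \<tau>) - 2 * c [s] * overlap \<sigma> \<tau> s"
      by (rule form_sign_gap[where \<epsilon> = \<epsilon> and R = "overlap \<sigma> \<tau>"]) (use P c eps R s in auto)
    ultimately show "(\<Sum>js\<in>idx I P. weight I c js * (spin js \<sigma> * spin js (flip \<epsilon> \<tau>)))
       \<le> (\<Sum>js\<in>idx I P. weight I c js * (spin js \<sigma> * spin js \<tau>)) - 2 * \<delta> * r * nm"
      unfolding sum_weight_spin by (simp add: mult.assoc)
  qed
qed

abbreviation "moment k P \<equiv> gibbs.pm (config k N I) (idx I P) spin"

lemma weight_nonneg:
  assumes "\<And>ss. ss \<in> words P \<Longrightarrow> 0 \<le> c ss" "js \<in> idx I P"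
  shows "0 \<le> weight I c js"
proof -
  have "map (species_of I) js \<in> words P" using assms(2) by (cases js) (auto simp: words_def idx_eq)
  then show ?thesis by (simp add: weight_def assms)
qed

text \<open>The polynomial inequality \<open>diff\<close> is required only for normalized overlaps
  above -r. A pair violating this is moved into some \<open>flip_region\<close> by reversing all
  species of negative overlap; it costs at most \<open>V0 + V1\<close>, and the number of sign
  patterns does not depend on \<open>N\<close>.\<close>

theorem spin_flow:
  assumes P: "1 \<le> P" and c: "\<And>ss. ss \<in> words P \<Longrightarrow> 0 \<le> c0 ss" "\<And>ss. ss \<in> words P \<Longrightarrow> 0 \<le> c1 ss"
    and \<delta>: "0 \<le> \<delta>" "\<And>s. \<delta> \<le> c0 [s]" "\<And>s. \<delta> \<le> c1 [s]" and r: "0 < r" and nm: "0 < nm" "\<And>s. nm \<le> real (card (I s))"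
    and V: "V0 = form P c0 (\<lambda>s. card (I s))" "V1 = form P c1 (\<lambda>s. card (I s))" "V0 \<le> Vm" "V1 \<le> Vm"
    and h: "0 < h" "h \<le> 1" and e0: "0 \<le> e0"
    and diff: "\<And>x :: 's \<Rightarrow> real. (\<And>s. - r \<le> x s \<and> x s \<le> 1) \<Longrightarrow> form P c1 (\<lambda>s. card (I s) * x s) - form P c0 (\<lambda>s. card (I s) * x s) \<le> e0"
  shows "moment k P (1 - h) (weight I c0) * exp ((1 - h) * (V1 - V0) / 2 - (1 - h) * h / 2 *
      (e0 + (V0 + V1) * (card (signs :: ('s \<Rightarrow> real) set) * exp (- h * (2 * \<delta> * r * nm) + 9 * h\<^sup>2 * Vm))))
    \<le> moment k P (1 - h) (weight I c1)"
proof -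
  interpret gibbs "config k N I" "idx I P" spin "real N ^ P" by (rule gibbs_config)
  have V0: "\<bar>form P c0 (overlap \<sigma> \<tau>)\<bar> \<le> V0" and V1: "\<bar>form P c1 (overlap \<sigma> \<tau>)\<bar> \<le> V1"
    if "\<sigma> \<in> config_space k N I" "\<tau> \<in> config_space k N I" for \<sigma> \<tau>
    unfolding V using overlap_bound[OF that] c by (auto intro!: form_mono)
  have Vn: "0 \<le> V0" "0 \<le> V1"
    using form_mono[of P c0 "\<lambda>_. 0" "\<lambda>s. card (I s)"] form_mono[of P c1 "\<lambda>_. 0" "\<lambda>s. card (I s)"] c unfolding V by fastforce+
  show ?thesis
  proof (rule flow_with_flips[OF prob_space_config _ _ _ _ V(3,4) h finite_signs, where \<theta> = flip
      and sg = "\<lambda>\<epsilon> js. prod_list (map (\<lambda>i. \<epsilon> (species_of I i)) js)" and B = "flip_region k r"])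
    show "0 \<le> weight I c0 js" "0 \<le> weight I c1 js" if "js \<in> idx I P" for js
      using weight_nonneg[OF _ that] c by blast+
    show "(\<Sum>j\<in>idx I P. weight I c0 j * (spin j \<sigma>)\<^sup>2) = V0" "(\<Sum>j\<in>idx I P. weight I c1 j * (spin j \<sigma>)\<^sup>2) = V1"
      if "\<sigma> \<in> space (config k N I)" for \<sigma> using that weight_sq_sum by (auto simp: V space_config)
    fix \<epsilon> :: "'s \<Rightarrow> real" and t :: real assume \<epsilon>: "\<epsilon> \<in> signs" and t: "0 < t" "t < 1"
    have "\<delta> \<le> mix c0 c1 t [s]" for s
    proof -
      have "(1 - t) * \<delta> + t * \<delta> \<le> mix c0 c1 t [s]" unfolding mix_def using t \<delta> by (intro add_mono mult_left_mono) auto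
      then show ?thesis by (simp add: algebra_simps)
    qed
    moreover have "0 \<le> mix c0 c1 t ss" if "ss \<in> words P" for ss using c that t by (intro mix_nonneg) auto
    ultimately show "gibbs_flip (config k N I) (idx I P) spin (real N ^ P) (mix (weight I c0) (weight I c1) t)
       ((1 - t) * V0 + t * V1) (flip \<epsilon>) (\<lambda>js. prod_list (map (\<lambda>i. \<epsilon> (species_of I i)) js)) (flip_region k r \<epsilon>) (2 * \<delta> * r * nm)"
      unfolding weight_mix V form_mix[symmetric] using P \<delta>(1) \<epsilon> r nm by (intro gibbs_flip_config) auto
  next
    show "0 \<le> V0 + V1" using Vn by simp
    fix \<sigma> \<tau> assume "\<sigma> \<in> space (config k N I)" "\<tau> \<in> space (config k N I)"
    then have st: "\<sigma> \<in> config_space k N I" "\<tau> \<in> config_space k N I" by (auto simp: space_config)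
    let ?R = "overlap \<sigma> \<tau>"
    let ?S = "\<Sum>\<epsilon>\<in>signs. indicator (flip_region k r \<epsilon>) (\<sigma>, flip \<epsilon> \<tau>) :: real"
    have S0: "0 \<le> ?S" by (intro sum_nonneg) auto
    have eq: "(\<Sum>js\<in>idx I P. (weight I c1 js - weight I c0 js) * (spin js \<sigma> * spin js \<tau>)) = form P c1 ?R - form P c0 ?R"
      by (simp add: left_diff_distrib sum_subtractf sum_weight_spin)
    have n0: "0 < card (I s)" for s using less_le_trans[OF nm(1) nm(2)[of s]] by simp
    show "(\<Sum>js\<in>idx I P. (weight I c1 js - weight I c0 js) * (spin js \<sigma> * spin js \<tau>)) \<le> e0 + (V0 + V1) * ?S"
    proof (cases "\<forall>s. - r * card (I s) \<le> ?R s")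
      case True
      define x where "x s = ?R s / card (I s)" for s
      have "?R = (\<lambda>s. card (I s) * x s)" 
      proof
        fix s
        show "?R s = card (I s) * x s" using n0[of s] by (cases "I s = {}") (auto simp: x_def)
      qed
      moreover have "- r \<le> x s \<and> x s \<le> 1" for s
        using True[rule_format, of s] overlap_bound[OF st, of s] n0[of s] by (simp add: x_def pos_le_divide_eq pos_divide_le_eq)
      ultimately have "form P c1 ?R - form P c0 ?R \<le> e0" using diff[of x] by simp
      moreover have "0 \<le> (V0 + V1) * ?S" using S0 Vn by simp
      ultimately show ?thesis unfolding eq by linarith
    next
      case False
      then obtain s0 where s0: "?R s0 < - r * card (I s0)" by (auto simp: not_le)
      \<comment> \<open>The sign pattern of the pair itself: this flip replaces every overlap by its
        absolute value.\<close>
      define \<epsilon> where "\<epsilon> s = (if ?R s < 0 then -1 else 1 :: real)" for s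
      have \<epsilon>: "\<epsilon> \<in> signs" by (simp add: signs_iff \<epsilon>_def)
      have abs: "overlap \<sigma> (flip \<epsilon> \<tau>) s = \<bar>?R s\<bar>" for s by (simp add: overlap_flip \<epsilon>_def)
      have "r * card (I s0) > 0" using r n0[of s0] by simp
      then have neg: "?R s0 < 0" "r * card (I s0) \<le> \<bar>?R s0\<bar>" using s0 by auto
      have "flip \<epsilon> \<tau> \<in> config_space k N I" using st \<epsilon> by (intro flip_config) (auto simp: signs_iff)
      then have "(\<sigma>, flip \<epsilon> \<tau>) \<in> flip_region k r \<epsilon>"
        using st neg by (auto simp: flip_region_def space_pair_measure space_config abs \<epsilon>_def intro!: exI[of _ s0])
      then have "1 = (indicator (flip_region k r \<epsilon>) (\<sigma>, flip \<epsilon> \<tau>) :: real)" by simp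
      also have "\<dots> \<le> ?S" by (rule member_le_sum[OF \<epsilon>]) auto
      finally have "(V0 + V1) * 1 \<le> (V0 + V1) * ?S" using Vn by (intro mult_left_mono) auto
      moreover have "form P c1 ?R - form P c0 ?R \<le> V0 + V1" using V0[OF st] V1[OF st] by linarith
      ultimately have "form P c1 ?R - form P c0 ?R \<le> (V0 + V1) * ?S" by simp
      then show ?thesis unfolding eq using e0 by linarith
    qed
  qed
qed

end

subsection \<open>Decoupled species\<close>

text \<open>Not divided by \<open>N\<close>, so that decoupled species contribute
  additively.\<close>

definition mean_ln :: "spin_type \<Rightarrow> nat \<Rightarrow> ('s \<Rightarrow> nat set) \<Rightarrow> nat \<Rightarrow> ('s list \<Rightarrow> real) \<Rightarrow> real" where
  "mean_ln k N I P c = (LINT x|gauss (idx I P). ln (pf (config k N I) (idx I P) spin (scale (weight I c) x)))"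

definition single_blocks :: "nat \<Rightarrow> unit \<Rightarrow> nat set" where
  "single_blocks n = (\<lambda>_. {1..n})"

definition single_coeff :: "(nat \<Rightarrow> real) \<Rightarrow> nat \<Rightarrow> unit list \<Rightarrow> real" where
  "single_coeff \<beta> n ss = (\<beta> (length ss))\<^sup>2 / real n ^ (length ss - 1)"

text \<open>Couplings within one species only, normalized by the size of that species instead of
  \<open>N\<close>: every species is a single-species model of its own size.\<close>

definition decoupled_coeff :: "(nat \<Rightarrow> real) \<Rightarrow> ('s \<Rightarrow> nat) \<Rightarrow> 's list \<Rightarrow> real" where
  "decoupled_coeff \<beta> n ss = (if \<forall>s\<in>set ss. s = hd ss then (\<beta> (length ss))\<^sup>2 / real (n (hd ss)) ^ (length ss - 1) else 0)"

lemma partition_single: "partition n (single_blocks n)"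
  by (simp add: partition_def species_partition_def single_blocks_def disjoint_family_on_def)

lemma integrable_block_exp:
  shows "integrable (block_measure k n) (\<lambda>\<tau>. exp (energy (idx (single_blocks n) P) spin y \<tau>))"
proof -
  interpret p: partition n "single_blocks n" by (rule partition_single)
  let ?J = "idx (single_blocks n) P"
  have pr: "prob_space (block_measure k n)"
    by (cases k) (auto simp: block_measure_def prob_space_uniform_count_measure finite_PiE PiE_eq_empty_iff prob_space_sphere)
  interpret prob_space "block_measure k n" by (rule pr)
  have AE: "AE \<tau> in block_measure k n. \<forall>i\<in>{1..n}. \<bar>\<tau> i\<bar> \<le> real n"
  proof (cases k)
    case Ising
    show ?thesis
    proof (rule AE_I2, rule ballI)
      fix \<tau> i assume "\<tau> \<in> space (block_measure k n)" and i: "i \<in> {1..n}"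
      then have "\<tau> i = -1 \<or> \<tau> i = 1" by (auto simp: Ising block_measure_def space_uniform_count_measure PiE_iff)
      then show "\<bar>\<tau> i\<bar> \<le> real n" using i by auto
    qed
  next
    case Spherical
    have "AE \<tau> in sphere_measure {1..n}. (\<Sum>i\<in>{1..n}. (\<tau> i)\<^sup>2) = real (card {1..n})" by (rule AE_sphere) simp
    then have "AE \<tau> in sphere_measure {1..n}. \<forall>i\<in>{1..n}. \<bar>\<tau> i\<bar> \<le> real n"
    proof (rule eventually_mono, intro ballI)
      fix \<tau> :: "nat \<Rightarrow> real" and i assume s: "(\<Sum>i\<in>{1..n}. (\<tau> i)\<^sup>2) = real (card {1..n})" and i: "i \<in> {1..n}"
      have "(\<tau> i)\<^sup>2 \<le> (\<Sum>i\<in>{1..n}. (\<tau> i)\<^sup>2)" by (rule member_le_sum[OF i]) auto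
      also have "\<dots> = real n" using s by simp
      also have "\<dots> \<le> (real n)\<^sup>2" using i by (simp add: power2_eq_square mult_le_cancel_left1)
      finally show "\<bar>\<tau> i\<bar> \<le> real n" by (metis abs_le_square_iff abs_of_nat)
    qed
    then show ?thesis unfolding Spherical block_measure_def spin_type.case .
  qed
  show ?thesis
  proof (rule integrable_const_bound[where B = "exp (real n ^ P * l1 ?J y)"])
    show "AE \<tau> in block_measure k n. norm (exp (energy ?J spin y \<tau>)) \<le> exp (real n ^ P * l1 ?J y)"
      using AE
    proof (rule eventually_mono)
      fix \<tau> assume t: "\<forall>i\<in>{1..n}. \<bar>\<tau> i\<bar> \<le> real n"
      have sb: "\<bar>spin js \<tau>\<bar> \<le> real n ^ P" if js: "js \<in> ?J" for js
      proof -
        have js: "js \<noteq> []" "length js \<le> P" "set js \<subseteq> {1..n}" using js by (auto simp: p.idx_eq)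
        then have n: "1 \<le> n" by (cases js) auto
        have "\<bar>spin js \<tau>\<bar> \<le> prod_list (map (\<lambda>_. real n) js)"
          unfolding spin_def using t js(3) by (intro prod_list_abs_le) blast
        also have "\<dots> = real n ^ length js" by (induction js) auto
        also have "\<dots> \<le> real n ^ P" using n js by (intro power_increasing) auto
        finally show ?thesis .
      qed
      have "energy ?J spin y \<tau> \<le> (\<Sum>js\<in>?J. \<bar>y js\<bar> * real n ^ P)"
        unfolding energy_def
      proof (rule sum_mono)
        fix js assume "js \<in> ?J"
        then have "\<bar>y js\<bar> * \<bar>spin js \<tau>\<bar> \<le> \<bar>y js\<bar> * real n ^ P" using sb by (intro mult_left_mono) auto
        then show "y js * spin js \<tau> \<le> \<bar>y js\<bar> * real n ^ P" by (simp add: abs_mult[symmetric])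
      qed
      then show "norm (exp (energy ?J spin y \<tau>)) \<le> exp (real n ^ P * l1 ?J y)"
        by (simp add: l1_def sum_distrib_left mult.commute)
    qed
    have "(\<lambda>\<tau>. \<tau> i) \<in> borel_measurable (block_measure k n)" if "i \<in> {1..n}" for i
    proof (cases k)
      case Ising
      show ?thesis by (simp add: Ising block_measure_def measurable_def sets_uniform_count_measure space_uniform_count_measure)
    next
      case Spherical
      have "(\<lambda>\<tau>. \<tau> i) \<in> borel_measurable (Pi\<^sub>M {1..n} (\<lambda>_. borel))" using that by (rule measurable_component_singleton)
      then show ?thesis unfolding Spherical block_measure_def spin_type.case measurable_cong_sets[OF sets_sphere refl] .
    qed
    then have ms: "spin js \<in> borel_measurable (block_measure k n)" if "set js \<subseteq> {1..n}" for js
      using that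
    proof (induction js)
      case (Cons j js)
      then have "(\<lambda>\<sigma>. \<sigma> j * spin js \<sigma>) \<in> borel_measurable (block_measure k n)" by (intro borel_measurable_times) auto
      then show ?case by (simp add: spin_def[abs_def])
    qed (simp add: spin_def[abs_def])
    show "(\<lambda>\<tau>. exp (energy ?J spin y \<tau>)) \<in> borel_measurable (block_measure k n)"
      unfolding energy_def
      by (intro borel_measurable_exp[THEN measurable_compose[rotated]] borel_measurable_sum borel_measurable_times ms) (auto simp: p.idx_eq)
  qed
qed

lemma integral_config_single:
  assumes "F \<in> borel_measurable (Pi\<^sub>M {1..n} (\<lambda>_. borel))" "integrable (block_measure k n) F"
  shows "(LINT \<sigma>|config k n (single_blocks n). F \<sigma>) = (LINT \<tau>|block_measure k n. F \<tau> :: real)"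
proof -
  interpret p: partition n "single_blocks n" by (rule partition_single)
  have c: "card (single_blocks n s) = n" for s by (simp add: single_blocks_def)
  have "(LINT \<sigma>|config k n (single_blocks n). (\<Prod>s\<in>(UNIV :: unit set). F (p.pull (\<lambda>_ i. i) s \<sigma>))) = (\<Prod>s\<in>(UNIV :: unit set). (LINT \<tau>|block_measure k (card (single_blocks n s)). F \<tau>))"
    by (rule p.integral_config_factor) (use assms in \<open>simp_all only: c\<close>, simp add: single_blocks_def bij_betw_def)
  moreover have "p.pull (\<lambda>_ i. i) s \<sigma> = \<sigma>" if "\<sigma> \<in> space (config k n (single_blocks n))" for s \<sigma>
  proof -
    have "\<sigma> \<in> extensional {1..n}" using that unfolding p.space_config by (cases k) (auto simp: PiE_def)
    then show ?thesis unfolding p.pull_def c by (simp add: fun_eq_iff extensional_def)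
  qed
  ultimately show ?thesis by (simp add: c cong: Bochner_Integration.integral_cong)
qed

lemma borel_measurable_exp_energy_block:
  "(\<lambda>\<tau>. exp (energy (idx (single_blocks n) P) spin y \<tau>)) \<in> borel_measurable (Pi\<^sub>M {1..n} (\<lambda>_. borel))"
proof -
  interpret p: partition n "single_blocks n" by (rule partition_single)
  have ms: "spin js \<in> borel_measurable (Pi\<^sub>M {1..n} (\<lambda>_. borel))" if "set js \<subseteq> {1..n}" for js
    using that
  proof (induction js)
    case (Cons j js)
    then have "(\<lambda>\<sigma>. \<sigma> j * spin js \<sigma>) \<in> borel_measurable (Pi\<^sub>M {1..n} (\<lambda>_. borel))"
      by (intro borel_measurable_times measurable_component_singleton) auto
    then show ?case by (simp add: spin_def[abs_def])
  qed (simp add: spin_def[abs_def])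
  show ?thesis unfolding energy_def
    by (intro borel_measurable_exp[THEN measurable_compose[rotated]] borel_measurable_sum borel_measurable_times ms) (auto simp: p.idx_eq)
qed

context partition
begin

text \<open>A coupling of positive variance has all its sites in one block. Hence the energy is a
  sum of functions of separate blocks, the partition function is a product, and each logarithm
  depends on the couplings of one block, whose joint law is that of the single-species
  disorder.\<close>

lemma mean_ln_decoupled:
  "mean_ln k N I P (decoupled_coeff \<beta> (\<lambda>s. card (I s))) =
     (\<Sum>s\<in>UNIV. mean_ln k (card (I s)) (single_blocks (card (I s))) P (single_coeff \<beta> (card (I s))))"
proof -
  have "\<exists>b. bij_betw b {1..card (I s)} (I s)" for s using ex_bij_betw_nat_finite_1[OF fin] .
  then obtain b where b: "\<And>s. bij_betw (b s) {1..card (I s)} (I s)" by metis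
  let ?n = "\<lambda>s. card (I s)"
  let ?J1 = "\<lambda>s. idx (single_blocks (?n s)) P"
  let ?w1 = "\<lambda>s. weight (single_blocks (?n s)) (single_coeff \<beta> (?n s))"
  let ?c = "decoupled_coeff \<beta> ?n"
  let ?y = "\<lambda>s x. \<lambda>js\<in>?J1 s. x (map (b s) js)"
  have part1: "partition (?n s) (single_blocks (?n s))" for s by (rule partition_single)
  have J1: "?J1 s = {js. js \<noteq> [] \<and> length js \<le> P \<and> set js \<subseteq> {1..?n s}}" for s
    by (rule partition.idx_eq[OF part1])
  have bI: "b s i \<in> I s" if "i \<in> {1..?n s}" for s i by (rule b_site[OF b that])
  have binj: "inj_on (b s) {1..?n s}" and bim: "b s ` {1..?n s} = I s" for s using b[of s] by (auto simp: bij_betw_def)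
  \<comment> \<open>The couplings inside the block of \<open>s\<close>, as images of the
    single-species ones under the enumeration.\<close>
  define T where "T s = map (b s) ` ?J1 s" for s
  have inj: "inj_on (map (b s)) (?J1 s)" for s
  proof (rule inj_onI)
    fix xs ys assume "xs \<in> ?J1 s" "ys \<in> ?J1 s" "map (b s) xs = map (b s) ys"
    moreover then have "inj_on (b s) (set xs \<union> set ys)" unfolding J1 by (intro inj_on_subset[OF binj]) auto
    ultimately show "xs = ys" by (metis map_inj_on)
  qed
  have T: "T s = {js \<in> idx I P. set js \<subseteq> I s}" for s
  proof (intro equalityI subsetI)
    fix js assume "js \<in> T s"
    then obtain js' where js': "js = map (b s) js'" "js' \<noteq> []" "length js' \<le> P" "set js' \<subseteq> {1..?n s}" unfolding T_def J1 by auto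
    then have "set js \<subseteq> I s" using bI[of _ s] by (auto simp del: atLeastAtMost_iff)
    then show "js \<in> {js \<in> idx I P. set js \<subseteq> I s}" using js' sub[of s] by (auto simp: idx_eq)
  next
    fix js assume js: "js \<in> {js \<in> idx I P. set js \<subseteq> I s}"
    define c where "c = the_inv_into {1..?n s} (b s)"
    have c: "b s (c i) = i" "c i \<in> {1..?n s}" if "i \<in> I s" for i
      using f_the_inv_into_f_bij_betw[OF b[of s]] bij_betwE[OF bij_betw_the_inv_into[OF b[of s]]] that
      unfolding c_def by blast+
    have "js = map (b s) (map c js)" using js c(1) by (auto simp: subset_eq intro!: map_idI[symmetric])
    moreover have "map c js \<in> ?J1 s" unfolding J1 using js c(2) by (auto simp: idx_eq simp del: atLeastAtMost_iff)
    ultimately show "js \<in> T s" unfolding T_def by blast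
  qed
  have wT: "weight I ?c (map (b s) js) = ?w1 s js" if js: "js \<in> ?J1 s" for s js
  proof -
    have sp: "species_of I (b s i) = s" if "i \<in> set js" for i
      using that js J1[of s] by (intro sp_eq bI) auto
    have "map (species_of I) (map (b s) js) = map (\<lambda>_. s) js" using sp by auto
    moreover have "js \<noteq> []" using js J1[of s] by auto
    ultimately show ?thesis
      by (simp add: weight_def decoupled_coeff_def single_coeff_def hd_map)
  qed
  have w0: "weight I ?c js = 0" if js: "js \<in> idx I P" "js \<notin> (\<Union>s. T s)" for js
  proof -
    have "\<not> (\<forall>s\<in>set (map (species_of I) js). s = hd (map (species_of I) js))"
    proof
      assume a: "\<forall>s\<in>set (map (species_of I) js). s = hd (map (species_of I) js)"
      have "set js \<subseteq> I (hd (map (species_of I) js))"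
      proof
        fix i assume i: "i \<in> set js"
        then have "species_of I i = hd (map (species_of I) js)" using a by auto
        moreover have "i \<in> I (species_of I i)" using i js by (intro sp_in) (auto simp: idx_eq)
        ultimately show "i \<in> I (hd (map (species_of I) js))" by simp
      qed
      then show False using js unfolding T by blast
    qed
    then show ?thesis unfolding weight_def decoupled_coeff_def by (simp only: if_False)
  qed
  have en: "energy (idx I P) spin (scale (weight I ?c) x) \<sigma> = (\<Sum>s\<in>UNIV. energy (?J1 s) spin (scale (?w1 s) (?y s x)) (pull b s \<sigma>))" for x \<sigma>
  proof -
    let ?f = "\<lambda>js. scale (weight I ?c) x js * spin js \<sigma>"
    have "energy (idx I P) spin (scale (weight I ?c) x) \<sigma> = (\<Sum>js\<in>(\<Union>s. T s). ?f js)"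
      unfolding energy_def by (rule sum.mono_neutral_right) (use w0 T in \<open>auto simp: scale_def\<close>)
    also have "\<dots> = (\<Sum>s\<in>UNIV. \<Sum>js\<in>T s. ?f js)"
    proof (rule sum.UNION_disjoint)
      show "\<forall>s\<in>UNIV. finite (T s)" unfolding T by auto
      show "\<forall>s\<in>UNIV. \<forall>s'\<in>UNIV. s \<noteq> s' \<longrightarrow> T s \<inter> T s' = {}"
      proof (intro ballI impI)
        fix s s' :: 's assume ne: "s \<noteq> s'"
        show "T s \<inter> T s' = {}"
        proof (rule ccontr)
          assume "T s \<inter> T s' \<noteq> {}"
          then obtain js where js: "js \<in> idx I P" "set js \<subseteq> I s" "set js \<subseteq> I s'" unfolding T by blast
          then have "hd js \<in> I s" "hd js \<in> I s'" by (auto simp: idx_eq)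
          then show False using sp_eq ne by blast
        qed
      qed
    qed simp
    also have "\<dots> = (\<Sum>s\<in>UNIV. energy (?J1 s) spin (scale (?w1 s) (?y s x)) (pull b s \<sigma>))"
    proof (rule sum.cong[OF refl])
      fix s
      have "(\<Sum>js\<in>T s. ?f js) = (\<Sum>js\<in>?J1 s. ?f (map (b s) js))" unfolding T_def by (rule sum.reindex[OF inj, unfolded comp_def])
      also have "\<dots> = energy (?J1 s) spin (scale (?w1 s) (?y s x)) (pull b s \<sigma>)"
        unfolding energy_def
      proof (rule sum.cong[OF refl])
        fix js assume js: "js \<in> ?J1 s"
        then have "set js \<subseteq> {1..?n s}" using J1[of s] by auto
        then have "spin (map (b s) js) \<sigma> = spin js (pull b s \<sigma>)"
          unfolding spin_def pull_def map_map by (intro arg_cong[of _ _ prod_list] map_cong refl) (auto simp: subset_eq)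
        then show "?f (map (b s) js) = scale (?w1 s) (?y s x) js * spin js (pull b s \<sigma>)"
          using js wT[OF js] by (simp add: scale_def)
      qed
      finally show "(\<Sum>js\<in>T s. ?f js) = energy (?J1 s) spin (scale (?w1 s) (?y s x)) (pull b s \<sigma>)" .
    qed
    finally show ?thesis .
  qed
  have pfp: "pf (config k N I) (idx I P) spin (scale (weight I ?c) x) = (\<Prod>s\<in>UNIV. pf (config k (?n s) (single_blocks (?n s))) (?J1 s) spin (scale (?w1 s) (?y s x)))" for x
  proof -
    have "pf (config k N I) (idx I P) spin (scale (weight I ?c) x) = (LINT \<sigma>|config k N I. (\<Prod>s\<in>UNIV. exp (energy (?J1 s) spin (scale (?w1 s) (?y s x)) (pull b s \<sigma>))))"
      unfolding pf_def en by (simp add: exp_sum)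
    also have "\<dots> = (\<Prod>s\<in>UNIV. (LINT \<tau>|block_measure k (?n s). exp (energy (?J1 s) spin (scale (?w1 s) (?y s x)) \<tau>)))"
      by (rule integral_config_factor[OF b borel_measurable_exp_energy_block integrable_block_exp])
    also have "\<dots> = (\<Prod>s\<in>UNIV. pf (config k (?n s) (single_blocks (?n s))) (?J1 s) spin (scale (?w1 s) (?y s x)))"
      unfolding pf_def by (intro prod.cong refl integral_config_single[symmetric] borel_measurable_exp_energy_block integrable_block_exp)
    finally show ?thesis .
  qed
  have gs: "gibbs (config k (?n s) (single_blocks (?n s))) (?J1 s) spin (real (?n s) ^ P)" for s
    by (rule partition.gibbs_config[OF part1])
  let ?L = "\<lambda>s y. ln (pf (config k (?n s) (single_blocks (?n s))) (?J1 s) spin (scale (?w1 s) y))"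
  have sub1: "map (b s) ` ?J1 s \<subseteq> idx I P" for s using T[of s] by (auto simp: T_def)
  have mL: "?L s \<in> borel_measurable (gauss (?J1 s))" for s
    using gibbs.integrable_ln_pf[OF gs[of s], where u = "?w1 s"] by (rule borel_measurable_integrable)
  have "mean_ln k N I P ?c = (LINT x|gauss (idx I P). (\<Sum>s\<in>UNIV. ?L s (?y s x)))"
    unfolding mean_ln_def pfp by (intro Bochner_Integration.integral_cong refl ln_prod) (simp, metis gibbs.pf_pos[OF gs] less_irrefl)
  also have "\<dots> = (\<Sum>s\<in>UNIV. (LINT x|gauss (idx I P). ?L s (?y s x)))"
    using gauss_reindex(2)[OF inj sub1 mL] gibbs.integrable_ln_pf[OF gs] by (intro Bochner_Integration.integral_sum) auto
  also have "\<dots> = (\<Sum>s\<in>UNIV. mean_ln k (?n s) (single_blocks (?n s)) P (single_coeff \<beta> (?n s)))"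
    unfolding mean_ln_def by (intro sum.cong refl gauss_reindex(1)[OF inj sub1 mL])
  finally show ?thesis .
qed

lemma sum_card: "(\<Sum>s\<in>UNIV. card (I s)) = N"
proof -
  have "card (\<Union>s\<in>UNIV. I s) = (\<Sum>s\<in>UNIV. card (I s))"
    using disj by (intro card_UN_disjoint) (auto simp: disjoint_family_on_def)
  then show ?thesis by (simp add: Un)
qed

end

text \<open>A Gaussian random field of variance \<delta> at every site; it is added to both models
  that are compared.\<close>

definition add_field :: "real \<Rightarrow> ('s list \<Rightarrow> real) \<Rightarrow> 's list \<Rightarrow> real" where
  "add_field \<delta> c ss = c ss + (if length ss = 1 then \<delta> else 0)"

lemma form_add_field:
  fixes c :: "'s::finite list \<Rightarrow> real"
  assumes "1 \<le> P"
  shows "form P (add_field \<delta> c) x = form P c x + \<delta> * (\<Sum>s\<in>UNIV. x s)"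
proof -
  have "(\<Sum>ss\<in>words P. (if length ss = 1 then \<delta> else 0) * prod_list (map x ss)) = (\<Sum>ss\<in>{ss. length ss = 1}. \<delta> * prod_list (map x ss))"
    using assms by (intro sum.mono_neutral_cong_right finite_words) (auto simp: words_def)
  also have "\<dots> = (\<Sum>s\<in>UNIV. \<delta> * x s)"
  proof (rule sum.reindex_bij_witness[where i = "\<lambda>s. [s]" and j = hd])
    fix ss :: "'s list" assume "ss \<in> {ss. length ss = 1}"
    then obtain s where "ss = [s]" by (cases ss) auto
    then show "[hd ss] = ss" "\<delta> * x (hd ss) = \<delta> * prod_list (map x ss)" by auto
  qed auto
  finally show ?thesis
    unfolding form_def add_field_def by (simp add: distrib_right sum.distrib sum_distrib_left)
qed

context partition
begin

text \<open>The moment of order \<open>1 - h\<close> is carried from the decoupled model to the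
  decoupled model with field, then to the multi-species model with field, and finally the field is
  removed. \<open>mean_ln_lower\<close> divides the total loss by h b. The losses of the
  interpolation contain a factor h / 2 and survive this with h cancelled; the deficit
  \<open>D\<close> of the decoupled model does not and must be small compared with h b.\<close>

theorem finite_volume_bound:
  fixes \<beta> :: "nat \<Rightarrow> real" and cm :: "'s list \<Rightarrow> real" and \<delta> r nm Vm b h e0 D :: real
  defines "cd \<equiv> decoupled_coeff \<beta> (\<lambda>s. card (I s))"
  assumes P: "1 \<le> P" and cm: "\<And>ss. ss \<in> words P \<Longrightarrow> 0 \<le> cm ss"
    and \<delta>: "0 \<le> \<delta>" and r: "0 < r" and nm: "0 < nm" "\<And>s. nm \<le> real (card (I s))"
    and Vm: "form P cm (\<lambda>s. card (I s)) + \<delta> * N \<le> Vm" "form P cd (\<lambda>s. card (I s)) + \<delta> * N \<le> Vm"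
    and b: "0 < b" "b < 1" and h: "0 < h" "h < 1 - b" and e0: "0 \<le> e0"
    and diff: "\<And>x :: 's \<Rightarrow> real. (\<And>s. - r \<le> x s \<and> x s \<le> 1) \<Longrightarrow> form P cm (\<lambda>s. card (I s) * x s) - form P cd (\<lambda>s. card (I s) * x s) \<le> e0"
    and D: "0 \<le> D" "form P cd (\<lambda>s. card (I s)) / 2 - D \<le> mean_ln k N I P cd"
  shows "form P cm (\<lambda>s. card (I s)) / 2 - (D + h / 2 * (\<delta> * N + e0 + 2 * Vm * (card (signs :: ('s \<Rightarrow> real) set) * exp (- h * (2 * \<delta> * r * nm) + 9 * h\<^sup>2 * Vm)))) / (h * b)
     - b * form P cm (\<lambda>s. card (I s)) \<le> mean_ln k N I P cm"
proof -
  let ?n = "\<lambda>s. real (card (I s))"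
  let ?a = "1 - h" and ?K = "real (card (signs :: ('s \<Rightarrow> real) set))"
  let ?q = "exp (- h * (2 * \<delta> * r * nm) + 9 * h\<^sup>2 * Vm)"
  define Vc Vd where "Vc = form P cm ?n" and "Vd = form P cd ?n"
  interpret g: gibbs "config k N I" "idx I P" spin "real N ^ P" by (rule gibbs_config)
  have cd: "0 \<le> cd ss" for ss unfolding cd_def decoupled_coeff_def by simp
  have sumn: "(\<Sum>s\<in>UNIV. ?n s) = real N" using sum_card by (metis of_nat_sum)
  have af: "0 \<le> add_field \<delta> c ss" if "0 \<le> c ss" for c :: "'s list \<Rightarrow> real" and ss using that \<delta> by (simp add: add_field_def)
  have fa: "form P (add_field \<delta> c) ?n = form P c ?n + \<delta> * N" for c by (simp add: form_add_field[OF P] sumn)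
  have Vpos: "0 \<le> Vc" "0 \<le> Vd"
    using form_mono[of P cm "\<lambda>_. 0" ?n] form_mono[of P cd "\<lambda>_. 0" ?n] cm cd unfolding Vc_def Vd_def by fastforce+
  have N0: "0 \<le> \<delta> * N" using \<delta> by simp
  have sq: "(\<Sum>j\<in>idx I P. weight I c j * (spin j \<sigma>)\<^sup>2) = form P c ?n" if "\<sigma> \<in> space (config k N I)" for c \<sigma>
    using that weight_sq_sum by (simp add: space_config)
  have a: "0 \<le> ?a" "?a \<le> 1" using h b by auto
  have s0: "exp (?a * (Vd / 2 - D)) \<le> g.pm ?a (weight I cd)"
  proof -
    have "exp (?a * (Vd / 2 - D)) \<le> exp (?a * mean_ln k N I P cd)" using D a by (simp add: Vd_def mult_left_mono)
    also have "\<dots> \<le> g.pm ?a (weight I cd)" unfolding mean_ln_def by (rule g.exp_mean_le_pm)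
    finally show ?thesis .
  qed
  have s1: "g.pm ?a (weight I cd) * exp (?a * (\<delta> * N) / 2 - ?a * h / 2 * (\<delta> * N)) \<le> g.pm ?a (weight I (add_field \<delta> cd))"
    using g.flow_up[of "weight I cd" "weight I (add_field \<delta> cd)" "form P cd ?n" "form P cd ?n + \<delta> * N" ?a] \<delta> a
    by (simp add: sq fa weight_nonneg cd) (simp add: weight_def add_field_def)
  have s2: "g.pm ?a (weight I (add_field \<delta> cd)) * exp (?a * (Vc - Vd) / 2 - ?a * h / 2 * (e0 + ((Vd + \<delta> * N) + (Vc + \<delta> * N)) * (?K * ?q)))
     \<le> g.pm ?a (weight I (add_field \<delta> cm))"
  proof -
    have "g.pm ?a (weight I (add_field \<delta> cd)) * exp (?a * ((Vc + \<delta> * N) - (Vd + \<delta> * N)) / 2 - ?a * h / 2 * (e0 + ((Vd + \<delta> * N) + (Vc + \<delta> * N)) * (?K * ?q)))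
       \<le> g.pm ?a (weight I (add_field \<delta> cm))"
    proof (rule spin_flow)
      show "1 \<le> P" "0 \<le> \<delta>" "0 < r" "0 < nm" "0 < h" "0 \<le> e0" by fact+
      show "nm \<le> card (I s)" for s by (rule nm)
      show "0 \<le> add_field \<delta> cd ss" for ss by (rule af) (rule cd)
      show "0 \<le> add_field \<delta> cm ss" if "ss \<in> words P" for ss by (rule af) (rule cm[OF that])
      show "\<delta> \<le> add_field \<delta> cd [s]" for s using cd[of "[s]"] by (simp add: add_field_def)
      show "\<delta> \<le> add_field \<delta> cm [s]" for s using cm[of "[s]"] P by (simp add: add_field_def words_def)
      show "Vd + \<delta> * N = form P (add_field \<delta> cd) ?n" "Vc + \<delta> * N = form P (add_field \<delta> cm) ?n"
        by (simp_all add: fa Vc_def Vd_def)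
      show "Vd + \<delta> * N \<le> Vm" "Vc + \<delta> * N \<le> Vm" using Vm by (simp_all add: Vc_def Vd_def)
      show "h \<le> 1" using h b by simp
      fix x :: "'s \<Rightarrow> real" assume "\<And>s. - r \<le> x s \<and> x s \<le> 1"
      from diff[OF this] show "form P (add_field \<delta> cm) (\<lambda>s. ?n s * x s) - form P (add_field \<delta> cd) (\<lambda>s. ?n s * x s) \<le> e0"
        by (simp add: form_add_field[OF P])
    qed
    then show ?thesis by simp
  qed
  have s3: "g.pm ?a (weight I (add_field \<delta> cm)) * exp (?a * (- (\<delta> * N)) / 2) \<le> g.pm ?a (weight I cm)"
  proof -
    have "g.pm ?a (weight I (add_field \<delta> cm)) * exp (?a * (form P cm ?n - (form P cm ?n + \<delta> * N)) / 2) \<le> g.pm ?a (weight I cm)"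
    proof (rule g.flow_down)
      show "0 \<le> weight I cm j" if "j \<in> idx I P" for j by (rule weight_nonneg[OF cm that])
      show "weight I cm j \<le> weight I (add_field \<delta> cm) j" for j using \<delta> by (simp add: weight_def add_field_def)
    qed (use a in \<open>auto simp: sq fa\<close>)
    then show ?thesis by simp
  qed
  \<comment> \<open>The total loss at order \<open>1 - h\<close>: the deficit of the decoupled
    model, the two-replica loss from raising the field, and the comparison with its flip
    error.\<close>
  define \<eta> where "\<eta> = D + h / 2 * (\<delta> * N + e0 + 2 * Vm * (?K * ?q))"
  let ?B = "\<delta> * N + e0 + ((Vd + \<delta> * N) + (Vc + \<delta> * N)) * (?K * ?q)"
  have B: "0 \<le> ?B" "?B \<le> \<delta> * N + e0 + 2 * Vm * (?K * ?q)"
  proof -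
    show "0 \<le> ?B" using \<delta> e0 Vpos by (intro add_nonneg_nonneg mult_nonneg_nonneg) auto
    have "((Vd + \<delta> * N) + (Vc + \<delta> * N)) * (?K * ?q) \<le> 2 * Vm * (?K * ?q)"
      using Vm by (intro mult_right_mono) (auto simp: Vc_def Vd_def)
    then show "?B \<le> \<delta> * N + e0 + 2 * Vm * (?K * ?q)" by simp
  qed
  \<comment> \<open>The annealed parts telescope: \<open>Vd\<close> and the two changes of the field
    cancel and leave Vc / 2.\<close>
  have "exp (?a * Vc / 2 - \<eta>) \<le> exp (?a * (Vd / 2 - D) + (?a * (\<delta> * N) / 2 - ?a * h / 2 * (\<delta> * N)) +
      (?a * (Vc - Vd) / 2 - ?a * h / 2 * (e0 + ((Vd + \<delta> * N) + (Vc + \<delta> * N)) * (?K * ?q))) + ?a * (- (\<delta> * N)) / 2)"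
  proof -
    have "?a * D \<le> 1 * D" using D a by (intro mult_right_mono) auto
    moreover have "?a * (h / 2 * ?B) \<le> 1 * (h / 2 * ?B)" using B h a by (intro mult_right_mono) auto
    moreover have "h / 2 * ?B \<le> h / 2 * (\<delta> * N + e0 + 2 * Vm * (?K * ?q))" using B h by (intro mult_left_mono) auto
    ultimately have "?a * D + ?a * (h / 2 * ?B) \<le> \<eta>" unfolding \<eta>_def by linarith
    moreover have "?a * (Vd / 2 - D) + (?a * (\<delta> * N) / 2 - ?a * h / 2 * (\<delta> * N)) +
      (?a * (Vc - Vd) / 2 - ?a * h / 2 * (e0 + ((Vd + \<delta> * N) + (Vc + \<delta> * N)) * (?K * ?q))) + ?a * (- (\<delta> * N)) / 2
      = ?a * Vc / 2 - (?a * D + ?a * (h / 2 * ?B))" by (simp add: field_simps)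
    ultimately show ?thesis by simp
  qed
  also have "\<dots> = ((exp (?a * (Vd / 2 - D)) * exp (?a * (\<delta> * N) / 2 - ?a * h / 2 * (\<delta> * N))) *
      exp (?a * (Vc - Vd) / 2 - ?a * h / 2 * (e0 + ((Vd + \<delta> * N) + (Vc + \<delta> * N)) * (?K * ?q)))) * exp (?a * (- (\<delta> * N)) / 2)"
    by (simp only: exp_add)
  also have "\<dots> \<le> ((g.pm ?a (weight I cd) * exp (?a * (\<delta> * N) / 2 - ?a * h / 2 * (\<delta> * N))) *
      exp (?a * (Vc - Vd) / 2 - ?a * h / 2 * (e0 + ((Vd + \<delta> * N) + (Vc + \<delta> * N)) * (?K * ?q)))) * exp (?a * (- (\<delta> * N)) / 2)"
    by (intro mult_right_mono s0) auto
  also have "\<dots> \<le> (g.pm ?a (weight I (add_field \<delta> cd)) *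
      exp (?a * (Vc - Vd) / 2 - ?a * h / 2 * (e0 + ((Vd + \<delta> * N) + (Vc + \<delta> * N)) * (?K * ?q)))) * exp (?a * (- (\<delta> * N)) / 2)"
    by (intro mult_right_mono s1) auto
  also have "\<dots> \<le> g.pm ?a (weight I (add_field \<delta> cm)) * exp (?a * (- (\<delta> * N)) / 2)"
    by (intro mult_right_mono s2) auto
  also have "\<dots> \<le> g.pm ?a (weight I cm)" by (rule s3)
  finally have low: "exp (?a * Vc / 2 - \<eta>) \<le> g.pm ?a (weight I cm)" .
  have "0 \<le> \<delta> * N + e0 + 2 * Vm * (?K * ?q)" by (rule order_trans[OF B])
  then have "0 \<le> h / 2 * (\<delta> * N + e0 + 2 * Vm * (?K * ?q))" using h by (intro mult_nonneg_nonneg) auto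
  then have \<eta>0: "0 \<le> \<eta>" unfolding \<eta>_def using D(1) by linarith
  have "Vc / 2 - \<eta> / (h * b) - b * Vc \<le> mean_ln k N I P cm"
    unfolding mean_ln_def
  proof (rule g.mean_ln_lower[OF prob_space_config _ _ b h \<eta>0 low])
    show "0 \<le> weight I cm j" if "j \<in> idx I P" for j by (rule weight_nonneg[OF cm that])
  qed (simp_all add: sq Vc_def)
  then show ?thesis unfolding \<eta>_def Vc_def .
qed

end

subsection \<open>Balanced interactions\<close>

lemma prod_list_const_mult: "prod_list (map (\<lambda>s. a * f s) ss) = a ^ length ss * prod_list (map f ss)" for a :: real
  by (induction ss) auto

lemma finite_length_eq [simp]: "finite {ss :: 's::finite list. length ss = p}"
  using finite_lists_length_eq[of "UNIV :: 's set" p] by simp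

lemma form_by_length:
  fixes c :: "'s::finite list \<Rightarrow> real"
  shows "form P c x = (\<Sum>p=1..P. \<Sum>ss | length ss = p. c ss * prod_list (map x ss))"
proof -
  have "words P = (\<Union>p\<in>{1..P}. {ss :: 's list. length ss = p})" by (auto simp: words_def)
  then show ?thesis unfolding form_def by (simp only:) (rule sum.UNION_disjoint, auto)
qed

lemma sum_lists_Suc:
  fixes f :: "'s::finite list \<Rightarrow> real"
  shows "(\<Sum>ss | length ss = Suc p. f ss) = (\<Sum>t\<in>UNIV. \<Sum>ss | length ss = p. f (t # ss))"
proof -
  have eq: "{ss :: 's list. length ss = Suc p} = (\<lambda>(t, ss). t # ss) ` (UNIV \<times> {ss. length ss = p})"
    by (auto simp: length_Suc_conv image_iff)
  have "inj_on (\<lambda>(t, ss). t # ss) (UNIV \<times> {ss :: 's list. length ss = p})" by (auto simp: inj_on_def)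
  then show ?thesis unfolding eq by (simp add: sum.reindex sum.cartesian_product case_prod_beta')
qed

text \<open>The variance of a coupling with the normalization \<open>N powr ((p - 1) / 2)\<close> of
  the Hamiltonian absorbed.\<close>

definition multi_coeff :: "('s list \<Rightarrow> real) \<Rightarrow> nat \<Rightarrow> 's list \<Rightarrow> real" where
  "multi_coeff \<Delta> N ss = (\<Delta> ss)\<^sup>2 / real N ^ (length ss - 1)"

lemma form_multi:
  fixes \<Delta> :: "'s::finite list \<Rightarrow> real"
  assumes "1 \<le> N"
  shows "form P (multi_coeff \<Delta> N) x = N * (\<Sum>p=1..P. variance_coeff \<Delta> (\<lambda>s. x s / N) p)"
proof -
  have "multi_coeff \<Delta> N ss * prod_list (map x ss) = N * ((\<Delta> ss)\<^sup>2 * prod_list (map (\<lambda>s. x s / N) ss))" if "1 \<le> length ss" for ss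
  proof -
    have "prod_list (map x ss) = prod_list (map (\<lambda>s. N * (x s / N)) ss)" using assms by simp
    also have "\<dots> = real N ^ length ss * prod_list (map (\<lambda>s. x s / N) ss)" by (rule prod_list_const_mult)
    also have "real N ^ length ss = real N * real N ^ (length ss - 1)" using that by (cases ss) auto
    finally show ?thesis using assms by (simp add: multi_coeff_def)
  qed
  then show ?thesis
    unfolding form_by_length variance_coeff_def sum_distrib_left by (intro sum.cong refl) auto
qed

text \<open>Only constant words survive, and n_s^p / n_s^(p-1) leaves one factor n_s.\<close>

lemma form_decoupled:
  fixes n :: "'s::finite \<Rightarrow> nat" and x :: "'s \<Rightarrow> real"
  assumes "\<And>s. 0 < n s"
  shows "form P (decoupled_coeff \<beta> n) (\<lambda>s. n s * x s) = (\<Sum>p=1..P. (\<beta> p)\<^sup>2 * (\<Sum>s\<in>UNIV. n s * x s ^ p))"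
  unfolding form_by_length
proof (rule sum.cong[OF refl])
  fix p assume p: "p \<in> {1..P}"
  let ?f = "\<lambda>ss. decoupled_coeff \<beta> n ss * prod_list (map (\<lambda>s. n s * x s) ss)"
  have "(\<Sum>ss | length ss = p. ?f ss) = (\<Sum>ss\<in>replicate p ` UNIV. ?f ss)"
  proof (rule sum.mono_neutral_right)
    show "\<forall>ss\<in>{ss. length ss = p} - range (replicate p). ?f ss = 0"
    proof
      fix ss :: "'s list" assume ss: "ss \<in> {ss. length ss = p} - range (replicate p)"
      have "\<not> (\<forall>s\<in>set ss. s = hd ss)"
      proof
        assume "\<forall>s\<in>set ss. s = hd ss"
        then have "ss = replicate (length ss) (hd ss)" by (simp add: replicate_length_same)
        then show False using ss by auto
      qed
      then show "?f ss = 0" unfolding decoupled_coeff_def by (simp only: if_False mult_zero_left)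
    qed
  qed auto
  also have "\<dots> = (\<Sum>s\<in>UNIV. ?f (replicate p s))"
    using p by (subst sum.reindex) (auto simp: inj_on_def replicate_eq_replicate)
  also have "\<dots> = (\<Sum>s\<in>UNIV. (\<beta> p)\<^sup>2 * (n s * x s ^ p))"
  proof (rule sum.cong[OF refl])
    fix s
    obtain q where q: "p = Suc q" using p by (cases p) auto
    have "prod_list (map (\<lambda>s. n s * x s) (replicate p s)) = (n s * x s) ^ p" by (simp add: prod_list_replicate)
    moreover have "decoupled_coeff \<beta> n (replicate p s) = (\<beta> p)\<^sup>2 / n s ^ q" by (simp add: decoupled_coeff_def q)
    ultimately show "?f (replicate p s) = (\<beta> p)\<^sup>2 * (n s * x s ^ p)"
      using assms[of s] by (simp add: q power_mult_distrib)
  qed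
  finally show "(\<Sum>ss | length ss = p. ?f ss) = (\<beta> p)\<^sup>2 * (\<Sum>s\<in>UNIV. n s * x s ^ p)"
    by (simp add: sum_distrib_left)
qed

lemma variance_coeff_nonneg: "(\<And>s. 0 \<le> x s) \<Longrightarrow> 0 \<le> variance_coeff \<Delta> x p"
  unfolding variance_coeff_def by (intro sum_nonneg mult_nonneg_nonneg) (auto intro!: prod_list_nonneg)

lemma variance_coeff_mono:
  assumes "\<And>s. 0 \<le> x s \<and> x s \<le> y s"
  shows "variance_coeff \<Delta> x p \<le> variance_coeff \<Delta> y p"
  unfolding variance_coeff_def using assms by (intro sum_mono mult_left_mono prod_list_pos_mono) auto

lemma variance_coeff_scale: "variance_coeff \<Delta> (\<lambda>s. a * x s) p = a ^ p * variance_coeff \<Delta> x p"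
  unfolding variance_coeff_def prod_list_const_mult sum_distrib_left by (intro sum.cong refl) auto

lemma powr_inverse_power:
  fixes z :: real
  assumes "0 \<le> z" "0 < p"
  shows "z = (z ^ p) powr (1 / real p)"
proof (cases "z = 0")
  case False
  then have "0 < z" using assms by simp
  then have "z ^ p = z powr real p" by (simp add: powr_realpow)
  then show ?thesis using assms \<open>0 < z\<close> by (simp add: powr_powr)
qed (use assms in \<open>simp add: power_0_left\<close>)

text \<open>The AM-GM inequality for the p-th powers; the p-th root of their product is the product
  itself.\<close>

lemma prod_list_le_mean_power:
  fixes y :: "'a \<Rightarrow> real"
  assumes "\<And>s. 0 \<le> y s" "ss \<noteq> []"
  shows "prod_list (map y ss) \<le> (\<Sum>k<length ss. y (ss ! k) ^ length ss) / length ss"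
proof -
  let ?p = "length ss"
  have p: "0 < ?p" using assms by simp
  let ?Q = "\<Prod>k<?p. y (ss ! k)"
  have Q: "prod_list (map y ss) = ?Q" by (simp add: prod.list_conv_set_nth atLeast0LessThan)
  have Q0: "0 \<le> ?Q" by (intro prod_nonneg) (simp add: assms)
  have "?Q = (?Q ^ ?p) powr (1 / ?p)" by (rule powr_inverse_power[OF Q0 p])
  also have "?Q ^ ?p = (\<Prod>k<?p. y (ss ! k) ^ ?p)" by (rule prod_power_distrib)
  also have "(\<Prod>k<?p. y (ss ! k) ^ ?p) powr (1 / ?p) \<le> (\<Sum>k<?p. y (ss ! k) ^ ?p / ?p)"
  proof -
    have "{..<?p} \<noteq> {}" using p by blast
    then show ?thesis using arith_geom_mean[of "{..<?p}" "\<lambda>k. y (ss ! k) ^ ?p"] assms by simp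
  qed
  finally show ?thesis unfolding Q by (simp add: sum_divide_distrib)
qed

text \<open>AM-GM bounds each monomial by the mean over positions k of y^p at the k-th species. By
  symmetry of \<Delta> all positions contribute equally, and in the first one the sum over the
  remaining indices is the quantity that balancedness makes constant. Since the proportions sum to
  1, this constant is the variance coefficient.\<close>

theorem balanced_form_le:
  fixes \<Delta> :: "'s::finite list \<Rightarrow> real"
  assumes int: "interaction \<Delta>" and bal: "balanced \<Delta> lam" and lam: "\<And>s. 0 < lam s" "(\<Sum>s\<in>UNIV. lam s) = 1"
    and p: "1 \<le> p" and y: "\<And>s. 0 \<le> y s"
  shows "variance_coeff \<Delta> (\<lambda>s. lam s * y s) p \<le> variance_coeff \<Delta> lam p * (\<Sum>s\<in>UNIV. lam s * y s ^ p)"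
proof -
  let ?S = "{ss :: 's list. length ss = p}"
  let ?m = "\<lambda>ss. (\<Delta> ss)\<^sup>2 * prod_list (map lam ss)"
  obtain q where q: "p = Suc q" using p by (cases p) auto
  \<comment> \<open>The quantity in the balance condition; for q = 0 it is the separate condition on
    words of length 1.\<close>
  define B where "B t = (\<Sum>ss | length ss = q. (\<Delta> (t # ss))\<^sup>2 * prod_list (map lam ss))" for t
  have B: "B t = B t'" for t t'
  proof (cases "q = 0")
    case True
    then show ?thesis using bal by (simp add: B_def balanced_def)
  next
    case False
    then have "2 \<le> p" "q = p - 1" using q by auto
    then show ?thesis using bal unfolding B_def balanced_def by blast
  qed
  \<comment> \<open>The contribution of position \<open>k\<close> to the AM-GM bound. Swapping the
    positions 0 and \<open>k\<close> shows that it does not depend on \<open>k\<close>.\<close>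
  define A where "A k = (\<Sum>ss\<in>?S. ?m ss * y (ss ! k) ^ p)" for k
  have A0: "A 0 = (\<Sum>t\<in>UNIV. lam t * y t ^ p * B t)"
    unfolding A_def q sum_lists_Suc B_def sum_distrib_left by (intro sum.cong refl) (simp add: mult_ac)
  have Ak: "A k = A 0" if k: "k < p" for k
    unfolding A_def
  proof (rule sum.reindex_bij_witness[where i = "permute_list (Transposition.transpose 0 k)" and j = "permute_list (Transposition.transpose 0 k)"])
    have perm: "Transposition.transpose 0 k permutes {..<length ss}" if "ss \<in> ?S" for ss :: "'s list"
      using that k p by (intro permutes_swap_id) auto
    fix ss :: "'s list" assume ss: "ss \<in> ?S"
    note pm = perm[OF ss]
    show "permute_list (Transposition.transpose 0 k) (permute_list (Transposition.transpose 0 k) ss) = ss"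
      using permute_list_compose[OF pm, of "Transposition.transpose 0 k"] by (simp add: transpose_comp_involutory)
    then show "permute_list (Transposition.transpose 0 k) (permute_list (Transposition.transpose 0 k) ss) = ss" .
    show "permute_list (Transposition.transpose 0 k) ss \<in> ?S" "permute_list (Transposition.transpose 0 k) ss \<in> ?S" using ss by auto
    have "ss \<noteq> []" using ss p by auto
    then have "\<Delta> (permute_list (Transposition.transpose 0 k) ss) = \<Delta> ss" using int pm unfolding interaction_def by blast
    moreover have "prod_list (map lam (permute_list (Transposition.transpose 0 k) ss)) = prod_list (map lam ss)"
      using pm by (metis mset_map mset_permute_list prod_mset_prod_list)
    moreover have "permute_list (Transposition.transpose 0 k) ss ! 0 = ss ! k"
      using permute_list_nth[OF pm, of 0] ss p \<open>ss \<noteq> []\<close> by simp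
    ultimately show "?m (permute_list (Transposition.transpose 0 k) ss) * y (permute_list (Transposition.transpose 0 k) ss ! 0) ^ p = ?m ss * y (ss ! k) ^ p"
      by simp
  qed
  have "variance_coeff \<Delta> (\<lambda>s. lam s * y s) p = (\<Sum>ss\<in>?S. ?m ss * prod_list (map y ss))"
    unfolding variance_coeff_def by (intro sum.cong refl) (simp add: prod_list_mult[symmetric])
  also have "\<dots> \<le> (\<Sum>ss\<in>?S. ?m ss * ((\<Sum>k<p. y (ss ! k) ^ p) / p))"
  proof (intro sum_mono mult_left_mono)
    fix ss :: "'s list" assume "ss \<in> ?S"
    then have ss: "length ss = p" "ss \<noteq> []" using p by auto
    show "prod_list (map y ss) \<le> (\<Sum>k<p. y (ss ! k) ^ p) / p"
      using prod_list_le_mean_power[of y ss, OF y ss(2)] unfolding ss(1) .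
    show "0 \<le> ?m ss" using lam by (intro mult_nonneg_nonneg prod_list_nonneg) (auto intro: less_imp_le)
  qed
  also have "\<dots> = (\<Sum>k<p. A k) / p"
    unfolding A_def sum.swap[of _ _ "{..<p}"] by (simp add: sum_distrib_left sum_divide_distrib)
  also have "(\<Sum>k<p. A k) = (\<Sum>k<p. A 0)" using Ak by (intro sum.cong refl) blast
  also have "(\<Sum>k<p. A 0) / p = A 0" using p by simp
  \<comment> \<open>\<open>undefined\<close> stands for an arbitrary species, as \<open>B\<close> is
    constant.\<close>
  also have "\<dots> = B undefined * (\<Sum>t\<in>UNIV. lam t * y t ^ p)"
    unfolding A0 sum_distrib_left
  proof (intro sum.cong refl)
    fix t show "lam t * y t ^ p * B t = B undefined * (lam t * y t ^ p)" using B[of t undefined] by simp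
  qed
  also have "B undefined = variance_coeff \<Delta> lam p"
  proof -
    have "variance_coeff \<Delta> lam p = (\<Sum>t\<in>UNIV. lam t * B t)"
      unfolding variance_coeff_def q sum_lists_Suc B_def sum_distrib_left by (intro sum.cong refl) (simp add: mult_ac)
    also have "\<dots> = (\<Sum>t\<in>UNIV. lam t) * B undefined" unfolding sum_distrib_right
    proof (intro sum.cong refl)
      fix t show "lam t * B t = lam t * B undefined" using B[of t undefined] by simp
    qed
    finally show ?thesis using lam by simp
  qed
  finally show ?thesis .
qed

lemma prod_list_diff_le:
  fixes x y :: "'a \<Rightarrow> real" and r :: real
  assumes "\<And>s. \<bar>x s\<bar> \<le> 1" "\<And>s. \<bar>y s\<bar> \<le> 1" "\<And>s. \<bar>x s - y s\<bar> \<le> r"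
  shows "\<bar>prod_list (map x ss) - prod_list (map y ss)\<bar> \<le> length ss * r"
proof (induction ss)
  case (Cons s ss)
  have px: "\<bar>prod_list (map x ss)\<bar> \<le> 1" using prod_list_abs_le[of ss x "\<lambda>_. 1"] assms(1) by (simp add: map_replicate_const prod_list_replicate)
  have "\<bar>x s * prod_list (map x ss) - y s * prod_list (map y ss)\<bar> \<le> \<bar>(x s - y s) * prod_list (map x ss)\<bar> + \<bar>y s * (prod_list (map x ss) - prod_list (map y ss))\<bar>"
    by (rule order_trans[OF _ abs_triangle_ineq]) (simp add: algebra_simps)
  also have "\<dots> \<le> r * 1 + 1 * (length ss * r)"
    unfolding abs_mult using assms px Cons.IH order_trans[OF abs_ge_zero assms(3)] by (intro add_mono mult_mono) auto
  finally show ?case by (simp add: algebra_simps)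
qed simp

lemma variance_coeff_diff_le:
  fixes x y l :: "'s::finite \<Rightarrow> real" and r :: real
  assumes "\<And>s. \<bar>x s\<bar> \<le> 1" "\<And>s. \<bar>y s\<bar> \<le> 1" "\<And>s. \<bar>x s - y s\<bar> \<le> r" and l: "\<And>s. 0 \<le> l s"
  shows "\<bar>variance_coeff \<Delta> (\<lambda>s. l s * x s) p - variance_coeff \<Delta> (\<lambda>s. l s * y s) p\<bar> \<le> p * r * variance_coeff \<Delta> l p"
proof -
  have "variance_coeff \<Delta> (\<lambda>s. l s * x s) p - variance_coeff \<Delta> (\<lambda>s. l s * y s) p =
     (\<Sum>ss | length ss = p. ((\<Delta> ss)\<^sup>2 * prod_list (map l ss)) * (prod_list (map x ss) - prod_list (map y ss)))"
    unfolding variance_coeff_def sum_subtractf[symmetric] by (intro sum.cong refl) (simp add: prod_list_mult[symmetric] algebra_simps)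
  also have "\<bar>\<dots>\<bar> \<le> (\<Sum>ss | length ss = p. ((\<Delta> ss)\<^sup>2 * prod_list (map l ss)) * (p * r))"
  proof (rule order_trans[OF sum_abs], rule sum_mono)
    fix ss :: "'s list" assume "ss \<in> {ss. length ss = p}"
    then have "\<bar>prod_list (map x ss) - prod_list (map y ss)\<bar> \<le> p * r" using prod_list_diff_le[where x = x and y = y and ss = ss, OF assms(1-3)] by simp
    moreover have "0 \<le> (\<Delta> ss)\<^sup>2 * prod_list (map l ss)" using l by (intro mult_nonneg_nonneg prod_list_nonneg) auto
    ultimately show "\<bar>((\<Delta> ss)\<^sup>2 * prod_list (map l ss)) * (prod_list (map x ss) - prod_list (map y ss))\<bar> \<le> ((\<Delta> ss)\<^sup>2 * prod_list (map l ss)) * (p * r)"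
      using mult_left_mono by (metis abs_mult abs_of_nonneg)
  qed
  also have "\<dots> = p * r * variance_coeff \<Delta> l p" unfolding variance_coeff_def sum_distrib_right[symmetric] by simp
  finally show ?thesis .
qed

text \<open>\<open>balanced_form_le\<close> under two perturbations: the proportions
  \<open>l\<close> of a finite system agree with \<open>lam\<close> up to the factor \<rho>, and
  overlaps may go down to -r. The first costs powers of \<rho>, the second at most p r at order p on
  either side. The bound vanishes for \<rho> = 1 and r = 0.\<close>

theorem coupling_gap:
  fixes \<Delta> :: "'s::finite list \<Rightarrow> real" and x l :: "'s \<Rightarrow> real" and r \<rho> :: real
  assumes int: "interaction \<Delta>" and bal: "balanced \<Delta> lam" and lam: "\<And>s. 0 < lam s" "(\<Sum>s\<in>UNIV. lam s) = 1"
    and l: "\<And>s. 0 \<le> l s" "(\<Sum>s\<in>UNIV. l s) = 1" and \<rho>: "1 \<le> \<rho>" "\<And>s. l s \<le> \<rho> * lam s" "\<And>s. lam s \<le> \<rho> * l s"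
    and r: "0 \<le> r" "r \<le> 1" and x: "\<And>s. - r \<le> x s \<and> x s \<le> 1"
  shows "(\<Sum>p=1..P. variance_coeff \<Delta> (\<lambda>s. l s * x s) p) - (\<Sum>p=1..P. variance_coeff \<Delta> lam p * (\<Sum>s\<in>UNIV. l s * x s ^ p))
     \<le> (\<Sum>p=1..P. variance_coeff \<Delta> lam p) * ((\<rho> ^ P - 1 / \<rho>) + 2 * real P * r * \<rho> ^ P)"
proof -
  have main: "variance_coeff \<Delta> (\<lambda>s. l s * x s) p - variance_coeff \<Delta> lam p * (\<Sum>s\<in>UNIV. l s * x s ^ p)
     \<le> variance_coeff \<Delta> lam p * ((\<rho> ^ P - 1 / \<rho>) + 2 * real P * r * \<rho> ^ P)" if p: "p \<in> {1..P}" for p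
  proof -
  let ?v = "variance_coeff \<Delta> lam p"
  \<comment> \<open>The positive part of \<open>x\<close>, to which the balanced inequality applies;
    it differs from \<open>x\<close> by at most \<open>r\<close>.\<close>
  define y where "y s = max (x s) 0" for s
  have v: "0 \<le> ?v" by (rule variance_coeff_nonneg) (use lam in \<open>auto intro: less_imp_le\<close>)
  have x1: "\<bar>x s\<bar> \<le> 1" for s using x[of s] r by (auto simp: abs_le_iff)
  have y0: "0 \<le> y s" and y1: "\<bar>y s\<bar> \<le> 1" and xy: "\<bar>x s - y s\<bar> \<le> r" for s using x[of s] r by (auto simp: y_def)
  have \<rho>p: "\<rho> ^ p \<le> \<rho> ^ P" "1 \<le> \<rho> ^ P" using p \<rho> by (auto intro!: power_increasing one_le_power)
  have lv: "variance_coeff \<Delta> l p \<le> \<rho> ^ P * ?v"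
  proof -
    have "variance_coeff \<Delta> l p \<le> variance_coeff \<Delta> (\<lambda>s. \<rho> * lam s) p" using l \<rho> by (intro variance_coeff_mono) auto
    also have "\<dots> = \<rho> ^ p * ?v" by (rule variance_coeff_scale)
    also have "\<dots> \<le> \<rho> ^ P * ?v" using \<rho>p v by (intro mult_right_mono)
    finally show ?thesis .
  qed
  have 1: "variance_coeff \<Delta> (\<lambda>s. l s * x s) p \<le> variance_coeff \<Delta> (\<lambda>s. l s * y s) p + P * r * \<rho> ^ P * ?v"
  proof -
    have "variance_coeff \<Delta> (\<lambda>s. l s * x s) p - variance_coeff \<Delta> (\<lambda>s. l s * y s) p \<le> p * r * variance_coeff \<Delta> l p"
      using variance_coeff_diff_le[where \<Delta> = \<Delta> and p = p and x = x and y = y and l = l, OF x1 y1 xy l(1)] by linarith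
    also have "\<dots> \<le> P * r * (\<rho> ^ P * ?v)"
      using p r lv variance_coeff_nonneg[of l \<Delta> p] l by (intro mult_mono) auto
    finally show ?thesis by (simp add: mult_ac)
  qed
  have 2: "variance_coeff \<Delta> (\<lambda>s. l s * y s) p \<le> \<rho> ^ P * ?v * (\<Sum>s\<in>UNIV. lam s * y s ^ p)"
  proof -
    have "variance_coeff \<Delta> (\<lambda>s. l s * y s) p \<le> variance_coeff \<Delta> (\<lambda>s. \<rho> * (lam s * y s)) p"
      using l \<rho> y0 by (intro variance_coeff_mono) (auto simp: mult.assoc[symmetric] intro!: mult_right_mono)
    also have "\<dots> = \<rho> ^ p * variance_coeff \<Delta> (\<lambda>s. lam s * y s) p" by (rule variance_coeff_scale)
    also have "\<dots> \<le> \<rho> ^ P * (?v * (\<Sum>s\<in>UNIV. lam s * y s ^ p))"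
    proof (intro mult_mono balanced_form_le[OF int bal lam] variance_coeff_nonneg)
      show "0 \<le> lam s * y s" for s using lam(1)[of s] y0[of s] by simp
    qed (use p \<rho>p \<rho> y0 in auto)
    finally show ?thesis by simp
  qed
  have 3: "(\<Sum>s\<in>UNIV. lam s * y s ^ p) / \<rho> - P * r \<le> (\<Sum>s\<in>UNIV. l s * x s ^ p)"
  proof -
    have "(\<Sum>s\<in>UNIV. lam s * y s ^ p) / \<rho> - P * r = (\<Sum>s\<in>UNIV. lam s * y s ^ p / \<rho> - l s * (P * r))"
      using l(2) by (simp add: sum_subtractf sum_divide_distrib sum_distrib_right[symmetric])
    also have "\<dots> \<le> (\<Sum>s\<in>UNIV. l s * x s ^ p)"
    proof (rule sum_mono)
      fix s
      have "\<bar>x s ^ p - y s ^ p\<bar> \<le> p * r"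
        using prod_list_diff_le[where x = x and y = y and ss = "replicate p s", OF x1 y1 xy] by (simp add: prod_list_replicate)
      also have "\<dots> \<le> P * r" using p r by (intro mult_right_mono) auto
      finally have "l s * (y s ^ p - P * r) \<le> l s * x s ^ p" using l by (intro mult_left_mono) auto
      moreover have "lam s * y s ^ p / \<rho> \<le> l s * y s ^ p"
        using mult_right_mono[OF \<rho>(3)[of s], of "y s ^ p"] y0 \<rho>(1) by (simp add: pos_divide_le_eq mult_ac)
      ultimately show "lam s * y s ^ p / \<rho> - l s * (P * r) \<le> l s * x s ^ p" by (simp add: algebra_simps)
    qed
    finally show ?thesis .
  qed
  define w where "w = (\<Sum>s\<in>UNIV. lam s * y s ^ p)"
  have w: "0 \<le> w" "w \<le> 1"
  proof -
    show "0 \<le> w" unfolding w_def using lam y0 by (intro sum_nonneg mult_nonneg_nonneg) (auto intro: less_imp_le)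
    have "w \<le> (\<Sum>s\<in>UNIV. lam s * 1)" unfolding w_def
      using lam y0 y1 by (intro sum_mono mult_left_mono power_le_one) (auto intro: less_imp_le simp: abs_le_iff)
    then show "w \<le> 1" using lam by simp
  qed
  have "variance_coeff \<Delta> (\<lambda>s. l s * x s) p - ?v * (\<Sum>s\<in>UNIV. l s * x s ^ p)
     \<le> (\<rho> ^ P * ?v * w + P * r * \<rho> ^ P * ?v) - ?v * (w / \<rho> - P * r)"
    using 1 2 mult_left_mono[OF 3 v] unfolding w_def[symmetric] by linarith
  also have "\<dots> = ?v * ((\<rho> ^ P - 1 / \<rho>) * w + P * r * \<rho> ^ P + P * r * 1)" by (simp add: algebra_simps)
  also have "\<dots> \<le> ?v * ((\<rho> ^ P - 1 / \<rho>) * 1 + P * r * \<rho> ^ P + P * r * \<rho> ^ P)"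
  proof (intro mult_left_mono add_mono v order_refl)
    have "1 / \<rho> \<le> 1" using \<rho> by simp
    then show "0 \<le> \<rho> ^ P - 1 / \<rho>" using \<rho>p by linarith
  qed (use w r \<rho>p in auto)
  finally show ?thesis by (simp add: algebra_simps)
  qed
  show ?thesis unfolding sum_subtractf[symmetric] sum_distrib_right by (rule sum_mono) (rule main)
qed

text \<open>The constants are chosen in the order \<open>b\<close>, \<open>z\<close>,
  \<open>h\<close>, \<open>d\<close>, each depending on the earlier ones and none on N. Only then N
  tends to infinity, which removes the flip error and makes every block large enough for the
  single-species hypothesis.\<close>

theorem truncated_limit:
  fixes \<Delta> :: "'s::finite list \<Rightarrow> real" and I :: "nat \<Rightarrow> 's \<Rightarrow> nat set" and lam :: "'s \<Rightarrow> real"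
    and \<beta> :: "nat \<Rightarrow> real" and k :: spin_type
  assumes int: "interaction \<Delta>"
    and part: "\<And>N. N \<ge> 1 \<Longrightarrow> species_partition N (I N)"
    and ratio: "\<And>s. (\<lambda>N. species_ratio N (I N) s) \<longlonglongrightarrow> lam s"
    and lam: "\<And>s. lam s > 0"
    and bal: "balanced \<Delta> lam"
    and \<beta>: "\<And>p. p \<ge> 1 \<Longrightarrow> (\<beta> p)\<^sup>2 = variance_coeff \<Delta> lam p"
    and P: "1 \<le> P"
    and single: "\<And>e. 0 < e \<Longrightarrow> \<forall>\<^sub>F n in sequentially. (\<Sum>p=1..P. (\<beta> p)\<^sup>2) / 2 - e \<le> mean_ln k n (single_blocks n) P (single_coeff \<beta> n) / n"
    and e: "0 < e"
  shows "\<forall>\<^sub>F N in sequentially. (\<Sum>p=1..P. (\<beta> p)\<^sup>2) / 2 - e \<le> mean_ln k N (I N) P (multi_coeff \<Delta> N) / N"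
proof -
  define S where "S = (\<Sum>p=1..P. (\<beta> p)\<^sup>2)"
  have S0: "0 \<le> S" unfolding S_def by (intro sum_nonneg) auto
  have S: "S = (\<Sum>p=1..P. variance_coeff \<Delta> lam p)" unfolding S_def by (intro sum.cong refl) (simp add: \<beta>)
  have ratio_sum: "(\<Sum>s\<in>UNIV. species_ratio N (I N) s) = 1" if N: "1 \<le> N" for N
  proof -
    interpret partition N "I N" by (rule partition.intro[OF part[OF N]])
    have "(\<Sum>s\<in>UNIV. real (card (I N s))) = real N" using sum_card by (metis of_nat_sum)
    then show ?thesis using N by (simp add: species_ratio_def sum_divide_distrib[symmetric])
  qed
  have lam1: "(\<Sum>s\<in>UNIV. lam s) = 1"
  proof (rule LIMSEQ_unique)
    show "(\<lambda>N. \<Sum>s\<in>UNIV. species_ratio N (I N) s) \<longlonglongrightarrow> (\<Sum>s\<in>UNIV. lam s)" by (intro tendsto_sum ratio)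
    show "(\<lambda>N. \<Sum>s\<in>UNIV. species_ratio N (I N) s) \<longlonglongrightarrow> 1"
      by (rule tendsto_eventually) (use ratio_sum in \<open>auto simp: eventually_sequentially intro!: exI[of _ 1]\<close>)
  qed
  \<comment> \<open>Makes the loss \<open>b * V\<close> of the passage to the mean logarithm at most
    e / 8, since V will be at most 2 S.\<close>
  define b where "b = min (1 / 2) (e / (16 * (S + 1)))"
  have b: "0 < b" "b < 1" "b \<le> 1 / 2"
  proof -
    show "0 < b" unfolding b_def using e S0 by auto
    show "b \<le> 1 / 2" unfolding b_def by (rule min.cobounded1)
    then show "b < 1" by simp
  qed
  have bS: "b * (2 * S) \<le> e / 8"
  proof -
    have "b * (2 * S) \<le> e / (16 * (S + 1)) * (2 * (S + 1))" using b S0 e unfolding b_def by (intro mult_mono) auto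
    also have "\<dots> = e / 8" using S0 by (simp add: field_simps)
    finally show ?thesis .
  qed
  \<comment> \<open>The loss per site from the field and from \<open>coupling_gap\<close>, one
    number \<open>z\<close> serving as field variance, as overlap threshold and as tolerance \<rho>
    - 1 of the species proportions.\<close>
  define \<epsilon> where "\<epsilon> z = z + S * (((1 + z) ^ P - 1 / (1 + z)) + 2 * real P * z * (1 + z) ^ P)" for z :: real
  obtain z where z: "0 < z" "z < 1" "\<epsilon> z < b * e / 2" "(1 + z) ^ P < 2" "S / 2 - e / 8 < S / 2 / (1 + z) ^ P"
  proof -
    have id: "((\<lambda>z::real. z) \<longlongrightarrow> 0) (at_right 0)" by (rule tendsto_ident_at)
    have "(\<epsilon> \<longlongrightarrow> 0 + S * (((1 + 0) ^ P - 1 / (1 + 0)) + 2 * real P * 0 * (1 + 0) ^ P)) (at_right 0)"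
      unfolding \<epsilon>_def by (intro tendsto_intros id) auto
    then have "(\<epsilon> \<longlongrightarrow> 0) (at_right 0)" by simp
    then have 1: "\<forall>\<^sub>F z in at_right 0. \<epsilon> z < b * e / 2" by (rule order_tendstoD) (use b e in auto)
    have "((\<lambda>z::real. (1 + z) ^ P) \<longlongrightarrow> (1 + 0) ^ P) (at_right 0)" by (intro tendsto_intros id)
    then have 2: "\<forall>\<^sub>F z::real in at_right 0. (1 + z) ^ P < 2" by (rule order_tendstoD) simp
    have "((\<lambda>z::real. S / 2 / (1 + z) ^ P) \<longlongrightarrow> S / 2 / (1 + 0) ^ P) (at_right 0)" by (intro tendsto_intros id) auto
    then have 3: "\<forall>\<^sub>F z::real in at_right 0. S / 2 - e / 8 < S / 2 / (1 + z) ^ P" by (rule order_tendstoD) (use e in simp)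
    have 4: "\<forall>\<^sub>F z::real in at_right 0. 0 < z \<and> z < 1"
      using eventually_at_right_real[of 0 1] by (auto elim: eventually_mono)
    have "\<forall>\<^sub>F z in at_right 0. 0 < z \<and> z < 1 \<and> \<epsilon> z < b * e / 2 \<and> (1 + z) ^ P < 2 \<and> S / 2 - e / 8 < S / 2 / (1 + z) ^ P"
      using 1 2 3 4 by eventually_elim auto
    then show ?thesis using that eventually_happens'[OF trivial_limit_at_right_real] by blast
  qed
  define \<rho> where "\<rho> = 1 + z"
  have \<rho>: "1 < \<rho>" "\<rho> ^ P < 2" "S / 2 - e / 8 \<le> S / 2 / \<rho> ^ P" using z by (auto simp: \<rho>_def)
  have \<rho>P: "1 \<le> \<rho> ^ P" using \<rho> by (intro one_le_power) auto
  \<comment> \<open>A lower bound for all species proportions at large N, giving block sizes at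
    least N \<nu>.\<close>
  define \<nu> where "\<nu> = Min (range lam) / \<rho>"
  have \<nu>: "0 < \<nu>" "\<And>s. \<nu> \<le> lam s / \<rho>"
  proof -
    have "Min (range lam) \<in> range lam" by (rule Min_in) auto
    then show "0 < \<nu>" using lam \<rho> by (auto simp: \<nu>_def)
    show "\<nu> \<le> lam s / \<rho>" for s using \<rho> by (auto simp: \<nu>_def intro!: divide_right_mono Min_le)
  qed
  define vm where "vm = \<rho> ^ P * S + z"
  have vm: "0 < vm" using z S0 \<rho>P by (simp add: vm_def add_nonneg_pos)
  \<comment> \<open>Makes the concentration error 9 h^2 vm at most half of the gain 2 h z z \<nu>,
    so the flip error decays exponentially in N. The bound 1 / 4 ensures h < 1 - b.\<close>
  define h where "h = min (1 / 4) (z * z * \<nu> / (9 * vm))"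
  have h: "0 < h" "h < 1 - b" using z \<nu> vm b by (auto simp: h_def)
  have h9: "9 * h * vm \<le> z * z * \<nu>"
  proof -
    have "9 * h * vm \<le> 9 * (z * z * \<nu> / (9 * vm)) * vm" using vm unfolding h_def by (intro mult_right_mono mult_left_mono) auto
    then show ?thesis using vm by simp
  qed
  \<comment> \<open>The deficit of the decoupled model is divided by h b, so the accuracy asked of
    the single-species model depends on both.\<close>
  define d where "d = h * b * e / 8"
  have d: "0 < d" using h b e by (simp add: d_def)
  let ?K = "real (card (signs :: ('s \<Rightarrow> real) set))"
  have ev_ratio: "\<forall>\<^sub>F N in sequentially. \<forall>s\<in>UNIV. species_ratio N (I N) s \<le> \<rho> * lam s \<and> lam s \<le> \<rho> * species_ratio N (I N) s"
  proof (rule eventually_ball_finite, simp, rule ballI)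
    fix s
    have "lam s < \<rho> * lam s" using \<rho> lam[of s] by simp
    with ratio have 1: "\<forall>\<^sub>F N in sequentially. species_ratio N (I N) s < \<rho> * lam s" by (rule order_tendstoD)
    have "((\<lambda>N. \<rho> * species_ratio N (I N) s) \<longlonglongrightarrow> \<rho> * lam s)" by (intro tendsto_intros ratio)
    then have 2: "\<forall>\<^sub>F N in sequentially. lam s < \<rho> * species_ratio N (I N) s" by (rule order_tendstoD) fact
    show "\<forall>\<^sub>F N in sequentially. species_ratio N (I N) s \<le> \<rho> * lam s \<and> lam s \<le> \<rho> * species_ratio N (I N) s"
      using 1 2 by eventually_elim auto
  qed
  obtain n0 where n0: "\<And>n. n0 \<le> n \<Longrightarrow> S / 2 - d \<le> mean_ln k n (single_blocks n) P (single_coeff \<beta> n) / n"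
    using single[OF d] unfolding S_def eventually_sequentially by blast
  have ev_n0: "\<forall>\<^sub>F N in sequentially. real n0 + 1 \<le> \<nu> * real N"
  proof -
    have "filterlim (\<lambda>N. \<nu> * real N) at_top sequentially"
      by (rule filterlim_tendsto_pos_mult_at_top[OF tendsto_const \<nu>(1) filterlim_real_sequentially])
    then show ?thesis by (simp add: filterlim_at_top)
  qed
  have ev_q: "\<forall>\<^sub>F N in sequentially. 2 * vm * (?K * exp (- (h * (z * z * \<nu>)) * real N)) \<le> b * e / 4"
  proof -
    have "filterlim (\<lambda>N. (h * (z * z * \<nu>)) * real N) at_top sequentially"
      by (rule filterlim_tendsto_pos_mult_at_top[OF tendsto_const _ filterlim_real_sequentially]) (use h z \<nu> in auto)
    then have "((\<lambda>N. exp (- ((h * (z * z * \<nu>)) * real N))) \<longlongrightarrow> 0) sequentially"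
      by (intro filterlim_compose[OF exp_at_bot] filterlim_uminus_at_bot_at_top[THEN filterlim_compose])
    then have "((\<lambda>N. 2 * vm * (?K * exp (- ((h * (z * z * \<nu>)) * real N)))) \<longlonglongrightarrow> 2 * vm * (?K * 0))"
      by (intro tendsto_intros)
    then have "\<forall>\<^sub>F N in sequentially. 2 * vm * (?K * exp (- ((h * (z * z * \<nu>)) * real N))) < b * e / 4"
      by (rule order_tendstoD) (use b e in simp)
    then show ?thesis by (rule eventually_mono) simp
  qed
  show ?thesis
    using ev_ratio ev_n0 ev_q eventually_ge_at_top[of 1]
  proof eventually_elim
    case (elim N)
    have N: "1 \<le> N" by fact
    interpret partition N "I N" by (rule partition.intro[OF part[OF N]])
    define l where "l s = species_ratio N (I N) s" for s
    have card: "real (card (I N s)) = real N * l s" for s using N by (simp add: l_def species_ratio_def)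
    have l0: "0 \<le> l s" for s by (simp add: l_def species_ratio_def)
    have l1: "(\<Sum>s\<in>UNIV. l s) = 1" using ratio_sum[OF N] by (simp add: l_def)
    have l\<rho>: "l s \<le> \<rho> * lam s" "lam s \<le> \<rho> * l s" for s using elim(1) by (auto simp: l_def)
    have nmc: "real N * \<nu> \<le> real (card (I N s))" for s
    proof -
      have "lam s / \<rho> \<le> l s" using l\<rho>(2)[of s] \<rho>(1) by (simp add: pos_divide_le_eq mult.commute)
      then have "\<nu> \<le> l s" using \<nu>(2)[of s] by linarith
      then show ?thesis unfolding card by (intro mult_left_mono) auto
    qed
    have cpos: "n0 < card (I N s)" for s using nmc[of s] elim(2) by (simp add: mult.commute)
    let ?cm = "multi_coeff \<Delta> N" and ?cd = "decoupled_coeff \<beta> (\<lambda>s. card (I N s))"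
    define V where "V = (\<Sum>p=1..P. variance_coeff \<Delta> l p)"
    have Vm: "form P ?cm (\<lambda>s. card (I N s)) = N * V"
      unfolding form_multi[OF N] V_def card using N by simp
    have cm_x: "form P ?cm (\<lambda>s. card (I N s) * x s) = N * (\<Sum>p=1..P. variance_coeff \<Delta> (\<lambda>s. l s * x s) p)" for x :: "'s \<Rightarrow> real"
      unfolding form_multi[OF N] card using N by simp
    have cd_x: "form P ?cd (\<lambda>s. card (I N s) * x s) = N * (\<Sum>p=1..P. variance_coeff \<Delta> lam p * (\<Sum>s\<in>UNIV. l s * x s ^ p))" for x :: "'s \<Rightarrow> real"
    proof -
      have "form P ?cd (\<lambda>s. card (I N s) * x s) = (\<Sum>p=1..P. (\<beta> p)\<^sup>2 * (\<Sum>s\<in>UNIV. card (I N s) * x s ^ p))"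
        by (rule form_decoupled) (use cpos in \<open>metis neq0_conv not_less0\<close>)
      also have "\<dots> = (\<Sum>p=1..P. N * (variance_coeff \<Delta> lam p * (\<Sum>s\<in>UNIV. l s * x s ^ p)))"
        by (intro sum.cong refl) (simp add: \<beta> card sum_distrib_left mult_ac)
      finally show ?thesis by (simp add: sum_distrib_left)
    qed
    have Vd: "form P ?cd (\<lambda>s. card (I N s)) = N * S"
      using cd_x[of "\<lambda>_. 1"] l1 by (simp add: S)
    have VS: "V \<le> \<rho> ^ P * S" and SV: "S \<le> \<rho> ^ P * V"
    proof -
      have lp: "\<rho> ^ p \<le> \<rho> ^ P" if "p \<in> {1..P}" for p using that \<rho> by (intro power_increasing) auto
      show "V \<le> \<rho> ^ P * S" unfolding V_def S sum_distrib_left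
      proof (rule sum_mono)
        fix p assume p: "p \<in> {1..P}"
        have "variance_coeff \<Delta> l p \<le> variance_coeff \<Delta> (\<lambda>s. \<rho> * lam s) p" using l0 l\<rho> by (intro variance_coeff_mono) auto
        also have "\<dots> = \<rho> ^ p * variance_coeff \<Delta> lam p" by (rule variance_coeff_scale)
        also have "\<dots> \<le> \<rho> ^ P * variance_coeff \<Delta> lam p"
          using lp[OF p] lam by (intro mult_right_mono variance_coeff_nonneg) (auto intro: less_imp_le)
        finally show "variance_coeff \<Delta> l p \<le> \<rho> ^ P * variance_coeff \<Delta> lam p" .
      qed
      show "S \<le> \<rho> ^ P * V" unfolding V_def S sum_distrib_left
      proof (rule sum_mono)
        fix p assume p: "p \<in> {1..P}"
        have "variance_coeff \<Delta> lam p \<le> variance_coeff \<Delta> (\<lambda>s. \<rho> * l s) p" using lam l\<rho> by (intro variance_coeff_mono) (auto intro: less_imp_le)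
        also have "\<dots> = \<rho> ^ p * variance_coeff \<Delta> l p" by (rule variance_coeff_scale)
        also have "\<dots> \<le> \<rho> ^ P * variance_coeff \<Delta> l p"
          using lp[OF p] l0 by (intro mult_right_mono variance_coeff_nonneg) auto
        finally show "variance_coeff \<Delta> lam p \<le> \<rho> ^ P * variance_coeff \<Delta> l p" .
      qed
    qed
    define g where "g = S * ((\<rho> ^ P - 1 / \<rho>) + 2 * real P * z * \<rho> ^ P)"
    have g0: "0 \<le> g"
    proof -
      have "1 / \<rho> \<le> 1" using \<rho> by simp
      then show ?thesis unfolding g_def using S0 \<rho>P z by (intro mult_nonneg_nonneg add_nonneg_nonneg) auto
    qed
    have zg: "z + g = \<epsilon> z" by (simp add: g_def \<epsilon>_def \<rho>_def)
    define q where "q = exp (- h * (2 * z * z * (N * \<nu>)) + 9 * h\<^sup>2 * (N * vm))"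
    have main: "N * V / 2 - (N * d + h / 2 * (z * N + N * g + 2 * (N * vm) * (?K * q))) / (h * b) - b * (N * V) \<le> mean_ln k N (I N) P ?cm"
      unfolding Vm[symmetric] q_def
    proof (rule finite_volume_bound[OF P, where \<beta> = \<beta> and cm = ?cm])
      show "0 \<le> ?cm ss" for ss by (simp add: multi_coeff_def)
      show "0 < N * \<nu>" using N \<nu> by simp
      show "N * \<nu> \<le> real (card (I N s))" for s by (rule nmc)
      show "form P ?cm (\<lambda>s. card (I N s)) + z * N \<le> N * vm"
        unfolding Vm vm_def using mult_left_mono[OF VS, of "real N"] by (simp add: algebra_simps)
      have "S \<le> \<rho> ^ P * S" using \<rho>P S0 by (simp add: mult_le_cancel_right1)
      from mult_left_mono[OF this, of "real N"] show "form P ?cd (\<lambda>s. card (I N s)) + z * N \<le> N * vm"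
        unfolding Vd vm_def by (simp add: algebra_simps)
      show "0 \<le> N * g" using g0 by simp
      show "0 \<le> N * d" using d by simp
      show "0 \<le> z" "0 < z" using z by auto
      show "0 < b" "b < 1" "0 < h" "h < 1 - b" using b h by auto
      fix x :: "'s \<Rightarrow> real" assume x: "\<And>s. - z \<le> x s \<and> x s \<le> 1"
      have "(\<Sum>p=1..P. variance_coeff \<Delta> (\<lambda>s. l s * x s) p) - (\<Sum>p=1..P. variance_coeff \<Delta> lam p * (\<Sum>s\<in>UNIV. l s * x s ^ p)) \<le> g"
        unfolding g_def S
        by (rule coupling_gap[where x = x and l = l and \<rho> = \<rho> and r = z, OF int bal lam lam1 l0 l1 _ l\<rho>]) (use \<rho> z x in auto)
      then show "form P ?cm (\<lambda>s. card (I N s) * x s) - form P ?cd (\<lambda>s. card (I N s) * x s) \<le> N * g"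
        unfolding cm_x cd_x right_diff_distrib[symmetric] by (intro mult_left_mono) auto
    next
      \<comment> \<open>All blocks have more than \<open>n0\<close> sites and their sizes sum to N,
        so the deficits of the species add up to N d.\<close>
      have "N * (S / 2 - d) = (\<Sum>s\<in>UNIV. real (card (I N s)) * (S / 2 - d))"
        unfolding sum_distrib_right[symmetric] card using l1 by (simp add: sum_distrib_left[symmetric])
      also have "\<dots> \<le> (\<Sum>s\<in>UNIV. mean_ln k (card (I N s)) (single_blocks (card (I N s))) P (single_coeff \<beta> (card (I N s))))"
      proof (rule sum_mono)
        fix s
        have "0 < real (card (I N s))" using cpos[of s] by linarith
        then show "real (card (I N s)) * (S / 2 - d) \<le> mean_ln k (card (I N s)) (single_blocks (card (I N s))) P (single_coeff \<beta> (card (I N s)))"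
          using n0[OF less_imp_le[OF cpos[of s]]] by (simp add: pos_le_divide_eq mult.commute)
      qed
      also have "\<dots> = mean_ln k N (I N) P ?cd" by (rule mean_ln_decoupled[symmetric])
      finally show "form P ?cd (\<lambda>s. card (I N s)) / 2 - N * d \<le> mean_ln k N (I N) P ?cd"
        unfolding Vd by (simp add: algebra_simps)
    qed
    have q: "q \<le> exp (- (h * (z * z * \<nu>)) * real N)"
    proof -
      have "(h * N) * (9 * h * vm) \<le> (h * N) * (z * z * \<nu>)" using h9 h by (intro mult_left_mono) auto
      then show ?thesis unfolding q_def by (simp add: algebra_simps power2_eq_square)
    qed
    \<comment> \<open>The budget per site: e / 8 from the deficit and 3 e / 8 from the
      interpolation, to which e / 8 is added below for replacing S by V and e / 8 for b V.\<close>
    have "(N * d + h / 2 * (z * N + N * g + 2 * (N * vm) * (?K * q))) / (h * b)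
      = N * (d / (h * b)) + N * ((\<epsilon> z + 2 * vm * (?K * q)) / (2 * b))"
      unfolding zg[symmetric] using h b by (simp add: field_simps)
    also have "\<dots> \<le> N * (e / 8) + N * (3 * e / 8)"
    proof (intro add_mono mult_left_mono)
      show "d / (h * b) \<le> e / 8" using h b by (simp add: d_def)
      have "2 * vm * (?K * q) \<le> 2 * vm * (?K * exp (- (h * (z * z * \<nu>)) * real N))"
        using q vm by (intro mult_left_mono) auto
      also have "\<dots> \<le> b * e / 4" by (rule elim(3))
      finally have "\<epsilon> z + 2 * vm * (?K * q) \<le> b * e / 2 + b * e / 4" using z by linarith
      then have "(\<epsilon> z + 2 * vm * (?K * q)) / (2 * b) \<le> (b * e / 2 + b * e / 4) / (2 * b)" using b by (intro divide_right_mono) auto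
      also have "\<dots> = 3 * e / 8" using b by (simp add: field_simps)
      finally show "(\<epsilon> z + 2 * vm * (?K * q)) / (2 * b) \<le> 3 * e / 8" .
    qed auto
    finally have X: "(N * d + h / 2 * (z * N + N * g + 2 * (N * vm) * (?K * q))) / (h * b) \<le> N * (e / 2)"
      by (simp add: algebra_simps)
    have "S / 2 - e / 8 \<le> V / 2"
    proof -
      have "S / 2 / \<rho> ^ P \<le> V / 2" using SV \<rho>P by (simp add: pos_divide_le_eq mult.commute)
      then show ?thesis using \<rho> by linarith
    qed
    then have VN: "N * (S / 2 - e / 8) \<le> N * (V / 2)" by (intro mult_left_mono) auto
    have "b * V \<le> b * (2 * S)"
    proof -
      have "\<rho> ^ P * S \<le> 2 * S" using \<rho> S0 by (intro mult_right_mono) auto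
      then show ?thesis using VS b by (intro mult_left_mono) auto
    qed
    then have "b * V \<le> e / 8" using bS by linarith
    then have bV: "N * (b * V) \<le> N * (e / 8)" by (intro mult_left_mono) auto
    have "N * (S / 2 - e) \<le> N * (S / 2 - e / 8) - N * (e / 2) - N * (e / 8)"
      using e by (simp add: algebra_simps)
    also have "\<dots> \<le> N * V / 2 - (N * d + h / 2 * (z * N + N * g + 2 * (N * vm) * (?K * q))) / (h * b) - b * (N * V)"
    proof -
      have "real N * (V / 2) = real N * V / 2" "real N * (b * V) = b * (real N * V)" by simp_all
      then show ?thesis using VN X bV by linarith
    qed
    also have "\<dots> \<le> mean_ln k N (I N) P ?cm" by (rule main)
    finally show ?case unfolding S_def[symmetric] using N by (simp add: pos_le_divide_eq mult.commute)
  qed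
qed

subsection \<open>Truncation of the Hamiltonian\<close>

text \<open>The Cameron-Martin formula for nonnegative functions without any integrability
  assumption, as needed for exponential moments under the tilted measure.\<close>

lemma nn_integral_gauss_shift:
  assumes J: "finite J" and [measurable]: "f \<in> borel_measurable (gauss J)"
  shows "(\<integral>\<^sup>+x. ennreal (exp (\<Sum>j\<in>J. a j * x j)) * f x \<partial>gauss J) =
     ennreal (exp ((\<Sum>j\<in>J. (a j)\<^sup>2) / 2)) * (\<integral>\<^sup>+x. f (\<lambda>j\<in>J. x j + a j) \<partial>gauss J)"
proof -
  have "(\<integral>\<^sup>+x. f (\<lambda>j\<in>J. x j + a j) \<partial>gauss J) = (\<integral>\<^sup>+x. f x \<partial>distr (gauss J) (gauss J) (\<lambda>x. \<lambda>j\<in>J. x j + a j))"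
    by (rule nn_integral_distr[symmetric]) measurable
  also have "\<dots> = (\<integral>\<^sup>+x. ennreal (exp (\<Sum>j\<in>J. a j * x j - (a j)\<^sup>2 / 2)) * f x \<partial>gauss J)"
    unfolding gauss_shift[OF J] by (rule nn_integral_density) measurable
  finally have "ennreal (exp ((\<Sum>j\<in>J. (a j)\<^sup>2) / 2)) * (\<integral>\<^sup>+x. f (\<lambda>j\<in>J. x j + a j) \<partial>gauss J)
     = (\<integral>\<^sup>+x. ennreal (exp ((\<Sum>j\<in>J. (a j)\<^sup>2) / 2)) * (ennreal (exp (\<Sum>j\<in>J. a j * x j - (a j)\<^sup>2 / 2)) * f x) \<partial>gauss J)"
    by (simp add: nn_integral_cmult)
  also have "\<dots> = (\<integral>\<^sup>+x. ennreal (exp (\<Sum>j\<in>J. a j * x j)) * f x \<partial>gauss J)"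
    by (intro nn_integral_cong)
       (simp add: mult.assoc[symmetric] ennreal_mult[symmetric] exp_add[symmetric] sum_subtractf sum_divide_distrib[symmetric])
  finally show ?thesis by simp
qed

text \<open>Sub-Gaussian moment generating functions suffice for all the tail estimates on the Hamiltonian.\<close>

locale gaussian_series = prob_space M for M :: "'a measure" +
  fixes h :: "nat \<Rightarrow> 'a \<Rightarrow> real" and V :: "nat \<Rightarrow> real"
  assumes meas_h [measurable]: "\<And>p. h p \<in> borel_measurable M"
    and V_nonneg: "\<And>p. 0 \<le> V p"
    and mgf: "\<And>p s. (\<integral>\<^sup>+x. ennreal (exp (s * h p x)) \<partial>M) = ennreal (exp (s\<^sup>2 * V p / 2))"
    and mgf_sum: "\<And>Q. (\<integral>\<^sup>+x. ennreal (exp (\<Sum>p<Q. h p x)) \<partial>M) = ennreal (exp ((\<Sum>p<Q. V p) / 2))"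
    and summable_sqrt: "summable (\<lambda>p. sqrt (V p))" and summable_V: "summable V"
begin

lemma integrable_exp_h: "integrable M (\<lambda>x. exp (s * h p x))" and integral_exp_h: "(LINT x|M. exp (s * h p x)) = exp (s\<^sup>2 * V p / 2)"
proof -
  show "integrable M (\<lambda>x. exp (s * h p x))"
    by (rule integrableI_bounded) (auto simp: mgf)
  show "(LINT x|M. exp (s * h p x)) = exp (s\<^sup>2 * V p / 2)"
    by (subst integral_eq_nn_integral) (auto simp: mgf)
qed

lemma abs_h_le: "0 < s \<Longrightarrow> \<bar>h p x\<bar> \<le> (exp (s * h p x) + exp (- s * h p x)) / s"
proof -
  assume s: "0 < s"
  have "s * \<bar>h p x\<bar> \<le> exp (s * \<bar>h p x\<bar>)" using exp_ge_add_one_self[of "s * \<bar>h p x\<bar>"] by linarith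
  also have "\<dots> \<le> exp (s * h p x) + exp (- s * h p x)" by (cases "h p x \<ge> 0") auto
  finally show ?thesis using s by (simp add: pos_le_divide_eq mult.commute)
qed

lemma integrable_h: "integrable M (h p)"
  by (rule Bochner_Integration.integrable_bound[where f = "\<lambda>x. exp (1 * h p x) + exp (- 1 * h p x)"])
     (use abs_h_le[of 1 p] integrable_exp_h[of 1 p] integrable_exp_h[of "-1" p] in \<open>auto intro!: AE_I2\<close>)

lemma abs_h_mean_s: "0 < s \<Longrightarrow> (LINT x|M. \<bar>h p x\<bar>) \<le> 2 / s * exp (s\<^sup>2 * V p / 2)"
proof -
  assume s: "0 < s"
  have "(LINT x|M. \<bar>h p x\<bar>) \<le> (LINT x|M. (exp (s * h p x) + exp (- s * h p x)) / s)"
    using integrable_exp_h[of s p] integrable_exp_h[of "- s" p] integrable_h[of p] abs_h_le[OF s, of p]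
    by (intro integral_mono) auto
  also have "\<dots> = 2 / s * exp (s\<^sup>2 * V p / 2)"
    using integrable_exp_h[of s p] integrable_exp_h[of "- s" p] integral_exp_h[of s p] integral_exp_h[of "- s" p] by simp
  finally show ?thesis .
qed

text \<open>The exponential bound with s = 1 / sqrt(V p). For variance 0 letting s grow shows that
  the mean vanishes.\<close>

lemma abs_h_mean: "(LINT x|M. \<bar>h p x\<bar>) \<le> 4 * sqrt (V p)"
proof (cases "V p = 0")
  case True
  have "(LINT x|M. \<bar>h p x\<bar>) \<le> 0"
  proof (rule field_le_epsilon)
    fix e :: real assume "0 < e"
    then show "(LINT x|M. \<bar>h p x\<bar>) \<le> 0 + e" using abs_h_mean_s[of "2 / e" p] True by simp
  qed
  then show ?thesis using True by simp
next
  case False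
  then have V: "0 < V p" using V_nonneg[of p] by simp
  have "(LINT x|M. \<bar>h p x\<bar>) \<le> 2 * sqrt (V p) * exp (1 / 2)"
    using abs_h_mean_s[of "1 / sqrt (V p)" p] V by (simp add: power_divide)
  also have "\<dots> \<le> 2 * sqrt (V p) * 2"
  proof (rule mult_left_mono)
    show "exp (1 / 2) \<le> (2::real)" using exp_bound_half[of "1 / 2 :: real"] by simp
  qed (use V in simp)
  finally show ?thesis by simp
qed

text \<open>With m the mean, exp(s^2 V / 2) - 1 - s m is nonnegative and vanishes at s = 0, so its
  derivative -m at 0 is zero.\<close>

lemma h_mean: "(LINT x|M. h p x) = 0"
proof -
  have le: "s * (LINT x|M. h p x) \<le> exp (s\<^sup>2 * V p / 2) - 1" for s
  proof -
    have "(LINT x|M. 1 + s * h p x) \<le> (LINT x|M. exp (s * h p x))"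
      using integrable_h[of p] integrable_exp_h[of s p] by (intro integral_mono) auto
    then show ?thesis using integrable_h[of p] by (simp add: integral_exp_h prob_space)
  qed
  define m where "m = (LINT x|M. h p x)"
  have "((\<lambda>s. exp (s\<^sup>2 * V p / 2)) has_real_derivative 0) (at 0)"
    by (auto intro!: derivative_eq_intros)
  then have "((\<lambda>s. exp (s\<^sup>2 * V p / 2) - 1 - s * m) has_real_derivative (0 - 0 - m)) (at 0)"
    by (auto intro!: derivative_eq_intros)
  then have "0 - 0 - m = 0"
  proof (rule DERIV_local_min[where d = 1])
    show "\<forall>y. \<bar>0 - y\<bar> < 1 \<longrightarrow> exp (0\<^sup>2 * V p / 2) - 1 - 0 * m \<le> exp (y\<^sup>2 * V p / 2) - 1 - y * m"
    proof (intro allI impI)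
      fix y :: real
      show "exp (0\<^sup>2 * V p / 2) - 1 - 0 * m \<le> exp (y\<^sup>2 * V p / 2) - 1 - y * m" using le[of y] unfolding m_def by simp
    qed
  qed simp
  then show ?thesis by (simp add: m_def)
qed

lemma AE_summable: "AE x in M. summable (\<lambda>p. \<bar>h p x\<bar>)"
proof -
  have "(\<integral>\<^sup>+x. (\<Sum>p. ennreal \<bar>h p x\<bar>) \<partial>M) = (\<Sum>p. \<integral>\<^sup>+x. ennreal \<bar>h p x\<bar> \<partial>M)"
    by (rule nn_integral_suminf) simp
  also have "\<dots> = (\<Sum>p. ennreal (LINT x|M. \<bar>h p x\<bar>))"
    using integrable_h by (intro suminf_cong nn_integral_eq_integral) auto
  also have "\<dots> \<le> (\<Sum>p. ennreal (4 * sqrt (V p)))"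
    by (intro suminf_le ennreal_leI abs_h_mean) auto
  also have "\<dots> = ennreal (\<Sum>p. 4 * sqrt (V p))"
    using summable_sqrt V_nonneg by (intro suminf_ennreal2 summable_mult) auto
  also have "\<dots> < \<infinity>" by simp
  finally have "(\<integral>\<^sup>+x. (\<Sum>p. ennreal \<bar>h p x\<bar>) \<partial>M) \<noteq> \<infinity>" by simp
  then have "AE x in M. (\<Sum>p. ennreal \<bar>h p x\<bar>) \<noteq> \<infinity>"
    by (rule nn_integral_PInf_AE[rotated]) measurable
  then show ?thesis by (rule eventually_mono) (auto intro!: summable_suminf_not_top)
qed

lemma summable_abs_mean: "summable (\<lambda>p. LINT x|M. norm (h p x))"
  by (rule summable_comparison_test'[where g = "\<lambda>p. 4 * sqrt (V p)" and N = 0])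
     (use summable_sqrt abs_h_mean in \<open>auto intro!: summable_mult integral_nonneg_AE\<close>)

lemma integrable_series: "integrable M (\<lambda>x. \<Sum>p. h p x)"
  by (rule integrable_suminf[OF integrable_h AE_summable[folded real_norm_def] summable_abs_mean])

lemma series_mean: "(LINT x|M. (\<Sum>p. h p x)) = 0"
  using integral_suminf[OF integrable_h AE_summable[folded real_norm_def] summable_abs_mean] by (simp only: h_mean suminf_zero)

text \<open>Fatou's lemma along the partial sums, which converge almost surely.\<close>

lemma exp_series_nn: "(\<integral>\<^sup>+x. ennreal (exp (\<Sum>p. h p x)) \<partial>M) \<le> ennreal (exp ((\<Sum>p. V p) / 2))"
proof -
  have "(\<integral>\<^sup>+x. ennreal (exp (\<Sum>p. h p x)) \<partial>M) = (\<integral>\<^sup>+x. liminf (\<lambda>Q. ennreal (exp (\<Sum>p<Q. h p x))) \<partial>M)"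
  proof (rule nn_integral_cong_AE)
    show "AE x in M. ennreal (exp (\<Sum>p. h p x)) = liminf (\<lambda>Q. ennreal (exp (\<Sum>p<Q. h p x)))"
      using AE_summable
    proof (rule eventually_mono)
      fix x assume x: "summable (\<lambda>p. \<bar>h p x\<bar>)"
      have "(\<lambda>Q. \<Sum>p<Q. h p x) \<longlonglongrightarrow> (\<Sum>p. h p x)" by (rule summable_LIMSEQ[OF summable_rabs_cancel[OF x]])
      then have "(\<lambda>Q. ennreal (exp (\<Sum>p<Q. h p x))) \<longlonglongrightarrow> ennreal (exp (\<Sum>p. h p x))"
        by (intro tendsto_ennrealI tendsto_exp)
      then show "ennreal (exp (\<Sum>p. h p x)) = liminf (\<lambda>Q. ennreal (exp (\<Sum>p<Q. h p x)))"
        by (rule lim_imp_Liminf[symmetric, OF sequentially_bot])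
    qed
  qed
  also have "\<dots> \<le> liminf (\<lambda>Q. \<integral>\<^sup>+x. ennreal (exp (\<Sum>p<Q. h p x)) \<partial>M)"
    by (rule nn_integral_liminf) simp
  also have "\<dots> \<le> liminf (\<lambda>Q::nat. ennreal (exp ((\<Sum>p. V p) / 2)))"
    unfolding mgf_sum
    by (intro Liminf_mono always_eventually allI ennreal_leI)
       (use sum_le_suminf[OF summable_V] V_nonneg in auto)
  also have "\<dots> = ennreal (exp ((\<Sum>p. V p) / 2))" by (simp add: Liminf_const)
  finally show ?thesis .
qed

lemma integrable_exp_series: "integrable M (\<lambda>x. exp (\<Sum>p. h p x))"
  by (rule integrableI_bounded) (use exp_series_nn in \<open>auto intro: le_less_trans\<close>)

lemma exp_series_mean: "(LINT x|M. exp (\<Sum>p. h p x)) \<le> exp ((\<Sum>p. V p) / 2)"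
proof -
  have "ennreal (LINT x|M. exp (\<Sum>p. h p x)) = (\<integral>\<^sup>+x. ennreal (exp (\<Sum>p. h p x)) \<partial>M)"
    by (rule nn_integral_eq_integral[symmetric, OF integrable_exp_series]) simp
  then have "ennreal (LINT x|M. exp (\<Sum>p. h p x)) \<le> ennreal (exp ((\<Sum>p. V p) / 2))" using exp_series_nn by simp
  then show ?thesis by simp
qed

end

lemma hamiltonian_term_eq:
  assumes "1 \<le> N" "disjoint_family I" "1 \<le> p"
  shows "hamiltonian_term N I \<Delta> G \<sigma> p =
    (\<Sum>ss | length ss = p. \<Sum>js\<in>listset (map I ss). scale (weight I (multi_coeff \<Delta> N)) G js * spin js \<sigma>)"
proof -
  have sq: "1 / real N powr ((real p - 1) / 2) = 1 / sqrt (real N ^ (p - 1))"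
  proof -
    have rp: "real p - 1 = real (p - 1)" using assms by (simp add: of_nat_diff)
    have "real N powr ((real p - 1) / 2) = (real N powr real (p - 1)) powr (1 / 2)"
      unfolding rp by (simp only: powr_powr) simp
    also have "real N powr real (p - 1) = real N ^ (p - 1)" using assms by (intro powr_realpow) simp
    finally show ?thesis by (simp add: powr_half_sqrt)
  qed
  have eq: "1 / real N powr ((real p - 1) / 2) * (sqrt ((\<Delta> ss)\<^sup>2) * (\<Sum>js\<in>listset (map I ss). G js * prod_list (map \<sigma> js)))
      = (\<Sum>js\<in>listset (map I ss). scale (weight I (multi_coeff \<Delta> N)) G js * spin js \<sigma>)" if ss: "length ss = p" for ss
    unfolding sum_distrib_left sq
  proof (rule sum.cong[OF refl])
    fix js assume js: "js \<in> listset (map I ss)"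
    have "map (species_of I) js = ss"
      using js assms(2) by (intro nth_equalityI) (auto simp: in_listset_iff species_of_eq)
    then have "scale (weight I (multi_coeff \<Delta> N)) G js = sqrt ((\<Delta> ss)\<^sup>2) / sqrt (real N ^ (p - 1)) * G js"
      by (simp only: scale_def weight_def multi_coeff_def ss real_sqrt_divide)
    then show "1 / sqrt (real N ^ (p - 1)) * (sqrt ((\<Delta> ss)\<^sup>2) * (G js * prod_list (map \<sigma> js))) = scale (weight I (multi_coeff \<Delta> N)) G js * spin js \<sigma>"
      by (simp add: spin_def)
  qed
  show ?thesis unfolding hamiltonian_term_def
    by (subst sum_distrib_left) (rule sum.cong[OF refl], rule eq, simp)
qed

section \<open>Truncated Hamiltonians and the disorder tilted by a Gibbs weight\<close>

locale disorder = partition N I for N and I :: "'s::finite \<Rightarrow> nat set" +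
  fixes M :: "'w measure" and g :: "nat list \<Rightarrow> 'w \<Rightarrow> real" and \<Delta> :: "'s list \<Rightarrow> real" and k :: spin_type
  assumes N1: "1 \<le> N" and family: "std_gaussian_family M g"
begin

abbreviation "\<mu> \<equiv> config k N I"
abbreviation "u \<equiv> weight I (multi_coeff \<Delta> N)"

text \<open>\<open>X Q\<close> collects the orders 1 to Q, whereas \<open>ham p\<close> is the term
  of order p + 1. The orders omitted by \<open>X P\<close> are therefore the
  \<open>ham (P + p)\<close> with p \<ge> 0. \<open>W P\<close> is the Gibbs density of the
  truncated model.\<close>

definition "X Q \<omega> \<sigma> = energy (idx I Q) spin (scale u (\<lambda>js. g js \<omega>)) \<sigma>"
definition "ham p \<omega> \<sigma> = hamiltonian_term N I \<Delta> (\<lambda>js. g js \<omega>) \<sigma> (Suc p)"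
definition "Var Q = form Q (multi_coeff \<Delta> N) (\<lambda>s. card (I s))"
definition "ZP P \<omega> = pf \<mu> (idx I P) spin (scale u (\<lambda>js. g js \<omega>))"
definition "W P \<omega> \<sigma> = exp (X P \<omega> \<sigma>) / ZP P \<omega>"

lemma prob_M: "prob_space M" using family by (simp add: std_gaussian_family_def Let_def)

sublocale P: prob_space M by (rule prob_M)
sublocale Q: prob_space \<mu> by (rule prob_space_config)
sublocale PQ: pair_sigma_finite M \<mu> ..

lemma idx_valid: "idx I Q \<subseteq> {js. js \<noteq> [] \<and> (\<forall>i\<in>set js. 1 \<le> i)}" by (auto simp: idx_eq)

lemma meas_g [measurable]: "js \<in> idx I Q \<Longrightarrow> g js \<in> borel_measurable M"
proof -
  assume "js \<in> idx I Q"
  then have "distributed M lborel (g js) std_normal_density"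
    using family idx_valid[of Q] unfolding std_gaussian_family_def Let_def by blast
  then show ?thesis using distributed_measurable by fastforce
qed

lemma gibbs_idx: "gibbs \<mu> (idx I Q) spin (real N ^ Q)" by (rule gibbs_config)

lemma distr_g: "distr M (gauss (idx I Q)) (\<lambda>\<omega>. \<lambda>js\<in>idx I Q. g js \<omega>) = gauss (idx I Q)"
proof (cases "idx I Q = {}")
  case True
  interpret G: prob_space "gauss ({} :: nat list set)" by (rule prob_space_gauss)
  have sp: "space (gauss ({} :: nat list set)) = {\<lambda>_. undefined}" by (simp add: space_gauss)
  interpret D: prob_space "distr M (gauss (idx I Q)) (\<lambda>\<omega>. \<lambda>js\<in>idx I Q. g js \<omega>)"
    by (rule P.prob_space_distr) (simp add: gauss_def)
  show ?thesis
  proof (rule measure_eqI)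
    fix A assume "A \<in> sets (distr M (gauss (idx I Q)) (\<lambda>\<omega>. \<lambda>js\<in>idx I Q. g js \<omega>))"
    then have A: "A \<in> sets (gauss (idx I Q))" by simp
    then have "A = {} \<or> A = space (gauss (idx I Q))" using sets.sets_into_space[OF A] unfolding True sp by auto
    then show "emeasure (distr M (gauss (idx I Q)) (\<lambda>\<omega>. \<lambda>js\<in>idx I Q. g js \<omega>)) A = emeasure (gauss (idx I Q)) A"
      using D.emeasure_space_1 G.emeasure_space_1 by (auto simp: True)
  qed simp
next
  case False
  have ind: "P.indep_vars (\<lambda>_. borel) g (idx I Q)"
    using family idx_valid[of Q] P.indep_vars_subset unfolding std_gaussian_family_def Let_def by blast
  have dist: "distr M borel (g js) = std_normal" if "js \<in> idx I Q" for js
  proof -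
    have "distributed M lborel (g js) std_normal_density"
      using family idx_valid[of Q] that unfolding std_gaussian_family_def Let_def by blast
    then have "distr M lborel (g js) = std_normal" by (simp add: distributed_def)
    then show ?thesis by (simp cong: distr_cong)
  qed
  have "distr M (Pi\<^sub>M (idx I Q) (\<lambda>_. borel)) (\<lambda>\<omega>. \<lambda>js\<in>idx I Q. g js \<omega>) = Pi\<^sub>M (idx I Q) (\<lambda>js. distr M borel (g js))"
    using ind P.indep_vars_iff_distr_eq_PiM'[OF False, of g "\<lambda>_. borel"] meas_g by blast
  also have "\<dots> = gauss (idx I Q)" unfolding gauss_def by (rule PiM_cong[OF refl]) (rule dist)
  finally have "distr M (Pi\<^sub>M (idx I Q) (\<lambda>_. borel)) (\<lambda>\<omega>. \<lambda>js\<in>idx I Q. g js \<omega>) = gauss (idx I Q)" .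
  then show ?thesis by (simp add: sets_gauss cong: distr_cong)
qed

lemma meas_restrict_g: "(\<lambda>\<omega>. \<lambda>js\<in>idx I Q. g js \<omega>) \<in> measurable M (gauss (idx I Q))"
  unfolding gauss_def by (rule measurable_restrict) (use meas_g in simp)

lemma words_Suc: "(words (Suc Q) :: 's list set) = words Q \<union> {ss. length ss = Suc Q}"
  by (auto simp: words_def)

lemma X_Suc: "X (Suc Q) \<omega> \<sigma> = X Q \<omega> \<sigma> + ham Q \<omega> \<sigma>"
proof -
  have "words Q \<inter> {ss :: 's list. length ss = Suc Q} = {}" by (auto simp: words_def)
  then show ?thesis unfolding X_def energy_def sum_idx words_Suc ham_def hamiltonian_term_eq[OF N1 disj le_add1[of 1, simplified plus_1_eq_Suc]]
    by (subst sum.union_disjoint) auto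
qed

lemma X_0: "X 0 \<omega> \<sigma> = 0" by (simp add: X_def energy_def idx_def words_def)

lemma sum_ham: "(\<Sum>p<Q. ham (P + p) \<omega> \<sigma>) = X (P + Q) \<omega> \<sigma> - X P \<omega> \<sigma>"
  by (induction Q) (auto simp: X_Suc)

lemma hamiltonian_eq: "hamiltonian N I \<Delta> (\<lambda>js. g js \<omega>) \<sigma> = (\<Sum>p. ham p \<omega> \<sigma>)"
  by (simp add: hamiltonian_def ham_def)

lemma meas_X [measurable]: "(\<lambda>(\<omega>, \<sigma>). X Q \<omega> \<sigma>) \<in> borel_measurable (M \<Otimes>\<^sub>M \<mu>)"
proof -
  have [measurable]: "spin js \<in> borel_measurable \<mu>" "g js \<in> borel_measurable M" if "js \<in> idx I Q" for js
    using that meas_spin meas_g by auto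
  show ?thesis unfolding X_def energy_def scale_def by measurable
qed

lemma meas_ham [measurable]: "(\<lambda>(\<omega>, \<sigma>). ham p \<omega> \<sigma>) \<in> borel_measurable (M \<Otimes>\<^sub>M \<mu>)"
proof -
  have "(\<lambda>(\<omega>, \<sigma>). X (Suc p) \<omega> \<sigma> - X p \<omega> \<sigma>) \<in> borel_measurable (M \<Otimes>\<^sub>M \<mu>)" by measurable
  then show ?thesis by (simp add: X_Suc)
qed

lemma meas_ZP [measurable]: "ZP P \<in> borel_measurable M"
  unfolding ZP_def[abs_def]
  by (rule gibbs.borel_measurable_pf[OF gibbs_idx]) (use meas_g in \<open>auto simp: scale_def\<close>)

lemma ZP_pos: "0 < ZP P \<omega>" unfolding ZP_def by (rule gibbs.pf_pos[OF gibbs_idx])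

lemma meas_W [measurable]: "(\<lambda>(\<omega>, \<sigma>). W P \<omega> \<sigma>) \<in> borel_measurable (M \<Otimes>\<^sub>M \<mu>)"
  unfolding W_def by measurable

lemma W_pos: "0 < W P \<omega> \<sigma>" using ZP_pos[of P \<omega>] by (simp add: W_def)

lemma integrable_W: "integrable \<mu> (W P \<omega>)" and integral_W: "(LINT \<sigma>|\<mu>. W P \<omega> \<sigma>) = 1"
proof -
  have i: "integrable \<mu> (\<lambda>\<sigma>. exp (X P \<omega> \<sigma>))" unfolding X_def by (rule gibbs.integrable_exp_energy[OF gibbs_idx])
  then show "integrable \<mu> (W P \<omega>)" unfolding W_def[abs_def] by simp
  have "(LINT \<sigma>|\<mu>. exp (X P \<omega> \<sigma>)) = ZP P \<omega>" by (simp add: ZP_def pf_def X_def)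
  then show "(LINT \<sigma>|\<mu>. W P \<omega> \<sigma>) = 1" using ZP_pos[of P \<omega>] unfolding W_def by simp
qed

lemma idx_mono: "P \<le> Q \<Longrightarrow> idx I P \<subseteq> idx I Q" by (auto simp: idx_eq)

text \<open>The orders above \<open>Q1\<close> use couplings that the Gibbs density of order
  \<open>P\<close> does not see. The Cameron-Martin shift produced by the exponential moves these
  couplings only and leaves \<open>W P\<close> unchanged.\<close>

lemma W_shift:
  assumes PQ: "P \<le> Q1" "Q1 \<le> Q2" and \<sigma>: "\<sigma> \<in> space \<mu>"
  shows "(\<integral>\<^sup>+\<omega>. ennreal (exp (s * (X Q2 \<omega> \<sigma> - X Q1 \<omega> \<sigma>)) * W P \<omega> \<sigma>) \<partial>M)
     = ennreal (exp (s\<^sup>2 * (Var Q2 - Var Q1) / 2)) * (\<integral>\<^sup>+\<omega>. ennreal (W P \<omega> \<sigma>) \<partial>M)"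
proof -
  let ?J = "idx I Q2" and ?g = "\<lambda>\<omega>. \<lambda>js\<in>idx I Q2. g js \<omega>"
  define Wx where "Wx x = exp (energy (idx I P) spin (scale u x) \<sigma>) / pf \<mu> (idx I P) spin (scale u x)" for x
  define a where "a js = (if js \<in> idx I Q1 then 0 else s * sqrt (u js) * spin js \<sigma>)" for js
  have u0: "0 \<le> u js" for js by (simp add: weight_def multi_coeff_def)
  have sub: "idx I P \<subseteq> idx I Q1" "idx I Q1 \<subseteq> ?J" using idx_mono PQ by auto
  have Wcong: "Wx x = Wx y" if "\<And>j. j \<in> idx I P \<Longrightarrow> x j = y j" for x y
  proof -
    have "\<And>j. j \<in> idx I P \<Longrightarrow> scale u x j = scale u y j" using that by (simp add: scale_def)
    then have "energy (idx I P) spin (scale u x) = energy (idx I P) spin (scale u y)"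
      "pf \<mu> (idx I P) spin (scale u x) = pf \<mu> (idx I P) spin (scale u y)"
      by (auto intro!: energy_cong pf_cong)
    then show ?thesis by (simp only: Wx_def)
  qed
  have Wg: "W P \<omega> \<sigma> = Wx (?g \<omega>)" for \<omega>
  proof -
    have "W P \<omega> \<sigma> = Wx (\<lambda>js. g js \<omega>)" by (simp add: W_def Wx_def X_def ZP_def)
    also have "\<dots> = Wx (?g \<omega>)" by (rule Wcong) (use sub in auto)
    finally show ?thesis .
  qed
  have Xg: "s * (X Q2 \<omega> \<sigma> - X Q1 \<omega> \<sigma>) = (\<Sum>js\<in>?J. a js * ?g \<omega> js)" for \<omega>
  proof -
    let ?f = "\<lambda>js. scale u (\<lambda>js. g js \<omega>) js * spin js \<sigma>"
    have "X Q2 \<omega> \<sigma> - X Q1 \<omega> \<sigma> = (\<Sum>js\<in>?J - idx I Q1. ?f js)"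
      unfolding X_def energy_def using sub by (subst sum_diff) auto
    then have "s * (X Q2 \<omega> \<sigma> - X Q1 \<omega> \<sigma>) = (\<Sum>js\<in>?J - idx I Q1. a js * ?g \<omega> js)"
      by (simp add: sum_distrib_left a_def scale_def mult_ac)
    also have "\<dots> = (\<Sum>js\<in>?J. a js * ?g \<omega> js)" by (rule sum.mono_neutral_left) (auto simp: a_def)
    finally show ?thesis .
  qed
  have asq: "(\<Sum>js\<in>?J. (a js)\<^sup>2) = s\<^sup>2 * (Var Q2 - Var Q1)"
  proof -
    have \<sigma>': "\<sigma> \<in> config_space k N I" using \<sigma> by (simp add: space_config)
    have "(\<Sum>js\<in>?J. (a js)\<^sup>2) = (\<Sum>js\<in>?J - idx I Q1. (a js)\<^sup>2)" by (rule sum.mono_neutral_right) (auto simp: a_def)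
    also have "\<dots> = (\<Sum>js\<in>?J - idx I Q1. s\<^sup>2 * (u js * (spin js \<sigma>)\<^sup>2))"
      by (intro sum.cong refl) (simp add: a_def power_mult_distrib u0)
    also have "\<dots> = s\<^sup>2 * ((\<Sum>js\<in>?J. u js * (spin js \<sigma>)\<^sup>2) - (\<Sum>js\<in>idx I Q1. u js * (spin js \<sigma>)\<^sup>2))"
      using sub by (simp add: sum_distrib_left[symmetric] sum_diff)
    finally show ?thesis by (simp add: weight_sq_sum[OF \<sigma>'] Var_def)
  qed
  have mc: "(\<lambda>x. x j) \<in> borel_measurable (gauss ?J)" if "j \<in> ?J" for j
  proof -
    have "(\<lambda>x. x j) \<in> measurable (gauss ?J) std_normal" unfolding gauss_def using that by (rule measurable_component_singleton)
    then show ?thesis by simp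
  qed
  have mW[measurable]: "Wx \<in> borel_measurable (gauss ?J)"
  proof -
    have sc: "(\<lambda>x. scale u x j) \<in> borel_measurable (gauss ?J)" if "j \<in> idx I P" for j
    proof -
      have "(\<lambda>x. x j) \<in> borel_measurable (gauss ?J)" by (rule mc) (use that sub in blast)
      then show ?thesis unfolding scale_def by (intro borel_measurable_times borel_measurable_const)
    qed
    have "(\<lambda>x. pf \<mu> (idx I P) spin (scale u x)) \<in> borel_measurable (gauss ?J)"
      by (rule gibbs.borel_measurable_pf[OF gibbs_idx sc])
    moreover have "(\<lambda>x. energy (idx I P) spin (scale u x) \<sigma>) \<in> borel_measurable (gauss ?J)"
      unfolding energy_def using sc by (intro borel_measurable_sum borel_measurable_times) auto
    ultimately show ?thesis unfolding Wx_def[abs_def] by measurable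
  qed
  have mE: "(\<lambda>x. \<Sum>js\<in>?J. a js * x js) \<in> borel_measurable (gauss ?J)"
    by (intro borel_measurable_sum borel_measurable_times borel_measurable_const mc)
  have mF: "(\<lambda>x. ennreal (exp (\<Sum>js\<in>?J. a js * x js)) * ennreal (Wx x)) \<in> borel_measurable (gauss ?J)"
    using mE mW by simp
  have "(\<integral>\<^sup>+\<omega>. ennreal (exp (s * (X Q2 \<omega> \<sigma> - X Q1 \<omega> \<sigma>)) * W P \<omega> \<sigma>) \<partial>M)
     = (\<integral>\<^sup>+\<omega>. (\<lambda>x. ennreal (exp (\<Sum>js\<in>?J. a js * x js)) * ennreal (Wx x)) (?g \<omega>) \<partial>M)"
    unfolding Xg Wg by (simp add: ennreal_mult')
  also have "\<dots> = (\<integral>\<^sup>+x. ennreal (exp (\<Sum>js\<in>?J. a js * x js)) * ennreal (Wx x) \<partial>distr M (gauss ?J) ?g)"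
    by (rule nn_integral_distr[symmetric, OF meas_restrict_g]) (use mF in simp)
  also have "\<dots> = ennreal (exp (s\<^sup>2 * (Var Q2 - Var Q1) / 2)) * (\<integral>\<^sup>+x. ennreal (Wx (\<lambda>j\<in>?J. x j + a j)) \<partial>gauss ?J)"
    unfolding distr_g asq[symmetric] by (rule nn_integral_gauss_shift) auto
  also have "(\<integral>\<^sup>+x. ennreal (Wx (\<lambda>j\<in>?J. x j + a j)) \<partial>gauss ?J) = (\<integral>\<^sup>+x. ennreal (Wx x) \<partial>gauss ?J)"
  proof (rule nn_integral_cong)
    fix x
    show "ennreal (Wx (\<lambda>j\<in>?J. x j + a j)) = ennreal (Wx x)"
      by (rule arg_cong[where f = ennreal], rule Wcong) (use sub in \<open>auto simp: a_def\<close>)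
  qed
  also have "(\<integral>\<^sup>+x. ennreal (Wx x) \<partial>gauss ?J) = (\<integral>\<^sup>+\<omega>. ennreal (W P \<omega> \<sigma>) \<partial>M)"
    unfolding Wg by (subst distr_g[symmetric]) (rule nn_integral_distr[OF meas_restrict_g], measurable)
  finally show ?thesis .
qed

lemma nn_integral_W: "(\<integral>\<^sup>+\<omega>. \<integral>\<^sup>+\<sigma>. ennreal (W P \<omega> \<sigma>) \<partial>\<mu> \<partial>M) = 1"
proof -
  have "(\<integral>\<^sup>+\<sigma>. ennreal (W P \<omega> \<sigma>) \<partial>\<mu>) = 1" for \<omega>
    using nn_integral_eq_integral[OF integrable_W[of P \<omega>]] W_pos[of P \<omega>] integral_W[of P \<omega>] by (simp add: less_imp_le)
  then show ?thesis by (simp add: P.emeasure_space_1)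
qed

text \<open>The joint law of the disorder and of a configuration drawn from the truncated Gibbs
  measure. Under it the omitted orders still have Gaussian exponential moments, because their
  couplings are independent of the density.\<close>

definition tilted :: "nat \<Rightarrow> ('w \<times> (nat \<Rightarrow> real)) measure" where
  "tilted P = density (M \<Otimes>\<^sub>M \<mu>) (\<lambda>(\<omega>, \<sigma>). ennreal (W P \<omega> \<sigma>))"

lemma nn_tilted_shift:
  assumes PQ: "P \<le> Q1" "Q1 \<le> Q2"
  shows "(\<integral>\<^sup>+z. ennreal (exp (s * (case z of (\<omega>, \<sigma>) \<Rightarrow> X Q2 \<omega> \<sigma> - X Q1 \<omega> \<sigma>))) \<partial>tilted P) = ennreal (exp (s\<^sup>2 * (Var Q2 - Var Q1) / 2))"
proof -
  have "(\<integral>\<^sup>+z. ennreal (exp (s * (case z of (\<omega>, \<sigma>) \<Rightarrow> X Q2 \<omega> \<sigma> - X Q1 \<omega> \<sigma>))) \<partial>tilted P) =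
    (\<integral>\<^sup>+z. (case z of (\<omega>, \<sigma>) \<Rightarrow> ennreal (exp (s * (X Q2 \<omega> \<sigma> - X Q1 \<omega> \<sigma>)) * W P \<omega> \<sigma>)) \<partial>(M \<Otimes>\<^sub>M \<mu>))"
    unfolding tilted_def
    by (subst nn_integral_density) (auto intro!: nn_integral_cong simp: ennreal_mult'' less_imp_le[OF W_pos] mult.commute)
  also have "\<dots> = (\<integral>\<^sup>+\<sigma>. \<integral>\<^sup>+\<omega>. ennreal (exp (s * (X Q2 \<omega> \<sigma> - X Q1 \<omega> \<sigma>)) * W P \<omega> \<sigma>) \<partial>M \<partial>\<mu>)"
    by (subst PQ.nn_integral_snd[symmetric]) auto
  also have "\<dots> = (\<integral>\<^sup>+\<sigma>. ennreal (exp (s\<^sup>2 * (Var Q2 - Var Q1) / 2)) * (\<integral>\<^sup>+\<omega>. ennreal (W P \<omega> \<sigma>) \<partial>M) \<partial>\<mu>)"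
    by (intro nn_integral_cong W_shift PQ)
  also have "\<dots> = ennreal (exp (s\<^sup>2 * (Var Q2 - Var Q1) / 2)) * (\<integral>\<^sup>+\<sigma>. \<integral>\<^sup>+\<omega>. ennreal (W P \<omega> \<sigma>) \<partial>M \<partial>\<mu>)"
    by (rule nn_integral_cmult) measurable
  also have "(\<integral>\<^sup>+\<sigma>. \<integral>\<^sup>+\<omega>. ennreal (W P \<omega> \<sigma>) \<partial>M \<partial>\<mu>) = (\<integral>\<^sup>+\<omega>. \<integral>\<^sup>+\<sigma>. ennreal (W P \<omega> \<sigma>) \<partial>\<mu> \<partial>M)"
    by (rule PQ.Fubini') measurable
  finally show ?thesis by (simp add: nn_integral_W)
qed

lemma prob_tilted: "prob_space (tilted P)"
  using nn_tilted_shift[of P P P 0] by (intro prob_spaceI) simp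

lemma sets_tilted [measurable_cong]: "sets (tilted P) = sets (M \<Otimes>\<^sub>M \<mu>)" by (simp add: tilted_def)

lemma gaussian_series_tilted:
  assumes sq: "summable (\<lambda>p. sqrt (Var (Suc p) - Var p))" and sV: "summable (\<lambda>p. Var (Suc p) - Var p)"
  shows "gaussian_series (tilted P) (\<lambda>p (\<omega>, \<sigma>). ham (P + p) \<omega> \<sigma>) (\<lambda>p. Var (Suc (P + p)) - Var (P + p))"
proof -
  interpret T: prob_space "tilted P" by (rule prob_tilted)
  show ?thesis
  proof
    show "(\<lambda>(\<omega>, \<sigma>). ham (P + p) \<omega> \<sigma>) \<in> borel_measurable (tilted P)" for p by measurable
    have "form Q c x \<le> form (Suc Q) c x" if "\<And>ss. 0 \<le> c ss" "\<And>s. 0 \<le> x s" for Q and c :: "'s list \<Rightarrow> real" and x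
      unfolding form_def words_Suc using that by (intro sum_mono2) (auto intro!: mult_nonneg_nonneg prod_list_nonneg finite_words)
    then show "0 \<le> Var (Suc (P + p)) - Var (P + p)" for p unfolding Var_def by (simp add: multi_coeff_def)
    show "(\<integral>\<^sup>+z. ennreal (exp (s * (case z of (\<omega>, \<sigma>) \<Rightarrow> ham (P + p) \<omega> \<sigma>))) \<partial>tilted P) = ennreal (exp (s\<^sup>2 * (Var (Suc (P + p)) - Var (P + p)) / 2))" for p s
      using nn_tilted_shift[of P "P + p" "Suc (P + p)" s] by (simp add: X_Suc)
    show "(\<integral>\<^sup>+z. ennreal (exp (\<Sum>p<Q. case z of (\<omega>, \<sigma>) \<Rightarrow> ham (P + p) \<omega> \<sigma>)) \<partial>tilted P) = ennreal (exp ((\<Sum>p<Q. Var (Suc (P + p)) - Var (P + p)) / 2))" for Q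
    proof -
      have "(\<Sum>p<Q. case z of (\<omega>, \<sigma>) \<Rightarrow> ham (P + p) \<omega> \<sigma>) = 1 * (case z of (\<omega>, \<sigma>) \<Rightarrow> X (P + Q) \<omega> \<sigma> - X P \<omega> \<sigma>)" for z
        by (cases z) (simp add: sum_ham)
      moreover have "(\<Sum>p<Q. Var (Suc (P + p)) - Var (P + p)) = Var (P + Q) - Var P"
        using sum_lessThan_telescope[of "\<lambda>p. Var (P + p)" Q] by simp
      ultimately show ?thesis using nn_tilted_shift[of P P "P + Q" 1] by (simp only:) simp
    qed
    show "summable (\<lambda>p. sqrt (Var (Suc (P + p)) - Var (P + p)))"
      using summable_ignore_initial_segment[OF sq, of P] by (simp add: add.commute)
    show "summable (\<lambda>p. Var (Suc (P + p)) - Var (P + p))"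
      using summable_ignore_initial_segment[OF sV, of P] by (simp add: add.commute)
  qed
qed

lemma mean_ln_eq: "(LINT \<omega>|M. ln (ZP P \<omega>)) = mean_ln k N I P (multi_coeff \<Delta> N)"
  and integrable_ln_ZP: "integrable M (\<lambda>\<omega>. ln (ZP P \<omega>))"
proof -
  let ?f = "\<lambda>x. ln (pf \<mu> (idx I P) spin (scale u x))"
  have i: "integrable (gauss (idx I P)) ?f" by (rule gibbs.integrable_ln_pf[OF gibbs_idx])
  then have m: "?f \<in> borel_measurable (gauss (idx I P))" by (rule borel_measurable_integrable)
  have e: "ln (ZP P \<omega>) = ?f (\<lambda>js\<in>idx I P. g js \<omega>)" for \<omega>
    unfolding ZP_def by (intro arg_cong[where f = ln] pf_cong) (simp add: scale_def)
  show "(LINT \<omega>|M. ln (ZP P \<omega>)) = mean_ln k N I P (multi_coeff \<Delta> N)"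
    unfolding e mean_ln_def integral_distr[OF meas_restrict_g m, symmetric] distr_g ..
  show "integrable M (\<lambda>\<omega>. ln (ZP P \<omega>))"
    unfolding e using i integrable_distr_eq[OF meas_restrict_g m] by (simp add: distr_g)
qed

text \<open>The partition function is \<open>ZP\<close> times R, the truncated Gibbs average of exp
  Y with Y the omitted orders. From below, ln R is at least the Gibbs average of Y, which has mean
  0. From above, E R is at most exp of half the omitted variance, and ln is concave. For P = 0 the
  upper bound is the annealed one.\<close>

theorem truncation:
  assumes sq: "summable (\<lambda>p. sqrt (Var (Suc p) - Var p))" and sV: "summable (\<lambda>p. Var (Suc p) - Var p)"
  defines "FE \<equiv> (LINT \<omega>|M. ln (LINT \<sigma>:config_space k N I|config_measure k N I. exp (hamiltonian N I \<Delta> (\<lambda>js. g js \<omega>) \<sigma>)))"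
  shows "mean_ln k N I P (multi_coeff \<Delta> N) \<le> FE"
    and "FE \<le> mean_ln k N I P (multi_coeff \<Delta> N) + (\<Sum>p. Var (Suc (P + p)) - Var (P + p)) / 2"
proof -
  interpret G: gaussian_series "tilted P" "\<lambda>p (\<omega>, \<sigma>). ham (P + p) \<omega> \<sigma>" "\<lambda>p. Var (Suc (P + p)) - Var (P + p)"
    by (rule gaussian_series_tilted[OF sq sV])
  define Y where "Y \<omega> \<sigma> = (\<Sum>p. ham (P + p) \<omega> \<sigma>)" for \<omega> \<sigma>
  define R where "R \<omega> = (LINT \<sigma>|\<mu>. W P \<omega> \<sigma> * exp (Y \<omega> \<sigma>))" for \<omega>
  define m where "m \<omega> = (LINT \<sigma>|\<mu>. W P \<omega> \<sigma> * Y \<omega> \<sigma>)" for \<omega>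
  define Zf where "Zf \<omega> = (LINT \<sigma>|\<mu>. exp (\<Sum>p. ham p \<omega> \<sigma>))" for \<omega>
  define \<kappa> where "\<kappa> = (\<Sum>p. Var (Suc (P + p)) - Var (P + p)) / 2"
  have FE: "FE = (LINT \<omega>|M. ln (Zf \<omega>))" unfolding FE_def Zf_def integral_config[symmetric] hamiltonian_eq ..
  have Yz: "(\<Sum>p. case z of (\<omega>, \<sigma>) \<Rightarrow> ham (P + p) \<omega> \<sigma>) = (case z of (\<omega>, \<sigma>) \<Rightarrow> Y \<omega> \<sigma>)" for z by (cases z) (simp add: Y_def)
  have mY[measurable]: "(\<lambda>(\<omega>, \<sigma>). Y \<omega> \<sigma>) \<in> borel_measurable (M \<Otimes>\<^sub>M \<mu>)" unfolding Y_def by measurable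
  have W0: "0 \<le> W P \<omega> \<sigma>" for \<omega> \<sigma> using W_pos[of P \<omega> \<sigma>] by simp
  have tint: "integrable (tilted P) (\<lambda>(\<omega>, \<sigma>). f \<omega> \<sigma>) \<longleftrightarrow> integrable (M \<Otimes>\<^sub>M \<mu>) (\<lambda>(\<omega>, \<sigma>). W P \<omega> \<sigma> * f \<omega> \<sigma>)"
    "(LINT z|tilted P. (\<lambda>(\<omega>, \<sigma>). f \<omega> \<sigma>) z) = (LINT z|(M \<Otimes>\<^sub>M \<mu>). (\<lambda>(\<omega>, \<sigma>). W P \<omega> \<sigma> * f \<omega> \<sigma>) z)"
    if [measurable]: "(\<lambda>(\<omega>, \<sigma>). f \<omega> \<sigma>) \<in> borel_measurable (M \<Otimes>\<^sub>M \<mu>)" for f :: "'w \<Rightarrow> (nat \<Rightarrow> real) \<Rightarrow> real"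
  proof -
    have t: "tilted P = density (M \<Otimes>\<^sub>M \<mu>) (\<lambda>z. ennreal ((\<lambda>(\<omega>, \<sigma>). W P \<omega> \<sigma>) z))" by (simp add: tilted_def case_prod_beta')
    show "integrable (tilted P) (\<lambda>(\<omega>, \<sigma>). f \<omega> \<sigma>) \<longleftrightarrow> integrable (M \<Otimes>\<^sub>M \<mu>) (\<lambda>(\<omega>, \<sigma>). W P \<omega> \<sigma> * f \<omega> \<sigma>)"
      unfolding t by (subst integrable_density) (auto simp: W0 case_prod_beta')
    show "(LINT z|tilted P. (\<lambda>(\<omega>, \<sigma>). f \<omega> \<sigma>) z) = (LINT z|(M \<Otimes>\<^sub>M \<mu>). (\<lambda>(\<omega>, \<sigma>). W P \<omega> \<sigma> * f \<omega> \<sigma>) z)"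
      unfolding t by (subst integral_density) (auto simp: W0 case_prod_beta')
  qed
  have iY: "integrable (M \<Otimes>\<^sub>M \<mu>) (\<lambda>(\<omega>, \<sigma>). W P \<omega> \<sigma> * Y \<omega> \<sigma>)"
    using G.integrable_series tint(1)[of Y] unfolding Yz by simp
  have iE: "integrable (M \<Otimes>\<^sub>M \<mu>) (\<lambda>(\<omega>, \<sigma>). W P \<omega> \<sigma> * exp (Y \<omega> \<sigma>))"
    using G.integrable_exp_series tint(1)[of "\<lambda>\<omega> \<sigma>. exp (Y \<omega> \<sigma>)"] unfolding Yz by (simp add: case_prod_beta')
  have m_int: "integrable M m" and m_mean: "(LINT \<omega>|M. m \<omega>) = 0"
  proof -
    show "integrable M m" unfolding m_def using PQ.integrable_fst[OF iY] by simp
    have "(LINT \<omega>|M. m \<omega>) = (LINT z|(M \<Otimes>\<^sub>M \<mu>). (\<lambda>(\<omega>, \<sigma>). W P \<omega> \<sigma> * Y \<omega> \<sigma>) z)" unfolding m_def using PQ.integral_fst[OF iY] by simp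
    also have "\<dots> = (LINT z|tilted P. (\<lambda>(\<omega>, \<sigma>). Y \<omega> \<sigma>) z)" by (rule tint(2)[symmetric]) measurable
    also have "\<dots> = 0" using G.series_mean unfolding Yz .
    finally show "(LINT \<omega>|M. m \<omega>) = 0" .
  qed
  have R_int: "integrable M R" and R_mean: "(LINT \<omega>|M. R \<omega>) \<le> exp \<kappa>"
  proof -
    show "integrable M R" unfolding R_def using PQ.integrable_fst[OF iE] by simp
    have "(LINT \<omega>|M. R \<omega>) = (LINT z|(M \<Otimes>\<^sub>M \<mu>). (\<lambda>(\<omega>, \<sigma>). W P \<omega> \<sigma> * exp (Y \<omega> \<sigma>)) z)" unfolding R_def using PQ.integral_fst[OF iE] by simp
    also have "\<dots> = (LINT z|tilted P. (\<lambda>(\<omega>, \<sigma>). exp (Y \<omega> \<sigma>)) z)" by (rule tint(2)[symmetric]) measurable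
    also have "\<dots> \<le> exp \<kappa>" using G.exp_series_mean unfolding Yz \<kappa>_def by (simp add: case_prod_beta')
    finally show "(LINT \<omega>|M. R \<omega>) \<le> exp \<kappa>" .
  qed
  have AEs: "AE \<omega> in M. AE \<sigma> in \<mu>. summable (\<lambda>p. ham (P + p) \<omega> \<sigma>)"
  proof -
    \<comment> \<open>A null set of the tilted measure is one of the product measure, as the density
      is positive everywhere.\<close>
    have "AE z in M \<Otimes>\<^sub>M \<mu>. 0 < (case z of (\<omega>, \<sigma>) \<Rightarrow> ennreal (W P \<omega> \<sigma>)) \<longrightarrow> summable (\<lambda>p. \<bar>case z of (\<omega>, \<sigma>) \<Rightarrow> ham (P + p) \<omega> \<sigma>\<bar>)"
      using G.AE_summable unfolding tilted_def by (subst (asm) AE_density) auto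
    then have "AE z in M \<Otimes>\<^sub>M \<mu>. (\<lambda>(\<omega>, \<sigma>). summable (\<lambda>p. ham (P + p) \<omega> \<sigma>)) z"
      by (rule eventually_mono) (auto simp: W_pos intro: summable_rabs_cancel)
    from PQ.AE_pair[OF this] show ?thesis by simp
  qed
  have AEY: "AE \<omega> in M. integrable \<mu> (\<lambda>\<sigma>. W P \<omega> \<sigma> * Y \<omega> \<sigma>)" using PQ.AE_integrable_fst[OF iY] by simp
  have AEE: "AE \<omega> in M. integrable \<mu> (\<lambda>\<sigma>. W P \<omega> \<sigma> * exp (Y \<omega> \<sigma>))" using PQ.AE_integrable_fst[OF iE] by simp
  have mX: "X P \<omega> \<in> borel_measurable \<mu>" if "\<omega> \<in> space M" for \<omega> using measurable_Pair2[OF meas_X[of P] that] by simp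
  have mham: "ham p \<omega> \<in> borel_measurable \<mu>" if "\<omega> \<in> space M" for \<omega> p using measurable_Pair2[OF meas_ham[of p] that] by simp
  \<comment> \<open>The last inequality is the tangent of ln at exp \<kappa>. Together with the
    lower bound \<open>m\<close> it makes ln R integrable, and integrating it gives the concave
    Jensen inequality.\<close>
  have main: "AE \<omega> in M. ln (Zf \<omega>) = ln (ZP P \<omega>) + ln (R \<omega>) \<and> m \<omega> \<le> ln (R \<omega>) \<and> ln (R \<omega>) \<le> R \<omega> / exp \<kappa> - 1 + \<kappa>"
    using AEs AEY AEE AE_space
  proof eventually_elim
    case (elim \<omega>)
    note [measurable] = mX[OF elim(4)] mham[OF elim(4)]
    have "Zf \<omega> = (LINT \<sigma>|\<mu>. ZP P \<omega> * (W P \<omega> \<sigma> * exp (Y \<omega> \<sigma>)))"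
      unfolding Zf_def
    proof (rule integral_cong_AE)
      show "(\<lambda>\<sigma>. exp (\<Sum>p. ham p \<omega> \<sigma>)) \<in> borel_measurable \<mu>" by measurable
      show "(\<lambda>\<sigma>. ZP P \<omega> * (W P \<omega> \<sigma> * exp (Y \<omega> \<sigma>))) \<in> borel_measurable \<mu>" using elim(3) by measurable
      show "AE \<sigma> in \<mu>. exp (\<Sum>p. ham p \<omega> \<sigma>) = ZP P \<omega> * (W P \<omega> \<sigma> * exp (Y \<omega> \<sigma>))"
        using elim(1)
      proof (rule eventually_mono)
        fix \<sigma> assume "summable (\<lambda>p. ham (P + p) \<omega> \<sigma>)"
        then have s: "summable (\<lambda>p. ham p \<omega> \<sigma>)" using summable_iff_shift[of "\<lambda>p. ham p \<omega> \<sigma>" P] by (simp add: add.commute)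
        have "(\<Sum>p. ham p \<omega> \<sigma>) = X P \<omega> \<sigma> + Y \<omega> \<sigma>"
          using suminf_split_initial_segment[OF s, of P] sum_ham[of 0 \<omega> \<sigma> P] by (simp add: Y_def X_0 add.commute)
        then show "exp (\<Sum>p. ham p \<omega> \<sigma>) = ZP P \<omega> * (W P \<omega> \<sigma> * exp (Y \<omega> \<sigma>))"
          using ZP_pos[of P \<omega>] by (simp add: W_def exp_add)
      qed
    qed
    then have Z: "Zf \<omega> = ZP P \<omega> * R \<omega>" by (simp add: R_def)
    have "exp (m \<omega>) = (LINT \<sigma>|\<mu>. exp (m \<omega>) * ((1 - m \<omega>) * W P \<omega> \<sigma> + W P \<omega> \<sigma> * Y \<omega> \<sigma>))"
      using elim(2) integrable_W[of P \<omega>] by (simp add: integral_W m_def[symmetric])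
    also have "\<dots> \<le> R \<omega>" unfolding R_def
    proof (rule integral_mono)
      show "integrable \<mu> (\<lambda>\<sigma>. exp (m \<omega>) * ((1 - m \<omega>) * W P \<omega> \<sigma> + W P \<omega> \<sigma> * Y \<omega> \<sigma>))"
        using elim(2) integrable_W[of P \<omega>] by simp
      fix \<sigma>
      have "exp (m \<omega>) * (1 + (Y \<omega> \<sigma> - m \<omega>)) \<le> exp (m \<omega>) * exp (Y \<omega> \<sigma> - m \<omega>)" by (intro mult_left_mono exp_ge_add_one_self) auto
      then have "exp (m \<omega>) * (1 + (Y \<omega> \<sigma> - m \<omega>)) \<le> exp (Y \<omega> \<sigma>)" by (simp add: exp_add[symmetric])
      from mult_left_mono[OF this W0[of \<omega> \<sigma>]]
      show "exp (m \<omega>) * ((1 - m \<omega>) * W P \<omega> \<sigma> + W P \<omega> \<sigma> * Y \<omega> \<sigma>) \<le> W P \<omega> \<sigma> * exp (Y \<omega> \<sigma>)" by (simp add: algebra_simps)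
    qed (rule elim(3))
    finally have Rm: "exp (m \<omega>) \<le> R \<omega>" .
    then have R0: "0 < R \<omega>" by (rule less_le_trans[OF exp_gt_zero])
    have "ln (Zf \<omega>) = ln (ZP P \<omega>) + ln (R \<omega>)" unfolding Z using R0 ZP_pos[of P \<omega>] by (simp add: ln_mult)
    moreover have "m \<omega> \<le> ln (R \<omega>)" using Rm R0 by (simp add: ln_ge_iff)
    moreover have "ln (R \<omega>) \<le> R \<omega> / exp \<kappa> - 1 + \<kappa>"
    proof -
      have "ln (R \<omega> / exp \<kappa>) \<le> R \<omega> / exp \<kappa> - 1" using R0 by (intro ln_le_minus_one) auto
      then show ?thesis using R0 by (simp add: ln_div)
    qed
    ultimately show ?case by blast
  qed
  have mlnR: "(\<lambda>\<omega>. ln (R \<omega>)) \<in> borel_measurable M" using R_int by measurable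
  have lnR_int: "integrable M (\<lambda>\<omega>. ln (R \<omega>))"
  proof (rule Bochner_Integration.integrable_bound)
    show "integrable M (\<lambda>\<omega>. \<bar>m \<omega>\<bar> + \<bar>R \<omega> / exp \<kappa> - 1 + \<kappa>\<bar>)" using m_int R_int by simp
    show "AE \<omega> in M. norm (ln (R \<omega>)) \<le> norm (\<bar>m \<omega>\<bar> + \<bar>R \<omega> / exp \<kappa> - 1 + \<kappa>\<bar>)"
      using main by (rule eventually_mono) auto
  qed (rule mlnR)
  have "(LINT \<omega>|M. ln (Zf \<omega>)) = (LINT \<omega>|M. ln (ZP P \<omega>) + ln (R \<omega>))"
  proof (rule integral_cong_AE)
    show "(\<lambda>\<omega>. ln (Zf \<omega>)) \<in> borel_measurable M" unfolding Zf_def by measurable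
    show "(\<lambda>\<omega>. ln (ZP P \<omega>) + ln (R \<omega>)) \<in> borel_measurable M" using mlnR by measurable
    show "AE \<omega> in M. ln (Zf \<omega>) = ln (ZP P \<omega>) + ln (R \<omega>)" using main by (rule eventually_mono) auto
  qed
  then have FE': "FE = mean_ln k N I P (multi_coeff \<Delta> N) + (LINT \<omega>|M. ln (R \<omega>))"
    unfolding FE using integrable_ln_ZP lnR_int by (simp add: mean_ln_eq)
  have "(LINT \<omega>|M. m \<omega>) \<le> (LINT \<omega>|M. ln (R \<omega>))"
    using main by (intro integral_mono_AE m_int lnR_int) (auto elim: eventually_mono)
  then show "mean_ln k N I P (multi_coeff \<Delta> N) \<le> FE" using m_mean FE' by simp
  have "(LINT \<omega>|M. ln (R \<omega>)) \<le> (LINT \<omega>|M. R \<omega> / exp \<kappa> - 1 + \<kappa>)"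
    using main R_int by (intro integral_mono_AE lnR_int) (auto elim: eventually_mono)
  also have "\<dots> = (LINT \<omega>|M. R \<omega>) / exp \<kappa> - 1 + \<kappa>" using R_int by (simp add: P.prob_space)
  also have "\<dots> \<le> \<kappa>" using R_mean by (simp add: pos_divide_le_eq)
  finally show "FE \<le> mean_ln k N I P (multi_coeff \<Delta> N) + (\<Sum>p. Var (Suc (P + p)) - Var (P + p)) / 2"
    using FE' by (simp add: \<kappa>_def)
qed

end

subsection \<open>Comparison with the single-species model\<close>

text \<open>By AM-GM sqrt(a_p) is at most half of R^p a_p + R^(-p). So the exponential rate in the
  summability assumption yields summable standard deviations, hence almost sure convergence of the
  Hamiltonian.\<close>

lemma summable_sqrt_geometric:
  fixes a :: "nat \<Rightarrow> real"
  assumes R: "1 < R" and a: "\<And>p. 0 \<le> a p" and s: "summable (\<lambda>p. R ^ p * a p)"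
  shows "summable (\<lambda>p. sqrt (a p))" and "summable a"
proof -
  have "summable (\<lambda>p. (1 / R) ^ p)" using R by (intro summable_geometric) simp
  from summable_add[OF s this] show "summable (\<lambda>p. sqrt (a p))"
  proof (rule summable_comparison_test'[where N = 0])
    fix p
    have "sqrt (a p) = sqrt ((R ^ p * a p) * (1 / R) ^ p)" using R by (simp add: power_divide)
    also have "\<dots> \<le> (R ^ p * a p + (1 / R) ^ p) / 2" using R a by (intro arith_geo_mean_sqrt) auto
    also have "\<dots> \<le> R ^ p * a p + (1 / R) ^ p" using R a[of p] by simp
    finally show "norm (sqrt (a p)) \<le> R ^ p * a p + (1 / R) ^ p" using a[of p] by simp
  qed
  show "summable a"
  proof (rule summable_comparison_test'[where N = 0, OF s])
    fix p
    have "1 * a p \<le> R ^ p * a p" using R a[of p] by (intro mult_right_mono) auto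
    then show "norm (a p) \<le> R ^ p * a p" using a[of p] by simp
  qed
qed

lemma mean_ln_0: "partition N I \<Longrightarrow> mean_ln k N I 0 c = 0"
proof -
  assume "partition N I"
  then interpret partition N I .
  interpret prob_space "config k N I" by (rule prob_space_config)
  have "idx I 0 = {}" by (simp add: idx_def words_def)
  then show ?thesis by (simp add: mean_ln_def pf_def energy_def prob_space)
qed

text \<open>The rate \<open>R\<close> may be any number above 1, which leaves room for the
  discrepancy between the proportions at finite N and their limits.\<close>

lemma free_energy_truncation:
  fixes I :: "'s::finite \<Rightarrow> nat set" and \<Delta> :: "'s list \<Rightarrow> real" and N :: nat
  defines "v p \<equiv> variance_coeff \<Delta> (species_ratio N I) (Suc p)"
  assumes fam: "std_gaussian_family M g" and N: "1 \<le> N" and part: "species_partition N I"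
    and R: "1 < R" and s: "summable (\<lambda>p. R ^ p * v p)"
  shows "mean_ln k N I P (multi_coeff \<Delta> N) / N \<le> free_energy M g k \<Delta> I N"
    and "free_energy M g k \<Delta> I N \<le> mean_ln k N I P (multi_coeff \<Delta> N) / N + (\<Sum>p. v (P + p)) / 2"
    and "summable (v)"
proof -
  interpret disorder N I M g \<Delta> k using fam N part by unfold_locales
  have N0: "0 < real N" using N by simp
  have d: "Var (Suc p) - Var p = N * v p" for p
    unfolding Var_def form_multi[OF N] v_def species_ratio_def[abs_def] by (simp add: algebra_simps)
  have v0: "0 \<le> v p" for p unfolding v_def by (intro variance_coeff_nonneg) (simp add: species_ratio_def)
  note sm = summable_sqrt_geometric[OF R v0 s]
  show "summable (v)" by (rule sm(2))
  have sq: "summable (\<lambda>p. sqrt (Var (Suc p) - Var p))" unfolding d real_sqrt_mult by (intro summable_mult sm)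
  have sV: "summable (\<lambda>p. Var (Suc p) - Var p)" unfolding d by (intro summable_mult sm)
  have sP: "summable (\<lambda>p. v (P + p))" using summable_ignore_initial_segment[OF sm(2), of P] by (simp add: add.commute)
  have t: "(\<Sum>p. Var (Suc (P + p)) - Var (P + p)) = N * (\<Sum>p. v (P + p))" unfolding d by (rule suminf_mult[OF sP])
  show "mean_ln k N I P (multi_coeff \<Delta> N) / N \<le> free_energy M g k \<Delta> I N"
    using truncation(1)[OF sq sV, of P] N0 unfolding free_energy_def by (simp add: divide_right_mono)
  have "free_energy M g k \<Delta> I N \<le> (mean_ln k N I P (multi_coeff \<Delta> N) + N * (\<Sum>p. v (P + p)) / 2) / N"
    using truncation(2)[OF sq sV, of P] N0 unfolding free_energy_def t by (simp add: divide_right_mono)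
  then show "free_energy M g k \<Delta> I N \<le> mean_ln k N I P (multi_coeff \<Delta> N) / N + (\<Sum>p. v (P + p)) / 2"
    using N0 by (simp add: add_divide_distrib)
qed

text \<open>The omitted orders contribute at most half of their variance to the free energy, and
  exactly that much to \<open>xi_single \<beta> 1 / 2\<close>. If the full model attains the
  annealed value, so does its truncation at every \<open>P\<close>.\<close>

lemma single_species_truncation:
  assumes fam: "std_gaussian_family M g" and R: "1 < R" and s: "summable (\<lambda>p. R ^ p * (\<beta> (Suc p))\<^sup>2)"
    and lim: "(\<lambda>N. free_energy_single M g k \<beta> N) \<longlonglongrightarrow> xi_single \<beta> 1 / 2" and e: "0 < e"
  shows "\<forall>\<^sub>F n in sequentially. (\<Sum>p=1..P. (\<beta> p)\<^sup>2) / 2 - e \<le> mean_ln k n (single_blocks n) P (single_coeff \<beta> n) / n"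
proof -
  have "\<forall>\<^sub>F n in sequentially. xi_single \<beta> 1 / 2 - e < free_energy_single M g k \<beta> n"
    using order_tendstoD(1)[OF lim, of "xi_single \<beta> 1 / 2 - e"] e by simp
  then show ?thesis using eventually_ge_at_top[of 1]
  proof eventually_elim
    case (elim n)
    let ?D = "\<lambda>ss :: unit list. \<beta> (length ss)"
    have part: "species_partition n (single_blocks n)" using partition_single[of n] by (simp add: partition_def)
    have ls: "{ss :: unit list. length ss = p} = {replicate p ()}" for p
      by (auto intro: nth_equalityI)
    have v: "variance_coeff ?D (species_ratio n (single_blocks n)) p = (\<beta> p)\<^sup>2" for p
      using elim(2) unfolding variance_coeff_def ls
      by (simp add: species_ratio_def single_blocks_def map_replicate_const prod_list_replicate)
    have c: "multi_coeff ?D n = single_coeff \<beta> n" by (rule ext) (simp add: multi_coeff_def single_coeff_def)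
    have f: "free_energy_single M g k \<beta> n = free_energy M g k ?D (single_blocks n) n"
      by (simp add: free_energy_single_def single_blocks_def)
    note tr = free_energy_truncation[OF fam elim(2) part R, of ?D, unfolded v c f[symmetric], OF s]
    have sb: "summable (\<lambda>p. (\<beta> (Suc p))\<^sup>2)" by (rule tr(3))
    have "xi_single \<beta> 1 = (\<Sum>p. (\<beta> (Suc (P + p)))\<^sup>2) + (\<Sum>p=1..P. (\<beta> p)\<^sup>2)"
      using suminf_split_initial_segment[OF sb, of P] unfolding xi_single_def
      by (simp add: sum.atLeast1_atMost_eq[simplified] add.commute)
    then show ?case using tr(2)[of k P] elim(1) f by linarith
  qed
qed

theorem corollary2p1:
  fixes M :: "'w measure"
    and g :: "nat list \<Rightarrow> 'w \<Rightarrow> real"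
    and \<Delta> :: "'s::finite list \<Rightarrow> real"
    and I :: "nat \<Rightarrow> 's \<Rightarrow> nat set"
    and lam :: "'s \<Rightarrow> real"
    and \<beta> :: "nat \<Rightarrow> real"
    and k :: spin_type
  assumes "std_gaussian_family M g"
    and "interaction \<Delta>"
    and "\<And>N. N \<ge> 1 \<Longrightarrow> species_partition N (I N)"
    and "\<And>s. (\<lambda>N. species_ratio N (I N) s) \<longlonglongrightarrow> lam s"
    and "\<And>s. lam s > 0"
    and "\<exists>\<epsilon>>0. summable (\<lambda>p. (1 + \<epsilon>) ^ Suc p * variance_coeff \<Delta> lam (Suc p))"
    and "balanced \<Delta> lam"
    and "\<And>p. p \<ge> 1 \<Longrightarrow> \<beta> p \<ge> 0 \<and> (\<beta> p)\<^sup>2 = variance_coeff \<Delta> lam p"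
  shows "(\<lambda>N. free_energy_single M g k \<beta> N) \<longlonglongrightarrow> xi_single \<beta> 1 / 2 \<longrightarrow>
         (\<lambda>N. free_energy M g k \<Delta> (I N) N) \<longlonglongrightarrow> xi_single \<beta> 1 / 2"
proof
  assume lim: "(\<lambda>N. free_energy_single M g k \<beta> N) \<longlonglongrightarrow> xi_single \<beta> 1 / 2"
  obtain \<epsilon> where \<epsilon>: "0 < \<epsilon>" and sum0: "summable (\<lambda>p. (1 + \<epsilon>) ^ Suc p * variance_coeff \<Delta> lam (Suc p))"
    using assms(6) by blast
  define b where "b p = (\<beta> (Suc p))\<^sup>2" for p
  have b: "b p = variance_coeff \<Delta> lam (Suc p)" for p using assms(8)[of "Suc p"] by (simp add: b_def)
  have b0: "0 \<le> b p" for p by (simp add: b_def)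
  have "summable (\<lambda>p. 1 / (1 + \<epsilon>) * ((1 + \<epsilon>) ^ Suc p * b p))" using sum0 unfolding b by (rule summable_mult)
  then have sb: "summable (\<lambda>p. (1 + \<epsilon>) ^ p * b p)" using \<epsilon> by simp
  have xi: "xi_single \<beta> 1 = (\<Sum>p. b p)" by (simp add: xi_single_def b_def)
  have b_sum: "summable b" using summable_sqrt_geometric(2)[OF _ b0 sb] \<epsilon> by simp
  \<comment> \<open>For large N all proportions are below r lam, so a coefficient of order p + 1
    grows at most by the factor r^(p+1).\<close>
  have dominated: "\<forall>\<^sub>F N in sequentially. 1 \<le> N \<and> (\<forall>p. 0 \<le> variance_coeff \<Delta> (species_ratio N (I N)) (Suc p) \<and>
      variance_coeff \<Delta> (species_ratio N (I N)) (Suc p) \<le> r ^ Suc p * b p)" if r: "1 < r" for r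
  proof -
    have "\<forall>\<^sub>F N in sequentially. \<forall>s. species_ratio N (I N) s < r * lam s"
    proof (rule eventually_all_finite)
      fix s
      have "lam s < r * lam s" using r assms(5)[of s] by simp
      then show "\<forall>\<^sub>F N in sequentially. species_ratio N (I N) s < r * lam s" by (rule order_tendstoD(2)[OF assms(4)])
    qed
    then show ?thesis using eventually_ge_at_top[of 1]
    proof eventually_elim
      case (elim N)
      have nn: "0 \<le> species_ratio N (I N) s" for s by (simp add: species_ratio_def)
      have "variance_coeff \<Delta> (species_ratio N (I N)) (Suc p) \<le> variance_coeff \<Delta> (\<lambda>s. r * lam s) (Suc p)" for p
        using elim(1) nn by (intro variance_coeff_mono) (auto intro: less_imp_le)
      then show ?case using elim(2) nn by (auto simp: variance_coeff_scale b intro!: variance_coeff_nonneg)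
    qed
  qed
  \<comment> \<open>Part of the rate 1 + \<epsilon> is spent on the factor \<open>r\<close>; a rate
    \<open>R\<close> remains as long as R r \<le> 1 + \<epsilon>.\<close>
  have summable_r: "summable (\<lambda>p. R ^ p * v p)"
    if "1 < r" "0 \<le> R" "R * r \<le> 1 + \<epsilon>" "\<And>p. 0 \<le> v p \<and> v p \<le> r ^ Suc p * b p" for r R and v :: "nat \<Rightarrow> real"
  proof (rule summable_comparison_test'[where N = 0, OF summable_mult[OF sb, of r]])
    fix p
    have "R ^ p * v p \<le> R ^ p * (r ^ Suc p * b p)" using that by (intro mult_left_mono) auto
    also have "\<dots> = r * ((R * r) ^ p * b p)" by (simp add: power_mult_distrib)
    also have "\<dots> \<le> r * ((1 + \<epsilon>) ^ p * b p)" using that b0[of p] by (intro mult_left_mono mult_right_mono power_mono) auto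
    finally show "norm (R ^ p * v p) \<le> r * ((1 + \<epsilon>) ^ p * b p)" using that by simp
  qed
  show "(\<lambda>N. free_energy M g k \<Delta> (I N) N) \<longlonglongrightarrow> xi_single \<beta> 1 / 2"
  proof (rule order_tendstoI)
    fix y assume y: "xi_single \<beta> 1 / 2 < y"
    \<comment> \<open>The dominating series is a power series in \<open>r\<close> converging beyond
      1, so its value tends to that of \<beta> as \<open>r\<close> decreases to 1.\<close>
    have "isCont (\<lambda>x. \<Sum>p. b p * x ^ p) 1"
      using sb \<epsilon> by (intro isCont_powser[where K = "1 + \<epsilon>"]) (auto simp: mult.commute)
    then have "isCont (\<lambda>x. x * (\<Sum>p. b p * x ^ p) / 2) 1" by (intro continuous_intros) auto
    then have tend: "((\<lambda>x. x * (\<Sum>p. b p * x ^ p) / 2) \<longlongrightarrow> 1 * (\<Sum>p. b p * 1 ^ p) / 2) (at_right 1)"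
      by (simp add: isCont_def filterlim_at_split)
    have "1 * (\<Sum>p. b p * 1 ^ p) / 2 < y" using y unfolding xi by simp
    then have "\<forall>\<^sub>F x in at_right 1. x * (\<Sum>p. b p * x ^ p) / 2 < y" by (rule order_tendstoD(2)[OF tend])
    moreover have "\<forall>\<^sub>F x in at_right 1. 1 < x \<and> x < 1 + \<epsilon>" using \<epsilon> by (intro eventually_at_rightI[of 1 "1 + \<epsilon>"]) auto
    ultimately have "\<forall>\<^sub>F x in at_right 1. x * (\<Sum>p. b p * x ^ p) / 2 < y \<and> 1 < x \<and> x < 1 + \<epsilon>" by eventually_elim blast
    then obtain r where r: "r * (\<Sum>p. b p * r ^ p) / 2 < y" "1 < r" "r < 1 + \<epsilon>"
      using eventually_happens'[OF trivial_limit_at_right_real] by blast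
    have R: "1 < (1 + \<epsilon>) / r" "(1 + \<epsilon>) / r * r \<le> 1 + \<epsilon>" using r by auto
    have sr: "summable (\<lambda>p. r ^ Suc p * b p)" using summable_r[of r 1 "\<lambda>p. r ^ Suc p * b p"] r b0 by simp
    have sr': "summable (\<lambda>p. b p * r ^ p)"
      using summable_mult[OF sr, of "1 / r"] r by (simp add: mult.commute)
    have "(\<Sum>p. r ^ Suc p * b p) = r * (\<Sum>p. b p * r ^ p)"
      unfolding suminf_mult[OF sr', symmetric] by (simp add: mult_ac)
    then have B: "(\<Sum>p. r ^ Suc p * b p) / 2 < y" using r(1) by simp
    from dominated[OF r(2)] show "\<forall>\<^sub>F N in sequentially. free_energy M g k \<Delta> (I N) N < y"
    proof eventually_elim
      case (elim N)
      let ?v = "\<lambda>p. variance_coeff \<Delta> (species_ratio N (I N)) (Suc p)"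
      have part: "species_partition N (I N)" using elim assms(3) by blast
      have s: "summable (\<lambda>p. ((1 + \<epsilon>) / r) ^ p * ?v p)" using elim R r by (intro summable_r[of r]) auto
      note tr = free_energy_truncation[OF assms(1) _ part R(1) s]
      have "(\<Sum>p. ?v p) \<le> (\<Sum>p. r ^ Suc p * b p)" using elim tr(3) sr by (intro suminf_le) auto
      \<comment> \<open>Truncation at P = 0 keeps nothing, and the bound by half of the omitted
        variance is the annealed bound.\<close>
      moreover have "free_energy M g k \<Delta> (I N) N \<le> (\<Sum>p. ?v p) / 2"
        using tr(2)[of k 0] elim part by (simp add: mean_ln_0 partition_def)
      ultimately show ?case using B by linarith
    qed
  next
    fix y assume y: "y < xi_single \<beta> 1 / 2"
    have "(\<lambda>P. (\<Sum>p<P. b p) / 2) \<longlonglongrightarrow> xi_single \<beta> 1 / 2" unfolding xi by (intro tendsto_divide summable_LIMSEQ b_sum) auto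
    from order_tendstoD(1)[OF this y] have "\<forall>\<^sub>F P in sequentially. y < (\<Sum>p<P. b p) / 2 \<and> 1 \<le> P"
      using eventually_ge_at_top[of 1] by eventually_elim blast
    then obtain P where P: "y < (\<Sum>p<P. b p) / 2" "1 \<le> P" using eventually_happens'[OF sequentially_bot] by blast
    have bP: "(\<Sum>p<P. b p) = (\<Sum>p=1..P. (\<beta> p)\<^sup>2)" unfolding b_def by (simp add: sum.atLeast1_atMost_eq[simplified])
    define e where "e = ((\<Sum>p<P. b p) / 2 - y) / 2"
    have e: "0 < e" "y < (\<Sum>p<P. b p) / 2 - e" using P(1) by (auto simp: e_def field_simps)
    have "\<forall>\<^sub>F N in sequentially. (\<Sum>p=1..P. (\<beta> p)\<^sup>2) / 2 - e \<le> mean_ln k N (I N) P (multi_coeff \<Delta> N) / N"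
    proof (rule truncated_limit[OF assms(2,3,4,5,7) _ P(2) _ e(1)])
      show "(\<beta> p)\<^sup>2 = variance_coeff \<Delta> lam p" if "1 \<le> p" for p using assms(8) that by blast
      show "\<forall>\<^sub>F n in sequentially. (\<Sum>p=1..P. (\<beta> p)\<^sup>2) / 2 - e' \<le> mean_ln k n (single_blocks n) P (single_coeff \<beta> n) / n" if "0 < e'" for e'
        by (rule single_species_truncation[OF assms(1) _ sb[unfolded b_def] lim that]) (use \<epsilon> in simp)
    qed
    \<comment> \<open>The square root lets \<open>r\<close> be both the domination factor and the
      remaining rate of convergence.\<close>
    define r where "r = sqrt (1 + \<epsilon>)"
    have r: "1 < r" "r * r \<le> 1 + \<epsilon>" using \<epsilon> by (auto simp: r_def)
    show "\<forall>\<^sub>F N in sequentially. y < free_energy M g k \<Delta> (I N) N"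
      using \<open>\<forall>\<^sub>F N in sequentially. _ \<le> _\<close> dominated[OF r(1)]
    proof eventually_elim
      case (elim N)
      let ?v = "\<lambda>p. variance_coeff \<Delta> (species_ratio N (I N)) (Suc p)"
      have part: "species_partition N (I N)" using elim assms(3) by blast
      have s: "summable (\<lambda>p. r ^ p * ?v p)" using elim r by (intro summable_r[of r]) auto
      have "mean_ln k N (I N) P (multi_coeff \<Delta> N) / N \<le> free_energy M g k \<Delta> (I N) N"
        by (rule free_energy_truncation(1)[OF assms(1) _ part r(1) s]) (use elim in blast)
      then show ?case using elim(1) e(2) bP by linarith
    qed
  qed
qed

end
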